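(* Let $\Omega\subset\mathbb{R}^n$ be open and bounded, and let $Lu=-\sum_{i,j=1}^n (a^{ij}u_{x_i})_{x_j}$, where the coefficients $a^{ij}=a^{ij}(x)$ satisfy $a^{ij}\in L^\infty(\Omega)$, $a^{ij}=a^{ji}$ for $i,j=1,\dots,n$, and there is $\lambda>0$ with $\sum_{i,j=1}^n a^{ij}(x)y_iy_j\ge\lambda|y|^2$ for all $x\in\Omega$, $y\in\mathbb{R}^n$. Let $f\in L^2_{\mathrm{loc}}([0,\infty);L^2(\Omega))\cap L^1(0,\infty;L^2(\Omega))$. Then the problem $$\begin{cases}u_{tt}+Lu=f&\text{in }(0,\infty)\times\Omega,\\ u=0&\text{on }(0,\infty)\times\partial\Omega,\\ \lim\limits_{t\to\infty}\|u(t,\cdot)\|_{L^2(\Omega)}=0\end{cases}$$ has a unique (weak) solution in $L^\infty_{\mathrm{loc}}(0,\infty;H^1_0(\Omega))\cap W^{1,\infty}_{\mathrm{loc}}(0,\infty;L^2(\Omega))\cap H^2_{\mathrm{loc}}(0,\infty;H^{-1}(\Omega))$.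
   Context: All functions are real-valued. The bilinear form associated with $L$ is $B(u,v)=\int_\Omega\sum_{i,j=1}^n a^{ij}u_{x_i}v_{x_j}\,dx$ on $H^1_0(\Omega)$. The subscript "loc" refers to time intervals $(0,T)$ with arbitrary finite $T$: a function belongs to the local space if for every $T>0$ its restriction to $(0,T)$ belongs to the corresponding space $L^2(0,T;\cdot)$, $L^\infty(0,T;\cdot)$, $W^{1,\infty}(0,T;\cdot)$ or $H^2(0,T;\cdot)$. A weak solution of the problem is a function $u$ in the stated class such that for every $v\in H^1_0(\Omega)$ and a.e. $t>0$, $\langle u''(t),v\rangle+B(u(t),v)=(f(t),v)_{L^2(\Omega)}$, and such that the decay condition holds, where $u$ is identified with its representative in $C([0,\infty);L^2(\Omega))$. No initial conditions are prescribed. *)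

theory Defs
  imports "HOL-Analysis.Analysis" "HOL-Library.Function_Algebras"
begin

text \<open>
  The Hilbert spaces that occur here depend on the domain \<open>\<Omega>\<close> and hence cannot be types.
  They are given by a carrier \<open>X\<close> inside a function type, with pointwise vector operations, and a
  function \<open>N\<close> that is a seminorm on \<open>X\<close>; elements at \<open>N\<close>-distance 0 (equality almost
  everywhere on \<open>\<Omega>\<close>, or equality of functionals on \<open>H\<^sup>1\<^sub>0\<close>) are representatives of the same
  vector. With the instance below, the simple functions of the library's Bochner integral can take
  values in such spaces.
\<close>

instantiation "fun" :: (type, real_vector) real_vector
begin

definition scaleR_fun :: "real \<Rightarrow> ('a \<Rightarrow> 'b) \<Rightarrow> 'a \<Rightarrow> 'b" where
  "scaleR_fun c f = (\<lambda>x. c *\<^sub>R f x)"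

instance
  by standard (simp_all add: scaleR_fun_def fun_eq_iff scaleR_add_right scaleR_add_left)

end


subsection \<open>Test functions\<close>

primrec C_k :: "nat \<Rightarrow> ('a::euclidean_space \<Rightarrow> real) \<Rightarrow> bool" where
  "C_k 0 f \<longleftrightarrow> continuous_on UNIV f"
| "C_k (Suc k) f \<longleftrightarrow> f differentiable_on UNIV \<and>
     (\<forall>b\<in>Basis. C_k k (\<lambda>x. frechet_derivative f (at x) b))"

definition test_functions :: "'a::euclidean_space set \<Rightarrow> ('a \<Rightarrow> real) set" where
  "test_functions \<Omega> = {\<phi>. (\<forall>k. C_k k \<phi>) \<and>
     compact (closure {x. \<phi> x \<noteq> 0}) \<and> closure {x. \<phi> x \<noteq> 0} \<subseteq> \<Omega>}"


subsection \<open>The spaces \<open>L\<^sup>2(\<Omega>)\<close>, \<open>H\<^sup>1(\<Omega>)\<close>, \<open>H\<^sup>1\<^sub>0(\<Omega>)\<close> and \<open>H\<^sup>-\<^sup>1(\<Omega>)\<close>\<close>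

definition L2 :: "(real^'n) set \<Rightarrow> (real^'n \<Rightarrow> real) set" where
  "L2 \<Omega> = {u. u \<in> borel_measurable (lebesgue_on \<Omega>) \<and>
              integrable (lebesgue_on \<Omega>) (\<lambda>x. (u x)\<^sup>2)}"

definition L2_inner :: "(real^'n) set \<Rightarrow> (real^'n \<Rightarrow> real) \<Rightarrow> (real^'n \<Rightarrow> real) \<Rightarrow> real" where
  "L2_inner \<Omega> u v = (LINT x|lebesgue_on \<Omega>. u x * v x)"

definition L2_norm :: "(real^'n) set \<Rightarrow> (real^'n \<Rightarrow> real) \<Rightarrow> real" where
  "L2_norm \<Omega> u = sqrt (L2_inner \<Omega> u u)"

definition is_weak_partial ::
  "(real^'n) set \<Rightarrow> 'n \<Rightarrow> (real^'n \<Rightarrow> real) \<Rightarrow> (real^'n \<Rightarrow> real) \<Rightarrow> bool" where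
  "is_weak_partial \<Omega> i u g \<longleftrightarrow> g \<in> L2 \<Omega> \<and>
     (\<forall>\<phi>\<in>test_functions \<Omega>.
        (LINT x|lebesgue_on \<Omega>. u x * frechet_derivative \<phi> (at x) (axis i 1))
        = - (LINT x|lebesgue_on \<Omega>. g x * \<phi> x))"

definition H1 :: "(real^'n) set \<Rightarrow> (real^'n \<Rightarrow> real) set" where
  "H1 \<Omega> = {u \<in> L2 \<Omega>. \<forall>i. \<exists>g. is_weak_partial \<Omega> i u g}"

text \<open>The weak partial derivative is unique only up to a null set. It is used below only under
  integrals over \<open>\<Omega>\<close> and for functions in \<open>H\<^sup>1(\<Omega>)\<close>, so the choice is immaterial.\<close>

definition weak_partial ::
  "(real^'n) set \<Rightarrow> 'n \<Rightarrow> (real^'n \<Rightarrow> real) \<Rightarrow> real^'n \<Rightarrow> real" where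
  "weak_partial \<Omega> i u = (SOME g. is_weak_partial \<Omega> i u g)"

definition H1_norm :: "(real^'n) set \<Rightarrow> (real^'n \<Rightarrow> real) \<Rightarrow> real" where
  "H1_norm \<Omega> u = sqrt ((L2_norm \<Omega> u)\<^sup>2 + (\<Sum>i\<in>UNIV. (L2_norm \<Omega> (weak_partial \<Omega> i u))\<^sup>2))"

definition H10 :: "(real^'n) set \<Rightarrow> (real^'n \<Rightarrow> real) set" where
  "H10 \<Omega> = {u \<in> H1 \<Omega>. \<exists>\<phi>. (\<forall>k::nat. \<phi> k \<in> test_functions \<Omega>) \<and>
                           (\<lambda>k. H1_norm \<Omega> (u - \<phi> k)) \<longlonglongrightarrow> 0}"

text \<open>Only the values of a functional on \<open>H\<^sup>1\<^sub>0(\<Omega>)\<close> matter, also for its norm.\<close>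

definition Hm1 :: "(real^'n) set \<Rightarrow> ((real^'n \<Rightarrow> real) \<Rightarrow> real) set" where
  "Hm1 \<Omega> = {F. (\<forall>u\<in>H10 \<Omega>. \<forall>v\<in>H10 \<Omega>. F (u + v) = F u + F v) \<and>
               (\<forall>c. \<forall>v\<in>H10 \<Omega>. F (c *\<^sub>R v) = c * F v) \<and>
               (\<exists>C. \<forall>v\<in>H10 \<Omega>. \<bar>F v\<bar> \<le> C * H1_norm \<Omega> v)}"

definition Hm1_norm :: "(real^'n) set \<Rightarrow> ((real^'n \<Rightarrow> real) \<Rightarrow> real) \<Rightarrow> real" where
  "Hm1_norm \<Omega> F = (SUP v\<in>{v \<in> H10 \<Omega>. H1_norm \<Omega> v \<le> 1}. \<bar>F v\<bar>)"


subsection \<open>Bochner spaces\<close>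

definition strongly_measurable_on ::
  "real set \<Rightarrow> 'b::real_vector set \<Rightarrow> ('b \<Rightarrow> real) \<Rightarrow> (real \<Rightarrow> 'b) \<Rightarrow> bool" where
  "strongly_measurable_on I X N u \<longleftrightarrow>
     (AE t in lebesgue_on I. u t \<in> X) \<and>
     (\<exists>s. (\<forall>k::nat. simple_function (lebesgue_on I) (s k) \<and> s k ` I \<subseteq> X) \<and>
          (AE t in lebesgue_on I. (\<lambda>k. N (s k t - u t)) \<longlonglongrightarrow> 0))"

text \<open>The analogue of \<^const>\<open>has_bochner_integral\<close> for values in a space \<open>(X, N)\<close>.\<close>

definition has_integral_in ::
  "real set \<Rightarrow> 'b::real_vector set \<Rightarrow> ('b \<Rightarrow> real) \<Rightarrow> (real \<Rightarrow> 'b) \<Rightarrow> 'b \<Rightarrow> bool" where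
  "has_integral_in I X N h z \<longleftrightarrow> z \<in> X \<and> strongly_measurable_on I X N h \<and>
     (\<exists>s. (\<forall>k::nat. Bochner_Integration.simple_bochner_integrable (lebesgue_on I) (s k) \<and> s k ` I \<subseteq> X \<and>
              integrable (lebesgue_on I) (\<lambda>t. N (s k t - h t))) \<and>
          (\<lambda>k. LINT t|lebesgue_on I. N (s k t - h t)) \<longlonglongrightarrow> 0 \<and>
          (\<lambda>k. N (Bochner_Integration.simple_bochner_integral (lebesgue_on I) (s k) - z)) \<longlonglongrightarrow> 0)"

definition bochner_Lp ::
  "nat \<Rightarrow> real set \<Rightarrow> 'b::real_vector set \<Rightarrow> ('b \<Rightarrow> real) \<Rightarrow> (real \<Rightarrow> 'b) set" where
  "bochner_Lp p I X N =
     {u. strongly_measurable_on I X N u \<and> integrable (lebesgue_on I) (\<lambda>t. N (u t) ^ p)}"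

definition bochner_Linf ::
  "real set \<Rightarrow> 'b::real_vector set \<Rightarrow> ('b \<Rightarrow> real) \<Rightarrow> (real \<Rightarrow> 'b) set" where
  "bochner_Linf I X N =
     {u. strongly_measurable_on I X N u \<and> (\<exists>C. AE t in lebesgue_on I. N (u t) \<le> C)}"

definition weak_time_deriv ::
  "real set \<Rightarrow> 'b::real_vector set \<Rightarrow> ('b \<Rightarrow> real) \<Rightarrow> (real \<Rightarrow> 'b) \<Rightarrow> (real \<Rightarrow> 'b) \<Rightarrow> bool" where
  "weak_time_deriv I X N u v \<longleftrightarrow>
     (\<forall>\<phi>\<in>test_functions I. \<exists>z. has_integral_in I X N (\<lambda>t. deriv \<phi> t *\<^sub>R u t) z \<and>
                                has_integral_in I X N (\<lambda>t. \<phi> t *\<^sub>R v t) (- z))"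

definition bochner_W1inf ::
  "real set \<Rightarrow> 'b::real_vector set \<Rightarrow> ('b \<Rightarrow> real) \<Rightarrow> (real \<Rightarrow> 'b) set" where
  "bochner_W1inf I X N =
     {u \<in> bochner_Linf I X N. \<exists>v\<in>bochner_Linf I X N. weak_time_deriv I X N u v}"

definition is_second_deriv_L2 ::
  "real set \<Rightarrow> 'b::real_vector set \<Rightarrow> ('b \<Rightarrow> real) \<Rightarrow> (real \<Rightarrow> 'b) \<Rightarrow> (real \<Rightarrow> 'b) \<Rightarrow> bool" where
  "is_second_deriv_L2 I X N u w \<longleftrightarrow> w \<in> bochner_Lp 2 I X N \<and>
     (\<exists>v\<in>bochner_Lp 2 I X N. weak_time_deriv I X N u v \<and> weak_time_deriv I X N v w)"

definition bochner_H2 ::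
  "real set \<Rightarrow> 'b::real_vector set \<Rightarrow> ('b \<Rightarrow> real) \<Rightarrow> (real \<Rightarrow> 'b) set" where
  "bochner_H2 I X N = {u \<in> bochner_Lp 2 I X N. \<exists>w. is_second_deriv_L2 I X N u w}"

definition in_loc :: "(real set \<Rightarrow> (real \<Rightarrow> 'b) set) \<Rightarrow> (real \<Rightarrow> 'b) \<Rightarrow> bool" where
  "in_loc S u \<longleftrightarrow> (\<forall>T>0. u \<in> S {0<..<T})"


subsection \<open>Weak solutions\<close>

definition admissible_coeffs ::
  "(real^'n) set \<Rightarrow> ('n \<Rightarrow> 'n \<Rightarrow> real^'n \<Rightarrow> real) \<Rightarrow> bool" where
  "admissible_coeffs \<Omega> a \<longleftrightarrow>
     (\<forall>i j. a i j \<in> borel_measurable (lebesgue_on \<Omega>) \<and>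
            (\<exists>C. AE x in lebesgue_on \<Omega>. \<bar>a i j x\<bar> \<le> C)) \<and>
     (\<forall>i j. AE x in lebesgue_on \<Omega>. a i j x = a j i x) \<and>
     (\<exists>l>0. \<forall>x\<in>\<Omega>. \<forall>y::real^'n.
        (\<Sum>i\<in>UNIV. \<Sum>j\<in>UNIV. a i j x * y $ i * y $ j) \<ge> l * (norm y)\<^sup>2)"

definition B_form :: "(real^'n) set \<Rightarrow> ('n \<Rightarrow> 'n \<Rightarrow> real^'n \<Rightarrow> real) \<Rightarrow>
    (real^'n \<Rightarrow> real) \<Rightarrow> (real^'n \<Rightarrow> real) \<Rightarrow> real" where
  "B_form \<Omega> a u v = (LINT x|lebesgue_on \<Omega>.
     (\<Sum>i\<in>UNIV. \<Sum>j\<in>UNIV. a i j x * weak_partial \<Omega> i u x * weak_partial \<Omega> j v x))"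

text \<open>\<^term>\<open>L2_inner \<Omega> u\<close> is the image of \<open>u \<in> L\<^sup>2(\<Omega>)\<close> under the
  canonical embedding \<open>L\<^sup>2(\<Omega>) \<rightarrow> H\<^sup>-\<^sup>1(\<Omega>)\<close>.\<close>

definition solution_class :: "(real^'n) set \<Rightarrow> (real \<Rightarrow> real^'n \<Rightarrow> real) \<Rightarrow> bool" where
  "solution_class \<Omega> u \<longleftrightarrow>
     in_loc (\<lambda>I. bochner_Linf I (H10 \<Omega>) (H1_norm \<Omega>)) u \<and>
     in_loc (\<lambda>I. bochner_W1inf I (L2 \<Omega>) (L2_norm \<Omega>)) u \<and>
     in_loc (\<lambda>I. bochner_H2 I (Hm1 \<Omega>) (Hm1_norm \<Omega>)) (\<lambda>t. L2_inner \<Omega> (u t))"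

definition solves_weakly :: "(real^'n) set \<Rightarrow> ('n \<Rightarrow> 'n \<Rightarrow> real^'n \<Rightarrow> real) \<Rightarrow>
    (real \<Rightarrow> real^'n \<Rightarrow> real) \<Rightarrow> (real \<Rightarrow> real^'n \<Rightarrow> real) \<Rightarrow> bool" where
  "solves_weakly \<Omega> a f u \<longleftrightarrow>
     (\<exists>u''. (\<forall>T>0. is_second_deriv_L2 {0<..<T} (Hm1 \<Omega>) (Hm1_norm \<Omega>)
                     (\<lambda>t. L2_inner \<Omega> (u t)) u'') \<and>
            (\<forall>v\<in>H10 \<Omega>. AE t in lebesgue_on {0<..}.
               u'' t v + B_form \<Omega> a (u t) v = L2_inner \<Omega> (f t) v))"

definition is_continuous_rep ::
  "(real^'n) set \<Rightarrow> (real \<Rightarrow> real^'n \<Rightarrow> real) \<Rightarrow> (real \<Rightarrow> real^'n \<Rightarrow> real) \<Rightarrow> bool" where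
  "is_continuous_rep \<Omega> u w \<longleftrightarrow>
     (\<forall>t\<ge>0. w t \<in> L2 \<Omega> \<and> ((\<lambda>s. L2_norm \<Omega> (w s - w t)) \<longlongrightarrow> 0) (at t within {0..})) \<and>
     (AE t in lebesgue_on {0<..}. AE x in lebesgue_on \<Omega>. w t x = u t x)"

definition decays :: "(real^'n) set \<Rightarrow> (real \<Rightarrow> real^'n \<Rightarrow> real) \<Rightarrow> bool" where
  "decays \<Omega> u \<longleftrightarrow>
     (\<exists>w. is_continuous_rep \<Omega> u w \<and> ((\<lambda>t. L2_norm \<Omega> (w t)) \<longlongrightarrow> 0) at_top)"

definition weak_solution :: "(real^'n) set \<Rightarrow> ('n \<Rightarrow> 'n \<Rightarrow> real^'n \<Rightarrow> real) \<Rightarrow>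
    (real \<Rightarrow> real^'n \<Rightarrow> real) \<Rightarrow> (real \<Rightarrow> real^'n \<Rightarrow> real) \<Rightarrow> bool" where
  "weak_solution \<Omega> a f u \<longleftrightarrow>
     solution_class \<Omega> u \<and> solves_weakly \<Omega> a f u \<and> decays \<Omega> u"

end

theory Submission
  imports Defs
begin

text \<open>
  By Poincare's inequality the form \<open>B\<close> is coercive on \<open>H\<^sup>1\<^sub>0(\<Omega>)\<close>, so by Riesz' theorem \<open>L\<close> has an
  inverse \<open>sol\<close> with values in \<open>H\<^sup>1\<^sub>0(\<Omega>)\<close>. Composed with the inclusion of \<open>H\<^sup>1\<^sub>0(\<Omega>)\<close> into
  \<open>L\<^sup>2\<close> it gives a bounded, symmetric, positive operator \<open>K\<close>, and all estimates in time are made for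
  such an operator on a Hilbert space. The equation \<open>u'' + Lu = f\<close> becomes \<open>(Ku)'' + u = Kf\<close>, or, for \<open>x = Lu\<close>,
  \<open>Kx'' + x = f\<close>.

  Uniqueness. The difference \<open>C\<close> of two solutions satisfies \<open>(KC)'' + C = 0\<close> in the sense of
  distributions. Twice integrated, this shows that \<open>KC\<close> is twice differentiable, and that the energy
  \<open>\<parallel>(KC)'\<parallel>\<^sup>2 + C \<bullet> KC\<close> of \<open>KC\<close> is a constant \<open>e\<close>. Since \<open>C\<close> tends to 0, so does the second summand;
  if \<open>e\<close> were positive, then \<open>KC \<bullet> (KC)'\<close> would have a derivative close to \<open>e\<close> for large times, while it
  tends to 0. Hence \<open>e = 0\<close> and \<open>KC = 0\<close>; as \<open>K\<close> is injective on \<open>L\<^sup>2(\<Omega>)\<close>, the solutions agree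
  (\<open>energy_rigidity\<close>, \<open>abstract_uniqueness\<close>).

  Existence. If \<open>f\<close> vanishes for \<open>t \<ge> T\<close>, the solution of the backward Cauchy problem with zero data
  at \<open>T\<close> vanishes for \<open>t \<ge> T\<close>. The energy inequality bounds
  \<open>\<parallel>u'(t)\<parallel>\<close> and \<open>\<surd>B(u(t), u(t))\<close>, uniformly in \<open>t\<close>, by \<open>2 \<integral> \<parallel>f\<parallel>\<close> over the whole half-line. So for
  \<open>f\<close> in \<open>L\<^sup>1(0, \<infinity>; L\<^sup>2(\<Omega>))\<close> one takes approximations of \<open>f\<close> with bounded support in time; the
  corresponding solutions form a Cauchy sequence uniformly in time, for \<open>u\<close> in \<open>H\<^sup>1\<^sub>0(\<Omega>)\<close> and for \<open>u'\<close> in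
  \<open>L\<^sup>2(\<Omega>)\<close>, and the decay at infinity passes to the limit.

  To have solutions to begin with, \<open>K\<close> is replaced by \<open>K + \<epsilon>\<close>, which is invertible: then
  \<open>(K + \<epsilon>)x'' + x = f\<close> is a linear differential equation with bounded coefficients. For
  \<open>f = K\<^sup>2g\<close> with \<open>g\<close> continuous the bound on \<open>x''\<close> is independent of \<open>\<epsilon>\<close>, so that \<open>\<epsilon>x''\<close> is
  harmless (\<open>approximate_solutions\<close>); and such right-hand sides are dense (\<open>approximable_rhs\<close>), because
  the range of \<open>K\<^sup>2\<close> is dense in \<open>L\<^sup>2(\<Omega>)\<close>.
\<close>

section \<open>Seminormed spaces on a carrier\<close>

locale seminormed_space =
  fixes X :: "'b::real_vector set" and N :: "'b \<Rightarrow> real"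
  assumes sub: "subspace X"
    and N_add: "x \<in> X \<Longrightarrow> y \<in> X \<Longrightarrow> N (x + y) \<le> N x + N y"
    and N_scale: "x \<in> X \<Longrightarrow> N (c *\<^sub>R x) = \<bar>c\<bar> * N x"
begin

lemma mem_zero [simp]: "0 \<in> X"
  and mem_add [simp]: "x \<in> X \<Longrightarrow> y \<in> X \<Longrightarrow> x + y \<in> X"
  and mem_diff [simp]: "x \<in> X \<Longrightarrow> y \<in> X \<Longrightarrow> x - y \<in> X"
  and mem_scale [simp]: "x \<in> X \<Longrightarrow> c *\<^sub>R x \<in> X"
  and mem_minus [simp]: "x \<in> X \<Longrightarrow> - x \<in> X"
  and mem_sum: "(\<And>i. i \<in> A \<Longrightarrow> g i \<in> X) \<Longrightarrow> sum g A \<in> X"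
  using sub by (auto simp: subspace_0 subspace_add subspace_diff subspace_scale subspace_neg
      intro: subspace_sum)

lemma N_zero [simp]: "N 0 = 0"
  using N_scale[of 0 0] by simp

lemma N_minus: "x \<in> X \<Longrightarrow> N (- x) = N x"
  using N_scale[of x "-1"] by simp

lemma N_commute: "x \<in> X \<Longrightarrow> y \<in> X \<Longrightarrow> N (x - y) = N (y - x)"
  using N_minus[of "x - y"] by simp

lemma N_nonneg: "x \<in> X \<Longrightarrow> 0 \<le> N x"
  using N_add[of x "- x"] N_minus[of x] by simp

lemma N_triangle: "x \<in> X \<Longrightarrow> y \<in> X \<Longrightarrow> z \<in> X \<Longrightarrow> N (x - z) \<le> N (x - y) + N (y - z)"
  using N_add[of "x - y" "y - z"] by simp

lemma N_diff: "x \<in> X \<Longrightarrow> y \<in> X \<Longrightarrow> N (x - y) \<le> N x + N y"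
  using N_add[of x "- y"] N_minus[of y] by simp

lemma N_reverse: "x \<in> X \<Longrightarrow> y \<in> X \<Longrightarrow> \<bar>N x - N y\<bar> \<le> N (x - y)"
  using N_add[of "x - y" y] N_add[of "y - x" x] N_commute[of x y] by simp

lemma N_sum: "finite A \<Longrightarrow> (\<And>i. i \<in> A \<Longrightarrow> g i \<in> X) \<Longrightarrow> N (sum g A) \<le> (\<Sum>i\<in>A. N (g i))"
proof (induction A rule: finite_induct)
  case (insert i A)
  then show ?case using N_add[of "g i" "sum g A"] mem_sum[of A g] by force
qed simp

end

definition complete_in :: "'b::real_vector set \<Rightarrow> ('b \<Rightarrow> real) \<Rightarrow> bool" where
  "complete_in X N \<longleftrightarrow> (\<forall>x. (\<forall>k::nat. x k \<in> X) \<longrightarrow>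
     (\<forall>e>0. \<exists>M. \<forall>i\<ge>M. \<forall>j\<ge>M. N (x i - x j) < e) \<longrightarrow>
     (\<exists>l\<in>X. (\<lambda>k. N (x k - l)) \<longlonglongrightarrow> 0))"

lemma complete_inD:
  assumes "complete_in X N" "\<And>k::nat. x k \<in> X"
    and "\<And>e. e > 0 \<Longrightarrow> \<exists>M. \<forall>i\<ge>M. \<forall>j\<ge>M. N (x i - x j) < e"
  obtains l where "l \<in> X" "(\<lambda>k. N (x k - l)) \<longlonglongrightarrow> 0"
  using assms unfolding complete_in_def by metis

locale psd_form =
  fixes X :: "'b::real_vector set" and b :: "'b \<Rightarrow> 'b \<Rightarrow> real"
  assumes subsp: "subspace X"
    and b_add: "u \<in> X \<Longrightarrow> v \<in> X \<Longrightarrow> w \<in> X \<Longrightarrow> b (u + v) w = b u w + b v w"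
    and b_scale: "u \<in> X \<Longrightarrow> v \<in> X \<Longrightarrow> b (c *\<^sub>R u) v = c * b u v"
    and b_sym: "u \<in> X \<Longrightarrow> v \<in> X \<Longrightarrow> b u v = b v u"
    and b_nonneg: "u \<in> X \<Longrightarrow> 0 \<le> b u u"
begin

lemma in_zero [simp]: "0 \<in> X"
  and in_add [simp]: "x \<in> X \<Longrightarrow> y \<in> X \<Longrightarrow> x + y \<in> X"
  and in_diff [simp]: "x \<in> X \<Longrightarrow> y \<in> X \<Longrightarrow> x - y \<in> X"
  and in_scale [simp]: "x \<in> X \<Longrightarrow> c *\<^sub>R x \<in> X"
  and in_minus [simp]: "x \<in> X \<Longrightarrow> - x \<in> X"
  using subsp by (auto simp: subspace_0 subspace_add subspace_diff subspace_scale subspace_neg)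

lemma b_add_right: "u \<in> X \<Longrightarrow> v \<in> X \<Longrightarrow> w \<in> X \<Longrightarrow> b w (u + v) = b w u + b w v"
  by (simp add: b_sym[of w] b_add)

lemma b_scale_right: "u \<in> X \<Longrightarrow> v \<in> X \<Longrightarrow> b v (c *\<^sub>R u) = c * b v u"
  by (simp add: b_sym[of v] b_scale)

lemma b_minus: "u \<in> X \<Longrightarrow> v \<in> X \<Longrightarrow> b (- u) v = - b u v"
  using b_scale[of u v "-1"] by simp

lemma b_minus_right: "u \<in> X \<Longrightarrow> v \<in> X \<Longrightarrow> b v (- u) = - b v u"
  using b_scale_right[of u v "-1"] by simp

lemma b_diff: "u \<in> X \<Longrightarrow> v \<in> X \<Longrightarrow> w \<in> X \<Longrightarrow> b (u - v) w = b u w - b v w"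
  using b_add[of u "- v" w] by (simp add: b_minus)

lemma b_diff_right: "u \<in> X \<Longrightarrow> v \<in> X \<Longrightarrow> w \<in> X \<Longrightarrow> b w (u - v) = b w u - b w v"
  using b_add_right[of u "- v" w] by (simp add: b_minus_right)

lemma b_expand:
  assumes "u \<in> X" "v \<in> X"
  shows "b (u + t *\<^sub>R v) (u + t *\<^sub>R v) = b u u + 2 * t * b u v + t\<^sup>2 * b v v"
  using assms by (simp add: b_add b_add_right b_scale b_scale_right b_sym[of v u]
      power2_eq_square algebra_simps)

lemma cauchy_schwarz: 
  assumes "u \<in> X" "v \<in> X"
  shows "\<bar>b u v\<bar> \<le> sqrt (b u u) * sqrt (b v v)"
proof -
  have q: "0 \<le> b u u + 2 * t * b u v + t\<^sup>2 * b v v" for t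
    using b_nonneg[of "u + t *\<^sub>R v"] assms by (simp add: b_expand)
  have "(b u v)\<^sup>2 \<le> b u u * b v v"
  proof (cases "b v v = 0")
    case True
    have "b u v = 0"
    proof (rule ccontr)
      assume n: "b u v \<noteq> 0"
      have "0 \<le> b u u + 2 * (- (b u u + 1) / (2 * b u v)) * b u v"
        using q[of "- (b u u + 1) / (2 * b u v)"] True by simp
      also have "\<dots> = -1" using n by (simp add: field_simps)
      finally show False by simp
    qed
    then show ?thesis using True by simp
  next
    case False
    then have p: "b v v > 0" using b_nonneg[of v] assms by simp
    have "0 \<le> b u u + 2 * (- b u v / b v v) * b u v + (- b u v / b v v)\<^sup>2 * b v v"
      by (rule q)
    also have "\<dots> = b u u - (b u v)\<^sup>2 / b v v"
      using p by (simp add: power2_eq_square field_simps)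
    finally show ?thesis using p by (simp add: field_simps)
  qed
  then have "sqrt ((b u v)\<^sup>2) \<le> sqrt (b u u * b v v)" by (rule real_sqrt_le_mono)
  then show ?thesis by (simp add: real_sqrt_mult)
qed

sublocale seminormed_space X "\<lambda>v. sqrt (b v v)"
proof
  show "subspace X" by (rule subsp)
  fix x y assume xy: "x \<in> X" "y \<in> X"
  have "b (x + y) (x + y) = b x x + 2 * b x y + b y y"
    using b_expand[of x y 1] xy by simp
  also have "\<dots> \<le> (sqrt (b x x) + sqrt (b y y))\<^sup>2"
    using cauchy_schwarz[OF xy] xy by (simp add: power2_sum b_nonneg)
  finally show "sqrt (b (x + y) (x + y)) \<le> sqrt (b x x) + sqrt (b y y)"
    using xy by (intro real_le_lsqrt) (auto simp: b_nonneg)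
next
  fix x c assume "x \<in> X"
  then show "sqrt (b (c *\<^sub>R x) (c *\<^sub>R x)) = \<bar>c\<bar> * sqrt (b x x)"
    by (simp add: b_scale b_scale_right real_sqrt_mult flip: mult.assoc)
qed

text \<open>The representing vector is the limit of a sequence that minimises \<open>b v v - 2 * l v\<close>. The form may
be degenerate: vectors at distance 0 need not be equal, which is the case for functions that differ on a
null set.\<close>

theorem riesz_representation:
  assumes comp: "complete_in X (\<lambda>v. sqrt (b v v))"
    and l_add: "\<And>u v. u \<in> X \<Longrightarrow> v \<in> X \<Longrightarrow> l (u + v) = l u + l v"
    and l_scale: "\<And>c v. v \<in> X \<Longrightarrow> l (c *\<^sub>R v) = c * l v"
    and l_bd: "\<And>v. v \<in> X \<Longrightarrow> \<bar>l v\<bar> \<le> C * sqrt (b v v)"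
  shows "\<exists>w\<in>X. \<forall>v\<in>X. b w v = l v"
proof -
  define I where "I v = b v v - 2 * l v" for v
  have low: "- (C\<^sup>2) \<le> I v" if "v \<in> X" for v
  proof -
    have "0 \<le> (sqrt (b v v) - C)\<^sup>2" by simp
    also have "\<dots> = b v v - 2 * (C * sqrt (b v v)) + C\<^sup>2"
      using that by (simp add: power2_diff b_nonneg)
    finally show ?thesis using l_bd[OF that] by (simp add: I_def)
  qed
  define m where "m = Inf (I ` X)"
  have bdd: "bdd_below (I ` X)" using low by (auto intro!: bdd_belowI2)
  have ne: "I ` X \<noteq> {}" using in_zero by blast
  have m_le: "m \<le> I v" if "v \<in> X" for v
    unfolding m_def using bdd that by (auto intro: cInf_lower)
  have "\<exists>v\<in>X. I v < m + 1 / real (Suc k)" for k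
  proof -
    have "Inf (I ` X) < m + 1 / real (Suc k)" by (simp add: m_def)
    from cInf_lessD[OF ne this] show ?thesis by auto
  qed
  then obtain x where x: "\<And>k. x k \<in> X" "\<And>k. I (x k) < m + 1 / real (Suc k)"
    by metis
  \<comment> \<open>the parallelogram identity makes the minimising sequence a Cauchy sequence\<close>
  have par: "b (x i - x j) (x i - x j) \<le> 2 / real (Suc i) + 2 / real (Suc j)" for i j
  proof -
    let ?z = "(1/2) *\<^sub>R (x i + x j)"
    have "b (x i - x j) (x i - x j) = 2 * I (x i) + 2 * I (x j) - 4 * I ?z"
      by (simp add: I_def x b_add b_add_right b_diff b_diff_right b_scale b_scale_right
          l_add l_scale b_sym[of "x j" "x i"], simp add: field_simps)
    also have "\<dots> \<le> 2 * I (x i) + 2 * I (x j) - 4 * m"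
      using m_le[of ?z] x by simp
    also have "\<dots> \<le> 2 / real (Suc i) + 2 / real (Suc j)"
      using x(2)[of i] x(2)[of j] by simp
    finally show ?thesis .
  qed
  obtain w where w: "w \<in> X" "(\<lambda>k. sqrt (b (x k - w) (x k - w))) \<longlonglongrightarrow> 0"
  proof (rule complete_inD[OF comp, of x])
    fix e :: real assume "e > 0"
    then obtain M where M: "inverse (real (Suc M)) < e\<^sup>2 / 4" 
      using reals_Archimedean[of "e\<^sup>2/4"] by auto
    have "sqrt (b (x i - x j) (x i - x j)) < e" if "i \<ge> M" "j \<ge> M" for i j
    proof -
      have "2 / real (Suc i) \<le> 2 * inverse (real (Suc M))" "2 / real (Suc j) \<le> 2 * inverse (real (Suc M))"
        using that by (auto simp: field_simps)
      then have "b (x i - x j) (x i - x j) < e\<^sup>2" using par[of i j] M by linarith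
      then have "sqrt (b (x i - x j) (x i - x j)) < sqrt (e\<^sup>2)" by (rule real_sqrt_less_mono)
      then show ?thesis using \<open>e > 0\<close> by simp
    qed
    then show "\<exists>M. \<forall>i\<ge>M. \<forall>j\<ge>M. sqrt (b (x i - x j) (x i - x j)) < e" by blast
  qed (use x in auto)
  have "b w v = l v" if v: "v \<in> X" for v
  proof -
    have lim: "(\<lambda>k. b (x k) v) \<longlonglongrightarrow> b w v"
    proof (rule LIM_zero_cancel, rule Lim_null_comparison)
      show "\<forall>\<^sub>F k in sequentially. norm (b (x k) v - b w v) \<le> sqrt (b (x k - w) (x k - w)) * sqrt (b v v)"
        using cauchy_schwarz[of "x _ - w" v] by (auto simp: x w v b_diff)
      show "(\<lambda>k. sqrt (b (x k - w) (x k - w)) * sqrt (b v v)) \<longlonglongrightarrow> 0"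
        using tendsto_mult_right[OF w(2), of "sqrt (b v v)"] by simp
    qed
    \<comment> \<open>the first variation at the minimiser in direction \<open>v\<close>\<close>
    have q: "0 \<le> 2 * t * (b w v - l v) + t\<^sup>2 * b v v" for t
    proof -
      have "- (1 / real (Suc k)) \<le> 2 * t * (b (x k) v - l v) + t\<^sup>2 * b v v" for k
        using m_le[of "x k + t *\<^sub>R v"] x(2)[of k] x(1)[of k] v
        by (simp add: I_def b_expand l_add l_scale algebra_simps)
      moreover have "(\<lambda>k. - (1 / real (Suc k))) \<longlonglongrightarrow> 0"
        using tendsto_minus[OF LIMSEQ_inverse_real_of_nat] by (simp add: inverse_eq_divide)
      moreover have "(\<lambda>k. 2 * t * (b (x k) v - l v) + t\<^sup>2 * b v v) \<longlonglongrightarrow>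
           2 * t * (b w v - l v) + t\<^sup>2 * b v v"
        by (intro tendsto_intros lim)
      ultimately show ?thesis by (intro LIMSEQ_le) auto
    qed
    define d where "d = b w v - l v"
    have "d = 0"
    proof (cases "b v v = 0")
      case True
      then show ?thesis using q[of "- d"] by (auto simp: d_def[symmetric] mult_le_0_iff)
    next
      case False
      then have p: "b v v > 0" using b_nonneg[OF v] by simp
      have "0 \<le> 2 * (- d / b v v) * d + (- d / b v v)\<^sup>2 * b v v"
        using q[of "- d / b v v"] by (simp add: d_def)
      also have "\<dots> = - (d\<^sup>2 / b v v)" using p by (simp add: power2_eq_square field_simps)
      finally have "d\<^sup>2 / b v v \<le> 0" by simp
      then have "d\<^sup>2 \<le> 0" using p by (simp add: divide_le_0_iff)
      then show ?thesis by simp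
    qed
    then show ?thesis by (simp add: d_def)
  qed
  then show ?thesis using w(1) by blast
qed

end

section \<open>Linear evolution equations in an abstract Hilbert space\<close>

lemma has_vector_derivative_integral_from_0:
  fixes G :: "real \<Rightarrow> 'e::banach"
  assumes cont: "continuous_on UNIV G" and zero: "\<And>t. t \<le> 0 \<Longrightarrow> G t = 0"
  shows "((\<lambda>t. integral {0..t} G) has_vector_derivative G t) (at t)"
proof -
  define a where "a = min t 0 - 1"
  have eq: "integral {0..s} G = integral {a..s} G" if "s \<in> {a<..<t+1}" for s
  proof (cases "s \<le> 0")
    case True
    have "integral {a..s} G = integral {a..s} (\<lambda>_. 0)"
      by (rule integral_cong) (use True zero in auto)
    moreover have "integral {0..s} G = integral {0..s} (\<lambda>_. 0)"
      by (rule integral_cong) (use True zero in auto)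
    ultimately show ?thesis by simp
  next
    case False
    have "integral {a..0} G + integral {0..s} G = integral {a..s} G"
      by (rule Henstock_Kurzweil_Integration.integral_combine)
        (use False in \<open>auto simp: a_def intro: integrable_continuous_interval
           continuous_on_subset[OF cont]\<close>)
    moreover have "integral {a..0} G = integral {a..0} (\<lambda>_. 0)"
      by (rule integral_cong) (use zero in auto)
    ultimately show ?thesis by simp
  qed
  have "((\<lambda>s. integral {a..s} G) has_vector_derivative G t) (at t within {a..t+1})"
    by (rule integral_has_vector_derivative) (auto simp: a_def intro: continuous_on_subset[OF cont])
  then have "((\<lambda>s. integral {a..s} G) has_vector_derivative G t) (at t within {a<..<t+1})"
    by (rule has_vector_derivative_within_subset) auto
  then have "((\<lambda>s. integral {0..s} G) has_vector_derivative G t) (at t within {a<..<t+1})"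
    by (rule has_vector_derivative_transform[rotated 2]) (use eq in \<open>auto simp: a_def\<close>)
  moreover have "at t within {a<..<t+1} = at t"
    by (rule at_within_open) (auto simp: a_def)
  ultimately show ?thesis by simp
qed

lemma integral_power_0:
  assumes "0 \<le> t"
  shows "((\<lambda>s. s ^ n) has_integral (t ^ Suc n / real (Suc n))) {0..t::real}"
proof -
  have "((\<lambda>s. s ^ n) has_integral (t ^ Suc n / real (Suc n) - 0 ^ Suc n / real (Suc n))) {0..t}"
  proof (rule fundamental_theorem_of_calculus[OF assms])
    fix s :: real
    have "((\<lambda>s. s ^ Suc n / real (Suc n)) has_real_derivative s ^ n) (at s within {0..t})"
      by (rule has_field_derivative_at_within, rule DERIV_cong[OF DERIV_cdivide[OF DERIV_pow]])
        (simp del: of_nat_Suc)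
    then show "((\<lambda>s. s ^ Suc n / real (Suc n)) has_vector_derivative s ^ n) (at s within {0..t})"
      by (simp add: has_real_derivative_iff_has_vector_derivative)
  qed
  then show ?thesis by simp
qed

text \<open>The solution is the sum of the iterated integrals \<open>D n\<close> of Picard's method, which are of order
\<open>t ^ n / fact n\<close>. As \<open>F\<close> vanishes for negative times, extending the solution by 0 makes it
differentiable on the whole line.\<close>

theorem linear_ode:
  fixes A :: "'e::banach \<Rightarrow> 'e" and F :: "real \<Rightarrow> 'e"
  assumes A: "bounded_linear A" and F: "continuous_on UNIV F" and F0: "\<And>t. t \<le> 0 \<Longrightarrow> F t = 0"
  obtains Y where "\<And>t. (Y has_vector_derivative A (Y t) + F t) (at t)" "\<And>t. t \<le> 0 \<Longrightarrow> Y t = 0"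
proof -
  interpret A: bounded_linear A by (rule A)
  define D where "D = rec_nat (\<lambda>t. integral {0..t} F) (\<lambda>_ d t. integral {0..t} (\<lambda>s. A (d s)))"
  have D0: "D 0 t = integral {0..t} F" and DS: "D (Suc n) t = integral {0..t} (\<lambda>s. A (D n s))" for n t
    by (simp_all add: D_def)
  have D_neg: "D n t = 0" if "t \<le> 0" for n t
  proof -
    have "integral {0..t} (G :: real \<Rightarrow> 'e) = 0" if "G 0 = 0" for G
      using \<open>t \<le> 0\<close> that by (cases "t = 0") auto
    moreover have "A (D n 0) = 0" for n
      by (induction n) (auto simp: D0 DS A.zero)
    ultimately show ?thesis by (cases n) (auto simp: D0 DS F0)
  qed
  have D_cont: "continuous_on UNIV (D n)" for n
  proof (induction n)
    case 0
    have "D 0 = (\<lambda>t. integral {0..t} F)" by (auto simp: D0)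
    then show ?case
      using has_vector_derivative_integral_from_0[OF F F0]
      by (metis continuous_at_imp_continuous_on has_vector_derivative_continuous)
  next
    case (Suc n)
    have "continuous_on UNIV (\<lambda>s. A (D n s))" by (rule A.continuous_on[OF Suc])
    moreover have "D (Suc n) = (\<lambda>t. integral {0..t} (\<lambda>s. A (D n s)))" by (auto simp: DS)
    ultimately show ?case
      using has_vector_derivative_integral_from_0[of "\<lambda>s. A (D n s)"]
      by (metis A.zero D_neg continuous_at_imp_continuous_on has_vector_derivative_continuous)
  qed
  have AD_int: "(\<lambda>s. A (D n s)) integrable_on {0..t}" for n t
    by (intro integrable_continuous_interval A.continuous_on continuous_on_subset[OF D_cont]) auto
  obtain c where c: "c \<ge> 0" "\<And>x. norm (A x) \<le> norm x * c"
    using A.nonneg_bounded by blast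
  have bound: "\<exists>M\<ge>0. \<forall>n. \<forall>t\<in>{0..S}. norm (D n t) \<le> M * c ^ n * t ^ n / fact n" for S
  proof -
    have "compact (D 0 ` {0..S})"
      by (intro compact_continuous_image continuous_on_subset[OF D_cont]) auto
    then obtain M where M: "\<And>t. t \<in> {0..S} \<Longrightarrow> norm (D 0 t) \<le> M"
      by (meson bounded_iff compact_imp_bounded image_eqI)
    have "norm (D n t) \<le> max 0 M * c ^ n * t ^ n / fact n" if "t \<in> {0..S}" for n t
      using that
    proof (induction n arbitrary: t)
      case 0
      then show ?case using M[of t] by simp
    next
      case (Suc n)
      have "norm (D (Suc n) t) \<le> integral {0..t} (\<lambda>s. (max 0 M * c ^ Suc n / fact n) * s ^ n)"
        unfolding DS
      proof (rule integral_norm_bound_integral[OF AD_int])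
        show "(\<lambda>s. max 0 M * c ^ Suc n / fact n * s ^ n) integrable_on {0..t}"
          by (intro integrable_continuous_interval continuous_intros)
        fix s assume s: "s \<in> {0..t}"
        have "norm (A (D n s)) \<le> norm (D n s) * c" by (rule c)
        also have "\<dots> \<le> (max 0 M * c ^ n * s ^ n / fact n) * c"
          using Suc.IH[of s] s Suc.prems c(1) by (intro mult_right_mono) auto
        finally show "norm (A (D n s)) \<le> max 0 M * c ^ Suc n / fact n * s ^ n"
          by (simp add: mult_ac)
      qed
      also have "\<dots> = (max 0 M * c ^ Suc n / fact n) * (t ^ Suc n / real (Suc n))"
        using integral_power_0[of t n] Suc.prems by (simp add: integral_unique)
      also have "\<dots> = max 0 M * c ^ Suc n * t ^ Suc n / fact (Suc n)"
        by (simp add: field_simps)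
      finally show ?case .
    qed
    then show ?thesis by (intro exI[of _ "max 0 M"]) auto
  qed
  define Y where "Y = (\<lambda>t. \<Sum>n. D n t)"
  have unif: "uniform_limit {..S} (\<lambda>n t. \<Sum>i<n. D i t) Y sequentially" for S
  proof -
    obtain M where M: "M \<ge> 0" "\<And>n t. t \<in> {0..S} \<Longrightarrow> norm (D n t) \<le> M * c ^ n * t ^ n / fact n"
      using bound[of S] by blast
    have "uniform_limit {..S} (\<lambda>n t. \<Sum>i<n. D i t) (\<lambda>t. \<Sum>i. D i t) sequentially"
    proof (rule Weierstrass_m_test)
      show "summable (\<lambda>n. M * (inverse (fact n) * (c * max 0 S) ^ n))"
        by (intro summable_mult summable_exp)
      fix n t assume t: "t \<in> {..S}"
      show "norm (D n t) \<le> M * (inverse (fact n) * (c * max 0 S) ^ n)"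
      proof (cases "t \<le> 0")
        case True
        then show ?thesis using D_neg M(1) c(1) by (auto intro!: mult_nonneg_nonneg)
      next
        case False
        have "norm (D n t) \<le> M * c ^ n * t ^ n / fact n" by (rule M(2)) (use False t in auto)
        also have "\<dots> = M * (inverse (fact n) * (c * t) ^ n)"
          by (simp add: field_simps power_mult_distrib)
        also have "\<dots> \<le> M * (inverse (fact n) * (c * max 0 S) ^ n)"
          using False t M(1) c(1) by (intro mult_left_mono power_mono) auto
        finally show ?thesis .
      qed
    qed
    then show ?thesis by (simp add: Y_def)
  qed
  have Y_cont: "continuous_on UNIV Y"
  proof -
    have c: "continuous_on {..S} Y" for S
      by (rule uniform_limit_theorem[OF _ unif])
        (auto intro!: always_eventually continuous_on_sum continuous_on_subset[OF D_cont])
    have "continuous (at t) Y" for t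
    proof -
      have "continuous_on {..<t+1} Y" by (rule continuous_on_subset[OF c[of "t+1"]]) auto
      then show ?thesis using continuous_on_interior[of "{..<t+1}" Y t] by (simp add: interior_open)
    qed
    then show ?thesis by (simp add: continuous_at_imp_continuous_on)
  qed
  have Y_neg: "Y t = 0" if "t \<le> 0" for t using D_neg that by (simp add: Y_def)
  have Y_eq: "Y t = integral {0..t} (\<lambda>s. A (Y s) + F s)" for t
  proof -
    have F_int: "F integrable_on {0..t}"
      by (intro integrable_continuous_interval continuous_on_subset[OF F]) auto
    have AY_int: "(\<lambda>s. A (Y s)) integrable_on {0..t}"
      by (intro integrable_continuous_interval A.continuous_on continuous_on_subset[OF Y_cont]) auto
    let ?S = "\<lambda>n t. \<Sum>i<n. D i t"
    have step: "?S (Suc n) t = integral {0..t} F + integral {0..t} (\<lambda>s. A (?S n s))" for n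
    proof -
      have "integral {0..t} (\<lambda>s. A (?S n s)) = (\<Sum>i<n. D (Suc i) t)"
        using AD_int by (simp add: A.sum DS integral_sum)
      then show ?thesis unfolding sum.lessThan_Suc_shift by (simp add: D0)
    qed
    have "uniform_limit {0..t} (\<lambda>n s. A (?S n s)) (\<lambda>s. A (Y s)) sequentially"
      by (rule bounded_linear.uniform_limit[OF A]) (rule uniform_limit_on_subset[OF unif[of t]], auto)
    then obtain I J where "\<And>n. ((\<lambda>s. A (?S n s)) has_integral I n) {0..t}"
      "((\<lambda>s. A (Y s)) has_integral J) {0..t}" "I \<longlonglongrightarrow> J"
      by (rule uniform_limit_integral)
        (auto intro!: A.continuous_on continuous_on_sum continuous_on_subset[OF D_cont])
    then have "(\<lambda>n. integral {0..t} (\<lambda>s. A (?S n s))) \<longlonglongrightarrow> integral {0..t} (\<lambda>s. A (Y s))"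
      by (metis (no_types, lifting) ext integral_unique)
    then have "(\<lambda>n. ?S (Suc n) t) \<longlonglongrightarrow> integral {0..t} F + integral {0..t} (\<lambda>s. A (Y s))"
      unfolding step by (intro tendsto_intros)
    moreover have "(\<lambda>n. ?S (Suc n) t) \<longlonglongrightarrow> Y t"
      by (rule LIMSEQ_Suc) (use tendsto_uniform_limitI[OF unif[of t], of t] in auto)
    ultimately have "Y t = integral {0..t} F + integral {0..t} (\<lambda>s. A (Y s))"
      using LIMSEQ_unique by blast
    then show ?thesis using AY_int F_int by (simp add: integral_add)
  qed
  have "(Y has_vector_derivative A (Y t) + F t) (at t)" for t
  proof -
    have "((\<lambda>t. integral {0..t} (\<lambda>s. A (Y s) + F s)) has_vector_derivative A (Y t) + F t) (at t)"
      by (rule has_vector_derivative_integral_from_0)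
        (auto intro!: continuous_intros A.continuous_on Y_cont F simp: Y_neg A.zero F0)
    moreover have "Y = (\<lambda>t. integral {0..t} (\<lambda>s. A (Y s) + F s))" using Y_eq by blast
    ultimately show ?thesis by simp
  qed
  then show ?thesis using that Y_neg by blast
qed

section \<open>The regularised wave equation\<close>

text \<open>The energy \<open>E = x \<bullet> L x + L x' \<bullet> L x'\<close> has the derivative \<open>2 (L x' \<bullet> f)\<close>, which is at
most \<open>2 \<surd>E \<parallel>f\<parallel>\<close> in absolute value. Since \<open>E\<close> vanishes from \<open>T\<close> on, integrating from a point where
\<open>E\<close> is maximal up to \<open>T\<close> bounds the maximum of \<open>\<surd>E\<close>.\<close>

lemma energy_estimate:
  fixes L :: "'h::{real_inner,banach} \<Rightarrow> 'h"
  assumes L: "bounded_linear L" and sym: "\<And>x y. L x \<bullet> y = x \<bullet> L y" and pos: "\<And>x. 0 \<le> x \<bullet> L x"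
    and x: "\<And>t. (x has_vector_derivative x1 t) (at t)"
    and x1: "\<And>t. (x1 has_vector_derivative x2 t) (at t)"
    and eq: "\<And>t. L (x2 t) + x t = f t" and f: "continuous_on UNIV f"
    and T: "0 \<le> T" "\<And>t. T \<le> t \<Longrightarrow> x t = 0 \<and> x1 t = 0" and t: "0 \<le> t"
  shows "norm (L (x1 t)) \<le> 2 * integral {0..T} (\<lambda>s. norm (f s))"
    and "x t \<bullet> L (x t) \<le> (2 * integral {0..T} (\<lambda>s. norm (f s)))\<^sup>2"
proof -
  interpret L: bounded_linear L by (rule L)
  define E where "E t = x t \<bullet> L (x t) + L (x1 t) \<bullet> L (x1 t)" for t
  define I where "I = integral {0..T} (\<lambda>s. norm (f s))"
  have fi: "(\<lambda>s. norm (f s)) integrable_on {a..b}" for a b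
    by (intro integrable_continuous_interval continuous_intros continuous_on_subset[OF f]) auto
  have I0: "0 \<le> I" unfolding I_def by (intro integral_nonneg fi) auto
  have dE: "(E has_vector_derivative 2 * (L (x1 t) \<bullet> f t)) (at t)" for t
  proof -
    have d1: "((\<lambda>t. L (x t)) has_vector_derivative L (x1 t)) (at t)"
      and d2: "((\<lambda>t. L (x1 t)) has_vector_derivative L (x2 t)) (at t)"
      by (intro bounded_linear.has_vector_derivative[OF L] x x1)+
    have "(E has_vector_derivative (x t \<bullet> L (x1 t) + x1 t \<bullet> L (x t)) +
        (L (x1 t) \<bullet> L (x2 t) + L (x2 t) \<bullet> L (x1 t))) (at t)"
      unfolding E_def
      by (intro has_vector_derivative_add bounded_bilinear.has_vector_derivative[OF bounded_bilinear_inner] x d1 d2)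
    also have "(x t \<bullet> L (x1 t) + x1 t \<bullet> L (x t)) + (L (x1 t) \<bullet> L (x2 t) + L (x2 t) \<bullet> L (x1 t))
        = 2 * (L (x1 t) \<bullet> f t)"
      using sym[of "x1 t" "x t"] inner_commute[of "L (x1 t)" "x t"]
        inner_commute[of "L (x1 t)" "L (x2 t)"]
      by (simp add: eq[symmetric] inner_add_right)
    finally show ?thesis .
  qed
  have E_cont: "continuous_on S E" for S
    using dE by (metis continuous_at_imp_continuous_on has_vector_derivative_continuous)
  have E_zero: "E t = 0" if "T \<le> t" for t using T(2)[OF that] by (simp add: E_def L.zero)
  have "{0..T} \<noteq> {}" using T by simp
  from continuous_attains_sup[OF compact_Icc this E_cont]
  obtain t0 where t0: "t0 \<in> {0..T}" "\<And>t. t \<in> {0..T} \<Longrightarrow> E t \<le> E t0" by blast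
  define S where "S = sqrt (E t0)"
  have E_nonneg: "0 \<le> E t" for t using pos by (simp add: E_def)
  have S0: "S \<ge> 0" by (simp add: S_def E_nonneg)
  have Lx1: "norm (L (x1 t)) \<le> sqrt (E t)" for t
    using pos by (auto intro!: real_le_rsqrt simp: E_def power2_norm_eq_inner)
  have "((\<lambda>s. 2 * (L (x1 s) \<bullet> f s)) has_integral E T - E t0) {t0..T}"
    using t0(1) by (intro fundamental_theorem_of_calculus has_vector_derivative_at_within[OF dE]) auto
  then have "integral {t0..T} (\<lambda>s. 2 * (L (x1 s) \<bullet> f s)) = - E t0"
    and int: "(\<lambda>s. 2 * (L (x1 s) \<bullet> f s)) integrable_on {t0..T}"
    using E_zero[of T] by (simp only: integral_unique, auto)
  then have "E t0 \<le> norm (integral {t0..T} (\<lambda>s. 2 * (L (x1 s) \<bullet> f s)))"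
    by simp
  also have "\<dots> \<le> integral {t0..T} (\<lambda>s. 2 * S * norm (f s))"
  proof (rule integral_norm_bound_integral[OF int])
    show "(\<lambda>s. 2 * S * norm (f s)) integrable_on {t0..T}" 
      by (intro integrable_continuous_interval continuous_intros continuous_on_subset[OF f]) auto
    fix s assume s: "s \<in> {t0..T}"
    have "norm (L (x1 s)) \<le> S"
      using Lx1[of s] t0(1) t0(2)[of s] s unfolding S_def by (auto intro: order_trans)
    then have "\<bar>L (x1 s) \<bullet> f s\<bar> \<le> S * norm (f s)"
      using Cauchy_Schwarz_ineq2[of "L (x1 s)" "f s"] mult_right_mono[of _ S "norm (f s)"]
      by (meson norm_ge_zero order_trans)
    then show "norm (2 * (L (x1 s) \<bullet> f s)) \<le> 2 * S * norm (f s)" by simp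
  qed
  also have "\<dots> = 2 * S * integral {t0..T} (\<lambda>s. norm (f s))" by simp
  also have "\<dots> \<le> 2 * S * I"
    unfolding I_def using t0(1) S0 by (intro mult_left_mono integral_subset_le fi) auto
  finally have "S * S \<le> (2 * I) * S" by (simp add: S_def E_nonneg mult_ac)
  then have S_le: "S \<le> 2 * I" using S0 I0 by (cases "S = 0") auto
  have "sqrt (E t) \<le> 2 * I"
  proof (cases "t \<le> T")
    case True
    then have "sqrt (E t) \<le> S" unfolding S_def using t0(2)[of t] t by (intro real_sqrt_le_mono) auto
    then show ?thesis using S_le by linarith
  next
    case False
    then show ?thesis using E_zero[of t] I0 by simp
  qed
  then show "norm (L (x1 t)) \<le> 2 * integral {0..T} (\<lambda>s. norm (f s))"
    using Lx1[of t] by (simp add: I_def)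
  have "x t \<bullet> L (x t) \<le> E t" by (simp add: E_def)
  also have "E t = (sqrt (E t))\<^sup>2" by (simp add: E_nonneg)
  also have "\<dots> \<le> (2 * I)\<^sup>2" using \<open>sqrt (E t) \<le> 2 * I\<close> by (intro power_mono) (simp_all add: E_nonneg)
  finally show "x t \<bullet> L (x t) \<le> (2 * integral {0..T} (\<lambda>s. norm (f s)))\<^sup>2" by (simp add: I_def)
qed

text \<open>In the application \<open>K\<close> is the inverse of \<open>L\<close>. The space consists of functions on all of \<open>\<real>\<^sup>n\<close>, so
\<open>K\<close> annihilates those that vanish on \<open>\<Omega>\<close>; hence the hypothesis on the kernel in the lemmas on the
density of its range.\<close>

locale positive_operator =
  fixes K :: "'h::{real_inner,banach} \<Rightarrow> 'h"
  assumes bl: "bounded_linear K" and K_sym: "K x \<bullet> y = x \<bullet> K y" and K_pos: "0 \<le> x \<bullet> K x"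
begin

sublocale K: bounded_linear K by (rule bl)

lemma bounded_linear_shift: "bounded_linear (\<lambda>x. K x + e *\<^sub>R x)"
  by (intro bounded_linear_add bl bounded_linear_scaleR_right)

lemma norm_le_shift: 
  assumes "e \<ge> 0" shows "norm (K x) \<le> norm (K x + e *\<^sub>R x)"
proof -
  have "(K x + e *\<^sub>R x) \<bullet> (K x + e *\<^sub>R x) = K x \<bullet> K x + 2 * e * (x \<bullet> K x) + e\<^sup>2 * (x \<bullet> x)"
    using inner_commute[of x "K x"]
    by (simp add: inner_add_left inner_add_right power2_eq_square algebra_simps)
  then have "K x \<bullet> K x \<le> (K x + e *\<^sub>R x) \<bullet> (K x + e *\<^sub>R x)"
    using K_pos[of x] assms by simp
  then show ?thesis by (simp add: norm_eq_sqrt_inner)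
qed

text \<open>Riesz' theorem for the form \<open>(K x + e x) \<bullet> y\<close>, which is coercive because \<open>e > 0\<close>.\<close>

lemma resolvent:
  assumes e: "e > 0"
  obtains R where "bounded_linear R" "\<And>h. K (R h) + e *\<^sub>R R h = h"
proof -
  define b where "b x y = (K x + e *\<^sub>R x) \<bullet> y" for x y
  interpret b: psd_form UNIV b
  proof
    show "subspace (UNIV :: 'h set)" by simp
    show "b (u + v) w = b u w + b v w" for u v w
      by (simp add: b_def K.add inner_add_left scaleR_add_right algebra_simps)
    show "b (c *\<^sub>R u) v = c * b u v" for c u v
      by (simp add: b_def K.scaleR inner_add_left algebra_simps)
    show "b u v = b v u" for u v
      using K_sym[of v u] inner_commute[of v "K u"] inner_commute[of u v]
      by (simp add: b_def inner_add_left)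
    show "0 \<le> b u u" for u
      using K_pos[of u] e by (simp add: b_def inner_add_left inner_commute[of u "K u"])
  qed
  have coer: "sqrt e * norm x \<le> sqrt (b x x)" for x
  proof -
    have "e * (x \<bullet> x) \<le> b x x"
      using K_pos[of x] by (simp add: b_def inner_add_left inner_commute[of x "K x"])
    then have "sqrt (e * (x \<bullet> x)) \<le> sqrt (b x x)" by (rule real_sqrt_le_mono)
    then show ?thesis by (simp add: real_sqrt_mult norm_eq_sqrt_inner)
  qed
  have comp: "complete_in UNIV (\<lambda>v. sqrt (b v v))"
    unfolding complete_in_def
  proof (intro allI impI)
    fix x :: "nat \<Rightarrow> 'h"
    assume C: "\<forall>d>0. \<exists>M. \<forall>i\<ge>M. \<forall>j\<ge>M. sqrt (b (x i - x j) (x i - x j)) < d"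
    have "Cauchy x"
      unfolding Cauchy_def
    proof (intro allI impI)
      fix d :: real assume "d > 0"
      then have "sqrt e * d > 0" using e by simp
      then obtain M where M: "\<forall>i\<ge>M. \<forall>j\<ge>M. sqrt (b (x i - x j) (x i - x j)) < sqrt e * d"
        using C by blast
      have "dist (x i) (x j) < d" if "i \<ge> M" "j \<ge> M" for i j
      proof -
        have "sqrt e * norm (x i - x j) < sqrt e * d"
          using M that coer[of "x i - x j"] by (meson le_less_trans)
        then show ?thesis using e by (simp add: dist_norm)
      qed
      then show "\<exists>M. \<forall>m\<ge>M. \<forall>n\<ge>M. dist (x m) (x n) < d" by blast
    qed
    then obtain l where l: "x \<longlonglongrightarrow> l" using Cauchy_convergent convergent_def by blast
    have "(\<lambda>k. sqrt (b (x k - l) (x k - l))) \<longlonglongrightarrow> sqrt (b (l - l) (l - l))"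
      unfolding b_def
      by (intro tendsto_intros tendsto_inner tendsto_add bounded_linear.tendsto[OF bl] l)
    then show "\<exists>l\<in>UNIV. (\<lambda>k. sqrt (b (x k - l) (x k - l))) \<longlonglongrightarrow> 0"
      by (auto simp: b_def K.zero)
  qed
  have ex: "\<exists>w. K w + e *\<^sub>R w = h" for h
  proof -
    have "\<exists>w\<in>UNIV. \<forall>v\<in>UNIV. b w v = h \<bullet> v"
    proof (rule b.riesz_representation[OF comp])
      show "\<bar>h \<bullet> v\<bar> \<le> (norm h / sqrt e) * sqrt (b v v)" for v
      proof -
        have "\<bar>h \<bullet> v\<bar> \<le> norm h * norm v" by (rule Cauchy_Schwarz_ineq2)
        also have "\<dots> \<le> norm h * (sqrt (b v v) / sqrt e)"
          using coer[of v] e by (intro mult_left_mono) (auto simp: field_simps)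
        finally show ?thesis by simp
      qed
    qed (auto simp: inner_add_right)
    then show ?thesis unfolding b_def by (metis UNIV_I vector_eq_rdot)
  qed
  have low: "e * norm x \<le> norm (K x + e *\<^sub>R x)" for x
  proof -
    have "e * norm x * norm x \<le> (K x + e *\<^sub>R x) \<bullet> x"
      using K_pos[of x] inner_commute[of x "K x"]
      by (simp add: inner_add_left dot_square_norm power2_eq_square)
    also have "\<dots> \<le> norm (K x + e *\<^sub>R x) * norm x" by (rule norm_cauchy_schwarz)
    finally show ?thesis by (cases "x = 0") auto
  qed
  have inj: "x = y" if "K x + e *\<^sub>R x = K y + e *\<^sub>R y" for x y
    using low[of "x - y"] that e
    by (simp add: K.diff scaleR_diff_right algebra_simps mult_le_0_iff)
  obtain R where R: "\<And>h. K (R h) + e *\<^sub>R R h = h"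
    using choice[of "\<lambda>h w. K w + e *\<^sub>R w = h"] ex by blast
  have "bounded_linear R"
  proof (rule bounded_linear_intro[where K = "1/e"])
    show "R (x + y) = R x + R y" for x y
    proof (rule inj)
      have "K (R x + R y) + e *\<^sub>R (R x + R y) = (K (R x) + e *\<^sub>R R x) + (K (R y) + e *\<^sub>R R y)"
        by (simp add: K.add scaleR_add_right)
      then show "K (R (x + y)) + e *\<^sub>R R (x + y) = K (R x + R y) + e *\<^sub>R (R x + R y)"
        by (simp only: R)
    qed
    show "R (c *\<^sub>R x) = c *\<^sub>R R x" for c x
    proof (rule inj)
      have "K (c *\<^sub>R R x) + e *\<^sub>R (c *\<^sub>R R x) = c *\<^sub>R (K (R x) + e *\<^sub>R R x)"
        by (simp add: K.scaleR scaleR_add_right scaleR_left_commute)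
      then show "K (R (c *\<^sub>R x)) + e *\<^sub>R R (c *\<^sub>R x) = K (c *\<^sub>R R x) + e *\<^sub>R (c *\<^sub>R R x)"
        by (simp only: R)
    qed
    show "norm (R x) \<le> norm x * (1/e)" for x
      using low[of "R x"] e by (simp add: R field_simps)
  qed
  then show ?thesis using that R by blast
qed

text \<open>With \<open>x = L u\<close> this is the wave equation, up to the term \<open>e x''\<close> that makes the coefficient of
\<open>x''\<close> invertible. The solution is the one with zero data at time \<open>T\<close>.\<close>

definition regularised_solution where
  "regularised_solution e T f x x1 x2 \<longleftrightarrow>
     (\<forall>t. (x has_vector_derivative x1 t) (at t)) \<and>
     (\<forall>t. (x1 has_vector_derivative x2 t) (at t)) \<and>
     continuous_on UNIV x2 \<and> 
     (\<forall>t. K (x2 t) + e *\<^sub>R x2 t + x t = f t) \<and>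
     (\<forall>t\<ge>T. x t = 0 \<and> x1 t = 0 \<and> x2 t = 0)"

lemma regularised_solution_exists:
  assumes e: "e > 0" and g: "continuous_on UNIV g" and g0: "\<And>t. T \<le> t \<Longrightarrow> g t = 0"
  obtains x x1 x2 where "regularised_solution e T g x x1 x2"
proof -
  obtain R where R: "bounded_linear R" "\<And>h. K (R h) + e *\<^sub>R R h = h"
    using resolvent[OF e] by blast
  interpret R: bounded_linear R by (rule R(1))
  \<comment> \<open>the first-order system for the pair of position and velocity, with time reversed from \<open>T\<close>\<close>
  define A where "A = (\<lambda>(u :: 'h, v :: 'h). (v, - R u))"
  define F where "F t = (0 :: 'h, R (g (T - t)))" for t
  have A: "bounded_linear A"
    unfolding A_def case_prod_beta
    by (intro bounded_linear_Pair bounded_linear_minus bounded_linear_snd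
        bounded_linear_compose[OF R(1)] bounded_linear_fst)
  obtain Y where Y: "\<And>t. (Y has_vector_derivative A (Y t) + F t) (at t)" "\<And>t. t \<le> 0 \<Longrightarrow> Y t = 0"
  proof (rule linear_ode[OF A, of F])
    show "continuous_on UNIV F" unfolding F_def
      by (intro continuous_intros R.continuous_on continuous_on_compose2[OF g]) auto
  qed (auto simp: F_def g0 R.zero zero_prod_def)
  define x where "x t = fst (Y (T - t))" for t
  define x1 where "x1 t = - snd (Y (T - t))" for t
  define x2 where "x2 t = R (g t - x t)" for t
  have Yr: "((\<lambda>t. Y (T - t)) has_vector_derivative - (A (Y (T - t)) + F (T - t))) (at t)" for t
  proof -
    have "((Y \<circ> (\<lambda>t. T - t)) has_vector_derivative (-1) *\<^sub>R (A (Y (T - t)) + F (T - t))) (at t)"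
      by (rule vector_diff_chain_at) (auto intro!: derivative_eq_intros Y(1))
    then show ?thesis by (simp add: o_def)
  qed
  have dx: "(x has_vector_derivative x1 t) (at t)" for t
    using bounded_linear.has_vector_derivative[OF bounded_linear_fst Yr[of t]]
    by (simp add: x_def[abs_def] x1_def A_def F_def case_prod_beta)
  have dx1: "(x1 has_vector_derivative x2 t) (at t)" for t
    using has_vector_derivative_minus[OF bounded_linear.has_vector_derivative[OF bounded_linear_snd Yr[of t]]]
    by (simp add: x_def x1_def[abs_def] x2_def A_def F_def case_prod_beta R.diff)
  have "continuous_on UNIV x"
    using dx by (metis continuous_at_imp_continuous_on has_vector_derivative_continuous)
  then have "continuous_on UNIV x2"
    unfolding x2_def by (intro R.continuous_on continuous_intros g)
  moreover have "x t = 0 \<and> x1 t = 0 \<and> x2 t = 0" if "t \<ge> T" for t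
    using that Y(2)[of "T - t"] g0[of t] by (simp add: x_def x1_def x2_def R.zero)
  moreover have "K (x2 t) + e *\<^sub>R x2 t + x t = g t" for t
    by (simp add: x2_def R(2))
  ultimately have "regularised_solution e T g x x1 x2"
    unfolding regularised_solution_def using dx dx1 by blast
  then show ?thesis by (rule that)
qed

lemma continuous_regularised:
  assumes "regularised_solution e T f x x1 x2"
  shows "continuous_on UNIV x" "continuous_on UNIV x1" "continuous_on UNIV x2" "continuous_on UNIV f"
proof -
  show c: "continuous_on UNIV x" "continuous_on UNIV x1" "continuous_on UNIV x2"
    using assms unfolding regularised_solution_def
    by (metis continuous_at_imp_continuous_on has_vector_derivative_continuous)+
  have "f = (\<lambda>t. K (x2 t) + e *\<^sub>R x2 t + x t)"
    using assms unfolding regularised_solution_def by (intro ext) simp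
  then show "continuous_on UNIV f"
    using c by (auto intro!: continuous_intros K.continuous_on)
qed

lemma regularised_energy:
  assumes s: "regularised_solution e T f x x1 x2" and e: "e \<ge> 0" and T: "T \<ge> 0" and t: "0 \<le> t"
  shows "norm (K (x1 t)) \<le> 2 * integral {0..T} (\<lambda>s. norm (f s))"
    and "x t \<bullet> K (x t) \<le> (2 * integral {0..T} (\<lambda>s. norm (f s)))\<^sup>2"
proof -
  let ?L = "\<lambda>v. K v + e *\<^sub>R v"
  have L: "?L v \<bullet> w = v \<bullet> ?L w" "0 \<le> v \<bullet> ?L v" for v w
    using e K_pos[of v] by (simp_all add: inner_add_left inner_add_right K_sym)
  have c: "continuous_on UNIV f" using continuous_regularised[OF s] by simp
  note E = energy_estimate[OF bounded_linear_shift L _ _ _ c T _ t, of x x1 x2]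
  have 1: "norm (?L (x1 t)) \<le> 2 * integral {0..T} (\<lambda>s. norm (f s))"
    by (rule E) (use s in \<open>auto simp: regularised_solution_def\<close>)
  have 2: "x t \<bullet> ?L (x t) \<le> (2 * integral {0..T} (\<lambda>s. norm (f s)))\<^sup>2"
    by (rule E) (use s in \<open>auto simp: regularised_solution_def\<close>)
  show "norm (K (x1 t)) \<le> 2 * integral {0..T} (\<lambda>s. norm (f s))"
    using norm_le_shift[OF e, of "x1 t"] 1 by simp
  show "x t \<bullet> K (x t) \<le> (2 * integral {0..T} (\<lambda>s. norm (f s)))\<^sup>2"
  proof -
    have "x t \<bullet> ?L (x t) = x t \<bullet> K (x t) + e * (x t \<bullet> x t)" by (simp add: inner_add_right)
    moreover have "0 \<le> e * (x t \<bullet> x t)" using e by simp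
    ultimately show ?thesis using 2 by linarith
  qed
qed

text \<open>Solutions for different parameters are compared by moving the difference of the regularising terms to
the right-hand side.\<close>

lemma regularised_diff:
  assumes "regularised_solution e T f x x1 x2" "regularised_solution d S g y y1 y2"
  shows "regularised_solution e (max T S) (\<lambda>t. f t - g t - (e - d) *\<^sub>R y2 t)
    (\<lambda>t. x t - y t) (\<lambda>t. x1 t - y1 t) (\<lambda>t. x2 t - y2 t)"
proof -
  have "f t = K (x2 t) + e *\<^sub>R x2 t + x t" "g t = K (y2 t) + d *\<^sub>R y2 t + y t" for t
    using assms by (auto simp: regularised_solution_def)
  then show ?thesis
    using assms unfolding regularised_solution_def
    by (auto intro!: has_vector_derivative_diff continuous_intros simp: K.diff algebra_simps)
qed

lemma regularised_apply:
  assumes "regularised_solution e T f x x1 x2"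
  shows "regularised_solution e T (\<lambda>t. K (f t)) (\<lambda>t. K (x t)) (\<lambda>t. K (x1 t)) (\<lambda>t. K (x2 t))"
proof -
  have "K (K (x2 t)) + e *\<^sub>R K (x2 t) + K (x t) = K (K (x2 t) + e *\<^sub>R x2 t + x t)" for t
    by (simp add: K.add K.scaleR)
  then show ?thesis
    using assms unfolding regularised_solution_def
    by (auto intro!: K.has_vector_derivative K.continuous_on simp: K.zero)
qed

text \<open>The Cauchy-Schwarz inequality of the form \<open>K x \<bullet> y\<close>, applied to \<open>v\<close> and \<open>K v\<close>.\<close>

lemma K_norm_le:
  assumes c: "c \<ge> 0" "\<And>v. norm (K v) \<le> norm v * c"
  shows "norm (K v) \<le> sqrt c * sqrt (v \<bullet> K v)"
proof -
  interpret psd_form UNIV "\<lambda>x y. K x \<bullet> y"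
  proof
    show "K u \<bullet> v = K v \<bullet> u" for u v using K_sym[of u v] by (simp add: inner_commute)
    show "0 \<le> K u \<bullet> u" for u using K_pos[of u] by (simp add: inner_commute)
  qed (auto simp: K.add K.scaleR inner_add_left)
  have "norm (K v) * norm (K v) = K v \<bullet> K v" by (simp add: dot_square_norm power2_eq_square)
  also have "\<dots> \<le> sqrt (K v \<bullet> v) * sqrt (K (K v) \<bullet> K v)"
    using cauchy_schwarz[of v "K v"] by simp
  also have "K (K v) \<bullet> K v \<le> norm (K v) * c * norm (K v)"
    using norm_cauchy_schwarz[of "K (K v)" "K v"] mult_right_mono[OF c(2)[of "K v"], of "norm (K v)"]
    by (meson norm_ge_zero order_trans)
  then have "sqrt (K (K v) \<bullet> K v) \<le> sqrt (c * (norm (K v))\<^sup>2)"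
    by (intro real_sqrt_le_mono) (simp add: power2_eq_square mult_ac)
  then have "sqrt (K v \<bullet> v) * sqrt (K (K v) \<bullet> K v) \<le> sqrt (K v \<bullet> v) * (sqrt c * norm (K v))"
    using K_pos[of v] by (intro mult_left_mono) (auto simp: real_sqrt_mult inner_commute)
  finally have "norm (K v) * norm (K v) \<le> (sqrt c * sqrt (v \<bullet> K v)) * norm (K v)"
    by (simp add: inner_commute mult_ac)
  then show ?thesis
    using K_pos[of v] c(1) by (cases "norm (K v) = 0") (auto simp: mult_le_cancel_right)
qed

text \<open>If \<open>z\<close> solves the equation with right-hand side \<open>g\<close>, then \<open>K\<^sup>2 z\<close> solves it with right-hand side
\<open>K\<^sup>2 g\<close>. Since \<open>(K + e) z'' = g - z\<close> and \<open>\<parallel>K y\<parallel> \<le> \<parallel>(K + e) y\<parallel>\<close>, the norm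
of \<open>K\<^sup>2 z''\<close> is at most that of \<open>K (g - z)\<close>, for which the energy estimate gives a bound that does not
depend on \<open>e\<close>. The second power of \<open>K\<close> is what this argument needs.\<close>

lemma regularised_second_derivative_bound:
  assumes g: "continuous_on UNIV g" and T: "T \<ge> 0" and g0: "\<And>t. T \<le> t \<Longrightarrow> g t = 0"
  shows "\<exists>C\<ge>0. \<forall>e>0. \<exists>x x1 x2. regularised_solution e T (\<lambda>t. K (K (g t))) x x1 x2 \<and>
           (\<forall>t\<ge>0. norm (x2 t) \<le> C)"
proof -
  obtain c where c: "c \<ge> 0" "\<And>v. norm (K v) \<le> norm v * c"
    using K.nonneg_bounded by blast
  have "compact (g ` {0..T})"
    by (intro compact_continuous_image continuous_on_subset[OF g]) auto
  then obtain G' where G': "\<And>t. t \<in> {0..T} \<Longrightarrow> norm (g t) \<le> G'"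
    by (meson bounded_iff compact_imp_bounded image_eqI)
  define G where "G = max 0 G'"
  have G: "norm (g t) \<le> G" if "t \<ge> 0" for t
    using G'[of t] g0[of t] that by (cases "t \<le> T") (auto simp: G_def)
  define J where "J = 2 * integral {0..T} (\<lambda>s. norm (g s))"
  have J: "J \<ge> 0" unfolding J_def 
    by (auto intro!: integral_nonneg integrable_continuous_interval continuous_intros continuous_on_subset[OF g])
  define C where "C = G * c + sqrt c * J"
  have "C \<ge> 0" using c(1) J by (simp add: C_def G_def)
  moreover have "\<exists>x x1 x2. regularised_solution e T (\<lambda>t. K (K (g t))) x x1 x2 \<and>
      (\<forall>t\<ge>0. norm (x2 t) \<le> C)" if e: "e > 0" for e
  proof -
    obtain z z1 z2 where z: "regularised_solution e T g z z1 z2"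
      using regularised_solution_exists[OF e g g0] by blast
    have "norm (K (K (z2 t))) \<le> C" if t: "t \<ge> 0" for t
    proof -
      have "K (K (z2 t)) + e *\<^sub>R K (z2 t) = K (K (z2 t) + e *\<^sub>R z2 t)"
        by (simp add: K.add K.scaleR)
      also have "K (z2 t) + e *\<^sub>R z2 t = g t - z t"
        using z unfolding regularised_solution_def by (metis add_diff_cancel_right')
      finally have "norm (K (K (z2 t))) \<le> norm (K (g t - z t))"
        using norm_le_shift[of e "K (z2 t)"] e by simp
      also have "\<dots> \<le> norm (K (g t)) + norm (K (z t))"
        by (simp add: K.diff norm_triangle_ineq4)
      also have "norm (K (g t)) \<le> G * c"
        using c(2)[of "g t"] mult_right_mono[OF G[OF t] c(1)] by linarith
      also have "norm (K (z t)) \<le> sqrt c * J"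
      proof -
        have "sqrt (z t \<bullet> K (z t)) \<le> sqrt (J\<^sup>2)"
          using regularised_energy(2)[OF z _ T t] e by (intro real_sqrt_le_mono) (simp add: J_def)
        then have "sqrt c * sqrt (z t \<bullet> K (z t)) \<le> sqrt c * J"
          using J c(1) by (intro mult_left_mono) auto
        then show ?thesis using K_norm_le[OF c, of "z t"] by linarith
      qed
      finally show ?thesis by (simp add: C_def)
    qed
    then show ?thesis using regularised_apply[OF regularised_apply[OF z]] by blast
  qed
  ultimately show ?thesis by blast
qed

text \<open>The parameters \<open>e k\<close> decrease so fast that the regularising terms contribute at most
\<open>1 / Suc k\<close> to each right-hand side. The energy estimate for the difference of two solutions then
makes the sequence Cauchy as soon as the right-hand sides are Cauchy in \<open>L\<^sup>1\<close> in time.\<close>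

theorem approximate_solutions:
  assumes g: "\<And>k::nat. continuous_on UNIV (g k)" and T: "\<And>k. T k \<ge> 0"
    and g0: "\<And>k t. T k \<le> t \<Longrightarrow> g k t = 0"
  shows "\<exists>e x x1 x2. \<forall>k. e k > 0 \<and>
     regularised_solution (e k) (T k) (\<lambda>t. K (K (g k t))) (x k) (x1 k) (x2 k) \<and>
     (\<forall>t\<ge>0. norm (e k *\<^sub>R x2 k t) \<le> 1 / real (Suc k)) \<and>
     (\<forall>j\<ge>k. \<forall>t\<ge>0. let M = 2 * integral {0..max (T j) (T k)} (\<lambda>t. norm (K (K (g j t)) - K (K (g k t)))) + 2 / real (Suc k)
        in norm (K (x1 j t - x1 k t)) \<le> M \<and> (x j t - x k t) \<bullet> K (x j t - x k t) \<le> M\<^sup>2)"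
proof -
  have "\<forall>k. \<exists>C\<ge>0. \<forall>e>0. \<exists>x x1 x2. regularised_solution e (T k) (\<lambda>t. K (K (g k t))) x x1 x2 \<and>
           (\<forall>t\<ge>0. norm (x2 t) \<le> C)"
    using regularised_second_derivative_bound[OF g T g0] by blast
  then obtain C where C: "\<And>k. C k \<ge> 0" "\<And>k e. e > 0 \<Longrightarrow>
      \<exists>x x1 x2. regularised_solution e (T k) (\<lambda>t. K (K (g k t))) x x1 x2 \<and> (\<forall>t\<ge>0. norm (x2 t) \<le> C k)"
    by metis
  \<comment> \<open>a sum over all indices up to \<open>k\<close>, so that \<open>e\<close> is decreasing; the factor \<open>1 + T i\<close> serves both the
    pointwise bound and the integral of \<open>x2\<close> over \<open>{0..T i}\<close>\<close>
  define D where "D k = real (Suc k) * (1 + (\<Sum>i\<le>k. C i * (1 + T i)))" for k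
  define e where "e k = 1 / D k" for k
  have CT: "0 \<le> C i * (1 + T i)" for i using C(1)[of i] T[of i] by simp
  have D_pos: "D k > 0" for k
    unfolding D_def by (intro mult_pos_pos add_pos_nonneg sum_nonneg CT) auto
  have e_pos: "e k > 0" for k using D_pos[of k] by (simp add: e_def)
  have D_mono: "D k \<le> D j" if "k \<le> j" for k j
    unfolding D_def using that CT
    by (intro mult_mono add_left_mono sum_mono2 add_nonneg_nonneg sum_nonneg) auto
  have e_mono: "e j \<le> e k" if "k \<le> j" for k j
    unfolding e_def using D_mono[OF that] D_pos[of k] by (simp add: frac_le)
  have eC: "e k * (C k * (1 + T k)) \<le> 1 / real (Suc k)" for k
  proof -
    have "C k * (1 + T k) \<le> (\<Sum>i\<le>k. C i * (1 + T i))"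
      by (rule member_le_sum) (use CT in auto)
    then have "real (Suc k) * (C k * (1 + T k)) \<le> D k"
      unfolding D_def by (intro mult_left_mono) auto
    then show ?thesis using D_pos[of k] by (simp add: e_def field_simps del: of_nat_Suc)
  qed
  have "\<forall>k. \<exists>x x1 x2. regularised_solution (e k) (T k) (\<lambda>t. K (K (g k t))) x x1 x2 \<and> (\<forall>t\<ge>0. norm (x2 t) \<le> C k)"
    using C(2) e_pos by blast
  then obtain x x1 x2 where
      sol: "\<And>k. regularised_solution (e k) (T k) (\<lambda>t. K (K (g k t))) (x k) (x1 k) (x2 k)"
      and x2: "\<And>k t. t \<ge> 0 \<Longrightarrow> norm (x2 k t) \<le> C k"
    by metis
  have small: "norm (e k *\<^sub>R x2 k t) \<le> 1 / real (Suc k)" if "t \<ge> 0" for k t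
  proof -
    have "C k * 1 \<le> C k * (1 + T k)" using C(1)[of k] T[of k] by (intro mult_left_mono) auto
    then have "e k * norm (x2 k t) \<le> e k * (C k * (1 + T k))"
      using x2[OF that, of k] e_pos[of k] by (intro mult_left_mono) auto
    then have "e k * norm (x2 k t) \<le> 1 / real (Suc k)" using eC[of k] by linarith
    then show ?thesis using e_pos[of k] by simp
  qed
  have est: "let M = 2 * integral {0..max (T j) (T k)} (\<lambda>t. norm (K (K (g j t)) - K (K (g k t)))) + 2 / real (Suc k)
        in norm (K (x1 j t - x1 k t)) \<le> M \<and> (x j t - x k t) \<bullet> K (x j t - x k t) \<le> M\<^sup>2"
    if kj: "k \<le> j" and t: "t \<ge> 0" for k j t
  proof -
    let ?S = "max (T j) (T k)"
    let ?n = "\<lambda>t. norm (K (K (g j t)) - K (K (g k t)))"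
    let ?h = "\<lambda>t. K (K (g j t)) - K (K (g k t)) - (e j - e k) *\<^sub>R x2 k t"
    note d = regularised_diff[OF sol[of j] sol[of k]]
    have ci: "continuous_on S (\<lambda>t. K (K (g i t)))" for S i
      by (intro K.continuous_on continuous_on_subset[OF g]) auto
    have ch: "continuous_on S ?h" for S
      using continuous_regularised(4)[OF d] continuous_on_subset by blast
    have cx: "continuous_on S (x2 k)" for S
      using continuous_regularised(3)[OF sol[of k]] continuous_on_subset by blast
    have S: "0 \<le> ?S" using T[of j] by simp
    have i2: "integral {0..?S} (\<lambda>t. norm (x2 k t)) \<le> C k * (1 + T k)"
    proof -
      have "integral {0..T k} (\<lambda>t. norm (x2 k t)) + integral {T k..?S} (\<lambda>t. norm (x2 k t))
          = integral {0..?S} (\<lambda>t. norm (x2 k t))"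
        by (rule Henstock_Kurzweil_Integration.integral_combine)
          (use T[of k] in \<open>auto intro!: integrable_continuous_interval continuous_intros cx\<close>)
      moreover have "integral {T k..?S} (\<lambda>t. norm (x2 k t)) = integral {T k..?S} (\<lambda>t. 0)"
        by (rule integral_cong) (use sol[of k] in \<open>auto simp: regularised_solution_def\<close>)
      moreover have "integral {0..T k} (\<lambda>t. norm (x2 k t)) \<le> integral {0..T k} (\<lambda>t. C k)"
        by (rule integral_le) (auto intro!: integrable_continuous_interval continuous_intros cx x2)
      ultimately show ?thesis using T[of k] C(1)[of k] by (simp add: algebra_simps)
    qed
    have "integral {0..?S} (\<lambda>t. norm (?h t)) \<le> integral {0..?S} (\<lambda>t. ?n t + e k * norm (x2 k t))"
    proof (rule integral_le)
      fix t
      have "norm (?h t) \<le> ?n t + \<bar>e j - e k\<bar> * norm (x2 k t)"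
        by (metis norm_scaleR norm_triangle_ineq4)
      also have "\<bar>e j - e k\<bar> * norm (x2 k t) \<le> e k * norm (x2 k t)"
        using e_mono[OF kj] e_pos[of j] by (intro mult_right_mono) auto
      finally show "norm (?h t) \<le> ?n t + e k * norm (x2 k t)" by simp
    qed (auto intro!: integrable_continuous_interval continuous_intros ch ci cx)
    also have "\<dots> = integral {0..?S} ?n + e k * integral {0..?S} (\<lambda>t. norm (x2 k t))"
      by (subst integral_add) (auto intro!: integrable_continuous_interval continuous_intros ci cx)
    also have "e k * integral {0..?S} (\<lambda>t. norm (x2 k t)) \<le> 1 / real (Suc k)"
      using mult_left_mono[OF i2, of "e k"] e_pos[of k] eC[of k] by linarith
    finally have le: "2 * integral {0..?S} (\<lambda>t. norm (?h t)) \<le> 2 * integral {0..?S} ?n + 2 / real (Suc k)"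
      by simp
    have nn: "0 \<le> integral {0..?S} (\<lambda>t. norm (?h t))"
      by (intro integral_nonneg) (auto intro!: integrable_continuous_interval continuous_intros ch)
    have "norm (K (x1 j t - x1 k t)) \<le> 2 * integral {0..?S} ?n + 2 / real (Suc k)"
      using regularised_energy(1)[OF d _ S t] e_pos[of j] le by simp
    moreover have "(x j t - x k t) \<bullet> K (x j t - x k t) \<le> (2 * integral {0..?S} ?n + 2 / real (Suc k))\<^sup>2"
      using regularised_energy(2)[OF d _ S t] e_pos[of j] power_mono[OF le, of 2] nn by simp
    ultimately show ?thesis by (simp add: Let_def)
  qed
  show ?thesis
    by (intro exI[of _ e] exI[of _ x] exI[of _ x1] exI[of _ x2] allI conjI impI e_pos sol small est)
qed

end

lemma subspace_closure_normed:
  fixes S :: "'h::real_normed_vector set"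
  assumes S: "subspace S" shows "subspace (closure S)"
  unfolding subspace_def
proof (intro conjI ballI allI)
  show "0 \<in> closure S" using subspace_0[OF S] closure_subset by blast
  fix x assume "x \<in> closure S"
  then obtain a where a: "\<And>n. a n \<in> S" "a \<longlonglongrightarrow> x" by (auto simp: closure_sequential)
  show "c *\<^sub>R x \<in> closure S" for c
    unfolding closure_sequential
    by (rule exI[of _ "\<lambda>n. c *\<^sub>R a n"]) (simp add: a subspace_scale[OF S] tendsto_scaleR)
  fix y assume "y \<in> closure S"
  then obtain b where b: "\<And>n. b n \<in> S" "b \<longlonglongrightarrow> y" by (auto simp: closure_sequential)
  show "x + y \<in> closure S"
    unfolding closure_sequential
    by (rule exI[of _ "\<lambda>n. a n + b n"]) (simp add: a b subspace_add[OF S] tendsto_add)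
qed

lemma psd_form_inner:
  assumes "subspace M" shows "psd_form M ((\<bullet>) :: 'h::real_inner \<Rightarrow> _)"
  by (rule psd_form.intro) (simp_all add: assms inner_add_left, rule inner_commute)

context positive_operator
begin

text \<open>The orthogonal projection \<open>w\<close> of \<open>h\<close> to the closure of the range of \<open>K\<close> exists by Riesz' theorem;
\<open>h - w\<close> is orthogonal to the range, hence in the kernel of the symmetric operator \<open>K\<close>, hence
orthogonal to \<open>h\<close> by hypothesis.\<close>

lemma range_approximates:
  assumes ker: "\<And>q. K q = 0 \<Longrightarrow> q \<bullet> h = 0" and d: "d > 0"
  shows "\<exists>g. norm (h - K g) < d"
proof -
  let ?M = "closure (range K)"
  have subK: "subspace (range K)"
    by (rule linear_subspace_image[OF bounded_linear.linear[OF bl] subspace_UNIV])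
  interpret M: psd_form ?M "(\<bullet>)"
    by (rule psd_form_inner[OF subspace_closure_normed[OF subK]])
  have "complete_in ?M (\<lambda>v. sqrt (v \<bullet> v))"
    unfolding complete_in_def
  proof (intro allI impI)
    fix x :: "nat \<Rightarrow> 'h"
    assume x: "\<forall>k. x k \<in> ?M" 
      and C: "\<forall>d>0. \<exists>M. \<forall>i\<ge>M. \<forall>j\<ge>M. sqrt ((x i - x j) \<bullet> (x i - x j)) < d"
    then have "Cauchy x" by (simp add: Cauchy_def dist_norm norm_eq_sqrt_inner)
    then obtain l where l: "x \<longlonglongrightarrow> l" using Cauchy_convergent convergent_def by blast
    then have "l \<in> ?M" using x closed_sequentially[OF closed_closure] by blast
    moreover have "(\<lambda>k. sqrt ((x k - l) \<bullet> (x k - l))) \<longlonglongrightarrow> 0"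
      using l by (simp add: norm_eq_sqrt_inner[symmetric] tendsto_norm_zero_iff LIM_zero_iff)
    ultimately show "\<exists>l\<in>?M. (\<lambda>k. sqrt ((x k - l) \<bullet> (x k - l))) \<longlonglongrightarrow> 0" by blast
  qed
  then have "\<exists>w\<in>?M. \<forall>v\<in>?M. w \<bullet> v = h \<bullet> v"
    by (rule M.riesz_representation[where C = "norm h"])
      (auto simp: inner_add_right norm_eq_sqrt_inner[symmetric] Cauchy_Schwarz_ineq2)
  then obtain w where w: "w \<in> ?M" "\<And>v. v \<in> ?M \<Longrightarrow> w \<bullet> v = h \<bullet> v" by blast
  have "K (h - w) \<bullet> v = 0" for v
  proof -
    have "K v \<in> ?M" using closure_subset[of "range K"] by blast
    then show ?thesis using w(2)[of "K v"] by (simp add: K_sym inner_diff_left)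
  qed
  then have "K (h - w) = 0" by (metis inner_eq_zero_iff)
  then have "(h - w) \<bullet> (h - w) = 0"
    using ker[of "h - w"] w(2)[OF w(1)] by (simp add: inner_diff_left inner_diff_right)
  then have "h = w" by simp
  then have "\<exists>y\<in>range K. dist y h < d"
    using w(1) d closure_approachable by metis
  then show ?thesis by (auto simp: dist_norm norm_minus_commute)
qed

lemma range_square_approximates:
  assumes ker: "\<And>q. K q = 0 \<Longrightarrow> q \<bullet> h = 0" and d: "d > 0"
  shows "\<exists>g. norm (h - K (K g)) < d"
proof -
  interpret K2: positive_operator "\<lambda>x. K (K x)"
  proof (rule positive_operator.intro)
    show "bounded_linear (\<lambda>x. K (K x))" using bounded_linear_compose[OF bl bl] by (simp add: o_def)
    show "K (K x) \<bullet> y = x \<bullet> K (K y)" for x y by (simp only: K_sym)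
    show "0 \<le> x \<bullet> K (K x)" for x
      using inner_ge_zero[of "K x"] by (simp only: K_sym)
  qed
  have "K q = 0" if "K (K q) = 0" for q
    using that K_sym[of q "K q"] by simp
  then show ?thesis using K2.range_approximates[of h d] ker d by blast
qed

end

section \<open>Smooth functions and test functions\<close>

lemma C_k_cont: "C_k k f \<Longrightarrow> continuous_on UNIV f"
  by (cases k) (auto intro: differentiable_imp_continuous_on)

lemma C_k_SucI:
  assumes d: "\<And>x. (f has_derivative f' x) (at x)" and "\<And>b. b \<in> Basis \<Longrightarrow> C_k k (\<lambda>x. f' x b)"
  shows "C_k (Suc k) f"
proof -
  have "frechet_derivative f (at x) = f' x" for x
    using frechet_derivative_at[OF d] by simp
  then show ?thesis
    using assms by (auto simp: differentiable_on_def differentiable_def)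
qed

lemma C_k_has_derivative:
  "C_k (Suc k) f \<Longrightarrow> (f has_derivative frechet_derivative f (at x)) (at x)"
  by (auto simp: differentiable_on_def frechet_derivative_works[symmetric])

lemma C_k_mono_Suc: "C_k (Suc k) f \<Longrightarrow> C_k k f"
proof (induction k arbitrary: f)
  case 0
  then show ?case using C_k_cont[of "Suc 0" f] by simp
next
  case (Suc k)
  then show ?case by simp
qed

lemma C_k_const: "C_k k (\<lambda>x. c)"
proof (induction k arbitrary: c)
  case (Suc k)
  show ?case by (rule C_k_SucI[where f' = "\<lambda>_ _. 0"]) (use Suc in auto)
qed auto

lemma C_k_add: "C_k k f \<Longrightarrow> C_k k g \<Longrightarrow> C_k k (\<lambda>x. f x + g x)"
proof (induction k arbitrary: f g)
  case (Suc k)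
  show ?case
    by (rule C_k_SucI, rule has_derivative_add, rule C_k_has_derivative, rule Suc.prems,
        rule C_k_has_derivative, rule Suc.prems) (use Suc in auto)
qed (auto intro: continuous_on_add)

lemma C_k_mult: "C_k k f \<Longrightarrow> C_k k g \<Longrightarrow> C_k k (\<lambda>x. f x * g x)"
proof (induction k arbitrary: f g)
  case (Suc k)
  show ?case
  proof (rule C_k_SucI)
    show "((\<lambda>x. f x * g x) has_derivative
       (\<lambda>h. f x * frechet_derivative g (at x) h + frechet_derivative f (at x) h * g x)) (at x)" for x
      by (intro has_derivative_mult C_k_has_derivative[OF Suc.prems(1)] C_k_has_derivative[OF Suc.prems(2)])
    show "C_k k (\<lambda>x. f x * frechet_derivative g (at x) b + frechet_derivative f (at x) b * g x)"
      if "b \<in> Basis" for b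
    proof -
      have "C_k k f" "C_k k g" by (rule C_k_mono_Suc, fact)+
      moreover have "C_k k (\<lambda>x. frechet_derivative f (at x) b)" "C_k k (\<lambda>x. frechet_derivative g (at x) b)"
        using Suc.prems that by auto
      ultimately show ?thesis by (intro C_k_add Suc.IH)
    qed
  qed
qed (auto intro: continuous_on_mult)

lemma C_k_cmult: "C_k k f \<Longrightarrow> C_k k (\<lambda>x. c * f x)"
  by (intro C_k_mult C_k_const)

lemma C_k_prod: "finite I \<Longrightarrow> (\<And>i. i \<in> I \<Longrightarrow> C_k k (f i)) \<Longrightarrow> C_k k (\<lambda>x. \<Prod>i\<in>I. f i x)"
  by (induction I rule: finite_induct) (auto intro: C_k_const C_k_mult)

lemma C_k_SucI_real:
  assumes "\<And>x. (f has_real_derivative f' x) (at x)" and "C_k k f'"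
  shows "C_k (Suc k) f"
  by (rule C_k_SucI[where f' = "\<lambda>x h. f' x * h"])
    (use assms in \<open>auto simp: has_field_derivative_def\<close>)

lemma C_k_compose_linear:
  fixes f :: "real \<Rightarrow> real" and v :: "'a::euclidean_space"
  shows "C_k k f \<Longrightarrow> C_k k (\<lambda>x. f (c + d * (x \<bullet> v)))"
proof (induction k arbitrary: f)
  case 0
  then have "continuous_on UNIV f" by simp
  then show ?case by (auto intro!: continuous_intros continuous_on_compose2[of UNIV f])
next
  case (Suc k)
  show ?case
  proof (rule C_k_SucI)
    fix x :: 'a
    have f: "(f has_derivative (\<lambda>h. frechet_derivative f (at y) 1 * h)) (at y)" for y
    proof -
      have lin: "linear (frechet_derivative f (at y))"
        using C_k_has_derivative[OF Suc.prems] has_derivative_linear by blast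
      have "frechet_derivative f (at y) = (\<lambda>h. frechet_derivative f (at y) 1 * h)"
      proof
        fix h show "frechet_derivative f (at y) h = frechet_derivative f (at y) 1 * h"
          using linear_cmul[OF lin, of h 1] by simp
      qed
      then show ?thesis using C_k_has_derivative[OF Suc.prems, of y] by simp
    qed
    show "((\<lambda>x. f (c + d * (x \<bullet> v))) has_derivative
       (\<lambda>h. frechet_derivative f (at (c + d * (x \<bullet> v))) 1 * (d * (h \<bullet> v)))) (at x)"
      by (rule has_derivative_compose[OF _ f]) (auto intro!: derivative_eq_intros)
  next
    fix b :: 'a
    have "C_k k (\<lambda>x. frechet_derivative f (at (c + d * (x \<bullet> v))) 1)"
      by (rule Suc.IH) (use Suc.prems in simp)
    then show "C_k k (\<lambda>x. frechet_derivative f (at (c + d * (x \<bullet> v))) 1 * (d * (b \<bullet> v)))"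
      by (intro C_k_mult C_k_const)
  qed
qed

lemma C_k_inner: "C_k k (\<lambda>x::'a::euclidean_space. x \<bullet> v)"
proof -
  have "C_k k (\<lambda>t::real. t)"
    by (cases k) (auto intro!: C_k_SucI_real[where f' = "\<lambda>_. 1"] C_k_const simp del: C_k.simps(2))
  from C_k_compose_linear[OF this, of 0 1 v] show ?thesis by simp
qed

text \<open>The standard flat function for \<open>p = 1\<close>. The family with a polynomial factor is closed under
differentiation, so one computation shows that all its members are smooth.\<close>

definition flat :: "real poly \<Rightarrow> real \<Rightarrow> real" where
  "flat p t = (if t > 0 then poly p (1 / t) * exp (- (1 / t)) else 0)"

lemma poly_mult_exp_tendsto_0: "((\<lambda>y. poly p y * exp (- y)) \<longlongrightarrow> 0) at_top" for p :: "real poly"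
proof -
  have "((\<lambda>y. \<Sum>i\<le>degree p. coeff p i * (y ^ i / exp y)) \<longlongrightarrow> (\<Sum>i\<le>degree p. coeff p i * 0)) at_top"
    by (intro tendsto_sum tendsto_mult tendsto_const tendsto_power_div_exp_0)
  moreover have "poly p y * exp (- y) = (\<Sum>i\<le>degree p. coeff p i * (y ^ i / exp y))" for y
    by (simp add: poly_altdef sum_distrib_left exp_minus divide_inverse mult_ac)
  ultimately show ?thesis by simp
qed

lemma flat_has_derivative:
  "(flat p has_real_derivative flat ([:0, 0, 1:] * (p - pderiv p)) t) (at t)"
proof -
  let ?q = "[:0, 0, 1:] * (p - pderiv p)"
  consider "t > 0" | "t < 0" | "t = 0" by linarith
  then show ?thesis
  proof cases
    case 1
    have "((\<lambda>t. poly p (1 / t) * exp (- (1 / t))) has_real_derivative flat ?q t) (at t)"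
      using 1
      by (auto intro!: derivative_eq_intros poly_DERIV[THEN DERIV_chain2]
          simp: flat_def field_simps power2_eq_square)
    then show ?thesis
    proof (rule has_field_derivative_transform_within_open[of _ _ _ "{0<..}"])
      show "poly p (1 / x) * exp (- (1 / x)) = flat p x" if "x \<in> {0<..}" for x
        using that by (simp add: flat_def)
    qed (use 1 in auto)
  next
    case 2
    have "((\<lambda>t. 0) has_real_derivative flat ?q t) (at t)"
      using 2 by (simp add: flat_def)
    then show ?thesis
    proof (rule has_field_derivative_transform_within_open[of _ _ _ "{..<0}"])
      show "0 = flat p x" if "x \<in> {..<0}" for x
        using that by (simp add: flat_def)
    qed (use 2 in auto)
  next
    case 3
    have "((\<lambda>h. flat p h / h) \<longlongrightarrow> 0) (at 0)"
    proof (rule filterlim_split_at_real)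
      have "\<forall>\<^sub>F h in at_left 0. 0 = flat p h / h"
        by (auto simp: eventually_at_filter flat_def)
      then show "((\<lambda>h. flat p h / h) \<longlongrightarrow> 0) (at_left 0)"
        by (rule Lim_transform_eventually[rotated]) simp
      have "((\<lambda>h. poly ([:0, 1:] * p) (inverse h) * exp (- inverse h)) \<longlongrightarrow> 0) (at_right 0)"
        using filterlim_compose[OF poly_mult_exp_tendsto_0 filterlim_inverse_at_top_right] .
      moreover have "\<forall>\<^sub>F h in at_right 0. poly ([:0, 1:] * p) (inverse h) * exp (- inverse h) = flat p h / h"
        by (auto simp: eventually_at_filter flat_def divide_inverse)
      ultimately show "((\<lambda>h. flat p h / h) \<longlongrightarrow> 0) (at_right 0)"
        by (rule Lim_transform_eventually)
    qed
    then show ?thesis using 3 by (simp add: DERIV_def flat_def)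
  qed
qed

lemma C_k_flat: "C_k k (flat p)"
proof (induction k arbitrary: p)
  case 0
  then show ?case
    using flat_has_derivative by (auto intro!: continuous_at_imp_continuous_on DERIV_isCont)
next
  case (Suc k)
  show ?case by (rule C_k_SucI_real[OF flat_has_derivative Suc])
qed

lemma test_functionsI:
  assumes "\<And>k. C_k k \<phi>" "\<And>x. x \<notin> S \<Longrightarrow> \<phi> x = 0" "compact S" "S \<subseteq> \<Omega>"
  shows "\<phi> \<in> test_functions \<Omega>"
proof -
  have "closure {x. \<phi> x \<noteq> 0} \<subseteq> S"
    using assms by (intro closure_minimal compact_imp_closed) auto
  moreover from this have "compact (closure {x. \<phi> x \<noteq> 0})"
    using assms(3) by (metis closed_closure compact_Int_closed inf.absorb2)
  ultimately show ?thesis using assms by (auto simp: test_functions_def)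
qed

lemma test_functionsE:
  assumes "\<phi> \<in> test_functions \<Omega>"
  obtains S where "compact S" "S \<subseteq> \<Omega>" "\<And>x. x \<notin> S \<Longrightarrow> \<phi> x = 0"
    "\<And>x. x \<notin> S \<Longrightarrow> (\<phi> has_derivative (\<lambda>_. 0)) (at x)"
proof (rule that)
  let ?S = "closure {x. \<phi> x \<noteq> 0}"
  show "compact ?S" "?S \<subseteq> \<Omega>" using assms by (auto simp: test_functions_def)
  show z: "\<phi> x = 0" if "x \<notin> ?S" for x using that closure_subset[of "{x. \<phi> x \<noteq> 0}"] by auto
  show "(\<phi> has_derivative (\<lambda>_. 0)) (at x)" if "x \<notin> ?S" for x
  proof (rule has_derivative_transform_within_open[OF has_derivative_const])
    show "open (- ?S)" by (simp add: open_Compl)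
    show "x \<in> - ?S" using that by simp
    show "0 = \<phi> y" if "y \<in> - ?S" for y using z[of y] that by simp
  qed
qed

lemma test_C_k: "\<phi> \<in> test_functions \<Omega> \<Longrightarrow> C_k k \<phi>"
  by (simp add: test_functions_def)

lemma test_derivative:
  "\<phi> \<in> test_functions \<Omega> \<Longrightarrow> (\<phi> has_derivative frechet_derivative \<phi> (at x)) (at x)"
  using C_k_has_derivative[OF test_C_k[of _ _ "Suc 0"]] by blast

lemma test_partial:
  assumes \<phi>: "\<phi> \<in> test_functions \<Omega>" and b: "b \<in> Basis"
  shows "(\<lambda>x. frechet_derivative \<phi> (at x) b) \<in> test_functions \<Omega>"
proof -
  obtain S where S: "compact S" "S \<subseteq> \<Omega>" "\<And>x. x \<notin> S \<Longrightarrow> (\<phi> has_derivative (\<lambda>_. 0)) (at x)"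
    using test_functionsE[OF \<phi>] by metis
  show ?thesis
  proof (rule test_functionsI[OF _ _ S(1,2)])
    show "C_k k (\<lambda>x. frechet_derivative \<phi> (at x) b)" for k
      using test_C_k[OF \<phi>, of "Suc k"] b by simp
    show "frechet_derivative \<phi> (at x) b = 0" if "x \<notin> S" for x
      using frechet_derivative_at[OF S(3)[OF that]] by metis
  qed
qed

lemma test_zero: "(\<lambda>_. 0) \<in> test_functions \<Omega>"
  by (rule test_functionsI[where S = "{}"]) (auto intro: C_k_const)

lemma test_smooth_mult:
  assumes \<phi>: "\<phi> \<in> test_functions \<Omega>" and g: "\<And>k. C_k k g"
  shows "(\<lambda>x. g x * \<phi> x) \<in> test_functions \<Omega>"
proof -
  obtain S where S: "compact S" "S \<subseteq> \<Omega>" "\<And>x. x \<notin> S \<Longrightarrow> \<phi> x = 0"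
    using test_functionsE[OF \<phi>] by metis
  show ?thesis
    by (rule test_functionsI[OF _ _ S(1,2)]) (auto intro!: C_k_mult g test_C_k[OF \<phi>] S(3))
qed

lemma test_add:
  assumes \<phi>: "\<phi> \<in> test_functions \<Omega>" and \<psi>: "\<psi> \<in> test_functions \<Omega>"
  shows "(\<lambda>x. \<phi> x + \<psi> x) \<in> test_functions \<Omega>"
proof -
  obtain S where S: "compact S" "S \<subseteq> \<Omega>" "\<And>x. x \<notin> S \<Longrightarrow> \<phi> x = 0"
    using test_functionsE[OF \<phi>] by metis
  obtain S' where S': "compact S'" "S' \<subseteq> \<Omega>" "\<And>x. x \<notin> S' \<Longrightarrow> \<psi> x = 0"
    using test_functionsE[OF \<psi>] by metis
  show ?thesis
  proof (rule test_functionsI[where S = "S \<union> S'"])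
    show "C_k k (\<lambda>x. \<phi> x + \<psi> x)" for k
      by (rule C_k_add[OF test_C_k[OF \<phi>] test_C_k[OF \<psi>]])
  qed (use S S' in auto)
qed

lemma test_cmult: "\<phi> \<in> test_functions \<Omega> \<Longrightarrow> (\<lambda>x. c * \<phi> x) \<in> test_functions \<Omega>"
  by (rule test_smooth_mult) (auto intro: C_k_const)

lemma test_bounded:
  assumes \<phi>: "\<phi> \<in> test_functions \<Omega>"
  obtains M where "M \<ge> 0" "\<And>x. \<bar>\<phi> x\<bar> \<le> M"
proof -
  obtain S where S: "compact S" "\<And>x. x \<notin> S \<Longrightarrow> \<phi> x = 0"
    using test_functionsE[OF \<phi>] by metis
  have "compact (\<phi> ` S)"
    using S(1) C_k_cont[OF test_C_k[OF \<phi>]] by (metis compact_continuous_image continuous_on_subset subset_UNIV)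
  then obtain M where M: "\<And>x. x \<in> S \<Longrightarrow> \<bar>\<phi> x\<bar> \<le> M"
    by (metis bounded_iff compact_imp_bounded image_eqI real_norm_def)
  have "\<bar>\<phi> x\<bar> \<le> max 0 M" for x using M[of x] S(2)[of x] by (cases "x \<in> S") auto
  then show ?thesis using that[of "max 0 M"] by simp
qed

lemma test_cont: "\<phi> \<in> test_functions \<Omega> \<Longrightarrow> continuous_on S \<phi>"
  using C_k_cont[OF test_C_k] continuous_on_subset by blast

lemma test_integrable:
  assumes \<phi>: "\<phi> \<in> test_functions \<Omega>"
  shows "integrable lborel \<phi>"
proof -
  obtain S where S: "compact S" "\<And>x. x \<notin> S \<Longrightarrow> \<phi> x = 0"
    using test_functionsE[OF \<phi>] by metis
  have "integrable lborel (\<lambda>x. indicator S x *\<^sub>R \<phi> x)"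
    by (rule borel_integrable_compact[OF S(1) test_cont[OF \<phi>]])
  moreover have "(\<lambda>x. indicator S x *\<^sub>R \<phi> x) = \<phi>"
    by (rule ext) (use S(2) in \<open>auto simp: indicator_def\<close>)
  ultimately show ?thesis by simp
qed

lemma test_measurable: "\<phi> \<in> test_functions \<Omega> \<Longrightarrow> \<phi> \<in> borel_measurable borel"
  by (intro borel_measurable_continuous_onI test_cont)

text \<open>The integrals of the difference quotients vanish by translation invariance; the derivative is their
dominated limit, so no iterated integration is needed.\<close>

lemma integral_partial_test:
  fixes \<phi> :: "'a::euclidean_space \<Rightarrow> real"
  assumes \<phi>: "\<phi> \<in> test_functions \<Omega>" and b: "b \<in> Basis"
  shows "(LINT x|lborel. frechet_derivative \<phi> (at x) b) = 0"
proof -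
  define D where "D x = frechet_derivative \<phi> (at x) b" for x
  have D: "D \<in> test_functions \<Omega>" using test_partial[OF \<phi> b] by (simp add: D_def[abs_def])
  obtain M where M: "M \<ge> 0" "\<And>x. \<bar>D x\<bar> \<le> M" using test_bounded[OF D] by blast
  obtain S where S: "compact S" "\<And>x. x \<notin> S \<Longrightarrow> \<phi> x = 0"
    using test_functionsE[OF \<phi>] by metis
  obtain R where R: "\<And>x. x \<in> S \<Longrightarrow> norm x \<le> R" 
    using S(1) compact_imp_bounded bounded_iff by metis
  define h where "h n = inverse (real (Suc n))" for n
  have h: "0 < h n" "h n \<le> 1" for n by (auto simp: h_def inverse_le_1_iff)
  have hlim: "h \<longlonglongrightarrow> 0" unfolding h_def by (rule LIMSEQ_inverse_real_of_nat)
  have line: "((\<lambda>s. \<phi> (x + s *\<^sub>R b)) has_real_derivative D (x + s *\<^sub>R b)) (at s)" for x s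
  proof -
    have "((\<lambda>s. \<phi> (x + s *\<^sub>R b)) has_derivative (\<lambda>k. frechet_derivative \<phi> (at (x + s *\<^sub>R b)) (k *\<^sub>R b))) (at s)"
      by (rule has_derivative_compose[OF _ test_derivative[OF \<phi>]]) (auto intro!: derivative_eq_intros)
    moreover have "linear (frechet_derivative \<phi> (at (x + s *\<^sub>R b)))"
      using test_derivative[OF \<phi>] has_derivative_linear by blast
    ultimately show ?thesis
      by (simp add: has_field_derivative_def linear_cmul D_def mult_commute_abs)
  qed
  define q where "q n x = (\<phi> (x + h n *\<^sub>R b) - \<phi> x) / h n" for n x
  have q_le: "\<bar>q n x\<bar> \<le> M" for n x
  proof -
    obtain z where "\<phi> (x + h n *\<^sub>R b) - \<phi> (x + 0 *\<^sub>R b) = (h n - 0) * D (x + z *\<^sub>R b)"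
      using MVT2[OF h(1)[of n], of "\<lambda>s. \<phi> (x + s *\<^sub>R b)" "\<lambda>s. D (x + s *\<^sub>R b)"] line by blast
    then have "q n x = D (x + z *\<^sub>R b)" using h(1)[of n] by (simp add: q_def)
    then show ?thesis using M by simp
  qed
  have q_supp: "q n x = 0" if "x \<notin> cball 0 (R + 1)" for n x
  proof -
    have "norm x \<le> norm (x + h n *\<^sub>R b) + norm (h n *\<^sub>R b)" by (metis add_diff_cancel_right' norm_triangle_ineq4)
    moreover have "norm (h n *\<^sub>R b) \<le> 1" using b h[of n] by simp
    ultimately have "x \<notin> S" "x + h n *\<^sub>R b \<notin> S"
      using R[of x] R[of "x + h n *\<^sub>R b"] that by auto
    then show ?thesis by (simp add: q_def S(2))
  qed
  have \<phi>s: "integrable lborel (\<lambda>x. \<phi> (x + h n *\<^sub>R b))"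
    and \<phi>i: "(LINT x|lborel. \<phi> (x + h n *\<^sub>R b)) = (LINT x|lborel. \<phi> x)" for n
  proof -
    have m: "(\<lambda>x. h n *\<^sub>R b + x) \<in> measurable lborel borel" by simp
    have "integrable (distr lborel borel ((+) (h n *\<^sub>R b))) \<phi>"
      using test_integrable[OF \<phi>] by (simp add: lborel_distr_plus)
    then show "integrable lborel (\<lambda>x. \<phi> (x + h n *\<^sub>R b))"
      using integrable_distr_eq[OF m test_measurable[OF \<phi>]] by (simp add: add.commute)
    have "(LINT x|distr lborel borel ((+) (h n *\<^sub>R b)). \<phi> x) = (LINT x|lborel. \<phi> (h n *\<^sub>R b + x))"
      by (rule integral_distr[OF m test_measurable[OF \<phi>]])
    then show "(LINT x|lborel. \<phi> (x + h n *\<^sub>R b)) = (LINT x|lborel. \<phi> x)"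
      by (simp add: lborel_distr_plus add.commute)
  qed
  have q0: "(LINT x|lborel. q n x) = 0" for n
    using \<phi>s[of n] \<phi>i[of n] test_integrable[OF \<phi>] by (simp add: q_def)
  have "(\<lambda>n. LINT x|lborel. q n x) \<longlonglongrightarrow> (LINT x|lborel. D x)"
  proof (rule integral_dominated_convergence[where w = "\<lambda>x. M * indicator (cball 0 (R + 1)) x"])
    show "D \<in> borel_measurable lborel" using test_measurable[OF D] by simp
    show "q n \<in> borel_measurable lborel" for n
      using borel_measurable_integrable[OF \<phi>s[of n]] test_measurable[OF \<phi>]
      unfolding q_def by measurable
    show "integrable lborel (\<lambda>x::'a. M * indicator (cball 0 (R + 1)) x :: real)"
      by (intro integrable_mult_right integrable_real_indicator)
        (use emeasure_bounded_finite[OF bounded_cball[of "0 :: 'a" "R + 1"]] in auto)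
    show "AE x in lborel. (\<lambda>n. q n x) \<longlonglongrightarrow> D x"
    proof (rule AE_I2)
      fix x
      have "((\<lambda>s. (\<phi> (x + (0 + s) *\<^sub>R b) - \<phi> (x + 0 *\<^sub>R b)) / s) \<longlongrightarrow> D (x + 0 *\<^sub>R b)) (at 0)"
        using line[of x 0] unfolding DERIV_def .
      moreover have "filterlim h (at 0) sequentially"
        unfolding filterlim_at using hlim h(1) by (auto intro!: always_eventually simp: less_imp_neq[symmetric])
      ultimately have "((\<lambda>n. (\<phi> (x + (0 + h n) *\<^sub>R b) - \<phi> (x + 0 *\<^sub>R b)) / h n) \<longlongrightarrow> D (x + 0 *\<^sub>R b)) sequentially"
        by (rule filterlim_compose)
      then show "(\<lambda>n. q n x) \<longlonglongrightarrow> D x" by (simp add: q_def)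
    qed
    show "AE x in lborel. norm (q n x) \<le> M * indicator (cball 0 (R + 1)) x" for n
      using q_le q_supp by (intro AE_I2) (auto simp: indicator_def)
  qed
  then show ?thesis by (simp add: q0 D_def[symmetric] LIMSEQ_const_iff)
qed

section \<open>The fundamental lemma of the calculus of variations\<close>

text \<open>For \<open>k \<rightarrow> \<infinity>\<close> these increase to the indicator function of the open box, which allows to test with boxes.\<close>

definition bump :: "real \<Rightarrow> 'a::euclidean_space \<Rightarrow> 'a \<Rightarrow> 'a \<Rightarrow> real" where
  "bump k l r x = (\<Prod>b\<in>Basis. flat 1 (k * (x \<bullet> b - l \<bullet> b)) * flat 1 (k * (r \<bullet> b - x \<bullet> b)))"

lemma flat_1: "flat 1 t = (if t > 0 then exp (- (1 / t)) else 0)"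
  by (simp add: flat_def)

lemma flat_1_bounds: "0 \<le> flat 1 t" "flat 1 t \<le> 1"
  by (simp_all add: flat_1)

lemma bump_bounds: "0 \<le> bump k l r x" "bump k l r x \<le> 1"
  unfolding bump_def
  by (auto intro!: prod_nonneg prod_le_1 mult_nonneg_nonneg mult_le_one flat_1_bounds)

lemma bump_outside:
  assumes "k > 0" "x \<notin> box l r" shows "bump k l r x = 0"
proof -
  obtain b where "b \<in> Basis" "x \<bullet> b \<le> l \<bullet> b \<or> r \<bullet> b \<le> x \<bullet> b"
    using assms(2) by (auto simp: mem_box not_less)
  then show ?thesis
    using assms(1) unfolding bump_def
    by (intro prod_zero) (auto intro!: bexI[of _ b] simp: flat_1 zero_less_mult_iff)
qed

lemma bump_test:
  assumes "k > 0" "cbox l r \<subseteq> \<Omega>"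
  shows "bump k l r \<in> test_functions \<Omega>"
proof (rule test_functionsI[where S = "cbox l r"])
  fix m
  have "C_k m (\<lambda>x. flat 1 (k * (x \<bullet> b - l \<bullet> b)))" "C_k m (\<lambda>x. flat 1 (k * (r \<bullet> b - x \<bullet> b)))" for b
    using C_k_compose_linear[OF C_k_flat[of m 1], of "- (k * (l \<bullet> b))" k b]
      C_k_compose_linear[OF C_k_flat[of m 1], of "k * (r \<bullet> b)" "- k" b]
    by (simp_all add: algebra_simps)
  then show "C_k m (bump k l r)"
    unfolding bump_def[abs_def] by (intro C_k_prod C_k_mult) auto
next
  show "bump k l r x = 0" if "x \<notin> cbox l r" for x
    using bump_outside[OF assms(1), of x l r] box_subset_cbox[of l r] that by blast
qed (use assms in auto)

lemma bump_tendsto: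
  fixes x :: "'a::euclidean_space"
  assumes "x \<in> box l r"
  shows "(\<lambda>n. bump (real (Suc n)) l r x) \<longlonglongrightarrow> 1"
proof -
  have one: "(\<lambda>n. flat 1 (real (Suc n) * c)) \<longlonglongrightarrow> 1" if "c > 0" for c
  proof -
    have "(\<lambda>n. exp (- (inverse (real (Suc n)) * inverse c))) \<longlonglongrightarrow> exp (- (0 * inverse c))"
      by (intro tendsto_intros LIMSEQ_inverse_real_of_nat)
    then show ?thesis using that by (simp add: flat_1 divide_inverse zero_less_mult_iff)
  qed
  have "(\<lambda>n. bump (real (Suc n)) l r x) \<longlonglongrightarrow> (\<Prod>b\<in>(Basis :: 'a set). 1 * 1)"
    unfolding bump_def
  proof (rule Limits.tendsto_prod)
    fix b :: 'a assume "b \<in> Basis"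
    then have "0 < x \<bullet> b - l \<bullet> b" "0 < r \<bullet> b - x \<bullet> b" using assms by (auto simp: mem_box)
    then show "(\<lambda>n. flat 1 (real (Suc n) * (x \<bullet> b - l \<bullet> b)) * flat 1 (real (Suc n) * (r \<bullet> b - x \<bullet> b))) \<longlonglongrightarrow> 1 * 1"
      by (intro tendsto_mult one)
  qed
  then show ?thesis by simp
qed

lemma integral_box_eq_0:
  fixes g :: "'a::euclidean_space \<Rightarrow> real"
  assumes \<Omega>: "open \<Omega>" and sub: "cbox l r \<subseteq> \<Omega>"
    and g: "set_integrable lebesgue (cbox l r) g"
    and zero: "\<And>\<phi>. \<phi> \<in> test_functions \<Omega> \<Longrightarrow> (LINT x|lebesgue_on \<Omega>. g x * \<phi> x) = 0"
  shows "integral (cbox l r) g = 0"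
proof -
  let ?g = "\<lambda>x. indicator (cbox l r) x * g x"
  have gi: "integrable lebesgue ?g" using g by (simp add: set_integrable_def)
  have bm: "bump k l r \<in> borel_measurable lebesgue" if "k > 0" for k
    using test_measurable[OF bump_test[OF that sub]] by (intro measurable_completion) simp
  have "(\<lambda>n. LINT x|lebesgue. ?g x * bump (real (Suc n)) l r x) \<longlonglongrightarrow> (LINT x|lebesgue. ?g x * indicator (box l r) x)"
  proof (rule integral_dominated_convergence[where w = "\<lambda>x. \<bar>?g x\<bar>"])
    show "(\<lambda>x. ?g x * indicator (box l r) x) \<in> borel_measurable lebesgue"
      by (intro borel_measurable_times[OF borel_measurable_integrable[OF gi]] borel_measurable_indicator) simp
    show "(\<lambda>x. ?g x * bump (real (Suc n)) l r x) \<in> borel_measurable lebesgue" for n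
      by (rule borel_measurable_times[OF borel_measurable_integrable[OF gi] bm]) simp
    show "integrable lebesgue (\<lambda>x. \<bar>?g x\<bar>)" using gi by simp
    show "AE x in lebesgue. (\<lambda>n. ?g x * bump (real (Suc n)) l r x) \<longlonglongrightarrow> ?g x * indicator (box l r) x"
    proof (rule AE_I2)
      fix x show "(\<lambda>n. ?g x * bump (real (Suc n)) l r x) \<longlonglongrightarrow> ?g x * indicator (box l r) x"
      proof (cases "x \<in> box l r")
        case True
        then show ?thesis using tendsto_mult_left[OF bump_tendsto[OF True], of "?g x"] by simp
      qed (simp add: bump_outside)
    qed
    show "AE x in lebesgue. norm (?g x * bump (real (Suc n)) l r x) \<le> \<bar>?g x\<bar>" for n
      using bump_bounds[of "real (Suc n)" l r]
      by (intro AE_I2) (auto simp: abs_mult indicator_def intro!: mult_left_le)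
  qed
  moreover have "(LINT x|lebesgue. ?g x * bump (real (Suc n)) l r x) = 0" for n
  proof -
    let ?b = "bump (real (Suc n)) l r"
    have "(LINT x|lebesgue. ?g x * ?b x) = (LINT x|lebesgue. indicator \<Omega> x *\<^sub>R (g x * ?b x))"
    proof (rule Bochner_Integration.integral_cong)
      fix x show "?g x * ?b x = indicator \<Omega> x *\<^sub>R (g x * ?b x)"
        using sub bump_outside[of "real (Suc n)" x l r] box_subset_cbox[of l r]
        by (cases "x \<in> box l r") (auto simp: indicator_def)
    qed simp
    also have "\<dots> = (LINT x|lebesgue_on \<Omega>. g x * ?b x)"
      using \<Omega> by (subst integral_restrict_space) auto
    also have "\<dots> = 0" by (rule zero) (simp add: bump_test sub)
    finally show ?thesis .
  qed
  ultimately have "(LINT x|lebesgue. ?g x * indicator (box l r) x) = 0"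
    by (simp add: LIMSEQ_const_iff)
  moreover have "(LINT x|lebesgue. ?g x * indicator (box l r) x) = (LINT x|lebesgue. ?g x)"
  proof (rule integral_cong_AE)
    show "(\<lambda>x. ?g x * indicator (box l r) x) \<in> borel_measurable lebesgue" "?g \<in> borel_measurable lebesgue"
      by (intro borel_measurable_times[OF borel_measurable_integrable[OF gi]] borel_measurable_indicator)
        (simp_all add: borel_measurable_integrable[OF gi])
    have "cbox l r - box l r \<in> null_sets lebesgue"
      using negligible_frontier_interval[of l r] negligible_iff_null_sets by blast
    then show "AE x in lebesgue. ?g x * indicator (box l r) x = ?g x"
      by (rule AE_I') (auto simp: indicator_def)
  qed
  ultimately have "(LINT x|lebesgue. ?g x) = 0" by simp
  then show ?thesis
    using set_lebesgue_integral_eq_integral(2)[OF g] by (simp add: set_lebesgue_integral_def)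
qed

text \<open>All integrals over boxes inside \<open>\<Omega>\<close> vanish, so \<open>g\<close> vanishes almost everywhere, by differentiation of its integrals; countably many
boxes exhaust \<open>\<Omega>\<close>.\<close>

theorem fundamental_lemma:
  fixes g :: "'a::euclidean_space \<Rightarrow> real"
  assumes \<Omega>: "open \<Omega>"
    and g: "\<And>l r. cbox l r \<subseteq> \<Omega> \<Longrightarrow> set_integrable lebesgue (cbox l r) g"
    and zero: "\<And>\<phi>. \<phi> \<in> test_functions \<Omega> \<Longrightarrow> (LINT x|lebesgue_on \<Omega>. g x * \<phi> x) = 0"
  shows "AE x in lebesgue_on \<Omega>. g x = 0"
proof -
  have box: "negligible {x \<in> cbox c d. g x \<noteq> 0}" if cd: "cbox c d \<subseteq> \<Omega>" for c d
  proof -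
    define G where "G x = (if x \<in> cbox c d then g x else 0)" for x
    have G: "G integrable_on cbox a b" "integral (cbox a b) G = 0" for a b
    proof -
      obtain l r where lr: "cbox a b \<inter> cbox c d = cbox l r" using Int_interval by blast
      then have sub: "cbox l r \<subseteq> \<Omega>" using cd by blast
      have "integral (cbox l r) g = 0" by (rule integral_box_eq_0[OF \<Omega> sub g[OF sub] zero])
      moreover have "g integrable_on cbox l r" by (rule set_lebesgue_integral_eq_integral(1)[OF g[OF sub]])
      ultimately have "(g has_integral 0) (cbox l r)" by (simp add: has_integral_iff)
      then have "((\<lambda>x. if x \<in> cbox l r then g x else 0) has_integral 0) UNIV"
        by (simp add: has_integral_restrict_UNIV)
      moreover have "(\<lambda>x. if x \<in> cbox l r then g x else 0) = (\<lambda>x. if x \<in> cbox a b then G x else 0)"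
        unfolding lr[symmetric] G_def by auto
      ultimately have "(G has_integral 0) (cbox a b)" by (simp add: has_integral_restrict_UNIV)
      then show "G integrable_on cbox a b" "integral (cbox a b) G = 0" by (auto simp: has_integral_iff)
    qed
    obtain N where N: "negligible N" "\<And>x e. \<lbrakk>x \<notin> N; 0 < e\<rbrakk> \<Longrightarrow>
               \<exists>d>0. \<forall>h. 0 < h \<and> h < d \<longrightarrow> norm (integral (cbox x (x + h *\<^sub>R One)) G /\<^sub>R h ^ DIM('a) - G x) < e"
      using integrable_ccontinuous_explicit[of G] G(1) by blast
    have "G x = 0" if xN: "x \<notin> N" for x
    proof (rule ccontr)
      assume "G x \<noteq> 0"
      then obtain d where d: "d > 0" "\<forall>h. 0 < h \<and> h < d \<longrightarrow>
          norm (integral (cbox x (x + h *\<^sub>R One)) G /\<^sub>R h ^ DIM('a) - G x) < \<bar>G x\<bar>"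
        using N(2)[OF xN, of "\<bar>G x\<bar>"] by auto
      from d(2)[rule_format, of "d/2"] d(1) show False by (simp add: G(2))
    qed
    then have "{x \<in> cbox c d. g x \<noteq> 0} \<subseteq> N" unfolding G_def by (smt (verit) mem_Collect_eq subsetI)
    then show ?thesis using N(1) negligible_subset by blast
  qed
  obtain \<D> where D: "countable \<D>" "\<D> \<subseteq> Pow \<Omega>" "\<And>X. X \<in> \<D> \<Longrightarrow> \<exists>a b. X = cbox a b" "\<Union>\<D> = \<Omega>"
    by (rule open_countable_Union_open_cbox[OF \<Omega>]) blast
  have "negligible (\<Union>X\<in>\<D>. {x \<in> X. g x \<noteq> 0})"
  proof (rule negligible_countable_Union)
    show "countable ((\<lambda>X. {x \<in> X. g x \<noteq> 0}) ` \<D>)" using D(1) by simp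
    fix T assume "T \<in> (\<lambda>X. {x \<in> X. g x \<noteq> 0}) ` \<D>"
    then obtain X where X: "X \<in> \<D>" "T = {x \<in> X. g x \<noteq> 0}" by blast
    obtain a b where ab: "X = cbox a b" using D(3)[OF X(1)] by blast
    then have "cbox a b \<subseteq> \<Omega>" using D(2) X(1) by blast
    then show "negligible T" using box[of a b] X(2) ab by simp
  qed
  moreover have "(\<Union>X\<in>\<D>. {x \<in> X. g x \<noteq> 0}) = {x \<in> \<Omega>. g x \<noteq> 0}" using D(4) by blast
  ultimately have "{x \<in> \<Omega>. g x \<noteq> 0} \<in> null_sets lebesgue" by (simp add: negligible_iff_null_sets)
  then have "AE x in lebesgue. x \<in> \<Omega> \<longrightarrow> g x = 0" by (rule AE_I') auto
  then show ?thesis using \<Omega> by (simp add: AE_restrict_space_iff)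
qed

section \<open>Distributions on the line\<close>

text \<open>Twice integrating a bump \<open>\<psi>\<close> of mass one yields a smoothed version \<open>\<theta>\<close> of the ramp
  \<open>max 0 (t - \<mu>)\<close>.\<close>

lemma smooth_ramp:
  assumes d: "(d::real) > 0"
  obtains \<theta> \<theta>1 \<psi> :: "real \<Rightarrow> real" and \<mu> where
    "\<And>k. C_k k \<theta>" "\<And>t. (\<theta> has_real_derivative \<theta>1 t) (at t)"
    "\<And>t. (\<theta>1 has_real_derivative \<psi> t) (at t)" "\<And>t. \<psi> t \<ge> 0"
    "\<And>t. t \<le> 0 \<Longrightarrow> \<psi> t = 0" "\<And>t. t \<ge> d \<Longrightarrow> \<psi> t = 0"
    "\<And>t. t \<le> 0 \<Longrightarrow> \<theta> t = 0" "\<And>t. t \<ge> d \<Longrightarrow> \<theta> t = t - \<mu>"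
    "(\<psi> has_integral 1) {0..d}" "continuous_on UNIV \<psi>"
proof -
  define \<beta> where "\<beta> t = flat 1 t * flat 1 (d - t)" for t
  have Ck\<beta>: "C_k k \<beta>" for k
    using C_k_mult[OF C_k_flat[of k 1] C_k_compose_linear[OF C_k_flat[of k 1], of d "-1" 1]]
    by (simp add: \<beta>_def[abs_def])
  have \<beta>c: "continuous_on S \<beta>" for S using C_k_cont[OF Ck\<beta>] continuous_on_subset by blast
  have \<beta>0: "\<beta> t \<ge> 0" for t by (simp add: \<beta>_def flat_1_bounds)
  define c where "c = integral {0..d} \<beta>"
  have "c \<ge> 0" unfolding c_def using \<beta>0 \<beta>c by (intro integral_nonneg integrable_continuous_interval)
  moreover have "c \<noteq> 0"
  proof
    assume "c = 0"
    then have "\<forall>t\<in>{0..d}. \<beta> t = 0"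
      using integral_eq_0_iff[of 0 d \<beta>] \<beta>c \<beta>0 d by (auto simp: c_def)
    then have "\<beta> (d / 2) = 0" using d by simp
    then show False using d by (simp add: \<beta>_def flat_1)
  qed
  ultimately have c: "c > 0" by simp
  define \<psi> where "\<psi> t = \<beta> t / c" for t
  have Ck\<psi>: "C_k k \<psi>" for k
    using C_k_cmult[OF Ck\<beta>, of k "1/c"] by (simp add: \<psi>_def[abs_def])
  have \<psi>c: "continuous_on S \<psi>" for S using C_k_cont[OF Ck\<psi>] continuous_on_subset by blast
  have \<psi>0: "\<psi> t = 0" if "t \<le> 0 \<or> t \<ge> d" for t using that by (auto simp: \<psi>_def \<beta>_def flat_1)
  have \<psi>i: "(\<psi> has_integral 1) {0..d}"
  proof -
    have "(\<beta> has_integral c) {0..d}"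
      unfolding c_def using \<beta>c by (intro integrable_integral integrable_continuous_interval)
    from has_integral_divide[OF this, of c] show ?thesis using c by (simp add: \<psi>_def[abs_def])
  qed
  define \<theta>1 where "\<theta>1 t = integral {0..t} \<psi>" for t
  have d\<theta>1: "(\<theta>1 has_real_derivative \<psi> t) (at t)" for t
    unfolding has_real_derivative_iff_has_vector_derivative \<theta>1_def
    by (rule has_vector_derivative_integral_from_0) (use \<psi>c \<psi>0 in auto)
  have \<theta>1c: "continuous_on S \<theta>1" for S
    using d\<theta>1 by (auto intro!: continuous_at_imp_continuous_on DERIV_isCont)
  have \<theta>1_0: "\<theta>1 t = 0" if "t \<le> 0" for t using that by (cases "t = 0") (auto simp: \<theta>1_def)
  have \<theta>1_1: "\<theta>1 t = 1" if "t \<ge> d" for t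
  proof -
    have "integral {0..d} \<psi> + integral {d..t} \<psi> = integral {0..t} \<psi>"
      using d that by (intro Henstock_Kurzweil_Integration.integral_combine integrable_continuous_interval \<psi>c) auto
    moreover have "integral {d..t} \<psi> = integral {d..t} (\<lambda>_. 0)"
      by (rule integral_cong) (use \<psi>0 in auto)
    ultimately show ?thesis using \<psi>i by (simp add: \<theta>1_def integral_unique)
  qed
  define \<theta> where "\<theta> t = integral {0..t} \<theta>1" for t
  have d\<theta>: "(\<theta> has_real_derivative \<theta>1 t) (at t)" for t
    unfolding has_real_derivative_iff_has_vector_derivative \<theta>_def
    by (rule has_vector_derivative_integral_from_0) (use \<theta>1c \<theta>1_0 in auto)
  have \<theta>_0: "\<theta> t = 0" if "t \<le> 0" for t using that by (cases "t = 0") (auto simp: \<theta>_def)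
  have \<theta>_1: "\<theta> t = t - (d - \<theta> d)" if "t \<ge> d" for t
  proof -
    have "integral {0..d} \<theta>1 + integral {d..t} \<theta>1 = integral {0..t} \<theta>1"
      using d that by (intro Henstock_Kurzweil_Integration.integral_combine integrable_continuous_interval \<theta>1c) auto
    moreover have "integral {d..t} \<theta>1 = integral {d..t} (\<lambda>_. 1)"
      by (rule integral_cong) (use \<theta>1_1 in auto)
    ultimately show ?thesis using that by (simp add: \<theta>_def)
  qed
  have Ck: "C_k k \<theta>" for k
    by (rule C_k_mono_Suc, rule C_k_SucI_real[OF d\<theta>], rule C_k_mono_Suc, rule C_k_SucI_real[OF d\<theta>1], rule Ck\<psi>)
  show ?thesis
    by (rule that[OF Ck d\<theta> d\<theta>1 _ _ _ \<theta>_0 \<theta>_1 \<psi>i \<psi>c]) (use \<psi>0 c \<beta>0 in \<open>auto simp: \<psi>_def\<close>)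
qed

lemma integral_against_bump:
  fixes q \<psi> :: "real \<Rightarrow> real"
  assumes I: "{p..p+d} \<subseteq> I" "I \<in> sets lebesgue" and d: "d > 0"
    and q: "continuous_on {p..p+d} q" "\<And>t. t \<in> {p..p+d} \<Longrightarrow> \<bar>q t - q p\<bar> \<le> e"
    and \<psi>: "\<And>t. \<psi> t \<ge> 0" "\<And>t. t \<le> 0 \<Longrightarrow> \<psi> t = 0" "\<And>t. t \<ge> d \<Longrightarrow> \<psi> t = 0"
      "(\<psi> has_integral 1) {0..d}" "continuous_on UNIV \<psi>"
  shows "integrable (lebesgue_on I) (\<lambda>t. \<psi> (t - p) * q t)"
    and "\<bar>(LINT t|lebesgue_on I. \<psi> (t - p) * q t) - q p\<bar> \<le> e"
proof -
  have \<psi>c: "continuous_on S (\<lambda>t. \<psi> (t - p))" for S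
    by (intro continuous_on_compose2[OF \<psi>(5)] continuous_intros) auto
  have \<psi>i: "((\<lambda>t. \<psi> (t - p)) has_integral 1) {p..p+d}"
    using has_integral_affinity_iff[of 1 \<psi> "-p" 1 0 d] \<psi>(4)
    by (simp add: add.commute)
  let ?f = "\<lambda>t. \<psi> (t - p) * q t"
  have fc: "continuous_on {p..p+d} ?f" by (intro continuous_intros \<psi>c q)
  have ai: "?f absolutely_integrable_on {p..p+d}"
    by (rule absolutely_integrable_continuous_real[OF fc])
  have out: "indicator I t *\<^sub>R ?f t = indicator {p..p+d} t *\<^sub>R ?f t" for t
    using I(1) \<psi>(2)[of "t - p"] \<psi>(3)[of "t - p"] by (auto simp: indicator_def)
  show int: "integrable (lebesgue_on I) ?f"
    using ai I(2) by (simp add: integrable_restrict_space out[unfolded real_scaleR_def] set_integrable_def)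
  have "(LINT t|lebesgue_on I. ?f t) = (LINT t|lebesgue. indicator {p..p+d} t *\<^sub>R ?f t)"
    using I(2) by (simp add: integral_restrict_space out[unfolded real_scaleR_def])
  also have "\<dots> = integral {p..p+d} ?f"
    using set_lebesgue_integral_eq_integral(2)[OF ai] by (simp add: set_lebesgue_integral_def)
  finally have eq: "(LINT t|lebesgue_on I. ?f t) = integral {p..p+d} ?f" .
  have fi: "(?f has_integral integral {p..p+d} ?f) {p..p+d}"
    using fc by (intro integrable_integral integrable_continuous_interval)
  have h1: "((\<lambda>t. ?f t - \<psi> (t - p) * q p) has_integral (integral {p..p+d} ?f - 1 * q p)) {p..p+d}"
    by (intro has_integral_diff fi has_integral_mult_left \<psi>i)
  have h2: "((\<lambda>t. \<psi> (t - p) * e) has_integral (1 * e)) {p..p+d}"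
    by (intro has_integral_mult_left \<psi>i)
  have "norm (?f t - \<psi> (t - p) * q p) \<le> \<psi> (t - p) * e" if "t \<in> {p..p+d}" for t
  proof -
    have "?f t - \<psi> (t - p) * q p = \<psi> (t - p) * (q t - q p)" by (simp add: algebra_simps)
    then show ?thesis using \<psi>(1)[of "t - p"] q(2)[OF that] by (simp add: abs_mult mult_left_mono)
  qed
  from integral_norm_bound_integral[OF has_integral_integrable[OF h1] has_integral_integrable[OF h2] this]
  have "norm (integral {p..p+d} ?f - 1 * q p) \<le> 1 * e"
    unfolding integral_unique[OF h1] integral_unique[OF h2] .
  then show "\<bar>(LINT t|lebesgue_on I. ?f t) - q p\<bar> \<le> e" by (simp add: eq)
qed

text \<open>The test function is the combination of three smoothed ramps starting at \<open>u\<close>, \<open>m\<close> and \<open>v\<close> whose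
slopes and offsets cancel to the right of all three; its second derivative is concentrated near these
points. The conclusion says that \<open>q\<close> is affine, in the form of the interpolation identity for three
points.\<close>

theorem second_derivative_zero_affine:
  fixes q :: "real \<Rightarrow> real"
  assumes q: "continuous_on {0<..<T} q"
    and zero: "\<And>\<phi>. \<phi> \<in> test_functions {0<..<T} \<Longrightarrow>
      (LINT t|lebesgue_on {0<..<T}. deriv (deriv \<phi>) t * q t) = 0"
    and uv: "0 < u" "u < m" "m < v" "v < T"
  shows "(v - m) * q u + (m - u) * q v = (v - u) * q m"
proof -
  let ?I = "{0<..<T}"
  have "\<bar>(v - m) * q u + (m - u) * q v - (v - u) * q m\<bar> \<le> 2 * (v - u) * e" if e: "e > 0" for e
  proof -
    have cont: "\<exists>d>0. \<forall>t. \<bar>t - p\<bar> < d \<longrightarrow> \<bar>q t - q p\<bar> < e \<and> t \<in> ?I" if "p \<in> ?I" for p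
    proof -
      obtain d1 where d1: "d1 > 0" "\<And>t. t \<in> ?I \<Longrightarrow> dist t p < d1 \<Longrightarrow> dist (q t) (q p) < e"
        using q \<open>p \<in> ?I\<close> e unfolding continuous_on_iff by meson
      obtain d2 where d2: "d2 > 0" "ball p d2 \<subseteq> ?I"
        using \<open>p \<in> ?I\<close> open_greaterThanLessThan[of 0 T] open_contains_ball by metis
      show ?thesis
        using d1 d2 by (intro exI[of _ "min d1 d2"]) (auto simp: dist_real_def subset_iff abs_minus_commute)
    qed
    obtain du where du: "du > 0" "\<And>t. \<bar>t - u\<bar> < du \<Longrightarrow> \<bar>q t - q u\<bar> < e \<and> t \<in> ?I"
      using cont[of u] uv by auto
    obtain dm where dm: "dm > 0" "\<And>t. \<bar>t - m\<bar> < dm \<Longrightarrow> \<bar>q t - q m\<bar> < e \<and> t \<in> ?I"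
      using cont[of m] uv by auto
    obtain dv where dv: "dv > 0" "\<And>t. \<bar>t - v\<bar> < dv \<Longrightarrow> \<bar>q t - q v\<bar> < e \<and> t \<in> ?I"
      using cont[of v] uv by auto
    define d where "d = min du (min dm dv) / 2"
    have d: "d > 0" "d < du" "d < dm" "d < dv" using du dm dv by (auto simp: d_def min_def)
    obtain \<theta> \<theta>1 \<psi> :: "real \<Rightarrow> real" and \<mu> where Ck: "\<And>k. C_k k \<theta>"
      and d1: "\<And>t. (\<theta> has_real_derivative \<theta>1 t) (at t)"
      and d2: "\<And>t. (\<theta>1 has_real_derivative \<psi> t) (at t)" 
      and \<psi>: "\<And>t. \<psi> t \<ge> 0" "\<And>t. t \<le> 0 \<Longrightarrow> \<psi> t = 0" "\<And>t. t \<ge> d \<Longrightarrow> \<psi> t = 0"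
        "(\<psi> has_integral 1) {0..d}" "continuous_on UNIV \<psi>"
      and \<theta>0: "\<And>t. t \<le> 0 \<Longrightarrow> \<theta> t = 0" and \<theta>1: "\<And>t. t \<ge> d \<Longrightarrow> \<theta> t = t - \<mu>"
      by (rule smooth_ramp[OF d(1)]) blast
    define \<phi> where "\<phi> t = (v - m) * \<theta> (t - u) + (m - u) * \<theta> (t - v) - (v - u) * \<theta> (t - m)" for t
    have "\<phi> \<in> test_functions ?I"
    proof (rule test_functionsI[where S = "{u..v+d}"])
      have sh: "C_k k (\<lambda>t. \<theta> (t - p))" for k p
        using C_k_compose_linear[OF Ck[of k], of "-p" 1 "1::real"] by simp
      have "C_k k (\<lambda>t. (v - m) * \<theta> (t - u) + (m - u) * \<theta> (t - v) + (-(v - u)) * \<theta> (t - m))" for k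
        by (intro C_k_add C_k_cmult sh)
      then show "C_k k \<phi>" for k by (simp add: \<phi>_def[abs_def] algebra_simps)
      show "\<phi> t = 0" if "t \<notin> {u..v+d}" for t
      proof (cases "t < u")
        case True
        then show ?thesis using uv by (simp add: \<phi>_def \<theta>0)
      next
        case False
        then have "t > v + d" using that by simp
        then have "\<phi> t = (v - m) * (t - u - \<mu>) + (m - u) * (t - v - \<mu>) - (v - u) * (t - m - \<mu>)"
          using uv by (simp add: \<phi>_def \<theta>1)
        also have "\<dots> = 0" by (simp add: algebra_simps)
        finally show ?thesis .
      qed
      show "{u..v+d} \<subseteq> ?I" using dv(2)[of "v + d"] d uv by auto
    qed simp
    then have z: "(LINT t|lebesgue_on ?I. deriv (deriv \<phi>) t * q t) = 0" by (rule zero)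
    have sh1: "((\<lambda>t. \<theta> (t - p)) has_real_derivative \<theta>1 (t - p)) (at t)"
      and sh2: "((\<lambda>t. \<theta>1 (t - p)) has_real_derivative \<psi> (t - p)) (at t)" for p t
      using DERIV_shift[of \<theta> "\<theta>1 (t - p)" t "-p"] d1[of "t - p"]
        DERIV_shift[of \<theta>1 "\<psi> (t - p)" t "-p"] d2[of "t - p"] by simp_all
    have "deriv \<phi> = (\<lambda>t. (v - m) * \<theta>1 (t - u) + (m - u) * \<theta>1 (t - v) - (v - u) * \<theta>1 (t - m))"
      unfolding \<phi>_def
      by (intro ext DERIV_imp_deriv DERIV_diff DERIV_add DERIV_cmult sh1)
    moreover have "deriv (\<lambda>t. (v - m) * \<theta>1 (t - u) + (m - u) * \<theta>1 (t - v) - (v - u) * \<theta>1 (t - m))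
        = (\<lambda>t. (v - m) * \<psi> (t - u) + (m - u) * \<psi> (t - v) - (v - u) * \<psi> (t - m))"
      by (intro ext DERIV_imp_deriv DERIV_diff DERIV_add DERIV_cmult sh2)
    ultimately have dd: "deriv (deriv \<phi>) t = (v - m) * \<psi> (t - u) + (m - u) * \<psi> (t - v) - (v - u) * \<psi> (t - m)" for t
      by simp
    have B: "integrable (lebesgue_on ?I) (\<lambda>t. \<psi> (t - p) * q t)
        \<and> \<bar>(LINT t|lebesgue_on ?I. \<psi> (t - p) * q t) - q p\<bar> \<le> e"
      if "\<And>t. \<bar>t - p\<bar> \<le> d \<Longrightarrow> \<bar>q t - q p\<bar> < e \<and> t \<in> ?I" for p
    proof -
      have I: "{p..p+d} \<subseteq> ?I" using that by (auto simp: abs_le_iff)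
      have "\<bar>q t - q p\<bar> \<le> e" if "t \<in> {p..p+d}" for t
        using \<open>\<And>t. \<bar>t - p\<bar> \<le> d \<Longrightarrow> \<bar>q t - q p\<bar> < e \<and> t \<in> ?I\<close>[of t] that by (auto simp: abs_le_iff)
      then show ?thesis
        using integral_against_bump[OF I _ d(1) continuous_on_subset[OF q I] _ \<psi>, of e] by simp
    qed
    let ?J = "\<lambda>p. LINT t|lebesgue_on ?I. \<psi> (t - p) * q t"
    have Bu: "integrable (lebesgue_on ?I) (\<lambda>t. \<psi> (t - u) * q t)" "\<bar>?J u - q u\<bar> \<le> e"
      and Bm: "integrable (lebesgue_on ?I) (\<lambda>t. \<psi> (t - m) * q t)" "\<bar>?J m - q m\<bar> \<le> e"
      and Bv: "integrable (lebesgue_on ?I) (\<lambda>t. \<psi> (t - v) * q t)" "\<bar>?J v - q v\<bar> \<le> e"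
      using B[of u] B[of m] B[of v] du(2) dm(2) dv(2) d by (meson le_less_trans)+
    have "(LINT t|lebesgue_on ?I. deriv (deriv \<phi>) t * q t) =
      (LINT t|lebesgue_on ?I. (v - m) * (\<psi> (t - u) * q t) + (m - u) * (\<psi> (t - v) * q t) - (v - u) * (\<psi> (t - m) * q t))"
      by (rule Bochner_Integration.integral_cong) (auto simp: dd algebra_simps)
    also have "\<dots> = (v - m) * ?J u + (m - u) * ?J v - (v - u) * ?J m"
      using Bu(1) Bm(1) Bv(1) by simp
    finally have eq: "(v - m) * ?J u + (m - u) * ?J v - (v - u) * ?J m = 0" using z by simp
    have "(v - m) * q u + (m - u) * q v - (v - u) * q m =
      - ((v - m) * (?J u - q u)) - (m - u) * (?J v - q v) + (v - u) * (?J m - q m)"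
      using eq by (simp add: algebra_simps)
    also have "\<bar>\<dots>\<bar> \<le> (v - m) * e + (m - u) * e + (v - u) * e"
    proof -
      have "\<bar>(v - m) * (?J u - q u)\<bar> \<le> (v - m) * e" "\<bar>(m - u) * (?J v - q v)\<bar> \<le> (m - u) * e"
        "\<bar>(v - u) * (?J m - q m)\<bar> \<le> (v - u) * e"
        using uv Bu(2) Bm(2) Bv(2) by (simp_all add: abs_mult mult_left_mono)
      then show ?thesis by linarith
    qed
    finally show ?thesis by (simp add: algebra_simps)
  qed
  note bound = this
  define A where "A = \<bar>(v - m) * q u + (m - u) * q v - (v - u) * q m\<bar>"
  have "A \<le> 0"
  proof (rule ccontr)
    assume "\<not> A \<le> 0"
    then have "A \<le> 2 * (v - u) * (A / (4 * (v - u)))"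
      unfolding A_def using uv by (intro bound divide_pos_pos) auto
    then show False using \<open>\<not> A \<le> 0\<close> uv by (simp add: field_simps)
  qed
  then show ?thesis by (simp add: A_def)
qed

section \<open>The space \<open>L\<^sup>2\<close>\<close>

lemma L2_measurable [measurable_dest]: "u \<in> L2 \<Omega> \<Longrightarrow> u \<in> borel_measurable (lebesgue_on \<Omega>)"
  by (simp add: L2_def)

lemma L2_square_integrable: "u \<in> L2 \<Omega> \<Longrightarrow> integrable (lebesgue_on \<Omega>) (\<lambda>x. (u x)\<^sup>2)"
  by (simp add: L2_def)

lemma L2_mult_integrable:
  assumes u: "u \<in> L2 \<Omega>" and v: "v \<in> L2 \<Omega>"
  shows "integrable (lebesgue_on \<Omega>) (\<lambda>x. u x * v x)"
proof (rule Bochner_Integration.integrable_bound)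
  show "integrable (lebesgue_on \<Omega>) (\<lambda>x. (u x)\<^sup>2 + (v x)\<^sup>2)"
    using u v by (intro Bochner_Integration.integrable_add L2_square_integrable)
  show "(\<lambda>x. u x * v x) \<in> borel_measurable (lebesgue_on \<Omega>)"
    using u v by (intro borel_measurable_times L2_measurable)
  have "\<bar>a * b\<bar> \<le> a\<^sup>2 + b\<^sup>2" for a b :: real
  proof -
    have "2 * (\<bar>a\<bar> * \<bar>b\<bar>) \<le> a\<^sup>2 + b\<^sup>2" using sum_squares_bound[of "\<bar>a\<bar>" "\<bar>b\<bar>"] by simp
    moreover have "0 \<le> \<bar>a\<bar> * \<bar>b\<bar>" by simp
    ultimately show ?thesis unfolding abs_mult by linarith
  qed
  then show "AE x in lebesgue_on \<Omega>. norm (u x * v x) \<le> norm ((u x)\<^sup>2 + (v x)\<^sup>2)"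
    by (intro AE_I2) auto
qed

lemma L2_scaleR: "u \<in> L2 \<Omega> \<Longrightarrow> c *\<^sub>R u \<in> L2 \<Omega>"
  unfolding L2_def scaleR_fun_def by (auto simp: power_mult_distrib)

lemma L2_add:
  assumes u: "u \<in> L2 \<Omega>" and v: "v \<in> L2 \<Omega>" shows "u + v \<in> L2 \<Omega>"
proof -
  have "integrable (lebesgue_on \<Omega>) (\<lambda>x. (u x)\<^sup>2 + (v x)\<^sup>2 + 2 * (u x * v x))"
    using u v by (intro Bochner_Integration.integrable_add L2_square_integrable
        integrable_mult_right L2_mult_integrable)
  then have "integrable (lebesgue_on \<Omega>) (\<lambda>x. (u x + v x)\<^sup>2)"
    by (simp add: power2_sum mult.assoc)
  then show ?thesis using u v by (auto simp: L2_def plus_fun_def)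
qed

lemma subspace_L2: "subspace (L2 \<Omega>)"
  unfolding subspace_def
proof (intro conjI ballI allI)
  show "0 \<in> L2 \<Omega>" by (simp add: L2_def zero_fun_def)
qed (simp_all add: L2_add L2_scaleR)

interpretation L2: psd_form "L2 \<Omega>" "L2_inner \<Omega>" for \<Omega> :: "(real^'n) set"
proof (rule psd_form.intro)
  show "subspace (L2 \<Omega>)" by (rule subspace_L2)
  fix u v w :: "real^'n \<Rightarrow> real" and c assume u: "u \<in> L2 \<Omega>" and v: "v \<in> L2 \<Omega>"
  show "L2_inner \<Omega> u v = L2_inner \<Omega> v u" by (simp add: L2_inner_def mult.commute)
  show "L2_inner \<Omega> (c *\<^sub>R u) v = c * L2_inner \<Omega> u v"
    using L2_mult_integrable[OF u v] by (simp add: L2_inner_def scaleR_fun_def mult.assoc)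
  assume w: "w \<in> L2 \<Omega>"
  show "L2_inner \<Omega> (u + v) w = L2_inner \<Omega> u w + L2_inner \<Omega> v w"
    using L2_mult_integrable[OF u w] L2_mult_integrable[OF v w]
    by (simp add: L2_inner_def plus_fun_def distrib_right)
qed (simp add: L2_inner_def)

interpretation L2n: seminormed_space "L2 \<Omega>" "L2_norm \<Omega>" for \<Omega> :: "(real^'n) set"
proof -
  have "L2_norm \<Omega> = (\<lambda>v. sqrt (L2_inner \<Omega> v v))" by (auto simp: L2_norm_def)
  then show "seminormed_space (L2 \<Omega>) (L2_norm \<Omega>)" using L2.seminormed_space_axioms by metis
qed

lemma L2_cauchy_schwarz:
  "u \<in> L2 \<Omega> \<Longrightarrow> v \<in> L2 \<Omega> \<Longrightarrow> \<bar>L2_inner \<Omega> u v\<bar> \<le> L2_norm \<Omega> u * L2_norm \<Omega> v"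
  using L2.cauchy_schwarz by (simp add: L2_norm_def)

lemma L2_norm_square: "(L2_norm \<Omega> u)\<^sup>2 = (LINT x|lebesgue_on \<Omega>. (u x)\<^sup>2)"
  by (simp add: L2_norm_def L2_inner_def power2_eq_square)

lemma L2_norm_square_inner: "(L2_norm \<Omega> u)\<^sup>2 = L2_inner \<Omega> u u"
  by (simp add: L2_norm_def L2_inner_def)

lemma L2_norm_ge_0 [simp]: "0 \<le> L2_norm \<Omega> u"
  by (simp add: L2_norm_def L2_inner_def)

lemma L2_norm_eq_0:
  assumes "u \<in> L2 \<Omega>"
  shows "L2_norm \<Omega> u = 0 \<longleftrightarrow> (AE x in lebesgue_on \<Omega>. u x = 0)"
proof -
  have "L2_norm \<Omega> u = 0 \<longleftrightarrow> (L2_norm \<Omega> u)\<^sup>2 = 0" by simp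
  also have "\<dots> \<longleftrightarrow> (AE x in lebesgue_on \<Omega>. (u x)\<^sup>2 = 0)"
    unfolding L2_norm_square
    by (rule integral_nonneg_eq_0_iff_AE) (use assms in \<open>auto simp: L2_square_integrable\<close>)
  finally show ?thesis by simp
qed

lemma L2_nn_integral:
  assumes "u \<in> L2 \<Omega>"
  shows "(\<integral>\<^sup>+x. ennreal ((u x)\<^sup>2) \<partial>lebesgue_on \<Omega>) = ennreal ((L2_norm \<Omega> u)\<^sup>2)"
  unfolding L2_norm_square
  by (rule nn_integral_eq_integral) (use assms in \<open>auto simp: L2_square_integrable\<close>)

lemma L2I_nn:
  assumes "u \<in> borel_measurable (lebesgue_on \<Omega>)"
    and "(\<integral>\<^sup>+x. ennreal ((u x)\<^sup>2) \<partial>lebesgue_on \<Omega>) \<le> ennreal (c\<^sup>2)" and "c \<ge> 0"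
  shows "u \<in> L2 \<Omega>" "L2_norm \<Omega> u \<le> c"
proof -
  have "integrable (lebesgue_on \<Omega>) (\<lambda>x. (u x)\<^sup>2)"
    using assms by (intro integrableI_bounded) (auto simp: le_less_trans[OF _ ennreal_less_top])
  then show L: "u \<in> L2 \<Omega>" using assms by (simp add: L2_def)
  then have "ennreal ((L2_norm \<Omega> u)\<^sup>2) \<le> ennreal (c\<^sup>2)" using assms(2) L2_nn_integral[OF L] by simp
  then have "(L2_norm \<Omega> u)\<^sup>2 \<le> c\<^sup>2" by simp
  then show "L2_norm \<Omega> u \<le> c" using assms(3) power2_le_imp_le by blast
qed

lemma L2_abs: "u \<in> L2 \<Omega> \<Longrightarrow> (\<lambda>x. \<bar>u x\<bar>) \<in> L2 \<Omega>" "L2_norm \<Omega> (\<lambda>x. \<bar>u x\<bar>) = L2_norm \<Omega> u"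
  by (auto simp: L2_def L2_norm_def L2_inner_def)

text \<open>The Riesz-Fischer argument: along a subsequence with summable distances the series of the differences
converges absolutely almost everywhere and in norm.\<close>

theorem L2_complete:
  fixes \<Omega> :: "(real^'n) set"
  shows "complete_in (L2 \<Omega>) (L2_norm \<Omega>)"
  unfolding complete_in_def
proof (intro allI impI)
  fix x :: "nat \<Rightarrow> real^'n \<Rightarrow> real"
  let ?M = "lebesgue_on \<Omega>"
  assume x: "\<forall>k. x k \<in> L2 \<Omega>"
    and C: "\<forall>e>0. \<exists>M. \<forall>i\<ge>M. \<forall>j\<ge>M. L2_norm \<Omega> (x i - x j) < e"
  have "\<exists>m. \<forall>i\<ge>m. \<forall>j\<ge>m. L2_norm \<Omega> (x i - x j) < (1/2) ^ k" for k :: nat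
    using C by simp
  then obtain m where m: "\<And>k i j. i \<ge> m k \<Longrightarrow> j \<ge> m k \<Longrightarrow> L2_norm \<Omega> (x i - x j) < (1/2) ^ k"
    by metis
  define r where "r k = (\<Sum>i\<le>k. m i) + k" for k
  have r_m: "r j \<ge> m k" if "j \<ge> k" for j k
  proof -
    have "m k \<le> (\<Sum>i\<le>j. m i)" by (rule member_le_sum) (use that in auto)
    then show ?thesis by (simp add: r_def)
  qed
  define d where "d k = x (r (Suc k)) - x (r k)" for k
  have d: "d k \<in> L2 \<Omega>" for k using x by (simp add: d_def)
  have dN: "L2_norm \<Omega> (d k) \<le> (1/2) ^ k" for k
    using m[of k "r (Suc k)" "r k"] r_m[of k k] r_m[of k "Suc k"] by (simp add: d_def)
  define S where "S n = (\<Sum>k<n. (\<lambda>t. \<bar>d k t\<bar>))" for n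
  have S_apply: "S n t = (\<Sum>k<n. \<bar>d k t\<bar>)" for n t
    unfolding S_def by (induction n) (auto simp: plus_fun_def zero_fun_def)
  have S: "S n \<in> L2 \<Omega>" for n unfolding S_def by (intro L2n.mem_sum L2_abs d)
  have SN: "L2_norm \<Omega> (S n) \<le> 2" for n
  proof -
    have "L2_norm \<Omega> (S n) \<le> (\<Sum>k<n. L2_norm \<Omega> (\<lambda>t. \<bar>d k t\<bar>))"
      unfolding S_def by (intro L2n.N_sum L2_abs d) auto
    also have "\<dots> \<le> (\<Sum>k<n. (1/2) ^ k)" using dN by (intro sum_mono) (simp add: L2_abs)
    also have "\<dots> \<le> (\<Sum>k. (1/2) ^ k)" by (intro sum_le_suminf summable_geometric) auto
    also have "\<dots> = 2" by (subst suminf_geometric) auto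
    finally show ?thesis .
  qed
  have Sm: "S n \<in> borel_measurable ?M" for n using S by (rule L2_measurable)
  have "(\<integral>\<^sup>+t. (SUP n. ennreal ((S n t)\<^sup>2)) \<partial>?M) = (SUP n. \<integral>\<^sup>+t. ennreal ((S n t)\<^sup>2) \<partial>?M)"
  proof (rule nn_integral_monotone_convergence_SUP)
    show "incseq (\<lambda>n t. ennreal ((S n t)\<^sup>2))"
      by (auto simp: incseq_def le_fun_def S_apply intro!: ennreal_leI power_mono sum_mono2 sum_nonneg)
    show "(\<lambda>t. ennreal ((S n t)\<^sup>2)) \<in> borel_measurable ?M" for n using Sm[of n] by measurable
  qed
  also have "\<dots> \<le> ennreal (2\<^sup>2)"
  proof (rule SUP_least)
    fix n
    have "(L2_norm \<Omega> (S n))\<^sup>2 \<le> 2\<^sup>2" using SN by (intro power_mono) auto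
    then show "(\<integral>\<^sup>+t. ennreal ((S n t)\<^sup>2) \<partial>?M) \<le> ennreal (2\<^sup>2)"
      unfolding L2_nn_integral[OF S] by (rule ennreal_leI)
  qed
  finally have "(\<integral>\<^sup>+t. (SUP n. ennreal ((S n t)\<^sup>2)) \<partial>?M) \<noteq> \<infinity>"
    by (auto simp: top_unique)
  then have "AE t in ?M. (SUP n. ennreal ((S n t)\<^sup>2)) \<noteq> \<infinity>"
    using Sm by (intro nn_integral_PInf_AE) measurable
  then have conv: "AE t in ?M. convergent (\<lambda>k. x (r k) t)"
  proof (rule AE_mp, intro AE_I2 impI)
    fix t assume "(SUP n. ennreal ((S n t)\<^sup>2)) \<noteq> \<infinity>"
    then obtain B where B: "B \<ge> 0" "(SUP n. ennreal ((S n t)\<^sup>2)) = ennreal B"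
      by (metis ennreal_cases infinity_ennreal_def)
    have "S n t \<le> sqrt B" for n
    proof -
      have "ennreal ((S n t)\<^sup>2) \<le> ennreal B" unfolding B(2)[symmetric] by (rule SUP_upper) simp
      then show ?thesis using B(1) by (intro real_le_rsqrt) simp
    qed
    then have "(\<Sum>k\<le>n. \<bar>d k t\<bar>) \<le> sqrt B" for n
      using S_apply[of "Suc n" t] by (simp only: lessThan_Suc_atMost) metis
    then have "summable (\<lambda>k. \<bar>d k t\<bar>)"
      by (intro bounded_imp_summable[of _ "sqrt B"]) auto
    then have "summable (\<lambda>k. d k t)" by (rule summable_rabs_cancel)
    then have "convergent (\<lambda>n. \<Sum>k<n. d k t)" by (rule summable_iff_convergent[THEN iffD1])
    moreover have "(\<Sum>k<n. d k t) = x (r n) t - x (r 0) t" for n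
      by (induction n) (auto simp: d_def)
    ultimately have "convergent (\<lambda>n. x (r n) t - x (r 0) t)" by simp
    from convergent_add[OF this convergent_const[of "x (r 0) t"]] show "convergent (\<lambda>k. x (r k) t)" by simp
  qed
  define l where "l t = lim (\<lambda>k. x (r k) t)" for t
  have lm: "l \<in> borel_measurable ?M"
    unfolding l_def using x by (intro borel_measurable_lim_metric L2_measurable) auto
  have est: "x i - l \<in> L2 \<Omega> \<and> L2_norm \<Omega> (x i - l) \<le> e"
    if e: "e > 0" and M: "\<And>i j. i \<ge> M \<Longrightarrow> j \<ge> M \<Longrightarrow> L2_norm \<Omega> (x i - x j) < e" and i: "i \<ge> M" for M i e
  proof -
    have meas: "(\<lambda>t. ennreal ((x i t - x (r k) t)\<^sup>2)) \<in> borel_measurable ?M" for k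
      using x by (intro measurable_compose[OF _ measurable_ennreal] borel_measurable_power
          borel_measurable_diff L2_measurable) auto
    have "(\<integral>\<^sup>+t. ennreal (((x i - l) t)\<^sup>2) \<partial>?M) = (\<integral>\<^sup>+t. liminf (\<lambda>k. ennreal ((x i t - x (r k) t)\<^sup>2)) \<partial>?M)"
    proof (rule nn_integral_cong_AE)
      show "AE t in ?M. ennreal (((x i - l) t)\<^sup>2) = liminf (\<lambda>k. ennreal ((x i t - x (r k) t)\<^sup>2))"
        using conv
      proof (rule AE_mp, intro AE_I2 impI)
        fix t assume "convergent (\<lambda>k. x (r k) t)"
        then have "(\<lambda>k. x (r k) t) \<longlonglongrightarrow> l t" by (simp add: l_def convergent_LIMSEQ_iff)
        then have "(\<lambda>k. ennreal ((x i t - x (r k) t)\<^sup>2)) \<longlonglongrightarrow> ennreal ((x i t - l t)\<^sup>2)"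
          by (intro tendsto_ennrealI tendsto_intros)
        then show "ennreal (((x i - l) t)\<^sup>2) = liminf (\<lambda>k. ennreal ((x i t - x (r k) t)\<^sup>2))"
          using lim_imp_Liminf[OF trivial_limit_sequentially] by fastforce
      qed
    qed
    also have "\<dots> \<le> liminf (\<lambda>k. \<integral>\<^sup>+t. ennreal ((x i t - x (r k) t)\<^sup>2) \<partial>?M)"
      by (rule nn_integral_liminf[OF meas])
    also have "\<dots> \<le> liminf (\<lambda>k::nat. ennreal (e\<^sup>2))"
    proof (rule Liminf_mono, rule eventually_sequentiallyI)
      fix k assume "k \<ge> M"
      then have "r k \<ge> M" by (simp add: r_def)
      then have "L2_norm \<Omega> (x i - x (r k)) < e" using M i by blast
      then have "(L2_norm \<Omega> (x i - x (r k)))\<^sup>2 \<le> e\<^sup>2" by (intro power_mono) auto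
      moreover have "(\<integral>\<^sup>+t. ennreal ((x i t - x (r k) t)\<^sup>2) \<partial>?M) = ennreal ((L2_norm \<Omega> (x i - x (r k)))\<^sup>2)"
        using L2_nn_integral[of "x i - x (r k)" \<Omega>] x by simp
      ultimately show "(\<integral>\<^sup>+t. ennreal ((x i t - x (r k) t)\<^sup>2) \<partial>?M) \<le> ennreal (e\<^sup>2)"
        by (simp add: ennreal_leI)
    qed
    also have "\<dots> = ennreal (e\<^sup>2)" by (rule Liminf_const) simp
    finally have le: "(\<integral>\<^sup>+t. ennreal (((x i - l) t)\<^sup>2) \<partial>?M) \<le> ennreal (e\<^sup>2)" .
    have "(\<lambda>t. x i t - l t) \<in> borel_measurable ?M"
      using x lm L2_measurable[of "x i" \<Omega>] by simp
    then have m: "x i - l \<in> borel_measurable ?M" by (simp only: fun_diff_def)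
    have e0: "e \<ge> 0" using e by simp
    show ?thesis using L2I_nn(1)[OF m le e0] L2I_nn(2)[OF m le e0] by (rule conjI)
  qed
  obtain M0 where M0: "\<forall>i\<ge>M0. \<forall>j\<ge>M0. L2_norm \<Omega> (x i - x j) < 1" using C by (metis zero_less_one)
  then have "x M0 - l \<in> L2 \<Omega>" using est[of 1 M0 M0] by simp
  then have "x M0 - (x M0 - l) \<in> L2 \<Omega>" using x L2n.mem_diff by blast
  then have "l \<in> L2 \<Omega>" by simp
  moreover have "(\<lambda>k. L2_norm \<Omega> (x k - l)) \<longlonglongrightarrow> 0"
  proof (rule LIMSEQ_I)
    fix e :: real assume e: "e > 0"
    then obtain M where "\<And>i j. i \<ge> M \<Longrightarrow> j \<ge> M \<Longrightarrow> L2_norm \<Omega> (x i - x j) < e / 2" using C by (metis half_gt_zero)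
    then have "L2_norm \<Omega> (x i - l) \<le> e / 2" if "i \<ge> M" for i using est[of "e/2" M i] e that by simp
    then show "\<exists>no. \<forall>n\<ge>no. norm (L2_norm \<Omega> (x n - l) - 0) < e"
      using e by (intro exI[of _ M]) force
  qed
  ultimately show "\<exists>l\<in>L2 \<Omega>. (\<lambda>k. L2_norm \<Omega> (x k - l)) \<longlonglongrightarrow> 0" by blast
qed

section \<open>The Hilbert space of square-integrable functions modulo null functions\<close>

text \<open>The abstract part needs a type of class \<^class>\<open>real_inner\<close> and \<^class>\<open>banach\<close>. As \<open>\<Omega>\<close> is not
fixed, the functions on \<open>\<real>\<^sup>n\<close> are used, and \<open>L\<^sup>2(\<Omega>)\<close> is embedded by extending functions by 0.\<close>

quotient_type (overloaded) 'n hilb =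
  "real^'n::finite \<Rightarrow> real" / partial: "\<lambda>u v. u \<in> L2 UNIV \<and> v \<in> L2 UNIV \<and> (AE x in lebesgue_on UNIV. u x = v x)"
proof (rule part_equivpI)
  show "\<exists>x::real^'n \<Rightarrow> real. x \<in> L2 UNIV \<and> x \<in> L2 UNIV \<and> (AE t in lebesgue_on UNIV. x t = x t)"
    by (intro exI[of _ 0]) simp
qed (auto simp: symp_def transp_def)

lemma L2_inner_cong:
  assumes "u \<in> L2 \<Omega>" "v \<in> L2 \<Omega>" "u' \<in> L2 \<Omega>" "v' \<in> L2 \<Omega>"
    "AE x in lebesgue_on \<Omega>. u x = u' x" "AE x in lebesgue_on \<Omega>. v x = v' x"
  shows "L2_inner \<Omega> u v = L2_inner \<Omega> u' v'"
  unfolding L2_inner_def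
proof (rule integral_cong_AE)
  show "(\<lambda>x. u x * v x) \<in> borel_measurable (lebesgue_on \<Omega>)"
    "(\<lambda>x. u' x * v' x) \<in> borel_measurable (lebesgue_on \<Omega>)"
    by (intro borel_measurable_integrable L2_mult_integrable assms)+
  show "AE x in lebesgue_on \<Omega>. u x * v x = u' x * v' x"
    using assms(5,6) by eventually_elim simp
qed

instantiation hilb :: (finite) real_vector
begin

lift_definition zero_hilb :: "'a hilb" is 0 by simp
lift_definition plus_hilb :: "'a hilb \<Rightarrow> 'a hilb \<Rightarrow> 'a hilb" is "(+)"
  by (auto simp: L2_add)
lift_definition minus_hilb :: "'a hilb \<Rightarrow> 'a hilb \<Rightarrow> 'a hilb" is "(-)"
  by auto
lift_definition uminus_hilb :: "'a hilb \<Rightarrow> 'a hilb" is uminus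
  by auto
lift_definition scaleR_hilb :: "real \<Rightarrow> 'a hilb \<Rightarrow> 'a hilb" is "\<lambda>c u. c *\<^sub>R u"
proof -
  fix c and u v :: "real^'a \<Rightarrow> real"
  assume "u \<in> L2 UNIV \<and> v \<in> L2 UNIV \<and> (AE x in lebesgue_on UNIV. u x = v x)"
  then show "c *\<^sub>R u \<in> L2 UNIV \<and> c *\<^sub>R v \<in> L2 UNIV \<and>
      (AE x in lebesgue_on UNIV. (c *\<^sub>R u) x = (c *\<^sub>R v) x)"
    using L2_scaleR by (auto simp: scaleR_fun_def fun_eq_iff)
qed
instance
proof
  fix x y z :: "'a hilb" and a b :: real
  show "x + y + z = x + (y + z)" by transfer (auto simp: add.assoc)
  show "x + y = y + x" by transfer (auto simp: add.commute)
  show "0 + x = x" by transfer auto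
  show "- x + x = 0" by transfer auto
  show "x - y = x + - y" by transfer auto
  show "a *\<^sub>R (x + y) = a *\<^sub>R x + a *\<^sub>R y" by transfer (auto simp: L2_add L2_scaleR scaleR_add_right)
  show "(a + b) *\<^sub>R x = a *\<^sub>R x + b *\<^sub>R x" by transfer (auto simp: L2_add L2_scaleR scaleR_add_left)
  show "a *\<^sub>R b *\<^sub>R x = (a * b) *\<^sub>R x" by transfer (auto simp: L2_scaleR)
  show "1 *\<^sub>R x = x" by transfer auto
qed

end

instantiation hilb :: (finite) real_inner
begin

lift_definition inner_hilb :: "'a hilb \<Rightarrow> 'a hilb \<Rightarrow> real" is "L2_inner UNIV"
  using L2_inner_cong by blast

definition norm_hilb :: "'a hilb \<Rightarrow> real" where "norm_hilb x = sqrt (inner x x)"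
definition dist_hilb :: "'a hilb \<Rightarrow> 'a hilb \<Rightarrow> real" where "dist_hilb x y = norm (x - y)"
definition sgn_hilb :: "'a hilb \<Rightarrow> 'a hilb" where "sgn_hilb x = x /\<^sub>R norm x"
definition uniformity_hilb :: "('a hilb \<times> 'a hilb) filter" where
  "uniformity_hilb = (INF e\<in>{0 <..}. principal {(x, y). dist x y < e})"
definition open_hilb :: "'a hilb set \<Rightarrow> bool" where
  "open_hilb U \<longleftrightarrow> (\<forall>x\<in>U. eventually (\<lambda>(x', y). x' = x \<longrightarrow> y \<in> U) uniformity)"

instance
proof
  fix x y z :: "'a hilb" and a b :: real
  show "dist x y = norm (x - y)" by (simp add: dist_hilb_def)
  show "sgn x = x /\<^sub>R norm x" by (simp add: sgn_hilb_def)
  show "(uniformity :: ('a hilb \<times> 'a hilb) filter) = (INF e\<in>{0 <..}. principal {(x, y). dist x y < e})"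
    by (rule uniformity_hilb_def)
  show "open U \<longleftrightarrow> (\<forall>x\<in>U. eventually (\<lambda>(x', y). x' = x \<longrightarrow> y \<in> U) uniformity)" for U :: "'a hilb set"
    by (rule open_hilb_def)
  show "inner x y = inner y x" by transfer (auto intro: L2.b_sym)
  show "inner (x + y) z = inner x z + inner y z" by transfer (auto intro: L2.b_add)
  show "inner (a *\<^sub>R x) y = a * inner x y" by transfer (auto intro: L2.b_scale)
  show "0 \<le> inner x x" by transfer (auto intro: L2.b_nonneg)
  show "inner x x = 0 \<longleftrightarrow> x = 0"
  proof transfer
    fix u :: "real^'a \<Rightarrow> real"
    assume "u \<in> L2 UNIV \<and> u \<in> L2 UNIV \<and> (AE x in lebesgue_on UNIV. u x = u x)"
    then have u: "u \<in> L2 UNIV" by simp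
    have "L2_inner UNIV u u = 0 \<longleftrightarrow> L2_norm UNIV u = 0" by (simp add: L2_norm_def)
    also have "\<dots> \<longleftrightarrow> (AE x in lebesgue_on UNIV. u x = 0)" by (rule L2_norm_eq_0[OF u])
    finally show "L2_inner UNIV u u = 0 \<longleftrightarrow>
      u \<in> L2 UNIV \<and> 0 \<in> L2 UNIV \<and> (AE x in lebesgue_on UNIV. u x = 0 x)" using u by simp
  qed
  show "norm x = sqrt (inner x x)" by (rule norm_hilb_def)
qed

end

lemma abs_hilb_inner: "u \<in> L2 UNIV \<Longrightarrow> v \<in> L2 UNIV \<Longrightarrow> abs_hilb u \<bullet> abs_hilb v = L2_inner UNIV u v"
  by (simp add: inner_hilb.abs_eq)

lemma rep_hilb_L2: "rep_hilb x \<in> L2 UNIV"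
  using Quotient3_rep_reflp[OF Quotient3_hilb, of x] by simp

lemma abs_rep_hilb: "abs_hilb (rep_hilb x) = x"
  using Quotient3_abs_rep[OF Quotient3_hilb] .

lemma norm_abs_hilb: "u \<in> L2 UNIV \<Longrightarrow> norm (abs_hilb u) = L2_norm UNIV u"
  by (simp add: norm_hilb_def abs_hilb_inner L2_norm_def)

instance hilb :: (finite) banach
proof
  fix X :: "nat \<Rightarrow> 'a hilb"
  assume C: "Cauchy X"
  have diff: "X i - X j = abs_hilb (rep_hilb (X i) - rep_hilb (X j))" for i j
    using minus_hilb.abs_eq[of "rep_hilb (X i)" "rep_hilb (X j)"] by (simp add: rep_hilb_L2 abs_rep_hilb)
  obtain l where l: "l \<in> L2 UNIV" "(\<lambda>k. L2_norm UNIV (rep_hilb (X k) - l)) \<longlonglongrightarrow> 0"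
  proof (rule complete_inD[OF L2_complete, of "\<lambda>k. rep_hilb (X k)" UNIV])
    fix e :: real assume "e > 0"
    then show "\<exists>M. \<forall>i\<ge>M. \<forall>j\<ge>M. L2_norm UNIV (rep_hilb (X i) - rep_hilb (X j)) < e"
      using C unfolding Cauchy_def dist_norm diff by (simp add: norm_abs_hilb rep_hilb_L2)
  qed (auto simp: rep_hilb_L2)
  have "X k - abs_hilb l = abs_hilb (rep_hilb (X k) - l)" for k
    using minus_hilb.abs_eq[of "rep_hilb (X k)" l] l(1) by (simp add: rep_hilb_L2 abs_rep_hilb)
  then have "(\<lambda>k. norm (X k - abs_hilb l)) \<longlonglongrightarrow> 0"
    using l by (simp add: norm_abs_hilb rep_hilb_L2)
  then show "convergent X" by (auto simp: convergent_def LIM_zero_iff tendsto_norm_zero_iff)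
qed

definition emb :: "(real^'n) set \<Rightarrow> (real^'n \<Rightarrow> real) \<Rightarrow> 'n hilb" where
  "emb \<Omega> u = abs_hilb (\<lambda>x. if x \<in> \<Omega> then u x else 0)"

lemma L2_restrict: 
  assumes "\<Omega> \<in> sets lebesgue" "u \<in> L2 UNIV" shows "u \<in> L2 \<Omega>"
proof -
  have "u \<in> borel_measurable (lebesgue_on \<Omega>)"
    using assms(2) by (intro measurable_restrict_space1) (simp add: L2_def lebesgue_on_UNIV_eq)
  moreover have "integrable (lebesgue_on \<Omega>) (\<lambda>x. (u x)\<^sup>2)"
    using integrable_restrict_space[of \<Omega> lebesgue "\<lambda>x. (u x)\<^sup>2"] assms
      integrable_mult_indicator[OF assms(1), of "\<lambda>x. (u x)\<^sup>2"]
    by (simp add: L2_def lebesgue_on_UNIV_eq)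
  ultimately show ?thesis by (simp add: L2_def)
qed

context
  fixes \<Omega> :: "(real^'n) set"
  assumes \<Omega>: "\<Omega> \<in> sets lebesgue"
begin

lemma ext_L2:
  assumes u: "u \<in> L2 \<Omega>" shows "(\<lambda>x. if x \<in> \<Omega> then u x else 0) \<in> L2 UNIV"
proof -
  have "(\<lambda>x. if x \<in> \<Omega> then u x else 0) \<in> borel_measurable lebesgue"
    using u \<Omega> by (simp add: L2_def borel_measurable_if)
  moreover have "integrable lebesgue (\<lambda>x. indicator \<Omega> x *\<^sub>R (u x)\<^sup>2)"
    using u \<Omega> by (simp add: L2_def integrable_restrict_space)
  moreover have "(\<lambda>x. indicator \<Omega> x *\<^sub>R (u x)\<^sup>2) = (\<lambda>x. (if x \<in> \<Omega> then u x else 0)\<^sup>2)"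
    by (auto simp: indicator_def)
  ultimately show ?thesis by (simp add: L2_def lebesgue_on_UNIV_eq)
qed

lemma emb_add: "u \<in> L2 \<Omega> \<Longrightarrow> v \<in> L2 \<Omega> \<Longrightarrow> emb \<Omega> (u + v) = emb \<Omega> u + emb \<Omega> v"
proof -
  assume "u \<in> L2 \<Omega>" "v \<in> L2 \<Omega>"
  moreover have "(\<lambda>x. if x \<in> \<Omega> then (u + v) x else 0) =
      (\<lambda>x. if x \<in> \<Omega> then u x else 0) + (\<lambda>x. if x \<in> \<Omega> then v x else 0)"
    by (auto simp: plus_fun_def)
  ultimately show ?thesis by (simp add: emb_def plus_hilb.abs_eq ext_L2)
qed

lemma emb_scaleR: "u \<in> L2 \<Omega> \<Longrightarrow> emb \<Omega> (c *\<^sub>R u) = c *\<^sub>R emb \<Omega> u"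
proof -
  assume "u \<in> L2 \<Omega>"
  moreover have "(\<lambda>x. if x \<in> \<Omega> then (c *\<^sub>R u) x else 0) = c *\<^sub>R (\<lambda>x. if x \<in> \<Omega> then u x else 0)"
    by (auto simp: scaleR_fun_def)
  ultimately show ?thesis by (simp add: emb_def scaleR_hilb.abs_eq ext_L2)
qed

lemma emb_diff: "u \<in> L2 \<Omega> \<Longrightarrow> v \<in> L2 \<Omega> \<Longrightarrow> emb \<Omega> (u - v) = emb \<Omega> u - emb \<Omega> v"
  using emb_add[of u "(-1) *\<^sub>R v"] emb_scaleR[of v "-1"] by (simp add: L2_scaleR)

lemma emb_inner_rep: "v \<in> L2 \<Omega> \<Longrightarrow> h \<bullet> emb \<Omega> v = L2_inner \<Omega> (rep_hilb h) v"
proof -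
  assume v: "v \<in> L2 \<Omega>"
  have "h \<bullet> emb \<Omega> v = L2_inner UNIV (rep_hilb h) (\<lambda>x. if x \<in> \<Omega> then v x else 0)"
    using abs_hilb_inner[OF rep_hilb_L2 ext_L2[OF v], of h] by (simp add: emb_def abs_rep_hilb)
  also have "\<dots> = (LINT x|lebesgue. indicator \<Omega> x *\<^sub>R (rep_hilb h x * v x))"
    unfolding L2_inner_def lebesgue_on_UNIV_eq by (intro Bochner_Integration.integral_cong) (auto simp: indicator_def)
  also have "\<dots> = L2_inner \<Omega> (rep_hilb h) v"
    using \<Omega> by (simp add: L2_inner_def integral_restrict_space)
  finally show ?thesis .
qed

lemma emb_inner: "u \<in> L2 \<Omega> \<Longrightarrow> v \<in> L2 \<Omega> \<Longrightarrow> emb \<Omega> u \<bullet> emb \<Omega> v = L2_inner \<Omega> u v"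
proof -
  assume u: "u \<in> L2 \<Omega>" and v: "v \<in> L2 \<Omega>"
  have "emb \<Omega> u \<bullet> emb \<Omega> v = L2_inner UNIV (\<lambda>x. if x \<in> \<Omega> then u x else 0) (\<lambda>x. if x \<in> \<Omega> then v x else 0)"
    by (simp add: emb_def abs_hilb_inner ext_L2 u v)
  also have "\<dots> = (LINT x|lebesgue. indicator \<Omega> x *\<^sub>R (u x * v x))"
    unfolding L2_inner_def lebesgue_on_UNIV_eq by (intro Bochner_Integration.integral_cong) (auto simp: indicator_def)
  also have "\<dots> = L2_inner \<Omega> u v"
    using \<Omega> by (simp add: L2_inner_def integral_restrict_space)
  finally show ?thesis .
qed

lemma norm_emb: "u \<in> L2 \<Omega> \<Longrightarrow> norm (emb \<Omega> u) = L2_norm \<Omega> u"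
  by (simp add: norm_eq_sqrt_inner emb_inner L2_norm_def)

lemma rep_L2: "rep_hilb h \<in> L2 \<Omega>"
  by (rule L2_restrict[OF \<Omega> rep_hilb_L2])

end

section \<open>Weak derivatives\<close>

lemma L2_cong_norm:
  assumes "u \<in> L2 \<Omega>" "v \<in> L2 \<Omega>" "AE x in lebesgue_on \<Omega>. u x = v x"
  shows "L2_norm \<Omega> u = L2_norm \<Omega> v"
  using L2_inner_cong[OF assms(1,1,2,2,3,3)] by (simp add: L2_norm_def)

lemma L2_inner_tendsto:
  assumes "\<And>k. x k \<in> L2 \<Omega>" "u \<in> L2 \<Omega>" "v \<in> L2 \<Omega>" "(\<lambda>k. L2_norm \<Omega> (x k - u)) \<longlonglongrightarrow> 0"
  shows "(\<lambda>k. L2_inner \<Omega> (x k) v) \<longlonglongrightarrow> L2_inner \<Omega> u v"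
proof (rule LIM_zero_cancel, rule Lim_null_comparison)
  show "\<forall>\<^sub>F k in sequentially. norm (L2_inner \<Omega> (x k) v - L2_inner \<Omega> u v) \<le> L2_norm \<Omega> (x k - u) * L2_norm \<Omega> v"
  proof (intro always_eventually allI)
    fix k
    show "norm (L2_inner \<Omega> (x k) v - L2_inner \<Omega> u v) \<le> L2_norm \<Omega> (x k - u) * L2_norm \<Omega> v"
      using L2_cauchy_schwarz[of "x k - u" \<Omega> v] assms by (simp add: L2.b_diff)
  qed
  show "(\<lambda>k. L2_norm \<Omega> (x k - u) * L2_norm \<Omega> v) \<longlonglongrightarrow> 0"
    using tendsto_mult_right[OF assms(4), of "L2_norm \<Omega> v"] by simp
qed

lemma axis_Basis: "(axis i 1 :: real^'n) \<in> Basis"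
  by (auto simp: Basis_vec_def)

lemma test_partial_axis:
  fixes \<phi> :: "real^'n \<Rightarrow> real"
  shows "\<phi> \<in> test_functions S \<Longrightarrow> (\<lambda>x. frechet_derivative \<phi> (at x) (axis i 1)) \<in> test_functions S"
  by (intro test_partial axis_Basis)

context
  fixes \<Omega> :: "(real^'n) set"
  assumes op: "open \<Omega>"
begin

lemma meas: "\<Omega> \<in> sets lebesgue" using op by simp

lemma L2_set_integrable:
  assumes f: "f \<in> L2 \<Omega>" and S: "S \<subseteq> \<Omega>" "S \<in> lmeasurable"
  shows "set_integrable lebesgue S f"
proof -
  have "integrable (lebesgue_on \<Omega>) (\<lambda>x. indicator S x :: real)"
  proof -
    have "integrable lebesgue (indicator S :: _ \<Rightarrow> real)"
      using S(2) by (intro integrable_real_indicator) (auto simp: fmeasurable_def)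
    moreover have "(\<lambda>x. indicator \<Omega> x *\<^sub>R indicator S x) = (indicator S :: _ \<Rightarrow> real)"
      using S(1) by (intro ext) (auto simp: indicator_def)
    ultimately show ?thesis using meas by (simp add: integrable_restrict_space)
  qed
  moreover have "indicator S \<in> borel_measurable (lebesgue_on \<Omega>)"
    using S(2) by (intro measurable_restrict_space1 borel_measurable_indicator) (auto simp: fmeasurable_def)
  moreover have "(indicator S x)\<^sup>2 = (indicator S x :: real)" for x :: "real^'n" by (auto simp: indicator_def)
  ultimately have "(indicator S :: _ \<Rightarrow> real) \<in> L2 \<Omega>" by (simp add: L2_def)
  from L2_mult_integrable[OF this f] 
  have "integrable lebesgue (\<lambda>x. indicator \<Omega> x *\<^sub>R (indicator S x * f x))"
    using meas by (simp add: integrable_restrict_space)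
  moreover have "(\<lambda>x. indicator \<Omega> x *\<^sub>R (indicator S x * f x)) = (\<lambda>x. indicator S x *\<^sub>R f x)"
    using S(1) by (intro ext) (auto simp: indicator_def)
  ultimately show ?thesis by (simp add: set_integrable_def)
qed

lemma test_L2:
  assumes "\<phi> \<in> test_functions S" shows "\<phi> \<in> L2 \<Omega>"
proof (rule L2_restrict[OF meas])
  have "\<phi> \<in> borel_measurable lebesgue"
    using test_measurable[OF assms] by (intro measurable_completion) simp
  moreover have "integrable lborel (\<lambda>x. \<phi> x * \<phi> x)"
    by (rule test_integrable[OF test_smooth_mult[OF assms test_C_k[OF assms]]])
  then have "integrable lebesgue (\<lambda>x. \<phi> x * \<phi> x)"
    using integrable_completion[of "\<lambda>x. \<phi> x * \<phi> x" lborel] by (simp add: borel_measurable_integrable)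
  ultimately show "\<phi> \<in> L2 UNIV" by (simp add: L2_def lebesgue_on_UNIV_eq power2_eq_square)
qed

lemma test_integral_on:
  assumes "\<phi> \<in> test_functions \<Omega>"
  shows "(LINT x|lebesgue_on \<Omega>. \<phi> x) = (LINT x|lborel. \<phi> x)"
proof -
  obtain S where S: "S \<subseteq> \<Omega>" "\<And>x. x \<notin> S \<Longrightarrow> \<phi> x = 0" using test_functionsE[OF assms] by metis
  have "(LINT x|lebesgue_on \<Omega>. \<phi> x) = (LINT x|lebesgue. indicator \<Omega> x *\<^sub>R \<phi> x)"
    using meas by (simp add: integral_restrict_space)
  also have "\<dots> = (LINT x|lebesgue. \<phi> x)"
    by (rule Bochner_Integration.integral_cong) (use S in \<open>auto simp: indicator_def\<close>)
  also have "\<dots> = (LINT x|lborel. \<phi> x)"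
    using test_measurable[OF assms] by (intro integral_completion) simp
  finally show ?thesis .
qed

lemma is_weak_partial_iff:
  "is_weak_partial \<Omega> i u g \<longleftrightarrow> g \<in> L2 \<Omega> \<and> (\<forall>\<phi>\<in>test_functions \<Omega>.
     L2_inner \<Omega> u (\<lambda>x. frechet_derivative \<phi> (at x) (axis i 1)) = - L2_inner \<Omega> g \<phi>)"
  by (simp add: is_weak_partial_def L2_inner_def)

lemma is_weak_partial_add:
  assumes "u \<in> L2 \<Omega>" "v \<in> L2 \<Omega>" "is_weak_partial \<Omega> i u g" "is_weak_partial \<Omega> i v h"
  shows "is_weak_partial \<Omega> i (u + v) (g + h)"
  using assms unfolding is_weak_partial_iff
  by (auto simp: L2.b_add test_L2 test_L2[OF test_partial_axis])

lemma is_weak_partial_scaleR: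
  assumes "u \<in> L2 \<Omega>" "is_weak_partial \<Omega> i u g"
  shows "is_weak_partial \<Omega> i (c *\<^sub>R u) (c *\<^sub>R g)"
  using assms unfolding is_weak_partial_iff
  by (auto simp: L2.b_scale test_L2 test_L2[OF test_partial_axis])

lemma test_orthogonal_imp_0:
  assumes g: "g \<in> L2 \<Omega>" and z: "\<And>\<phi>. \<phi> \<in> test_functions \<Omega> \<Longrightarrow> L2_inner \<Omega> g \<phi> = 0"
  shows "AE x in lebesgue_on \<Omega>. g x = 0"
proof (rule fundamental_lemma[OF op])
  show "set_integrable lebesgue (cbox l r) g" if "cbox l r \<subseteq> \<Omega>" for l r
    by (rule L2_set_integrable[OF g that]) simp
  show "(LINT x|lebesgue_on \<Omega>. g x * \<phi> x) = 0" if "\<phi> \<in> test_functions \<Omega>" for \<phi>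
    using z[OF that] by (simp add: L2_inner_def)
qed

lemma is_weak_partial_unique:
  assumes "is_weak_partial \<Omega> i u g" "is_weak_partial \<Omega> i u h"
  shows "AE x in lebesgue_on \<Omega>. g x = h x"
proof -
  have gh: "g \<in> L2 \<Omega>" "h \<in> L2 \<Omega>" using assms by (auto simp: is_weak_partial_iff)
  have "L2_inner \<Omega> (g - h) \<phi> = 0" if \<phi>: "\<phi> \<in> test_functions \<Omega>" for \<phi>
  proof -
    have "L2_inner \<Omega> g \<phi> = L2_inner \<Omega> h \<phi>" using assms \<phi> by (simp add: is_weak_partial_iff)
    then show ?thesis using L2.b_diff[OF gh test_L2[OF \<phi>]] by linarith
  qed
  from test_orthogonal_imp_0[OF L2n.mem_diff[OF gh] this]
  have "AE x in lebesgue_on \<Omega>. (g - h) x = 0" .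
  then show ?thesis by simp
qed

lemma H1_L2: "u \<in> H1 \<Omega> \<Longrightarrow> u \<in> L2 \<Omega>" by (simp add: H1_def)

lemma weak_partial: "u \<in> H1 \<Omega> \<Longrightarrow> is_weak_partial \<Omega> i u (weak_partial \<Omega> i u)"
proof -
  assume "u \<in> H1 \<Omega>"
  then have "\<exists>g. is_weak_partial \<Omega> i u g" by (simp add: H1_def)
  then show ?thesis unfolding weak_partial_def by (rule someI_ex)
qed

lemma weak_partial_L2: "u \<in> H1 \<Omega> \<Longrightarrow> weak_partial \<Omega> i u \<in> L2 \<Omega>"
  using weak_partial is_weak_partial_def by blast

lemma weak_partial_eq:
  assumes "is_weak_partial \<Omega> i u g" "u \<in> H1 \<Omega>"
  shows "AE x in lebesgue_on \<Omega>. weak_partial \<Omega> i u x = g x"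
  by (rule is_weak_partial_unique[OF weak_partial[OF assms(2)] assms(1)])

lemma H1_add: "u \<in> H1 \<Omega> \<Longrightarrow> v \<in> H1 \<Omega> \<Longrightarrow> u + v \<in> H1 \<Omega>"
  unfolding H1_def using is_weak_partial_add by (auto; metis)

lemma H1_scaleR: "u \<in> H1 \<Omega> \<Longrightarrow> c *\<^sub>R u \<in> H1 \<Omega>"
  unfolding H1_def using is_weak_partial_scaleR by (auto simp: L2_scaleR; metis)

lemma subspace_H1: "subspace (H1 \<Omega>)"
  unfolding subspace_def
proof (intro conjI ballI allI)
  have "is_weak_partial \<Omega> i 0 0" for i
    by (simp add: is_weak_partial_def subspace_0[OF subspace_L2])
  then show "0 \<in> H1 \<Omega>" by (auto simp: H1_def)
qed (simp_all add: H1_add H1_scaleR)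

lemma weak_partial_add:
  "u \<in> H1 \<Omega> \<Longrightarrow> v \<in> H1 \<Omega> \<Longrightarrow>
     AE x in lebesgue_on \<Omega>. weak_partial \<Omega> i (u + v) x = (weak_partial \<Omega> i u + weak_partial \<Omega> i v) x"
  by (intro weak_partial_eq is_weak_partial_add weak_partial H1_add H1_L2)

lemma weak_partial_scaleR:
  "u \<in> H1 \<Omega> \<Longrightarrow> AE x in lebesgue_on \<Omega>. weak_partial \<Omega> i (c *\<^sub>R u) x = (c *\<^sub>R weak_partial \<Omega> i u) x"
  by (intro weak_partial_eq is_weak_partial_scaleR weak_partial H1_scaleR H1_L2)

definition H1_inner where
  "H1_inner u v = L2_inner \<Omega> u v + (\<Sum>i\<in>UNIV. L2_inner \<Omega> (weak_partial \<Omega> i u) (weak_partial \<Omega> i v))"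

lemma H1_norm_eq: "H1_norm \<Omega> u = sqrt (H1_inner u u)"
  by (simp add: H1_norm_def H1_inner_def L2_norm_square_inner)

lemma psd_H1: "psd_form (H1 \<Omega>) H1_inner"
proof (rule psd_form.intro)
  show "subspace (H1 \<Omega>)" by (rule subspace_H1)
  fix u v w c assume u: "u \<in> H1 \<Omega>" and v: "v \<in> H1 \<Omega>"
  note D = weak_partial_L2
  show "H1_inner u v = H1_inner v u"
    using u v by (simp add: H1_inner_def L2.b_sym H1_L2 D)
  have "L2_inner \<Omega> (weak_partial \<Omega> i (c *\<^sub>R u)) (weak_partial \<Omega> i v)
      = L2_inner \<Omega> (c *\<^sub>R weak_partial \<Omega> i u) (weak_partial \<Omega> i v)" for i
    by (rule L2_inner_cong) (auto intro!: D u v H1_scaleR weak_partial_scaleR L2_scaleR)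
  then show "H1_inner (c *\<^sub>R u) v = c * H1_inner u v"
    using u v by (simp add: H1_inner_def L2.b_scale H1_L2 D distrib_left sum_distrib_left)
  assume w: "w \<in> H1 \<Omega>"
  have "L2_inner \<Omega> (weak_partial \<Omega> i (u + v)) (weak_partial \<Omega> i w)
      = L2_inner \<Omega> (weak_partial \<Omega> i u + weak_partial \<Omega> i v) (weak_partial \<Omega> i w)" for i
    by (rule L2_inner_cong) (use weak_partial_add[OF u v, of i] in \<open>auto intro!: D u v w H1_add L2_add\<close>)
  then show "H1_inner (u + v) w = H1_inner u w + H1_inner v w"
    using u v w by (simp add: H1_inner_def L2.b_add H1_L2 D sum.distrib)
next
  fix u assume "u \<in> H1 \<Omega>"
  show "0 \<le> H1_inner u u"
    unfolding H1_inner_def L2_norm_square_inner[symmetric] by (intro add_nonneg_nonneg sum_nonneg) auto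
qed

interpretation H1: psd_form "H1 \<Omega>" H1_inner by (rule psd_H1)

lemma seminormed_H1: "seminormed_space (H1 \<Omega>) (H1_norm \<Omega>)"
proof -
  have "H1_norm \<Omega> = (\<lambda>v. sqrt (H1_inner v v))" by (auto simp: H1_norm_eq)
  then show ?thesis using H1.seminormed_space_axioms by metis
qed

interpretation H1n: seminormed_space "H1 \<Omega>" "H1_norm \<Omega>" by (rule seminormed_H1)

lemma L2_le_H1: "L2_norm \<Omega> u \<le> H1_norm \<Omega> u"
  unfolding H1_norm_def by (rule real_le_rsqrt) (simp add: sum_nonneg)

lemma partial_le_H1: "L2_norm \<Omega> (weak_partial \<Omega> i u) \<le> H1_norm \<Omega> u"
proof -
  have "(L2_norm \<Omega> (weak_partial \<Omega> i u))\<^sup>2 \<le> (\<Sum>i\<in>UNIV. (L2_norm \<Omega> (weak_partial \<Omega> i u))\<^sup>2)"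
    by (rule member_le_sum) auto
  also have "\<dots> \<le> (L2_norm \<Omega> u)\<^sup>2 + \<dots>" by simp
  finally show ?thesis unfolding H1_norm_def by (rule real_le_rsqrt)
qed

lemma partial_diff_norm:
  assumes "u \<in> H1 \<Omega>" "v \<in> H1 \<Omega>"
  shows "L2_norm \<Omega> (weak_partial \<Omega> i u - weak_partial \<Omega> i v) \<le> H1_norm \<Omega> (u - v)"
proof -
  have "AE x in lebesgue_on \<Omega>. weak_partial \<Omega> i ((u - v) + v) x = (weak_partial \<Omega> i (u - v) + weak_partial \<Omega> i v) x"
    by (rule weak_partial_add) (use assms in auto)
  then have "AE x in lebesgue_on \<Omega>. (weak_partial \<Omega> i u - weak_partial \<Omega> i v) x = weak_partial \<Omega> i (u - v) x"
    by (auto simp: diff_add_cancel elim: eventually_mono)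
  then have "L2_norm \<Omega> (weak_partial \<Omega> i u - weak_partial \<Omega> i v) = L2_norm \<Omega> (weak_partial \<Omega> i (u - v))"
    by (intro L2_cong_norm) (use assms in \<open>auto intro!: weak_partial_L2 L2n.mem_diff\<close>)
  then show ?thesis using partial_le_H1 by metis
qed

text \<open>A limit in \<open>L\<^sup>2\<close> of weak derivatives is a weak derivative of the limit.\<close>

theorem H1_complete: "complete_in (H1 \<Omega>) (H1_norm \<Omega>)"
  unfolding complete_in_def
proof (intro allI impI)
  fix x :: "nat \<Rightarrow> real^'n \<Rightarrow> real"
  assume x: "\<forall>k. x k \<in> H1 \<Omega>"
    and C: "\<forall>e>0. \<exists>M. \<forall>i\<ge>M. \<forall>j\<ge>M. H1_norm \<Omega> (x i - x j) < e"
  note D = weak_partial_L2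
  obtain u where u: "u \<in> L2 \<Omega>" "(\<lambda>k. L2_norm \<Omega> (x k - u)) \<longlonglongrightarrow> 0"
  proof (rule complete_inD[OF L2_complete, of x \<Omega>])
    show "\<exists>M. \<forall>i\<ge>M. \<forall>j\<ge>M. L2_norm \<Omega> (x i - x j) < e" if "e > 0" for e
      using C that L2_le_H1 by (meson le_less_trans)
  qed (use x H1_L2 in auto)
  have "\<exists>g\<in>L2 \<Omega>. (\<lambda>k. L2_norm \<Omega> (weak_partial \<Omega> i (x k) - g)) \<longlonglongrightarrow> 0" for i
  proof (rule complete_inD[OF L2_complete, of "\<lambda>k. weak_partial \<Omega> i (x k)" \<Omega>])
    show "\<exists>M. \<forall>k\<ge>M. \<forall>j\<ge>M. L2_norm \<Omega> (weak_partial \<Omega> i (x k) - weak_partial \<Omega> i (x j)) < e" if "e > 0" for e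
      using C that partial_diff_norm x by (meson le_less_trans)
  qed (use x D in auto)
  then obtain g where g: "\<And>i. g i \<in> L2 \<Omega>" "\<And>i. (\<lambda>k. L2_norm \<Omega> (weak_partial \<Omega> i (x k) - g i)) \<longlonglongrightarrow> 0"
    by metis
  have wp: "is_weak_partial \<Omega> i u (g i)" for i
    unfolding is_weak_partial_iff
  proof (intro conjI ballI g)
    fix \<phi> assume \<phi>: "\<phi> \<in> test_functions \<Omega>"
    let ?d = "\<lambda>x. frechet_derivative \<phi> (at x) (axis i 1)"
    have "(\<lambda>k. L2_inner \<Omega> (x k) ?d) \<longlonglongrightarrow> L2_inner \<Omega> u ?d"
      using x H1_L2 u test_L2[OF test_partial_axis[OF \<phi>]] by (intro L2_inner_tendsto) auto
    moreover have "(\<lambda>k. - L2_inner \<Omega> (weak_partial \<Omega> i (x k)) \<phi>) \<longlonglongrightarrow> - L2_inner \<Omega> (g i) \<phi>"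
      using x D g test_L2[OF \<phi>] by (intro tendsto_minus L2_inner_tendsto) auto
    moreover have "L2_inner \<Omega> (x k) ?d = - L2_inner \<Omega> (weak_partial \<Omega> i (x k)) \<phi>" for k
      using weak_partial[of "x k" i] x \<phi> by (simp add: is_weak_partial_iff)
    ultimately show "L2_inner \<Omega> u ?d = - L2_inner \<Omega> (g i) \<phi>" using LIMSEQ_unique by simp
  qed
  then have uH: "u \<in> H1 \<Omega>" using u(1) by (auto simp: H1_def)
  have "L2_norm \<Omega> (weak_partial \<Omega> i (x k - u)) = L2_norm \<Omega> (weak_partial \<Omega> i (x k) - g i)" for i k
  proof (rule L2_cong_norm)
    have "is_weak_partial \<Omega> i (x k - u) (weak_partial \<Omega> i (x k) - g i)"
      using is_weak_partial_add[OF _ _ weak_partial is_weak_partial_scaleR[OF u(1) wp, where c = "-1"], of "x k"]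
        x H1_L2 u(1) L2_scaleR[OF u(1), of "-1"] by simp
    then show "AE t in lebesgue_on \<Omega>. weak_partial \<Omega> i (x k - u) t = (weak_partial \<Omega> i (x k) - g i) t"
      using weak_partial_eq x uH H1n.mem_diff by blast
    show "weak_partial \<Omega> i (x k - u) \<in> L2 \<Omega>" using x uH by (intro D) simp
    show "weak_partial \<Omega> i (x k) - g i \<in> L2 \<Omega>" using x g(1) D by simp
  qed
  then have "H1_norm \<Omega> (x k - u) = sqrt ((L2_norm \<Omega> (x k - u))\<^sup>2 + (\<Sum>i\<in>UNIV. (L2_norm \<Omega> (weak_partial \<Omega> i (x k) - g i))\<^sup>2))" for k
    by (simp add: H1_norm_def)
  moreover have "(\<lambda>k. sqrt ((L2_norm \<Omega> (x k - u))\<^sup>2 + (\<Sum>i\<in>UNIV. (L2_norm \<Omega> (weak_partial \<Omega> i (x k) - g i))\<^sup>2)))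
      \<longlonglongrightarrow> sqrt (0\<^sup>2 + (\<Sum>i\<in>(UNIV::'n set). 0\<^sup>2))"
    by (intro tendsto_intros u g)
  ultimately have "(\<lambda>k. H1_norm \<Omega> (x k - u)) \<longlonglongrightarrow> 0" by simp
  then show "\<exists>l\<in>H1 \<Omega>. (\<lambda>k. H1_norm \<Omega> (x k - l)) \<longlonglongrightarrow> 0" using uH by blast
qed

text \<open>Integration by parts for two test functions, from the vanishing integral of a derivative of their product.\<close>

lemma test_weak_partial:
  assumes \<phi>: "\<phi> \<in> test_functions \<Omega>"
  shows "is_weak_partial \<Omega> i \<phi> (\<lambda>x. frechet_derivative \<phi> (at x) (axis i 1))"
  unfolding is_weak_partial_iff
proof (intro conjI ballI)
  let ?e = "axis i (1::real)" and ?D = "\<lambda>\<phi> x. frechet_derivative \<phi> (at x) (axis i 1)"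
  show "?D \<phi> \<in> L2 \<Omega>" by (rule test_L2[OF test_partial_axis[OF \<phi>]])
  fix \<eta> assume \<eta>: "\<eta> \<in> test_functions \<Omega>"
  have prod: "(\<lambda>x. \<phi> x * \<eta> x) \<in> test_functions \<Omega>"
    by (rule test_smooth_mult[OF \<eta> test_C_k[OF \<phi>]])
  have D: "?D (\<lambda>x. \<phi> x * \<eta> x) x = \<phi> x * ?D \<eta> x + ?D \<phi> x * \<eta> x" for x
    using frechet_derivative_at[OF has_derivative_mult[OF test_derivative[OF \<phi>] test_derivative[OF \<eta>]], of x]
    by metis
  have "L2_inner \<Omega> \<phi> (?D \<eta>) + L2_inner \<Omega> (?D \<phi>) \<eta> = (LINT x|lebesgue_on \<Omega>. \<phi> x * ?D \<eta> x + ?D \<phi> x * \<eta> x)"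
    unfolding L2_inner_def
    by (rule Bochner_Integration.integral_add[symmetric])
      (intro L2_mult_integrable test_L2[OF \<phi>] test_L2[OF \<eta>] test_L2[OF test_partial_axis[OF \<phi>]] test_L2[OF test_partial_axis[OF \<eta>]])+
  also have "\<dots> = (LINT x|lebesgue_on \<Omega>. ?D (\<lambda>x. \<phi> x * \<eta> x) x)" by (simp add: D)
  also have "\<dots> = (LINT x|lborel. ?D (\<lambda>x. \<phi> x * \<eta> x) x)" by (rule test_integral_on[OF test_partial_axis[OF prod]])
  also have "\<dots> = 0" by (rule integral_partial_test[OF prod axis_Basis])
  finally show "L2_inner \<Omega> \<phi> (?D \<eta>) = - L2_inner \<Omega> (?D \<phi>) \<eta>" by simp
qed

lemma test_H1: "\<phi> \<in> test_functions \<Omega> \<Longrightarrow> \<phi> \<in> H1 \<Omega>"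
  using test_weak_partial test_L2 by (auto simp: H1_def)

lemma test_H10: "\<phi> \<in> test_functions \<Omega> \<Longrightarrow> \<phi> \<in> H10 \<Omega>"
  unfolding H10_def by (auto intro!: exI[of _ "\<lambda>_. \<phi>"] test_H1)

lemma H10_H1: "u \<in> H10 \<Omega> \<Longrightarrow> u \<in> H1 \<Omega>" by (simp add: H10_def)
lemma subspace_H10: "subspace (H10 \<Omega>)"
  unfolding subspace_def
proof (intro conjI ballI allI)
  show "0 \<in> H10 \<Omega>" using test_H10[OF test_zero] by (simp add: zero_fun_def)
  fix u c assume u: "u \<in> H10 \<Omega>"
  then obtain \<phi> where \<phi>: "\<And>k. \<phi> k \<in> test_functions \<Omega>" "(\<lambda>k. H1_norm \<Omega> (u - \<phi> k)) \<longlonglongrightarrow> 0"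
    by (auto simp: H10_def)
  have "H1_norm \<Omega> (c *\<^sub>R u - c *\<^sub>R \<phi> k) = \<bar>c\<bar> * H1_norm \<Omega> (u - \<phi> k)" for k
    using H1n.N_scale[of "u - \<phi> k" c] u \<phi>(1)[of k] by (simp add: H10_H1 test_H1 scaleR_diff_right)
  moreover have "(\<lambda>k. \<bar>c\<bar> * H1_norm \<Omega> (u - \<phi> k)) \<longlonglongrightarrow> 0"
    using tendsto_mult_left[OF \<phi>(2), of "\<bar>c\<bar>"] by simp
  moreover have "c *\<^sub>R \<phi> k \<in> test_functions \<Omega>" for k
    using test_cmult[OF \<phi>(1), of c k] by (simp add: scaleR_fun_def)
  ultimately show "c *\<^sub>R u \<in> H10 \<Omega>"
    using u by (auto simp: H10_def H1_scaleR intro!: exI[of _ "\<lambda>k. c *\<^sub>R \<phi> k"])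
  fix v assume v: "v \<in> H10 \<Omega>"
  then obtain \<psi> where \<psi>: "\<And>k. \<psi> k \<in> test_functions \<Omega>" "(\<lambda>k. H1_norm \<Omega> (v - \<psi> k)) \<longlonglongrightarrow> 0"
    by (auto simp: H10_def)
  have "(\<lambda>k. H1_norm \<Omega> ((u + v) - (\<phi> k + \<psi> k))) \<longlonglongrightarrow> 0"
  proof (rule Lim_null_comparison)
    show "\<forall>\<^sub>F k in sequentially. norm (H1_norm \<Omega> ((u + v) - (\<phi> k + \<psi> k))) \<le> H1_norm \<Omega> (u - \<phi> k) + H1_norm \<Omega> (v - \<psi> k)"
    proof (intro always_eventually allI)
      fix k
      have "u - \<phi> k \<in> H1 \<Omega>" "v - \<psi> k \<in> H1 \<Omega>" using u v \<phi> \<psi> by (simp_all add: H10_H1 test_H1)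
      from H1n.N_add[OF this] H1n.N_nonneg[OF H1n.mem_add[OF this]]
      show "norm (H1_norm \<Omega> ((u + v) - (\<phi> k + \<psi> k))) \<le> H1_norm \<Omega> (u - \<phi> k) + H1_norm \<Omega> (v - \<psi> k)"
        by (simp add: add_diff_add)
    qed
    show "(\<lambda>k. H1_norm \<Omega> (u - \<phi> k) + H1_norm \<Omega> (v - \<psi> k)) \<longlonglongrightarrow> 0"
      using tendsto_add[OF \<phi>(2) \<psi>(2)] by simp
  qed
  moreover have "\<phi> k + \<psi> k \<in> test_functions \<Omega>" for k
    using test_add[OF \<phi>(1) \<psi>(1), of k k] by (simp add: plus_fun_def)
  ultimately show "u + v \<in> H10 \<Omega>"
    using u v by (auto simp: H10_def H1_add intro!: exI[of _ "\<lambda>k. \<phi> k + \<psi> k"])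
qed

lemma seminormed_H10: "seminormed_space (H10 \<Omega>) (H1_norm \<Omega>)"
  by (rule seminormed_space.intro) (auto simp: subspace_H10 H10_H1 H1n.N_add H1n.N_scale)

interpretation H10: seminormed_space "H10 \<Omega>" "H1_norm \<Omega>" by (rule seminormed_H10)

theorem H10_complete: "complete_in (H10 \<Omega>) (H1_norm \<Omega>)"
  unfolding complete_in_def
proof (intro allI impI)
  fix x :: "nat \<Rightarrow> real^'n \<Rightarrow> real"
  assume x: "\<forall>k. x k \<in> H10 \<Omega>"
    and C: "\<forall>e>0. \<exists>M. \<forall>i\<ge>M. \<forall>j\<ge>M. H1_norm \<Omega> (x i - x j) < e"
  obtain u where u: "u \<in> H1 \<Omega>" "(\<lambda>k. H1_norm \<Omega> (x k - u)) \<longlonglongrightarrow> 0"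
    by (rule complete_inD[OF H1_complete, of x]) (use x C H10_H1 in auto)
  have "\<exists>\<phi>. \<phi> \<in> test_functions \<Omega> \<and> H1_norm \<Omega> (x k - \<phi>) < inverse (real (Suc k))" for k
  proof -
    obtain \<phi> where \<phi>: "\<And>j. \<phi> j \<in> test_functions \<Omega>" "(\<lambda>j. H1_norm \<Omega> (x k - \<phi> j)) \<longlonglongrightarrow> 0"
      using x by (auto simp: H10_def)
    have "\<forall>\<^sub>F j in sequentially. H1_norm \<Omega> (x k - \<phi> j) < inverse (real (Suc k))"
      by (rule order_tendstoD[OF \<phi>(2)]) simp
    then obtain j where "H1_norm \<Omega> (x k - \<phi> j) < inverse (real (Suc k))"
      by (auto simp: eventually_sequentially)
    then show ?thesis using \<phi>(1) by blast
  qed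
  then obtain \<phi> where \<phi>: "\<And>k. \<phi> k \<in> test_functions \<Omega>" "\<And>k. H1_norm \<Omega> (x k - \<phi> k) < inverse (real (Suc k))"
    by metis
  have "(\<lambda>k. H1_norm \<Omega> (u - \<phi> k)) \<longlonglongrightarrow> 0"
  proof (rule Lim_null_comparison)
    show "\<forall>\<^sub>F k in sequentially. norm (H1_norm \<Omega> (u - \<phi> k)) \<le> H1_norm \<Omega> (x k - u) + inverse (real (Suc k))"
    proof (intro always_eventually allI)
      fix k
      have m: "u \<in> H1 \<Omega>" "x k \<in> H1 \<Omega>" "\<phi> k \<in> H1 \<Omega>" using u x \<phi> by (auto simp: H10_H1 test_H1)
      show "norm (H1_norm \<Omega> (u - \<phi> k)) \<le> H1_norm \<Omega> (x k - u) + inverse (real (Suc k))"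
        using H1n.N_triangle[OF m] H1n.N_commute[OF m(1,2)] H1n.N_nonneg[of "u - \<phi> k"] \<phi>(2)[of k] m by simp
    qed
    show "(\<lambda>k. H1_norm \<Omega> (x k - u) + inverse (real (Suc k))) \<longlonglongrightarrow> 0"
      using tendsto_add[OF u(2) LIMSEQ_inverse_real_of_nat] by simp
  qed
  then have "u \<in> H10 \<Omega>" using u(1) \<phi>(1) by (auto simp: H10_def)
  then show "\<exists>l\<in>H10 \<Omega>. (\<lambda>k. H1_norm \<Omega> (x k - l)) \<longlonglongrightarrow> 0" using u(2) by blast
qed

end

section \<open>The elliptic operator and its inverse\<close>

locale elliptic =
  fixes \<Omega> :: "(real^'n) set" and a :: "'n \<Rightarrow> 'n \<Rightarrow> real^'n \<Rightarrow> real"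
  assumes op: "open \<Omega>" and bd: "bounded \<Omega>" and adm: "admissible_coeffs \<Omega> a"
begin

abbreviation "D \<equiv> weak_partial \<Omega>"

lemma meas: "\<Omega> \<in> sets lebesgue" using op by simp

sublocale H10: seminormed_space "H10 \<Omega>" "H1_norm \<Omega>" by (rule seminormed_H10[OF op])

lemma H10_L2': "u \<in> H10 \<Omega> \<Longrightarrow> u \<in> L2 \<Omega>" by (simp add: H10_def H1_def)
lemma D_L2: "u \<in> H10 \<Omega> \<Longrightarrow> D i u \<in> L2 \<Omega>" by (rule weak_partial_L2[OF op]) (simp add: H10_def)

text \<open>Integrate the derivative of \<open>x\<^sub>i \<phi>\<^sup>2\<close>, whose integral vanishes, and use that the coordinate \<open>x\<^sub>i\<close> is
bounded on \<open>\<Omega>\<close>.\<close>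

lemma poincare_test:
  fixes i :: 'n
  assumes \<phi>: "\<phi> \<in> test_functions \<Omega>" and R: "\<And>x. x \<in> \<Omega> \<Longrightarrow> norm x \<le> R" "R \<ge> 0"
  shows "L2_norm \<Omega> \<phi> \<le> 2 * R * L2_norm \<Omega> (\<lambda>x. frechet_derivative \<phi> (at x) (axis i 1))"
proof -
  let ?e = "axis i 1 :: real^'n"
  let ?D = "\<lambda>x. frechet_derivative \<phi> (at x) ?e"
  have prod: "(\<lambda>x. (x \<bullet> ?e) * \<phi> x * \<phi> x) \<in> test_functions \<Omega>"
    by (rule test_smooth_mult[OF \<phi>]) (intro C_k_mult C_k_inner test_C_k[OF \<phi>])
  have \<phi>L: "\<phi> \<in> L2 \<Omega>" and DL: "?D \<in> L2 \<Omega>"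
    using test_L2[OF op \<phi>] test_L2[OF op test_partial_axis[OF \<phi>]] by auto
  have ee: "?e \<bullet> ?e = 1" by (simp add: inner_axis)
  have der: "frechet_derivative (\<lambda>x. (x \<bullet> ?e) * \<phi> x * \<phi> x) (at x) ?e = (\<phi> x)\<^sup>2 + 2 * ((x \<bullet> ?e) * (\<phi> x * ?D x))" for x
  proof -
    have "((\<lambda>x. (x \<bullet> ?e) * \<phi> x * \<phi> x) has_derivative
      (\<lambda>h. (x \<bullet> ?e) * \<phi> x * frechet_derivative \<phi> (at x) h +
         ((x \<bullet> ?e) * frechet_derivative \<phi> (at x) h + (h \<bullet> ?e) * \<phi> x) * \<phi> x)) (at x)"
      by (intro has_derivative_mult test_derivative[OF \<phi>] has_derivative_inner_left has_derivative_ident)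
    from fun_cong[OF frechet_derivative_at[OF this], of ?e]
    have "frechet_derivative (\<lambda>x. (x \<bullet> ?e) * \<phi> x * \<phi> x) (at x) ?e =
      (x \<bullet> ?e) * \<phi> x * ?D x + ((x \<bullet> ?e) * ?D x + (?e \<bullet> ?e) * \<phi> x) * \<phi> x" by (rule sym)
    then show ?thesis unfolding ee by (simp add: power2_eq_square algebra_simps)
  qed
  have "(LINT x|lebesgue_on \<Omega>. (\<phi> x)\<^sup>2 + 2 * ((x \<bullet> ?e) * (\<phi> x * ?D x))) = 0"
    using integral_partial_test[OF prod axis_Basis[of i]] test_integral_on[OF op test_partial_axis[OF prod, of i]]
    by (simp add: der)
  moreover have i2: "integrable (lebesgue_on \<Omega>) (\<lambda>x. (x \<bullet> ?e) * (\<phi> x * ?D x))"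
  proof -
    have "(\<lambda>x. (x \<bullet> ?e) * \<phi> x) \<in> L2 \<Omega>"
      by (rule test_L2[OF op test_smooth_mult[OF \<phi> C_k_inner]])
    from L2_mult_integrable[OF this DL] show ?thesis by (simp add: mult.assoc)
  qed
  ultimately have "(LINT x|lebesgue_on \<Omega>. (\<phi> x)\<^sup>2) + 2 * (LINT x|lebesgue_on \<Omega>. (x \<bullet> ?e) * (\<phi> x * ?D x)) = 0"
    using L2_square_integrable[OF \<phi>L] by simp
  then have "(L2_norm \<Omega> \<phi>)\<^sup>2 \<le> 2 * \<bar>LINT x|lebesgue_on \<Omega>. (x \<bullet> ?e) * (\<phi> x * ?D x)\<bar>"
    unfolding L2_norm_square by linarith
  also have "\<bar>LINT x|lebesgue_on \<Omega>. (x \<bullet> ?e) * (\<phi> x * ?D x)\<bar> \<le> (LINT x|lebesgue_on \<Omega>. R * (\<bar>\<phi> x\<bar> * \<bar>?D x\<bar>))"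
  proof (rule order_trans[OF integral_abs_bound], rule integral_mono)
    show "integrable (lebesgue_on \<Omega>) (\<lambda>x. \<bar>(x \<bullet> ?e) * (\<phi> x * ?D x)\<bar>)" using i2 by simp
    show "integrable (lebesgue_on \<Omega>) (\<lambda>x. R * (\<bar>\<phi> x\<bar> * \<bar>?D x\<bar>))"
      by (intro integrable_mult_right L2_mult_integrable L2_abs \<phi>L DL)
    fix x assume "x \<in> space (lebesgue_on \<Omega>)"
    then have "\<bar>x \<bullet> ?e\<bar> \<le> R"
      using Cauchy_Schwarz_ineq2[of x ?e] R(1)[of x] by (simp add: norm_axis_1)
    then show "\<bar>(x \<bullet> ?e) * (\<phi> x * ?D x)\<bar> \<le> R * (\<bar>\<phi> x\<bar> * \<bar>?D x\<bar>)"
      unfolding abs_mult by (intro mult_right_mono) auto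
  qed
  also have "\<dots> = R * L2_inner \<Omega> (\<lambda>x. \<bar>\<phi> x\<bar>) (\<lambda>x. \<bar>?D x\<bar>)"
    by (simp add: L2_inner_def)
  also have "\<dots> \<le> R * (L2_norm \<Omega> \<phi> * L2_norm \<Omega> ?D)"
    using L2_cauchy_schwarz[OF L2_abs(1)[OF \<phi>L] L2_abs(1)[OF DL]] R(2)
    by (intro mult_left_mono) (simp_all add: L2_abs)
  finally have "L2_norm \<Omega> \<phi> * L2_norm \<Omega> \<phi> \<le> (2 * R * L2_norm \<Omega> ?D) * L2_norm \<Omega> \<phi>"
    by (simp add: power2_eq_square mult_ac)
  then show ?thesis
    using R(2) L2_norm_ge_0[of \<Omega> \<phi>] L2_norm_ge_0[of \<Omega> ?D]
    by (cases "L2_norm \<Omega> \<phi> = 0") (auto simp: mult_le_cancel_right)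
qed

theorem poincare: "\<exists>C\<ge>0. \<forall>u\<in>H10 \<Omega>. \<forall>i. L2_norm \<Omega> u \<le> C * L2_norm \<Omega> (D i u)"
proof -
  obtain R' where R': "\<And>x. x \<in> \<Omega> \<Longrightarrow> norm x \<le> R'" using bd bounded_iff by metis
  define R where "R = max 0 R'"
  have R: "\<And>x. x \<in> \<Omega> \<Longrightarrow> norm x \<le> R" "R \<ge> 0" using R' by (auto simp: R_def max.coboundedI2)
  have "L2_norm \<Omega> u \<le> 2 * R * L2_norm \<Omega> (D i u)" if u: "u \<in> H10 \<Omega>" for u i
  proof -
    obtain \<phi> where \<phi>: "\<And>k. \<phi> k \<in> test_functions \<Omega>" "(\<lambda>k. H1_norm \<Omega> (u - \<phi> k)) \<longlonglongrightarrow> 0"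
      using u by (auto simp: H10_def)
    have "L2_norm \<Omega> u \<le> 2 * R * L2_norm \<Omega> (D i u) + (1 + 2 * R) * H1_norm \<Omega> (u - \<phi> k)" for k
    proof -
      have \<phi>H: "\<phi> k \<in> H10 \<Omega>" "\<phi> k \<in> H1 \<Omega>" using \<phi>(1) test_H10[OF op] test_H1[OF op] by auto
      have uH: "u \<in> H1 \<Omega>" using u by (rule H10_H1[OF op])
      note L = H10_L2'[OF u] H10_L2'[OF \<phi>H(1)] D_L2[OF u, of i] D_L2[OF \<phi>H(1), of i]
      have "L2_norm \<Omega> (\<phi> k) \<le> 2 * R * L2_norm \<Omega> (\<lambda>x. frechet_derivative (\<phi> k) (at x) (axis i 1))"
        by (rule poincare_test[OF \<phi>(1) R])
      also have "L2_norm \<Omega> (\<lambda>x. frechet_derivative (\<phi> k) (at x) (axis i 1)) = L2_norm \<Omega> (D i (\<phi> k))"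
        using weak_partial_eq[OF op test_weak_partial[OF op \<phi>(1)] \<phi>H(2)] L(4) test_L2[OF op test_partial_axis[OF \<phi>(1)]]
        by (intro L2_cong_norm[symmetric])
      also have "L2_norm \<Omega> (D i (\<phi> k)) \<le> L2_norm \<Omega> (D i u) + H1_norm \<Omega> (u - \<phi> k)"
        using L2n.N_add[of "D i (\<phi> k) - D i u" \<Omega> "D i u"] L2n.N_commute[OF L(3,4)] L
          partial_diff_norm[OF op uH \<phi>H(2), of i] by simp
      finally have "L2_norm \<Omega> (\<phi> k) \<le> 2 * R * (L2_norm \<Omega> (D i u) + H1_norm \<Omega> (u - \<phi> k))"
        using R(2) by (simp add: mult_left_mono)
      moreover have "L2_norm \<Omega> u \<le> H1_norm \<Omega> (u - \<phi> k) + L2_norm \<Omega> (\<phi> k)"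
        using L2n.N_add[of "u - \<phi> k" \<Omega> "\<phi> k"] L L2_le_H1[OF op, of "u - \<phi> k"] by simp
      ultimately show ?thesis by (simp add: algebra_simps)
    qed
    moreover have "(\<lambda>k. 2 * R * L2_norm \<Omega> (D i u) + (1 + 2 * R) * H1_norm \<Omega> (u - \<phi> k)) \<longlonglongrightarrow>
        2 * R * L2_norm \<Omega> (D i u) + (1 + 2 * R) * 0"
      by (intro tendsto_intros \<phi>)
    ultimately show ?thesis by (intro LIMSEQ_le_const) auto
  qed
  then show ?thesis using R(2) by (intro exI[of _ "2 * R"]) auto
qed

abbreviation "B \<equiv> B_form \<Omega> a"

lemma coeff_mult_L2:
  assumes u: "u \<in> L2 \<Omega>"
  shows "(\<lambda>x. a i j x * u x) \<in> L2 \<Omega>"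
proof -
  obtain C where C: "AE x in lebesgue_on \<Omega>. \<bar>a i j x\<bar> \<le> C" and m: "a i j \<in> borel_measurable (lebesgue_on \<Omega>)"
    using adm unfolding admissible_coeffs_def by blast
  have "integrable (lebesgue_on \<Omega>) (\<lambda>x. (a i j x * u x)\<^sup>2)"
  proof (rule Bochner_Integration.integrable_bound)
    show "integrable (lebesgue_on \<Omega>) (\<lambda>x. C\<^sup>2 * (u x)\<^sup>2)"
      using L2_square_integrable[OF u] by simp
    show "(\<lambda>x. (a i j x * u x)\<^sup>2) \<in> borel_measurable (lebesgue_on \<Omega>)"
      using m L2_measurable[OF u] by measurable
    show "AE x in lebesgue_on \<Omega>. norm ((a i j x * u x)\<^sup>2) \<le> norm (C\<^sup>2 * (u x)\<^sup>2)"
      using C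
    proof eventually_elim
      case (elim x)
      then have "(a i j x)\<^sup>2 \<le> C\<^sup>2" using power_mono[OF elim, of 2] by simp
      then show ?case by (simp add: power_mult_distrib mult_right_mono)
    qed
  qed
  then show ?thesis using m L2_measurable[OF u] by (simp add: L2_def)
qed

lemma coeff_bound:
  "\<exists>C\<ge>0. \<forall>i j. \<forall>u\<in>L2 \<Omega>. L2_norm \<Omega> (\<lambda>x. a i j x * u x) \<le> C * L2_norm \<Omega> u"
proof -
  obtain C where C: "\<And>i j. AE x in lebesgue_on \<Omega>. \<bar>a i j x\<bar> \<le> C i j"
    using adm unfolding admissible_coeffs_def by metis
  define M where "M = (\<Sum>i\<in>UNIV. \<Sum>j\<in>UNIV. \<bar>C i j\<bar>)"
  have M: "\<bar>C i j\<bar> \<le> M" for i j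
  proof -
    have "\<bar>C i j\<bar> \<le> (\<Sum>j\<in>UNIV. \<bar>C i j\<bar>)" by (rule member_le_sum) auto
    also have "\<dots> \<le> M" unfolding M_def by (rule member_le_sum) (auto intro: sum_nonneg)
    finally show ?thesis .
  qed
  have M0: "M \<ge> 0" unfolding M_def by (intro sum_nonneg) auto
  have "L2_norm \<Omega> (\<lambda>x. a i j x * u x) \<le> M * L2_norm \<Omega> u" if u: "u \<in> L2 \<Omega>" for i j u
  proof -
    have "(L2_norm \<Omega> (\<lambda>x. a i j x * u x))\<^sup>2 \<le> (LINT x|lebesgue_on \<Omega>. M\<^sup>2 * (u x)\<^sup>2)"
      unfolding L2_norm_square
    proof (rule integral_mono_AE)
      show "integrable (lebesgue_on \<Omega>) (\<lambda>x. (a i j x * u x)\<^sup>2)"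
        by (rule L2_square_integrable[OF coeff_mult_L2[OF u]])
      show "integrable (lebesgue_on \<Omega>) (\<lambda>x. M\<^sup>2 * (u x)\<^sup>2)" using L2_square_integrable[OF u] by simp
      show "AE x in lebesgue_on \<Omega>. (a i j x * u x)\<^sup>2 \<le> M\<^sup>2 * (u x)\<^sup>2"
        using C[of i j]
      proof eventually_elim
        case (elim x)
        then have "\<bar>a i j x\<bar> \<le> M" using M[of i j] by simp
        then have "(a i j x)\<^sup>2 \<le> M\<^sup>2" using power_mono[of "\<bar>a i j x\<bar>" M 2] by simp
        then show ?case by (simp add: power_mult_distrib mult_right_mono)
      qed
    qed
    also have "\<dots> = (M * L2_norm \<Omega> u)\<^sup>2" by (simp add: power_mult_distrib L2_norm_square)
    finally have le: "(L2_norm \<Omega> (\<lambda>x. a i j x * u x))\<^sup>2 \<le> (M * L2_norm \<Omega> u)\<^sup>2" .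
    show ?thesis by (rule power2_le_imp_le[OF le]) (simp add: M0)
  qed
  then show ?thesis using M0 by blast
qed

lemma B_eq:
  assumes "u \<in> H10 \<Omega>" "v \<in> H10 \<Omega>"
  shows "B u v = (\<Sum>i\<in>UNIV. \<Sum>j\<in>UNIV. L2_inner \<Omega> (\<lambda>x. a i j x * D i u x) (D j v))"
proof -
  have "integrable (lebesgue_on \<Omega>) (\<lambda>x. a i j x * D i u x * D j v x)" for i j
    by (rule L2_mult_integrable[OF coeff_mult_L2]) (intro D_L2 assms)+
  then show ?thesis unfolding B_form_def L2_inner_def by (simp add: Bochner_Integration.integral_sum)
qed

lemma B_cong_left:
  assumes "u \<in> H10 \<Omega>" "v \<in> H10 \<Omega>" "\<And>i. g i \<in> L2 \<Omega>" "\<And>i. AE x in lebesgue_on \<Omega>. D i u x = g i x"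
  shows "B u v = (\<Sum>i\<in>UNIV. \<Sum>j\<in>UNIV. L2_inner \<Omega> (\<lambda>x. a i j x * g i x) (D j v))"
proof -
  have "L2_inner \<Omega> (\<lambda>x. a i j x * D i u x) (D j v) = L2_inner \<Omega> (\<lambda>x. a i j x * g i x) (D j v)" for i j
  proof (rule L2_inner_cong)
    show "AE x in lebesgue_on \<Omega>. a i j x * D i u x = a i j x * g i x"
      using assms(4)[of i] by eventually_elim simp
  qed (auto intro!: coeff_mult_L2 D_L2 assms)
  then show ?thesis using B_eq[OF assms(1,2)] by simp
qed

text \<open>Ellipticity controls the gradient; Poincare's inequality controls the function by its gradient.\<close>

lemma norm_equivalence:
  "\<exists>c>0. \<forall>u\<in>H10 \<Omega>. c * (H1_norm \<Omega> u)\<^sup>2 \<le> B u u"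
proof -
  obtain l where l: "l > 0" "\<And>x y. x \<in> \<Omega> \<Longrightarrow>
      (\<Sum>i\<in>UNIV. \<Sum>j\<in>UNIV. a i j x * (y::real^'n) $ i * y $ j) \<ge> l * (norm y)\<^sup>2"
    using adm unfolding admissible_coeffs_def by blast
  obtain C where C: "C \<ge> 0" "\<And>u i. u \<in> H10 \<Omega> \<Longrightarrow> L2_norm \<Omega> u \<le> C * L2_norm \<Omega> (D i u)"
    using poincare by blast
  have "l / (C\<^sup>2 + 1) * (H1_norm \<Omega> u)\<^sup>2 \<le> B u u" if u: "u \<in> H10 \<Omega>" for u
  proof -
    have int: "integrable (lebesgue_on \<Omega>) (\<lambda>x. a i j x * D i u x * D j u x)" for i j
      by (rule L2_mult_integrable[OF coeff_mult_L2]) (intro D_L2 u)+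
    let ?S = "\<Sum>i\<in>UNIV. (L2_norm \<Omega> (D i u))\<^sup>2"
    have "l * ?S = (LINT x|lebesgue_on \<Omega>. (\<Sum>i\<in>UNIV. l * (D i u x)\<^sup>2))"
      unfolding L2_norm_square using L2_square_integrable[OF D_L2[OF u]]
      by (simp add: Bochner_Integration.integral_sum sum_distrib_left)
    also have "\<dots> \<le> B u u"
      unfolding B_form_def
    proof (rule integral_mono)
      fix x assume x: "x \<in> space (lebesgue_on \<Omega>)"
      have n: "(norm (\<chi> i. D i u x))\<^sup>2 = (\<Sum>i\<in>UNIV. (D i u x)\<^sup>2)"
        by (simp add: norm_vec_def L2_set_def sum_nonneg)
      show "(\<Sum>i\<in>UNIV. l * (D i u x)\<^sup>2) \<le> (\<Sum>i\<in>UNIV. \<Sum>j\<in>UNIV. a i j x * D i u x * D j u x)"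
        using l(2)[of x "\<chi> i. D i u x"] x by (simp add: n sum_distrib_left)
    qed (auto intro!: Bochner_Integration.integrable_sum int L2_square_integrable D_L2 u)
    finally have lS: "l * ?S \<le> B u u" .
    fix i0 :: 'n
    have "(L2_norm \<Omega> u)\<^sup>2 \<le> (C * L2_norm \<Omega> (D i0 u))\<^sup>2"
      by (intro power_mono C u) simp
    also have "\<dots> = C\<^sup>2 * (L2_norm \<Omega> (D i0 u))\<^sup>2" by (simp add: power_mult_distrib)
    also have "\<dots> \<le> C\<^sup>2 * ?S" by (intro mult_left_mono member_le_sum) auto
    finally have "(H1_norm \<Omega> u)\<^sup>2 \<le> (C\<^sup>2 + 1) * ?S"
      unfolding H1_norm_def by (simp add: sum_nonneg distrib_right)
    then have "l / (C\<^sup>2 + 1) * (H1_norm \<Omega> u)\<^sup>2 \<le> l / (C\<^sup>2 + 1) * ((C\<^sup>2 + 1) * ?S)"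
      using l(1) by (intro mult_left_mono) auto
    also have "\<dots> = l * ?S"
      using add_pos_nonneg[of 1 "C\<^sup>2"] by (simp add: add.commute)
    finally show ?thesis using lS by simp
  qed
  then show ?thesis using l(1) by (intro exI[of _ "l / (C\<^sup>2 + 1)"]) (auto intro!: divide_pos_pos add_nonneg_pos)
qed

lemma B_bound: "\<exists>M\<ge>0. \<forall>u\<in>H10 \<Omega>. \<forall>v\<in>H10 \<Omega>. \<bar>B u v\<bar> \<le> M * H1_norm \<Omega> u * H1_norm \<Omega> v"
proof -
  obtain C where C: "C \<ge> 0" "\<And>i j u. u \<in> L2 \<Omega> \<Longrightarrow> L2_norm \<Omega> (\<lambda>x. a i j x * u x) \<le> C * L2_norm \<Omega> u"
    using coeff_bound by blast
  define M where "M = (\<Sum>i\<in>(UNIV::'n set). \<Sum>j\<in>(UNIV::'n set). C)"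
  have "\<bar>B u v\<bar> \<le> M * H1_norm \<Omega> u * H1_norm \<Omega> v" if u: "u \<in> H10 \<Omega>" and v: "v \<in> H10 \<Omega>" for u v
  proof -
    have "\<bar>L2_inner \<Omega> (\<lambda>x. a i j x * D i u x) (D j v)\<bar> \<le> C * (H1_norm \<Omega> u * H1_norm \<Omega> v)" for i j
    proof -
      have "\<bar>L2_inner \<Omega> (\<lambda>x. a i j x * D i u x) (D j v)\<bar> \<le> L2_norm \<Omega> (\<lambda>x. a i j x * D i u x) * L2_norm \<Omega> (D j v)"
        by (intro L2_cauchy_schwarz coeff_mult_L2 D_L2 u v)
      also have "\<dots> \<le> (C * H1_norm \<Omega> u) * H1_norm \<Omega> v"
        using C(2)[OF D_L2[OF u], of i j i] C(1) partial_le_H1[OF op, of i u] partial_le_H1[OF op, of j v]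
          mult_left_mono[OF partial_le_H1[OF op, of i u] C(1)] H10.N_nonneg[OF u]
        by (intro mult_mono) auto
      finally show ?thesis by (simp add: mult.assoc)
    qed
    then have "\<bar>B u v\<bar> \<le> (\<Sum>i\<in>(UNIV::'n set). \<Sum>j\<in>(UNIV::'n set). C * (H1_norm \<Omega> u * H1_norm \<Omega> v))"
      unfolding B_eq[OF u v] by (intro order_trans[OF sum_abs] sum_mono) auto
    also have "\<dots> = M * H1_norm \<Omega> u * H1_norm \<Omega> v" by (simp add: M_def)
    finally show ?thesis .
  qed
  moreover have "M \<ge> 0" unfolding M_def using C(1) by (intro sum_nonneg) auto
  ultimately show ?thesis by blast
qed

sublocale B: psd_form "H10 \<Omega>" "B_form \<Omega> a"
proof (rule psd_form.intro)
  show "subspace (H10 \<Omega>)" by (rule subspace_H10[OF op])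
  fix u v w c assume u: "u \<in> H10 \<Omega>" and v: "v \<in> H10 \<Omega>"
  have sym: "AE x in lebesgue_on \<Omega>. \<forall>i j. a i j x = a j i x"
    using adm unfolding admissible_coeffs_def by (simp add: AE_all_countable)
  show "B u v = B v u"
    unfolding B_form_def
  proof (rule integral_cong_AE)
    have "integrable (lebesgue_on \<Omega>) (\<lambda>x. a i j x * D i w x * D j w' x)"
      if "w \<in> H10 \<Omega>" "w' \<in> H10 \<Omega>" for i j w w'
      by (rule L2_mult_integrable[OF coeff_mult_L2]) (intro D_L2 that)+
    then show "(\<lambda>x. \<Sum>i\<in>UNIV. \<Sum>j\<in>UNIV. a i j x * D i u x * D j v x) \<in> borel_measurable (lebesgue_on \<Omega>)"
      "(\<lambda>x. \<Sum>i\<in>UNIV. \<Sum>j\<in>UNIV. a i j x * D i v x * D j u x) \<in> borel_measurable (lebesgue_on \<Omega>)"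
      using u v by (auto intro!: borel_measurable_sum borel_measurable_integrable)
    show "AE x in lebesgue_on \<Omega>. (\<Sum>i\<in>UNIV. \<Sum>j\<in>UNIV. a i j x * D i u x * D j v x) =
        (\<Sum>i\<in>UNIV. \<Sum>j\<in>UNIV. a i j x * D i v x * D j u x)"
      using sym
    proof eventually_elim
      case (elim x)
      have "(\<Sum>i\<in>UNIV. \<Sum>j\<in>UNIV. a i j x * D i u x * D j v x) = (\<Sum>j\<in>UNIV. \<Sum>i\<in>UNIV. a i j x * D i u x * D j v x)"
        by (rule sum.swap)
      also have "\<dots> = (\<Sum>j\<in>UNIV. \<Sum>i\<in>UNIV. a j i x * D j v x * D i u x)"
        using elim by (intro sum.cong refl) (simp add: mult_ac)
      finally show ?case .
    qed
  qed
  show "0 \<le> B u u"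
  proof -
    obtain k where "k > 0" "k * (H1_norm \<Omega> u)\<^sup>2 \<le> B u u" using norm_equivalence u by blast
    then show ?thesis using zero_le_power2[of "H1_norm \<Omega> u"] by (meson less_imp_le mult_nonneg_nonneg order_trans)
  qed
  have "B (c *\<^sub>R u) v = (\<Sum>i\<in>UNIV. \<Sum>j\<in>UNIV. L2_inner \<Omega> (\<lambda>x. a i j x * (c *\<^sub>R D i u) x) (D j v))"
    by (rule B_cong_left) (use u v weak_partial_scaleR[OF op H10_H1[OF op u]] in \<open>auto intro!: D_L2 L2_scaleR\<close>)
  also have "\<dots> = (\<Sum>i\<in>UNIV. \<Sum>j\<in>UNIV. c * L2_inner \<Omega> (\<lambda>x. a i j x * D i u x) (D j v))"
  proof (intro sum.cong refl)
    fix i j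
    have "(\<lambda>x. a i j x * (c *\<^sub>R D i u) x) = c *\<^sub>R (\<lambda>x. a i j x * D i u x)" by (auto simp: scaleR_fun_def)
    then show "L2_inner \<Omega> (\<lambda>x. a i j x * (c *\<^sub>R D i u) x) (D j v) = c * L2_inner \<Omega> (\<lambda>x. a i j x * D i u x) (D j v)"
      using u v by (simp add: L2.b_scale coeff_mult_L2 D_L2)
  qed
  finally show "B (c *\<^sub>R u) v = c * B u v" using u v by (simp add: B_eq sum_distrib_left)
  assume w: "w \<in> H10 \<Omega>"
  have "B (u + v) w = (\<Sum>i\<in>UNIV. \<Sum>j\<in>UNIV. L2_inner \<Omega> (\<lambda>x. a i j x * (D i u + D i v) x) (D j w))"
  proof (rule B_cong_left[OF _ w])
    show "u + v \<in> H10 \<Omega>" using u v by simp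
    show "D i u + D i v \<in> L2 \<Omega>" for i by (intro L2_add D_L2 u v)
    show "AE x in lebesgue_on \<Omega>. D i (u + v) x = (D i u + D i v) x" for i
      by (rule weak_partial_add[OF op H10_H1[OF op u] H10_H1[OF op v]])
  qed
  also have "\<dots> = (\<Sum>i\<in>UNIV. \<Sum>j\<in>UNIV. L2_inner \<Omega> (\<lambda>x. a i j x * D i u x) (D j w) + L2_inner \<Omega> (\<lambda>x. a i j x * D i v x) (D j w))"
  proof (intro sum.cong refl)
    fix i j
    have "(\<lambda>x. a i j x * (D i u + D i v) x) = (\<lambda>x. a i j x * D i u x) + (\<lambda>x. a i j x * D i v x)"
      by (auto simp: distrib_left)
    then show "L2_inner \<Omega> (\<lambda>x. a i j x * (D i u + D i v) x) (D j w) =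
        L2_inner \<Omega> (\<lambda>x. a i j x * D i u x) (D j w) + L2_inner \<Omega> (\<lambda>x. a i j x * D i v x) (D j w)"
      using L2.b_add[OF coeff_mult_L2[OF D_L2[OF u]] coeff_mult_L2[OF D_L2[OF v]] D_L2[OF w]] by metis
  qed
  finally show "B (u + v) w = B u w + B v w" using u v w by (simp add: B_eq sum.distrib)
qed

lemma H1_le_B: "\<exists>C>0. \<forall>u\<in>H10 \<Omega>. H1_norm \<Omega> u \<le> C * sqrt (B u u)"
proof -
  obtain c where c: "c > 0" "\<And>u. u \<in> H10 \<Omega> \<Longrightarrow> c * (H1_norm \<Omega> u)\<^sup>2 \<le> B u u" using norm_equivalence by blast
  have "H1_norm \<Omega> u \<le> 1 / sqrt c * sqrt (B u u)" if u: "u \<in> H10 \<Omega>" for u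
  proof -
    have "sqrt (c * (H1_norm \<Omega> u)\<^sup>2) \<le> sqrt (B u u)" by (intro real_sqrt_le_mono c u)
    then show ?thesis using c(1) H10.N_nonneg[OF u] by (simp add: real_sqrt_mult field_simps)
  qed
  then show ?thesis using c(1) by (intro exI[of _ "1 / sqrt c"]) auto
qed

lemma B_complete: "complete_in (H10 \<Omega>) (\<lambda>v. sqrt (B v v))"
  unfolding complete_in_def
proof (intro allI impI)
  fix x :: "nat \<Rightarrow> real^'n \<Rightarrow> real"
  assume x: "\<forall>k. x k \<in> H10 \<Omega>"
    and C: "\<forall>e>0. \<exists>M. \<forall>i\<ge>M. \<forall>j\<ge>M. sqrt (B (x i - x j) (x i - x j)) < e"
  obtain c where c: "c > 0" "\<And>u. u \<in> H10 \<Omega> \<Longrightarrow> H1_norm \<Omega> u \<le> c * sqrt (B u u)" using H1_le_B by blast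
  obtain M where M: "M \<ge> 0" "\<And>u v. u \<in> H10 \<Omega> \<Longrightarrow> v \<in> H10 \<Omega> \<Longrightarrow> \<bar>B u v\<bar> \<le> M * H1_norm \<Omega> u * H1_norm \<Omega> v"
    using B_bound by blast
  obtain l where l: "l \<in> H10 \<Omega>" "(\<lambda>k. H1_norm \<Omega> (x k - l)) \<longlonglongrightarrow> 0"
  proof (rule complete_inD[OF H10_complete[OF op], of x])
    fix e :: real assume "e > 0"
    then have "e / c > 0" using c(1) by simp
    then obtain N where N: "\<forall>i\<ge>N. \<forall>j\<ge>N. sqrt (B (x i - x j) (x i - x j)) < e / c" using C by blast
    have "H1_norm \<Omega> (x i - x j) < e" if "i \<ge> N" "j \<ge> N" for i j
    proof -
      have "c * sqrt (B (x i - x j) (x i - x j)) < c * (e / c)"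
        using N that c(1) by (intro mult_strict_left_mono) auto
      then show ?thesis using c(2)[of "x i - x j"] x c(1) by simp
    qed
    then show "\<exists>M. \<forall>i\<ge>M. \<forall>j\<ge>M. H1_norm \<Omega> (x i - x j) < e" by blast
  qed (use x in auto)
  have "(\<lambda>k. sqrt (B (x k - l) (x k - l))) \<longlonglongrightarrow> 0"
  proof (rule Lim_null_comparison)
    show "\<forall>\<^sub>F k in sequentially. norm (sqrt (B (x k - l) (x k - l))) \<le> sqrt (M * H1_norm \<Omega> (x k - l) * H1_norm \<Omega> (x k - l))"
    proof (intro always_eventually allI)
      fix k
      have m: "x k - l \<in> H10 \<Omega>" using x l by simp
      show "norm (sqrt (B (x k - l) (x k - l))) \<le> sqrt (M * H1_norm \<Omega> (x k - l) * H1_norm \<Omega> (x k - l))"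
        using M(2)[OF m m] B.b_nonneg[OF m] by simp
    qed
    have "(\<lambda>k. sqrt (M * H1_norm \<Omega> (x k - l) * H1_norm \<Omega> (x k - l))) \<longlonglongrightarrow> sqrt (M * 0 * 0)"
      by (intro tendsto_intros l)
    then show "(\<lambda>k. sqrt (M * H1_norm \<Omega> (x k - l) * H1_norm \<Omega> (x k - l))) \<longlonglongrightarrow> 0" by simp
  qed
  then show "\<exists>l\<in>H10 \<Omega>. (\<lambda>k. sqrt (B (x k - l) (x k - l))) \<longlonglongrightarrow> 0" using l(1) by blast
qed

lemma L2_le_B: "\<exists>C>0. \<forall>u\<in>H10 \<Omega>. L2_norm \<Omega> u \<le> C * sqrt (B u u)"
proof -
  obtain C where C: "C > 0" "\<And>u. u \<in> H10 \<Omega> \<Longrightarrow> H1_norm \<Omega> u \<le> C * sqrt (B u u)" using H1_le_B by blast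
  have "L2_norm \<Omega> u \<le> C * sqrt (B u u)" if "u \<in> H10 \<Omega>" for u
    using L2_le_H1[OF op, of u] C(2)[OF that] by linarith
  then show ?thesis using C(1) by blast
qed

lemma solvable: "\<exists>w\<in>H10 \<Omega>. \<forall>v\<in>H10 \<Omega>. B w v = h \<bullet> emb \<Omega> v"
proof -
  obtain C where C: "C > 0" "\<And>u. u \<in> H10 \<Omega> \<Longrightarrow> L2_norm \<Omega> u \<le> C * sqrt (B u u)" using L2_le_B by blast
  show ?thesis
  proof (rule B.riesz_representation[OF B_complete])
    fix u v c assume u: "u \<in> H10 \<Omega>" and v: "v \<in> H10 \<Omega>"
    show "h \<bullet> emb \<Omega> (u + v) = h \<bullet> emb \<Omega> u + h \<bullet> emb \<Omega> v"
      using u v by (simp add: emb_add[OF meas] H10_L2' inner_add_right)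
  next
    fix v c assume v: "v \<in> H10 \<Omega>"
    show "h \<bullet> emb \<Omega> (c *\<^sub>R v) = c * (h \<bullet> emb \<Omega> v)"
      using v by (simp add: emb_scaleR[OF meas] H10_L2')
    have "\<bar>h \<bullet> emb \<Omega> v\<bar> \<le> norm h * L2_norm \<Omega> v"
      using Cauchy_Schwarz_ineq2[of h "emb \<Omega> v"] norm_emb[OF meas H10_L2'[OF v]] by simp
    also have "\<dots> \<le> norm h * (C * sqrt (B v v))" by (intro mult_left_mono C v) simp
    finally show "\<bar>h \<bullet> emb \<Omega> v\<bar> \<le> (norm h * C) * sqrt (B v v)" by simp
  qed
qed

text \<open>The solution operator of \<open>L u = h\<close>; its values are determined up to null sets.\<close>

definition sol :: "'n hilb \<Rightarrow> real^'n \<Rightarrow> real" where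
  "sol h = (SOME w. w \<in> H10 \<Omega> \<and> (\<forall>v\<in>H10 \<Omega>. B w v = h \<bullet> emb \<Omega> v))"

lemma sol_properties: "sol h \<in> H10 \<Omega> \<and> (\<forall>v\<in>H10 \<Omega>. B (sol h) v = h \<bullet> emb \<Omega> v)"
proof -
  have "\<exists>w. w \<in> H10 \<Omega> \<and> (\<forall>v\<in>H10 \<Omega>. B w v = h \<bullet> emb \<Omega> v)" using solvable[of h] by blast
  then show ?thesis unfolding sol_def by (rule someI_ex)
qed

lemma sol_H10: "sol h \<in> H10 \<Omega>"
  using sol_properties by blast

lemma B_sol: "v \<in> H10 \<Omega> \<Longrightarrow> B (sol h) v = h \<bullet> emb \<Omega> v"
  using sol_properties by blast

definition K :: "'n hilb \<Rightarrow> 'n hilb" where "K h = emb \<Omega> (sol h)"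

lemma B_sol_sol: "B (sol h) (sol k) = h \<bullet> K k"
  by (simp add: B_sol sol_H10 K_def)

lemma B_sol_diff: "B (sol h - sol k) (sol h - sol k) = (h - k) \<bullet> (K h - K k)"
  by (simp add: B.b_diff B.b_diff_right sol_H10 B_sol_sol inner_diff_left inner_diff_right)

lemma K_sym: "K h \<bullet> k = h \<bullet> K k"
  using B.b_sym[OF sol_H10[of h] sol_H10[of k]] by (simp add: B_sol_sol inner_commute)

sublocale positive_operator K
proof (rule positive_operator.intro)
  show "K x \<bullet> y = x \<bullet> K y" for x y by (rule K_sym)
  show pos: "0 \<le> x \<bullet> K x" for x using B.b_nonneg[OF sol_H10[of x]] by (simp add: B_sol_sol)
  obtain C where C: "C > 0" "\<And>u. u \<in> H10 \<Omega> \<Longrightarrow> L2_norm \<Omega> u \<le> C * sqrt (B u u)" using L2_le_B by blast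
  show "bounded_linear K"
  proof (rule bounded_linear_intro[where K = "C\<^sup>2"])
    have eq: "x = y" if "\<And>k. x \<bullet> k = y \<bullet> k" for x y :: "'n hilb"
    proof -
      have "\<forall>k. x \<bullet> k = y \<bullet> k" using that by simp
      then show ?thesis by (simp only: vector_eq_rdot)
    qed
    show "K (x + y) = K x + K y" for x y by (rule eq) (simp add: K_sym inner_add_left)
    show "K (c *\<^sub>R x) = c *\<^sub>R K x" for c x by (rule eq) (simp add: K_sym)
    show "norm (K x) \<le> norm x * C\<^sup>2" for x
    proof -
      have "norm (K x) \<le> C * sqrt (x \<bullet> K x)"
        using C(2)[OF sol_H10[of x]] by (simp add: K_def norm_emb[OF meas] H10_L2' sol_H10 B_sol)
      then have "(norm (K x))\<^sup>2 \<le> (C * sqrt (x \<bullet> K x))\<^sup>2" by (intro power_mono) auto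
      also have "\<dots> = C\<^sup>2 * (x \<bullet> K x)" by (simp add: power_mult_distrib pos)
      also have "\<dots> \<le> C\<^sup>2 * (norm x * norm (K x))" by (intro mult_left_mono norm_cauchy_schwarz) simp
      finally have "norm (K x) * norm (K x) \<le> (norm x * C\<^sup>2) * norm (K x)" by (simp add: power2_eq_square mult_ac)
      then show ?thesis by (cases "K x = 0") (auto simp: mult_le_cancel_right)
    qed
  qed
qed

text \<open>If \<open>K q = 0\<close> then \<open>B (sol q) (sol q) = 0\<close>, so \<open>q\<close> is orthogonal to all test functions and
vanishes on \<open>\<Omega>\<close>.\<close>

lemma K_kernel:
  assumes "K q = 0" "h \<in> L2 \<Omega>" shows "q \<bullet> emb \<Omega> h = 0"
proof -
  have z: "B (sol q) (sol q) = 0" using assms(1) by (simp add: B_sol_sol)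
  have "L2_inner \<Omega> (rep_hilb q) \<phi> = 0" if \<phi>: "\<phi> \<in> test_functions \<Omega>" for \<phi>
  proof -
    have \<phi>H: "\<phi> \<in> H10 \<Omega>" by (rule test_H10[OF op \<phi>])
    have "\<bar>B (sol q) \<phi>\<bar> \<le> 0" using B.cauchy_schwarz[OF sol_H10[of q] \<phi>H] z by simp
    then show ?thesis using B_sol[OF \<phi>H, of q] emb_inner_rep[OF meas H10_L2'[OF \<phi>H], of q] by simp
  qed
  then have "AE x in lebesgue_on \<Omega>. rep_hilb q x = 0"
    by (rule test_orthogonal_imp_0[OF op rep_L2[OF meas]])
  then have "AE x in lebesgue_on \<Omega>. rep_hilb q x * h x = 0" by eventually_elim simp
  then show ?thesis
    unfolding emb_inner_rep[OF meas assms(2)] L2_inner_def by (rule integral_eq_zero_AE)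
qed

end

section \<open>Bochner integration in a seminormed space\<close>

text \<open>The limit need not be measurable on the exceptional null set, where it is arbitrary; this is harmless
because the Lebesgue measure is complete.\<close>

lemma borel_measurable_AE_limit:
  fixes u :: "real \<Rightarrow> real"
  assumes I: "I \<in> sets lebesgue" and f: "\<And>k::nat. f k \<in> borel_measurable (lebesgue_on I)"
    and lim: "AE t in lebesgue_on I. (\<lambda>k. f k t) \<longlonglongrightarrow> u t"
  shows "u \<in> borel_measurable (lebesgue_on I)"
proof -
  have "AE t in lebesgue. t \<in> I \<longrightarrow> (\<lambda>k. f k t) \<longlonglongrightarrow> u t"
    using lim I by (simp add: AE_restrict_space_iff)
  then obtain Z where Z: "Z \<in> null_sets lebesgue" "{t. \<not> (t \<in> I \<longrightarrow> (\<lambda>k. f k t) \<longlonglongrightarrow> u t)} \<subseteq> Z"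
    by (auto simp: eventually_ae_filter)
  define g where "g t = lim (\<lambda>k. f k t)" for t
  have g: "g \<in> borel_measurable (lebesgue_on I)"
    unfolding g_def by (rule borel_measurable_lim_metric[OF f])
  have eq: "u t = g t" if "t \<in> I - Z" for t
  proof -
    have "(\<lambda>k. f k t) \<longlonglongrightarrow> u t" using Z(2) that by blast
    then show ?thesis by (simp add: g_def limI)
  qed
  have "g measurable_on I" using g I by (simp add: measurable_on_iff_borel_measurable)
  then have "u measurable_on I"
    by (rule measurable_on_spike[where S = Z]) (use Z eq in \<open>auto simp: negligible_iff_null_sets\<close>)
  then show ?thesis using I by (simp add: measurable_on_iff_borel_measurable)
qed

context seminormed_space
begin

definition bounded_functional :: "('b \<Rightarrow> real) \<Rightarrow> bool" where
  "bounded_functional l \<longleftrightarrow> (\<forall>x\<in>X. \<forall>y\<in>X. l (x + y) = l x + l y) \<and>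
     (\<forall>c. \<forall>x\<in>X. l (c *\<^sub>R x) = c * l x) \<and> (\<exists>C. \<forall>x\<in>X. \<bar>l x\<bar> \<le> C * N x)"

lemma bounded_functional_bound:
  assumes "bounded_functional l" obtains C where "C \<ge> 0" "\<And>x. x \<in> X \<Longrightarrow> \<bar>l x\<bar> \<le> C * N x"
proof -
  obtain C where C: "\<And>x. x \<in> X \<Longrightarrow> \<bar>l x\<bar> \<le> C * N x"
    using assms unfolding bounded_functional_def by blast
  have "\<bar>l x\<bar> \<le> max 0 C * N x" if "x \<in> X" for x
    using C[OF that] mult_right_mono[of C "max 0 C" "N x"] N_nonneg[OF that] by linarith
  then show ?thesis using that[of "max 0 C"] by simp
qed

lemma bounded_functional_zero: "bounded_functional l \<Longrightarrow> l 0 = 0"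
  using mem_zero unfolding bounded_functional_def by (metis mult_zero_left scaleR_zero_left)

lemma bounded_functional_diff:
  assumes "bounded_functional l" "x \<in> X" "y \<in> X" shows "l (x - y) = l x - l y"
proof -
  have add: "\<forall>x\<in>X. \<forall>y\<in>X. l (x + y) = l x + l y" and sc: "\<forall>c. \<forall>x\<in>X. l (c *\<^sub>R x) = c * l x"
    using assms(1) unfolding bounded_functional_def by blast+
  have "l (x + (-1) *\<^sub>R y) = l x + l ((-1) *\<^sub>R y)" using add assms(2,3) mem_scale by blast
  also have "l ((-1) *\<^sub>R y) = (-1) * l y" using sc assms(3) by blast
  finally show ?thesis by simp
qed

lemma bounded_functional_sum:
  assumes l: "bounded_functional l" and A: "finite A" and g: "\<And>i. i \<in> A \<Longrightarrow> g i \<in> X"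
  shows "l (sum g A) = (\<Sum>i\<in>A. l (g i))"
  using A g
proof (induction A rule: finite_induct)
  case (insert i A)
  then show ?case using l mem_sum[of A g] by (auto simp: bounded_functional_def)
qed (simp add: bounded_functional_zero[OF l])

lemma strongly_measurableE:
  assumes "strongly_measurable_on I X N u"
  obtains s where "\<And>k::nat. simple_function (lebesgue_on I) (s k)" "\<And>k t. t \<in> I \<Longrightarrow> s k t \<in> X"
    "AE t in lebesgue_on I. (\<lambda>k. N (s k t - u t)) \<longlonglongrightarrow> 0" "AE t in lebesgue_on I. u t \<in> X"
  using assms unfolding strongly_measurable_on_def image_subset_iff by blast

lemma strongly_measurableI:
  assumes "\<And>k::nat. simple_function (lebesgue_on I) (s k)" "\<And>k t. t \<in> I \<Longrightarrow> s k t \<in> X"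
    "AE t in lebesgue_on I. (\<lambda>k. N (s k t - u t)) \<longlonglongrightarrow> 0" "AE t in lebesgue_on I. u t \<in> X"
  shows "strongly_measurable_on I X N u"
  using assms unfolding strongly_measurable_on_def image_subset_iff by blast

lemma AE_in_I: "I \<in> sets lebesgue \<Longrightarrow> AE t in lebesgue_on I. t \<in> I"
  by (rule AE_I2) simp

lemma strongly_measurable_functional:
  assumes I: "I \<in> sets lebesgue" and u: "strongly_measurable_on I X N u" and l: "bounded_functional l"
  shows "(\<lambda>t. l (u t)) \<in> borel_measurable (lebesgue_on I)"
proof -
  obtain C where C: "C \<ge> 0" "\<And>x. x \<in> X \<Longrightarrow> \<bar>l x\<bar> \<le> C * N x" using bounded_functional_bound[OF l] by blast
  obtain s where s: "\<And>k::nat. simple_function (lebesgue_on I) (s k)" "\<And>k t. t \<in> I \<Longrightarrow> s k t \<in> X"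
    "AE t in lebesgue_on I. (\<lambda>k. N (s k t - u t)) \<longlonglongrightarrow> 0" "AE t in lebesgue_on I. u t \<in> X"
    by (rule strongly_measurableE[OF u]) (rule that; assumption)
  show ?thesis
  proof (rule borel_measurable_AE_limit[OF I, where f = "\<lambda>k t. l (s k t)"])
    show "(\<lambda>t. l (s k t)) \<in> borel_measurable (lebesgue_on I)" for k
      by (rule borel_measurable_simple_function[OF simple_function_compose1[OF s(1)]])
    show "AE t in lebesgue_on I. (\<lambda>k. l (s k t)) \<longlonglongrightarrow> l (u t)"
      using s(3,4) AE_in_I[OF I]
    proof eventually_elim
      case (elim t)
      show ?case
      proof (rule LIM_zero_cancel, rule Lim_null_comparison)
        show "\<forall>\<^sub>F k in sequentially. norm (l (s k t) - l (u t)) \<le> C * N (s k t - u t)"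
        proof (intro always_eventually allI)
          fix k show "norm (l (s k t) - l (u t)) \<le> C * N (s k t - u t)"
            using C(2)[of "s k t - u t"] bounded_functional_diff[OF l s(2)[of t k] elim(2)] elim s(2)[of t k] by simp
        qed
        show "(\<lambda>k. C * N (s k t - u t)) \<longlonglongrightarrow> 0"
          using tendsto_mult_left[OF elim(1), of C] by simp
      qed
    qed
  qed
qed

lemma strongly_measurable_norm:
  assumes I: "I \<in> sets lebesgue" and u: "strongly_measurable_on I X N u"
  shows "(\<lambda>t. N (u t)) \<in> borel_measurable (lebesgue_on I)"
proof -
  obtain s where s: "\<And>k::nat. simple_function (lebesgue_on I) (s k)" "\<And>k t. t \<in> I \<Longrightarrow> s k t \<in> X"
    "AE t in lebesgue_on I. (\<lambda>k. N (s k t - u t)) \<longlonglongrightarrow> 0" "AE t in lebesgue_on I. u t \<in> X"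
    by (rule strongly_measurableE[OF u]) (rule that; assumption)
  show ?thesis
  proof (rule borel_measurable_AE_limit[OF I, where f = "\<lambda>k t. N (s k t)"])
    show "(\<lambda>t. N (s k t)) \<in> borel_measurable (lebesgue_on I)" for k
      by (rule borel_measurable_simple_function[OF simple_function_compose1[OF s(1)]])
    show "AE t in lebesgue_on I. (\<lambda>k. N (s k t)) \<longlonglongrightarrow> N (u t)"
      using s(3,4) AE_in_I[OF I]
    proof eventually_elim
      case (elim t)
      show ?case
      proof (rule LIM_zero_cancel, rule Lim_null_comparison[OF _ elim(1)])
        show "\<forall>\<^sub>F k in sequentially. norm (N (s k t) - N (u t)) \<le> N (s k t - u t)"
          using N_reverse[OF s(2) elim(2)] elim(3) by auto
      qed
    qed
  qed
qed

lemma strongly_measurable_add: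
  assumes I: "I \<in> sets lebesgue"
    and u: "strongly_measurable_on I X N u" and v: "strongly_measurable_on I X N v"
  shows "strongly_measurable_on I X N (\<lambda>t. u t + v t)"
proof -
  obtain s where s: "\<And>k::nat. simple_function (lebesgue_on I) (s k)" "\<And>k t. t \<in> I \<Longrightarrow> s k t \<in> X"
    "AE t in lebesgue_on I. (\<lambda>k. N (s k t - u t)) \<longlonglongrightarrow> 0" "AE t in lebesgue_on I. u t \<in> X"
    by (rule strongly_measurableE[OF u]) (rule that; assumption)
  obtain r where r: "\<And>k::nat. simple_function (lebesgue_on I) (r k)" "\<And>k t. t \<in> I \<Longrightarrow> r k t \<in> X"
    "AE t in lebesgue_on I. (\<lambda>k. N (r k t - v t)) \<longlonglongrightarrow> 0" "AE t in lebesgue_on I. v t \<in> X"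
    by (rule strongly_measurableE[OF v]) (rule that; assumption)
  show ?thesis
  proof (rule strongly_measurableI[of I "\<lambda>k t. s k t + r k t"])
    show "simple_function (lebesgue_on I) (\<lambda>t. s k t + r k t)" for k
      by (rule simple_function_compose2[OF s(1) r(1)])
    show "AE t in lebesgue_on I. (\<lambda>k. N (s k t + r k t - (u t + v t))) \<longlonglongrightarrow> 0"
      using s(3,4) r(3,4) AE_in_I[OF I]
    proof eventually_elim
      case (elim t)
      show ?case
      proof (rule Lim_null_comparison)
        show "\<forall>\<^sub>F k in sequentially. norm (N (s k t + r k t - (u t + v t))) \<le> N (s k t - u t) + N (r k t - v t)"
        proof (intro always_eventually allI)
          fix k
          have m: "s k t - u t \<in> X" "r k t - v t \<in> X" using s(2) r(2) elim by auto
          show "norm (N (s k t + r k t - (u t + v t))) \<le> N (s k t - u t) + N (r k t - v t)"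
            using N_add[OF m] N_nonneg[OF mem_add[OF m]] by (simp add: add_diff_add)
        qed
        show "(\<lambda>k. N (s k t - u t) + N (r k t - v t)) \<longlonglongrightarrow> 0"
          using tendsto_add[OF elim(1) elim(3)] by simp
      qed
    qed
    show "AE t in lebesgue_on I. u t + v t \<in> X"
      using s(4) r(4) by eventually_elim simp
  qed (use s(2) r(2) in auto)
qed

lemma strongly_measurable_scaleR:
  fixes g :: "real \<Rightarrow> real"
  assumes I: "I \<in> sets lebesgue"
    and g: "g \<in> borel_measurable (lebesgue_on I)" and u: "strongly_measurable_on I X N u"
  shows "strongly_measurable_on I X N (\<lambda>t. g t *\<^sub>R u t)"
proof -
  obtain s where s: "\<And>k::nat. simple_function (lebesgue_on I) (s k)" "\<And>k t. t \<in> I \<Longrightarrow> s k t \<in> X"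
    "AE t in lebesgue_on I. (\<lambda>k. N (s k t - u t)) \<longlonglongrightarrow> 0" "AE t in lebesgue_on I. u t \<in> X"
    by (rule strongly_measurableE[OF u]) (rule that; assumption)
  obtain F where F: "\<And>k. simple_function (lebesgue_on I) (F k)"
    "\<And>t. t \<in> space (lebesgue_on I) \<Longrightarrow> (\<lambda>k. F k t) \<longlonglongrightarrow> g t"
    using borel_measurable_implies_sequence_metric[OF g, of 0] by blast
  show ?thesis
  proof (rule strongly_measurableI[of I "\<lambda>k t. F k t *\<^sub>R s k t"])
    show "simple_function (lebesgue_on I) (\<lambda>t. F k t *\<^sub>R s k t)" for k
      by (rule simple_function_compose2[OF F(1) s(1)])
    show "AE t in lebesgue_on I. (\<lambda>k. N (F k t *\<^sub>R s k t - g t *\<^sub>R u t)) \<longlonglongrightarrow> 0"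
      using s(3,4) AE_in_I[OF I]
    proof eventually_elim
      case (elim t)
      have Ft: "(\<lambda>k. F k t) \<longlonglongrightarrow> g t" using F(2) elim(3) I by simp
      show ?case
      proof (rule Lim_null_comparison)
        show "\<forall>\<^sub>F k in sequentially. norm (N (F k t *\<^sub>R s k t - g t *\<^sub>R u t)) \<le>
            \<bar>F k t\<bar> * N (s k t - u t) + \<bar>F k t - g t\<bar> * N (u t)"
        proof (intro always_eventually allI)
          fix k
          have m: "s k t \<in> X" "u t \<in> X" using s(2) elim by auto
          have eq: "F k t *\<^sub>R s k t - g t *\<^sub>R u t = F k t *\<^sub>R (s k t - u t) + (F k t - g t) *\<^sub>R u t"
            by (simp add: scaleR_diff_right scaleR_diff_left)
          have "0 \<le> N (F k t *\<^sub>R s k t - g t *\<^sub>R u t)" using m by (intro N_nonneg) simp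
          moreover have "N (F k t *\<^sub>R s k t - g t *\<^sub>R u t) \<le> \<bar>F k t\<bar> * N (s k t - u t) + \<bar>F k t - g t\<bar> * N (u t)"
            using N_add[of "F k t *\<^sub>R (s k t - u t)" "(F k t - g t) *\<^sub>R u t"] m
            unfolding eq by (simp add: N_scale)
          ultimately show "norm (N (F k t *\<^sub>R s k t - g t *\<^sub>R u t)) \<le>
            \<bar>F k t\<bar> * N (s k t - u t) + \<bar>F k t - g t\<bar> * N (u t)" by simp
        qed
        have "(\<lambda>k. \<bar>F k t\<bar> * N (s k t - u t) + \<bar>F k t - g t\<bar> * N (u t)) \<longlonglongrightarrow> \<bar>g t\<bar> * 0 + \<bar>g t - g t\<bar> * N (u t)"
          by (intro tendsto_intros Ft elim)
        then show "(\<lambda>k. \<bar>F k t\<bar> * N (s k t - u t) + \<bar>F k t - g t\<bar> * N (u t)) \<longlonglongrightarrow> 0" by simp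
      qed
    qed
    show "AE t in lebesgue_on I. g t *\<^sub>R u t \<in> X"
      using s(4) by eventually_elim simp
  qed (use s(2) in auto)
qed

text \<open>The step functions take the value of \<open>u\<close> at the largest multiple of \<open>1 / Suc k\<close> below \<open>t\<close>.\<close>

lemma strongly_measurable_continuous:
  assumes X: "\<And>t. t \<ge> 0 \<Longrightarrow> u t \<in> X"
    and c: "\<And>t. t \<ge> 0 \<Longrightarrow> ((\<lambda>s. N (u s - u t)) \<longlongrightarrow> 0) (at t within {0..})"
  shows "strongly_measurable_on {0<..<T} X N u"
proof -
  define q where "q k t = real_of_int \<lfloor>real (Suc k) * t\<rfloor> / real (Suc k)" for k t
  let ?M = "lebesgue_on {0<..<T}"
  have q0: "q k t \<ge> 0" if "t > 0" for k t
    using that by (simp add: q_def)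
  show ?thesis
  proof (rule strongly_measurableI[of _ "\<lambda>k t. u (q k t)"])
  show "simple_function ?M (\<lambda>t. u (q k t))" for k
  proof (rule simple_function_compose1[of ?M "q k" u])
    show "simple_function ?M (q k)"
      unfolding simple_function_def
    proof (intro conjI ballI)
      have "q k ` space ?M \<subseteq> (\<lambda>i. real_of_int i / real (Suc k)) ` {0..\<lfloor>real (Suc k) * T\<rfloor>}"
      proof
        fix y assume "y \<in> q k ` space ?M"
        then obtain t where t: "0 < t" "t < T" "y = q k t" by auto
        then have "\<lfloor>real (Suc k) * t\<rfloor> \<in> {0..\<lfloor>real (Suc k) * T\<rfloor>}"
          by (auto intro!: floor_mono mult_left_mono simp del: of_nat_Suc)
        then show "y \<in> (\<lambda>i. real_of_int i / real (Suc k)) ` {0..\<lfloor>real (Suc k) * T\<rfloor>}"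
          unfolding t(3) q_def by blast
      qed
      then show "finite (q k ` space ?M)" by (rule finite_subset) simp
      fix y
      have "q k \<in> borel_measurable ?M"
        unfolding q_def by (intro measurable_restrict_space1 measurable_completion) measurable
      then show "q k -` {y} \<inter> space ?M \<in> sets ?M" by (rule measurable_sets) simp
    qed
  qed
  show "u (q k t) \<in> X" if "t \<in> {0<..<T}" for k t using that q0 X by simp
  show "AE t in ?M. u t \<in> X" using X by (intro AE_I2) simp
  show "AE t in ?M. (\<lambda>k. N (u (q k t) - u t)) \<longlonglongrightarrow> 0"
  proof (rule AE_I2)
    fix t assume "t \<in> space ?M"
    then have t: "t > 0" by simp
    have "(\<lambda>k. q k t) \<longlonglongrightarrow> t"
    proof (rule LIM_zero_cancel, rule Lim_null_comparison)
      show "\<forall>\<^sub>F k in sequentially. norm (q k t - t) \<le> inverse (real (Suc k))"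
      proof (intro always_eventually allI)
        fix k
        have "\<bar>q k t - t\<bar> = \<bar>real_of_int \<lfloor>real (Suc k) * t\<rfloor> - real (Suc k) * t\<bar> / real (Suc k)"
          by (simp add: q_def field_simps del: of_nat_Suc flip: abs_mult_pos abs_divide)
        also have "\<dots> \<le> 1 / real (Suc k)" by (intro divide_right_mono) linarith+
        finally show "norm (q k t - t) \<le> inverse (real (Suc k))" by (simp add: inverse_eq_divide)
      qed
    qed (rule LIMSEQ_inverse_real_of_nat)
    moreover have "((\<lambda>s. N (u s - u t)) \<longlongrightarrow> N (u t - u t)) (at t within {0..})" using c[of t] t by simp
    then have "continuous (at t within {0..}) (\<lambda>s. N (u s - u t))" by (simp add: continuous_within)
    ultimately have "(\<lambda>k. N (u (q k t) - u t)) \<longlonglongrightarrow> N (u t - u t)"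
      using q0[OF t] by (auto simp: continuous_within_sequentially o_def)
    then show "(\<lambda>k. N (u (q k t) - u t)) \<longlonglongrightarrow> 0" by simp
  qed
  qed
qed

text \<open>Cutting the approximating simple functions off where they exceed \<open>2 N (u t)\<close> yields a dominated
sequence.\<close>

lemma simple_truncation:
  assumes I: "I \<in> sets lebesgue" and u: "strongly_measurable_on I X N u"
    and int: "integrable (lebesgue_on I) (\<lambda>t. N (u t))"
  obtains s where "\<And>k::nat. Bochner_Integration.simple_bochner_integrable (lebesgue_on I) (s k)"
    "\<And>k t. t \<in> I \<Longrightarrow> s k t \<in> X" "\<And>k. integrable (lebesgue_on I) (\<lambda>t. N (s k t - u t))"
    "(\<lambda>k. LINT t|lebesgue_on I. N (s k t - u t)) \<longlonglongrightarrow> 0"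
proof -
  let ?M = "lebesgue_on I"
  obtain s where s: "\<And>k::nat. simple_function ?M (s k)" "\<And>k t. t \<in> I \<Longrightarrow> s k t \<in> X"
    "AE t in ?M. (\<lambda>k. N (s k t - u t)) \<longlonglongrightarrow> 0" "AE t in ?M. u t \<in> X"
    by (rule strongly_measurableE[OF u]) (rule that; assumption)
  have Nu: "(\<lambda>t. N (u t)) \<in> borel_measurable ?M" using int by (rule borel_measurable_integrable)
  have Ns: "(\<lambda>t. N (s k t)) \<in> borel_measurable ?M" for k
    by (rule borel_measurable_simple_function[OF simple_function_compose1[OF s(1)]])
  \<comment> \<open>values of norm 0 are replaced by the vector 0, so that the support of \<open>r k\<close> has finite measure\<close>
  define r where "r k t = (if 0 < N (s k t) \<and> N (s k t) \<le> 2 * N (u t) then s k t else 0)" for k t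
  have r_simple: "simple_function ?M (r k)" for k
    unfolding r_def
  proof (rule simple_function_If[OF s(1)])
    show "{t \<in> space ?M. 0 < N (s k t) \<and> N (s k t) \<le> 2 * N (u t)} \<in> sets ?M"
      using Nu Ns[of k] by measurable
  qed simp
  have r_X: "r k t \<in> X" if "t \<in> I" for k t using s(2)[OF that] by (simp add: r_def)
  have r_le: "N (r k t) \<le> 2 * N (u t)" if "u t \<in> X" for k t
    using N_nonneg[OF that] by (simp add: r_def)
  have r_sbi: "Bochner_Integration.simple_bochner_integrable ?M (r k)" for k
  proof (rule Bochner_Integration.simple_bochner_integrable.intros[OF r_simple])
    have "Bochner_Integration.simple_bochner_integrable ?M (\<lambda>t. N (r k t))"
    proof (rule Bochner_Integration.simple_bochner_integrableI_bounded)
      show "simple_function ?M (\<lambda>t. N (r k t))" by (rule simple_function_compose1[OF r_simple])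
      have "(\<integral>\<^sup>+t. norm (N (r k t)) \<partial>?M) \<le> (\<integral>\<^sup>+t. norm (2 * N (u t)) \<partial>?M)"
      proof (rule nn_integral_mono_AE)
        show "AE t in ?M. ennreal (norm (N (r k t))) \<le> ennreal (norm (2 * N (u t)))"
          using s(4) AE_in_I[OF I]
        proof eventually_elim
          case (elim t)
          then show ?case using r_le[of t k] N_nonneg[OF r_X[of t k]] by (intro ennreal_leI) simp
        qed
      qed
      also have "\<dots> < \<infinity>" using integrable_mult_right[OF int, of 2] unfolding integrable_iff_bounded by (rule conjunct2)
      finally show "(\<integral>\<^sup>+t. norm (N (r k t)) \<partial>?M) < \<infinity>" .
    qed
    then have "emeasure ?M {t \<in> space ?M. N (r k t) \<noteq> 0} \<noteq> \<infinity>"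
      by (auto elim: Bochner_Integration.simple_bochner_integrable.cases)
    moreover have "{t \<in> space ?M. r k t \<noteq> 0} = {t \<in> space ?M. N (r k t) \<noteq> 0}"
      by (auto simp: r_def split: if_splits)
    ultimately show "emeasure ?M {t \<in> space ?M. r k t \<noteq> 0} \<noteq> \<infinity>" by simp
  qed
  have meas: "(\<lambda>t. N (r k t - u t)) \<in> borel_measurable ?M" for k
  proof -
    have c: "strongly_measurable_on I X N (r k)"
      by (rule strongly_measurableI[of I "\<lambda>_. r k"]) (use r_simple r_X I in auto)
    have "strongly_measurable_on I X N (\<lambda>t. r k t + (-1) *\<^sub>R u t)"
      by (intro strongly_measurable_add[OF I c] strongly_measurable_scaleR[OF I _ u]) simp
    from strongly_measurable_norm[OF I this] show ?thesis by simp
  qed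
  have bound: "AE t in ?M. norm (N (r k t - u t)) \<le> 3 * N (u t)" for k
    using s(4) AE_in_I[OF I]
  proof eventually_elim
    case (elim t)
    then show ?case using N_diff[OF r_X[of t k], of "u t"] r_le[of t k] r_X[of t k] N_nonneg[of "r k t - u t"] by simp
  qed
  have lim: "AE t in ?M. (\<lambda>k. N (r k t - u t)) \<longlonglongrightarrow> 0"
    using s(3,4) AE_in_I[OF I]
  proof eventually_elim
    case (elim t)
    show ?case
    proof (cases "N (u t) = 0")
      case True
      have "N (r k t - u t) = 0" for k
        using N_diff[OF r_X[OF elim(3), of k] elim(2)] r_le[OF elim(2), of k] True
          N_nonneg[of "r k t - u t"] r_X[OF elim(3), of k] elim(2) by simp
      then show ?thesis by simp
    next
      case False
      then have p: "N (u t) > 0" using N_nonneg[OF elim(2)] by simp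
      have "\<forall>\<^sub>F k in sequentially. N (s k t - u t) < N (u t)" by (rule order_tendstoD(2)[OF elim(1) p])
      then have "\<forall>\<^sub>F k in sequentially. N (s k t - u t) = N (r k t - u t)"
      proof eventually_elim
        case (elim k)
        then show ?case
          using N_reverse[OF s(2)[OF \<open>t \<in> I\<close>, of k] \<open>u t \<in> X\<close>] by (auto simp: r_def)
      qed
      then show ?thesis by (rule Lim_transform_eventually[OF elim(1)])
    qed
  qed
  have int3: "integrable ?M (\<lambda>t. 3 * N (u t))" using int by simp
  have m0: "(\<lambda>t. 0 :: real) \<in> borel_measurable ?M" by simp
  have "(\<lambda>k. LINT t|?M. N (r k t - u t)) \<longlonglongrightarrow> (LINT t|?M. 0)"
    by (rule integral_dominated_convergence[OF m0 meas int3 lim bound])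
  moreover have "integrable ?M (\<lambda>t. N (r k t - u t))" for k
    by (rule Bochner_Integration.integrable_bound[OF int3 meas])
      (use bound[of k] in \<open>auto elim!: eventually_mono\<close>)
  ultimately show ?thesis using that[of r] r_sbi r_X by simp
qed

lemma simple_integral_norm:
  assumes I: "I \<in> sets lebesgue" and s: "Bochner_Integration.simple_bochner_integrable (lebesgue_on I) s"
    and X: "\<And>t. t \<in> I \<Longrightarrow> s t \<in> X"
  shows "Bochner_Integration.simple_bochner_integral (lebesgue_on I) s \<in> X"
    and "integrable (lebesgue_on I) (\<lambda>t. N (s t))"
    and "N (Bochner_Integration.simple_bochner_integral (lebesgue_on I) s) \<le> (LINT t|lebesgue_on I. N (s t))"
    and "bounded_functional l \<Longrightarrow> l (Bochner_Integration.simple_bochner_integral (lebesgue_on I) s) = (LINT t|lebesgue_on I. l (s t))"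
    and "bounded_functional l \<Longrightarrow> integrable (lebesgue_on I) (\<lambda>t. l (s t))"
proof -
  let ?M = "lebesgue_on I"
  have sf: "simple_function ?M s" and em: "emeasure ?M {t \<in> space ?M. s t \<noteq> 0} \<noteq> \<infinity>"
    using s by (auto elim: Bochner_Integration.simple_bochner_integrable.cases)
  have fin: "finite (s ` space ?M)" using sf by (simp add: simple_function_def)
  have yX: "y \<in> X" if "y \<in> s ` space ?M" for y using that X by auto
  have comp: "Bochner_Integration.simple_bochner_integrable ?M (\<lambda>t. F (s t))" if "F 0 = (0::real)" for F
  proof (rule Bochner_Integration.simple_bochner_integrable.intros)
    show "simple_function ?M (\<lambda>t. F (s t))" by (rule simple_function_compose1[OF sf])
    have "emeasure ?M {t \<in> space ?M. F (s t) \<noteq> 0} \<le> emeasure ?M {t \<in> space ?M. s t \<noteq> 0}"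
      using that by (intro emeasure_mono simple_functionD(2)[OF sf, of "- {0}", THEN back_subst[of "\<lambda>A. A \<in> sets ?M"]]) auto
    then show "emeasure ?M {t \<in> space ?M. F (s t) \<noteq> 0} \<noteq> \<infinity>" using em by (auto simp: top_unique)
  qed
  have part: "(LINT t|?M. F (s t)) = (\<Sum>y\<in>s ` space ?M. measure ?M {t \<in> space ?M. s t = y} * F y)"
    if "F 0 = (0::real)" for F
    using Bochner_Integration.simple_bochner_integral_partition[OF comp[of F, OF that] sf, of F]
      simple_bochner_integrable_eq_integral[OF comp[of F, OF that]] by simp
  show "Bochner_Integration.simple_bochner_integral ?M s \<in> X"
    unfolding Bochner_Integration.simple_bochner_integral_def by (intro mem_sum mem_scale yX)
  show "integrable ?M (\<lambda>t. N (s t))"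
    by (intro Bochner_Integration.integrableI_simple_bochner_integrable comp) simp
  have "N (Bochner_Integration.simple_bochner_integral ?M s) \<le>
      (\<Sum>y\<in>s ` space ?M. N (measure ?M {t \<in> space ?M. s t = y} *\<^sub>R y))"
    unfolding Bochner_Integration.simple_bochner_integral_def by (intro N_sum fin mem_scale yX)
  also have "\<dots> = (LINT t|?M. N (s t))"
    unfolding part[of N, OF N_zero] by (intro sum.cong refl) (simp add: N_scale yX)
  finally show "N (Bochner_Integration.simple_bochner_integral ?M s) \<le> (LINT t|?M. N (s t))" .
  assume l: "bounded_functional l"
  show "integrable ?M (\<lambda>t. l (s t))"
    by (intro Bochner_Integration.integrableI_simple_bochner_integrable comp bounded_functional_zero[OF l])
  have "l (Bochner_Integration.simple_bochner_integral ?M s) =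
      (\<Sum>y\<in>s ` space ?M. l (measure ?M {t \<in> space ?M. s t = y} *\<^sub>R y))"
    unfolding Bochner_Integration.simple_bochner_integral_def
    by (intro bounded_functional_sum[OF l] fin mem_scale yX)
  also have "\<dots> = (LINT t|?M. l (s t))"
    unfolding part[of l, OF bounded_functional_zero[OF l]]
    using l by (intro sum.cong refl) (simp add: bounded_functional_def yX)
  finally show "l (Bochner_Integration.simple_bochner_integral ?M s) = (LINT t|?M. l (s t))" .
qed

lemma has_integral_in_functional:
  assumes I: "I \<in> sets lebesgue" and h: "has_integral_in I X N h z" and l: "bounded_functional l"
  shows "integrable (lebesgue_on I) (\<lambda>t. l (h t))" "(LINT t|lebesgue_on I. l (h t)) = l z"
proof -
  let ?M = "lebesgue_on I"
  obtain C where C: "C \<ge> 0" "\<And>x. x \<in> X \<Longrightarrow> \<bar>l x\<bar> \<le> C * N x" using bounded_functional_bound[OF l] by blast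
  have z: "z \<in> X" and sm: "strongly_measurable_on I X N h" using h by (auto simp: has_integral_in_def)
  have "\<exists>s. (\<forall>k::nat. Bochner_Integration.simple_bochner_integrable ?M (s k) \<and> s k ` I \<subseteq> X \<and>
              integrable ?M (\<lambda>t. N (s k t - h t))) \<and>
          (\<lambda>k. LINT t|?M. N (s k t - h t)) \<longlonglongrightarrow> 0 \<and>
          (\<lambda>k. N (Bochner_Integration.simple_bochner_integral ?M (s k) - z)) \<longlonglongrightarrow> 0"
    using h unfolding has_integral_in_def by (elim conjE)
  then obtain s where s': "\<forall>k::nat. Bochner_Integration.simple_bochner_integrable ?M (s k) \<and> s k ` I \<subseteq> X \<and>
              integrable ?M (\<lambda>t. N (s k t - h t))"
      and s4: "(\<lambda>k. LINT t|?M. N (s k t - h t)) \<longlonglongrightarrow> 0"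
      and s5: "(\<lambda>k. N (Bochner_Integration.simple_bochner_integral ?M (s k) - z)) \<longlonglongrightarrow> 0"
    by (elim exE conjE)
  have s: "\<And>k. Bochner_Integration.simple_bochner_integrable ?M (s k)" "\<And>k t. t \<in> I \<Longrightarrow> s k t \<in> X"
      "\<And>k. integrable ?M (\<lambda>t. N (s k t - h t))"
    using s' by (auto simp: image_subset_iff)
  have hX: "AE t in ?M. h t \<in> X" using sm by (simp add: strongly_measurable_on_def)
  have lm: "(\<lambda>t. l (h t)) \<in> borel_measurable ?M" by (rule strongly_measurable_functional[OF I sm l])
  have ls: "integrable ?M (\<lambda>t. l (s k t))" for k by (rule simple_integral_norm(5)[OF I s(1,2) l])
  have diff: "AE t in ?M. \<bar>l (s k t) - l (h t)\<bar> \<le> C * N (s k t - h t)" for k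
    using hX AE_in_I[OF I]
  proof eventually_elim
    case (elim t)
    then show ?case using C(2)[of "s k t - h t"] bounded_functional_diff[OF l s(2)[of t k], of "h t"] s(2)[of t k] by simp
  qed
  have ld: "integrable ?M (\<lambda>t. l (s k t) - l (h t))" for k
  proof (rule Bochner_Integration.integrable_bound)
    show "integrable ?M (\<lambda>t. C * N (s k t - h t))" using s(3) by simp
    show "(\<lambda>t. l (s k t) - l (h t)) \<in> borel_measurable ?M"
      using lm borel_measurable_integrable[OF ls[of k]] by simp
    show "AE t in ?M. norm (l (s k t) - l (h t)) \<le> norm (C * N (s k t - h t))"
      using diff[of k] by eventually_elim simp
  qed
  show li: "integrable ?M (\<lambda>t. l (h t))"
    using Bochner_Integration.integrable_diff[OF ls[of 0] ld[of 0]] by simp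
  have "(\<lambda>k. LINT t|?M. l (s k t)) \<longlonglongrightarrow> (LINT t|?M. l (h t))"
  proof (rule LIM_zero_cancel, rule Lim_null_comparison)
    show "\<forall>\<^sub>F k in sequentially. norm ((LINT t|?M. l (s k t)) - (LINT t|?M. l (h t))) \<le> C * (LINT t|?M. N (s k t - h t))"
    proof (intro always_eventually allI)
      fix k
      have "\<bar>(LINT t|?M. l (s k t)) - (LINT t|?M. l (h t))\<bar> = \<bar>LINT t|?M. l (s k t) - l (h t)\<bar>"
        using ls[of k] li by simp
      also have "\<dots> \<le> (LINT t|?M. \<bar>l (s k t) - l (h t)\<bar>)" by (rule integral_abs_bound)
      also have "\<dots> \<le> (LINT t|?M. C * N (s k t - h t))"
        using ld[of k] s(3)[of k] diff[of k] by (intro integral_mono_AE) auto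
      finally show "norm ((LINT t|?M. l (s k t)) - (LINT t|?M. l (h t))) \<le> C * (LINT t|?M. N (s k t - h t))" by simp
    qed
    show "(\<lambda>k. C * (LINT t|?M. N (s k t - h t))) \<longlonglongrightarrow> 0" using tendsto_mult_left[OF s4, of C] by simp
  qed
  moreover have "(\<lambda>k. LINT t|?M. l (s k t)) \<longlonglongrightarrow> l z"
  proof (rule LIM_zero_cancel, rule Lim_null_comparison)
    show "\<forall>\<^sub>F k in sequentially. norm ((LINT t|?M. l (s k t)) - l z) \<le>
        C * N (Bochner_Integration.simple_bochner_integral ?M (s k) - z)"
    proof (intro always_eventually allI)
      fix k
      have S1: "Bochner_Integration.simple_bochner_integral ?M (s k) \<in> X"
        by (rule simple_integral_norm(1)[OF I s(1,2)])
      have S4: "l (Bochner_Integration.simple_bochner_integral ?M (s k)) = (LINT t|?M. l (s k t))"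
        by (rule simple_integral_norm(4)[OF I]) (simp_all add: s l)
      show "norm ((LINT t|?M. l (s k t)) - l z) \<le> C * N (Bochner_Integration.simple_bochner_integral ?M (s k) - z)"
        using C(2)[OF mem_diff[OF S1 z]] bounded_functional_diff[OF l S1 z] S4 by simp
    qed
    show "(\<lambda>k. C * N (Bochner_Integration.simple_bochner_integral ?M (s k) - z)) \<longlonglongrightarrow> 0"
      using tendsto_mult_left[OF s5, of C] by simp
  qed
  ultimately show "(LINT t|?M. l (h t)) = l z" using LIMSEQ_unique by blast
qed

text \<open>The integrals of the approximating simple functions form a Cauchy sequence.\<close>

theorem has_integral_in_exists:
  assumes I: "I \<in> sets lebesgue" and comp: "complete_in X N" and u: "strongly_measurable_on I X N u"
    and int: "integrable (lebesgue_on I) (\<lambda>t. N (u t))"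
  shows "\<exists>z. has_integral_in I X N u z"
proof -
  let ?M = "lebesgue_on I"
  obtain s where s: "\<And>k::nat. Bochner_Integration.simple_bochner_integrable ?M (s k)"
    "\<And>k t. t \<in> I \<Longrightarrow> s k t \<in> X" "\<And>k. integrable ?M (\<lambda>t. N (s k t - u t))"
    "(\<lambda>k. LINT t|?M. N (s k t - u t)) \<longlonglongrightarrow> 0"
    by (rule simple_truncation[OF I u int]) (rule that; assumption)
  have uX: "AE t in ?M. u t \<in> X" using u by (simp add: strongly_measurable_on_def)
  define z where "z k = Bochner_Integration.simple_bochner_integral ?M (s k)" for k
  have zX: "z k \<in> X" for k unfolding z_def by (rule simple_integral_norm(1)[OF I s(1,2)])
  have zd: "N (z i - z j) \<le> (LINT t|?M. N (s i t - u t)) + (LINT t|?M. N (s j t - u t))" for i j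
  proof -
    have sd: "Bochner_Integration.simple_bochner_integrable ?M (\<lambda>t. s i t - s j t)"
      by (rule Bochner_Integration.simple_bochner_integrable_compose2[OF _ s(1) s(1)]) simp
    have sX: "s i t - s j t \<in> X" if "t \<in> I" for t using s(2)[OF that] by simp
    have "z i - z j = Bochner_Integration.simple_bochner_integral ?M (\<lambda>t. s i t - s j t)"
      unfolding z_def by (rule Bochner_Integration.simple_bochner_integral_diff[OF s(1) s(1), symmetric])
    then have "N (z i - z j) \<le> (LINT t|?M. N (s i t - s j t))"
      using simple_integral_norm(3)[OF I sd sX] by simp
    also have "\<dots> \<le> (LINT t|?M. N (s i t - u t) + N (s j t - u t))"
    proof (rule integral_mono_AE)
      show "integrable ?M (\<lambda>t. N (s i t - s j t))" by (rule simple_integral_norm(2)[OF I sd sX])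
      show "integrable ?M (\<lambda>t. N (s i t - u t) + N (s j t - u t))"
        by (intro Bochner_Integration.integrable_add s)
      show "AE t in ?M. N (s i t - s j t) \<le> N (s i t - u t) + N (s j t - u t)"
        using uX AE_in_I[OF I]
      proof eventually_elim
        case (elim t)
        then show ?case
          using N_triangle[OF s(2)[of t i] elim(1) s(2)[of t j]] N_commute[OF elim(1) s(2)[of t j]] by simp
      qed
    qed
    also have "\<dots> = (LINT t|?M. N (s i t - u t)) + (LINT t|?M. N (s j t - u t))"
      by (rule Bochner_Integration.integral_add[OF s(3) s(3)])
    finally show ?thesis .
  qed
  obtain l where l: "l \<in> X" "(\<lambda>k. N (z k - l)) \<longlonglongrightarrow> 0"
  proof (rule complete_inD[OF comp, of z])
    fix e :: real assume "e > 0"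
    then have "\<forall>\<^sub>F k in sequentially. (LINT t|?M. N (s k t - u t)) < e / 2"
      by (intro order_tendstoD(2)[OF s(4)]) simp
    then obtain M where M: "\<And>k. k \<ge> M \<Longrightarrow> (LINT t|?M. N (s k t - u t)) < e / 2"
      by (auto simp: eventually_sequentially)
    have "N (z i - z j) < e" if "i \<ge> M" "j \<ge> M" for i j
      using zd[of i j] M[OF that(1)] M[OF that(2)] by linarith
    then show "\<exists>M. \<forall>i\<ge>M. \<forall>j\<ge>M. N (z i - z j) < e" by blast
  qed (use zX in auto)
  have "has_integral_in I X N u l"
    unfolding has_integral_in_def image_subset_iff
    by (intro conjI exI[of _ s] l u allI s l(2)[unfolded z_def] ballI)
  then show ?thesis by blast
qed

lemma strongly_measurable_image:
  assumes u: "strongly_measurable_on I X N u"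
    and L: "\<And>x. x \<in> X \<Longrightarrow> L x \<in> Y" and N': "\<And>x y. x \<in> X \<Longrightarrow> y \<in> X \<Longrightarrow> 0 \<le> N' (L x - L y) \<and> N' (L x - L y) \<le> C * N (x - y)"
    and I: "I \<in> sets lebesgue"
  shows "strongly_measurable_on I Y N' (\<lambda>t. L (u t))"
proof -
  obtain s where s: "\<And>k::nat. simple_function (lebesgue_on I) (s k)" "\<And>k t. t \<in> I \<Longrightarrow> s k t \<in> X"
    "AE t in lebesgue_on I. (\<lambda>k. N (s k t - u t)) \<longlonglongrightarrow> 0" "AE t in lebesgue_on I. u t \<in> X"
    by (rule strongly_measurableE[OF u]) (rule that; assumption)
  have a1: "simple_function (lebesgue_on I) (\<lambda>t. L (s k t))" for k
    by (rule simple_function_compose1[OF s(1)])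
  have a2: "AE t in lebesgue_on I. (\<lambda>k. N' (L (s k t) - L (u t))) \<longlonglongrightarrow> 0"
    using s(3,4) AE_in_I[OF I]
  proof eventually_elim
    case (elim t)
    show ?case
    proof (rule Lim_null_comparison)
      show "\<forall>\<^sub>F k in sequentially. norm (N' (L (s k t) - L (u t))) \<le> C * N (s k t - u t)"
        using N'[OF s(2)[OF elim(3)] elim(2)] by simp
      show "(\<lambda>k. C * N (s k t - u t)) \<longlonglongrightarrow> 0" using tendsto_mult_left[OF elim(1), of C] by simp
    qed
  qed
  have a3: "AE t in lebesgue_on I. L (u t) \<in> Y" using s(4) by eventually_elim (rule L)
  show ?thesis
    unfolding strongly_measurable_on_def image_subset_iff
    by (intro conjI a3 exI[of _ "\<lambda>k t. L (s k t)"] allI a1 a2 ballI L s(2))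
qed

lemma has_integral_in_cong:
  assumes h: "has_integral_in I X N h z" and z': "z' \<in> X" "N (z - z') = 0" and I: "I \<in> sets lebesgue"
  shows "has_integral_in I X N h z'"
proof -
  let ?M = "lebesgue_on I"
  have z: "z \<in> X" and sm: "strongly_measurable_on I X N h" using h by (auto simp: has_integral_in_def)
  have "\<exists>s. (\<forall>k::nat. Bochner_Integration.simple_bochner_integrable ?M (s k) \<and> s k ` I \<subseteq> X \<and>
              integrable ?M (\<lambda>t. N (s k t - h t))) \<and>
          (\<lambda>k. LINT t|?M. N (s k t - h t)) \<longlonglongrightarrow> 0 \<and>
          (\<lambda>k. N (Bochner_Integration.simple_bochner_integral ?M (s k) - z)) \<longlonglongrightarrow> 0"
    using h unfolding has_integral_in_def by (elim conjE)
  then obtain s where s1: "\<forall>k::nat. Bochner_Integration.simple_bochner_integrable ?M (s k) \<and> s k ` I \<subseteq> X \<and>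
              integrable ?M (\<lambda>t. N (s k t - h t))"
      and s4: "(\<lambda>k. LINT t|?M. N (s k t - h t)) \<longlonglongrightarrow> 0"
      and s5: "(\<lambda>k. N (Bochner_Integration.simple_bochner_integral ?M (s k) - z)) \<longlonglongrightarrow> 0"
    by (elim exE conjE)
  have "(\<lambda>k. N (Bochner_Integration.simple_bochner_integral ?M (s k) - z')) \<longlonglongrightarrow> 0"
  proof (rule Lim_null_comparison[OF _ s5], intro always_eventually allI)
    fix k
    have S: "Bochner_Integration.simple_bochner_integral ?M (s k) \<in> X"
      by (rule simple_integral_norm(1)[OF I]) (use s1 in \<open>auto simp: image_subset_iff\<close>)
    show "norm (N (Bochner_Integration.simple_bochner_integral ?M (s k) - z')) \<le> N (Bochner_Integration.simple_bochner_integral ?M (s k) - z)"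
      using N_triangle[OF S z z'(1)] z'(2) N_nonneg[OF mem_diff[OF S z'(1)]] by simp
  qed
  then show ?thesis
    unfolding has_integral_in_def by (intro conjI z' sm exI[of _ s] s1 s4)
qed

lemma scaled_by_test:
  assumes I: "I \<in> sets lebesgue" and u: "strongly_measurable_on I X N u"
    and int: "integrable (lebesgue_on I) (\<lambda>t. N (u t))" and \<phi>: "\<phi> \<in> test_functions S"
  shows "strongly_measurable_on I X N (\<lambda>t. \<phi> t *\<^sub>R u t)"
    and "integrable (lebesgue_on I) (\<lambda>t. N (\<phi> t *\<^sub>R u t))"
proof -
  have \<phi>m: "\<phi> \<in> borel_measurable (lebesgue_on I)"
    using test_measurable[OF \<phi>] by (intro measurable_restrict_space1 measurable_completion) simp
  show sm: "strongly_measurable_on I X N (\<lambda>t. \<phi> t *\<^sub>R u t)"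
    by (rule strongly_measurable_scaleR[OF I \<phi>m u])
  obtain M where M: "M \<ge> 0" "\<And>x. \<bar>\<phi> x\<bar> \<le> M" using test_bounded[OF \<phi>] by blast
  have uX: "AE t in lebesgue_on I. u t \<in> X" using u by (simp add: strongly_measurable_on_def)
  show "integrable (lebesgue_on I) (\<lambda>t. N (\<phi> t *\<^sub>R u t))"
  proof (rule Bochner_Integration.integrable_bound)
    show "integrable (lebesgue_on I) (\<lambda>t. M * N (u t))" using int by simp
    show "(\<lambda>t. N (\<phi> t *\<^sub>R u t)) \<in> borel_measurable (lebesgue_on I)" by (rule strongly_measurable_norm[OF I sm])
    show "AE t in lebesgue_on I. norm (N (\<phi> t *\<^sub>R u t)) \<le> norm (M * N (u t))"
      using uX
    proof eventually_elim
      case (elim t)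
      then show ?case using mult_right_mono[OF M(2)[of t] N_nonneg[OF elim]] N_nonneg[OF elim] M(1)
        by (simp add: N_scale abs_mult)
    qed
  qed
qed

end

lemma test_deriv:
  assumes "\<phi> \<in> test_functions (S :: real set)" shows "deriv \<phi> \<in> test_functions S"
proof -
  have "deriv \<phi> = (\<lambda>x. frechet_derivative \<phi> (at x) 1)"
  proof
    fix x
    have lin: "linear (frechet_derivative \<phi> (at x))"
      using test_derivative[OF assms] has_derivative_linear by blast
    have "frechet_derivative \<phi> (at x) h = frechet_derivative \<phi> (at x) 1 * h" for h
      using linear_cmul[OF lin, of h 1] by simp
    then have "frechet_derivative \<phi> (at x) = (*) (frechet_derivative \<phi> (at x) 1)" by (rule ext)
    then have "(\<phi> has_real_derivative frechet_derivative \<phi> (at x) 1) (at x)"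
      unfolding has_field_derivative_def using test_derivative[OF assms, of x] by metis
    then show "deriv \<phi> x = frechet_derivative \<phi> (at x) 1" by (rule DERIV_imp_deriv)
  qed
  then show ?thesis using test_partial[OF assms, of 1] by simp
qed

lemma test_has_real_derivative:
  assumes "\<phi> \<in> test_functions (S :: real set)" shows "(\<phi> has_real_derivative deriv \<phi> x) (at x)"
proof -
  have "\<phi> differentiable (at x)" using test_derivative[OF assms] by (auto simp: differentiable_def)
  then show ?thesis by (simp add: DERIV_deriv_iff_real_differentiable)
qed

context seminormed_space
begin

text \<open>Both Bochner integrals exist by completeness, and their equality can be tested with a separating family
of functionals. This reduces weak derivatives to scalar integration by parts.\<close>

theorem weak_time_derivI:
  assumes I: "I \<in> sets lebesgue" and comp: "complete_in X N"
    and u: "strongly_measurable_on I X N u" "integrable (lebesgue_on I) (\<lambda>t. N (u t))"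
    and v: "strongly_measurable_on I X N v" "integrable (lebesgue_on I) (\<lambda>t. N (v t))"
    and bf: "\<And>l. l \<in> \<Lambda> \<Longrightarrow> bounded_functional l"
    and sep: "\<And>z. z \<in> X \<Longrightarrow> (\<And>l. l \<in> \<Lambda> \<Longrightarrow> l z = 0) \<Longrightarrow> N z = 0"
    and parts: "\<And>l \<phi>. l \<in> \<Lambda> \<Longrightarrow> \<phi> \<in> test_functions I \<Longrightarrow>
      (LINT t|lebesgue_on I. deriv \<phi> t * l (u t)) = - (LINT t|lebesgue_on I. \<phi> t * l (v t))"
  shows "weak_time_deriv I X N u v"
  unfolding weak_time_deriv_def
proof
  fix \<phi> assume \<phi>: "\<phi> \<in> test_functions I"
  obtain z where z: "has_integral_in I X N (\<lambda>t. deriv \<phi> t *\<^sub>R u t) z"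
    using has_integral_in_exists[OF I comp scaled_by_test[OF I u test_deriv[OF \<phi>]]] by blast
  obtain y where y: "has_integral_in I X N (\<lambda>t. \<phi> t *\<^sub>R v t) y"
    using has_integral_in_exists[OF I comp scaled_by_test[OF I v \<phi>]] by blast
  have zX: "z \<in> X" and yX: "y \<in> X" using z y by (auto simp: has_integral_in_def)
  have "N (z + y) = 0"
  proof (rule sep)
    show "z + y \<in> X" using zX yX by simp
    fix l assume l: "l \<in> \<Lambda>"
    note bl = bf[OF l]
    have hom: "AE t in lebesgue_on I. l (w t *\<^sub>R x t) = w t * l (x t)"
      if "strongly_measurable_on I X N x" for w x
    proof -
      have "AE t in lebesgue_on I. x t \<in> X" using that by (simp add: strongly_measurable_on_def)
      then show ?thesis by eventually_elim (use bl in \<open>simp add: bounded_functional_def\<close>)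
    qed
    have ae: "(LINT t|lebesgue_on I. l (w t *\<^sub>R x t)) = (LINT t|lebesgue_on I. w t * l (x t))"
      if "strongly_measurable_on I X N x" "w \<in> test_functions I" for w x
    proof (rule integral_cong_AE)
      have wm: "w \<in> borel_measurable (lebesgue_on I)"
        using test_measurable[OF that(2)] by (intro measurable_restrict_space1 measurable_completion) simp
      show "(\<lambda>t. l (w t *\<^sub>R x t)) \<in> borel_measurable (lebesgue_on I)"
        by (rule strongly_measurable_functional[OF I strongly_measurable_scaleR[OF I wm that(1)] bl])
      show "(\<lambda>t. w t * l (x t)) \<in> borel_measurable (lebesgue_on I)"
        by (rule borel_measurable_times[OF wm strongly_measurable_functional[OF I that(1) bl]])
    qed (rule hom[OF that(1)])
    have "l z = - l y"
      using has_integral_in_functional(2)[OF I z bl] has_integral_in_functional(2)[OF I y bl]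
        ae[OF u(1) test_deriv[OF \<phi>]] ae[OF v(1) \<phi>] parts[OF l \<phi>] by simp
    moreover have "l (z + y) = l z + l y" using bl zX yX by (simp add: bounded_functional_def)
    ultimately show "l (z + y) = 0" by simp
  qed
  then have "N (y - - z) = 0" by (simp add: add.commute)
  from has_integral_in_cong[OF y _ this I] zX
  have "has_integral_in I X N (\<lambda>t. \<phi> t *\<^sub>R v t) (- z)" by simp
  then show "\<exists>z. has_integral_in I X N (\<lambda>t. deriv \<phi> t *\<^sub>R u t) z \<and>
      has_integral_in I X N (\<lambda>t. \<phi> t *\<^sub>R v t) (- z)" using z by blast
qed

theorem weak_time_derivD:
  assumes I: "I \<in> sets lebesgue" and w: "weak_time_deriv I X N u v"
    and X: "AE t in lebesgue_on I. u t \<in> X" "AE t in lebesgue_on I. v t \<in> X"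
    and l: "bounded_functional l" and \<phi>: "\<phi> \<in> test_functions I"
  shows "(LINT t|lebesgue_on I. deriv \<phi> t * l (u t)) = - (LINT t|lebesgue_on I. \<phi> t * l (v t))"
    and "integrable (lebesgue_on I) (\<lambda>t. \<phi> t * l (v t))"
    and "integrable (lebesgue_on I) (\<lambda>t. deriv \<phi> t * l (u t))"
proof -
  obtain z where z: "has_integral_in I X N (\<lambda>t. deriv \<phi> t *\<^sub>R u t) z"
    "has_integral_in I X N (\<lambda>t. \<phi> t *\<^sub>R v t) (- z)"
    using w \<phi> unfolding weak_time_deriv_def by blast
  have zX: "z \<in> X" using z(1) by (simp add: has_integral_in_def)
  have hom: "AE t in lebesgue_on I. l (w t *\<^sub>R x t) = w t * l (x t)"
    if "AE t in lebesgue_on I. x t \<in> X" for w x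
    using that by eventually_elim (use l in \<open>simp add: bounded_functional_def\<close>)
  note A = has_integral_in_functional[OF I z(1) l] and B = has_integral_in_functional[OF I z(2) l]
  have lm: "l (- z) = - l z"
    using bounded_functional_diff[OF l mem_zero zX] bounded_functional_zero[OF l] by simp
  have hi: "has_bochner_integral (lebesgue_on I) (\<lambda>t. w t * l (x t)) y"
    if "integrable (lebesgue_on I) (\<lambda>t. l (w t *\<^sub>R x t))" "(LINT t|lebesgue_on I. l (w t *\<^sub>R x t)) = y"
      "AE t in lebesgue_on I. x t \<in> X" for w x y
  proof -
    have "AE t in lebesgue_on I. t \<in> I" by (rule AE_in_I[OF I])
    have m: "(\<lambda>t. w t * l (x t)) \<in> borel_measurable (lebesgue_on I)"
      by (rule borel_measurable_AE_limit[OF I borel_measurable_integrable[OF that(1)]])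
        (use hom[OF that(3), of w] in \<open>auto elim!: eventually_mono\<close>)
    show ?thesis
      using has_bochner_integral_cong_AE[OF borel_measurable_integrable[OF that(1)] m hom[OF that(3)], of y]
        has_bochner_integral_integrable[OF that(1)] that(2) by simp
  qed
  note hA = hi[OF A X(1)] and hB = hi[OF B X(2)]
  show "(LINT t|lebesgue_on I. deriv \<phi> t * l (u t)) = - (LINT t|lebesgue_on I. \<phi> t * l (v t))"
    using has_bochner_integral_integral_eq[OF hA] has_bochner_integral_integral_eq[OF hB] lm by simp
  show "integrable (lebesgue_on I) (\<lambda>t. \<phi> t * l (v t))" using hB by (rule integrable.intros)
  show "integrable (lebesgue_on I) (\<lambda>t. deriv \<phi> t * l (u t))" using hA by (rule integrable.intros)
qed

end

section \<open>The dual space\<close>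

lemma scaleR_apply: "(c *\<^sub>R F) v = c *\<^sub>R F v" for F :: "'a \<Rightarrow> 'b::real_vector"
  by (simp add: scaleR_fun_def)

context elliptic
begin

lemma Hm1_E: 
  assumes "F \<in> Hm1 \<Omega>" obtains C where "C \<ge> 0" "\<And>v. v \<in> H10 \<Omega> \<Longrightarrow> \<bar>F v\<bar> \<le> C * H1_norm \<Omega> v"
proof -
  obtain C where C: "\<And>v. v \<in> H10 \<Omega> \<Longrightarrow> \<bar>F v\<bar> \<le> C * H1_norm \<Omega> v"
    using assms unfolding Hm1_def by blast
  have "\<bar>F v\<bar> \<le> max 0 C * H1_norm \<Omega> v" if "v \<in> H10 \<Omega>" for v
    using C[OF that] mult_right_mono[of C "max 0 C" "H1_norm \<Omega> v"] H10.N_nonneg[OF that] by linarith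
  then show ?thesis using that[of "max 0 C"] by simp
qed

lemma Hm1_ball_ne: "{v \<in> H10 \<Omega>. H1_norm \<Omega> v \<le> 1} \<noteq> {}"
  using H10.mem_zero H10.N_zero by (metis (mono_tags, lifting) empty_Collect_eq zero_le_one)

lemma Hm1_norm_le:
  assumes "C \<ge> 0" "\<And>v. v \<in> H10 \<Omega> \<Longrightarrow> \<bar>F v\<bar> \<le> C * H1_norm \<Omega> v"
  shows "Hm1_norm \<Omega> F \<le> C"
  unfolding Hm1_norm_def
proof (rule cSUP_least[OF Hm1_ball_ne])
  fix v assume "v \<in> {v \<in> H10 \<Omega>. H1_norm \<Omega> v \<le> 1}"
  then have "\<bar>F v\<bar> \<le> C * H1_norm \<Omega> v" "C * H1_norm \<Omega> v \<le> C * 1" using assms mult_left_mono[of "H1_norm \<Omega> v" 1 C] by auto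
  then show "\<bar>F v\<bar> \<le> C" by simp
qed

lemma Hm1_bdd: assumes "F \<in> Hm1 \<Omega>" shows "bdd_above ((\<lambda>v. \<bar>F v\<bar>) ` {v \<in> H10 \<Omega>. H1_norm \<Omega> v \<le> 1})"
proof -
  obtain C where C: "C \<ge> 0" "\<And>v. v \<in> H10 \<Omega> \<Longrightarrow> \<bar>F v\<bar> \<le> C * H1_norm \<Omega> v" using Hm1_E[OF assms] by blast
  show ?thesis
  proof (rule bdd_aboveI2)
    fix v assume "v \<in> {v \<in> H10 \<Omega>. H1_norm \<Omega> v \<le> 1}"
    then have "\<bar>F v\<bar> \<le> C * H1_norm \<Omega> v" "C * H1_norm \<Omega> v \<le> C * 1" using C mult_left_mono[of "H1_norm \<Omega> v" 1 C] by auto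
    then show "\<bar>F v\<bar> \<le> C" by simp
  qed
qed

lemma Hm1_nonneg: assumes "F \<in> Hm1 \<Omega>" shows "0 \<le> Hm1_norm \<Omega> F"
proof -
  have "\<bar>F 0\<bar> \<le> Hm1_norm \<Omega> F"
    unfolding Hm1_norm_def by (rule cSUP_upper[OF _ Hm1_bdd[OF assms]]) simp
  then show ?thesis by linarith
qed

lemma Hm1_bound:
  assumes F: "F \<in> Hm1 \<Omega>" and v: "v \<in> H10 \<Omega>"
  shows "\<bar>F v\<bar> \<le> Hm1_norm \<Omega> F * H1_norm \<Omega> v"
proof (cases "H1_norm \<Omega> v = 0")
  case True
  obtain C where C: "C \<ge> 0" "\<And>v. v \<in> H10 \<Omega> \<Longrightarrow> \<bar>F v\<bar> \<le> C * H1_norm \<Omega> v" using Hm1_E[OF F] by blast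
  show ?thesis using C(2)[OF v] True by simp
next
  case False
  then have p: "H1_norm \<Omega> v > 0" using H10.N_nonneg[OF v] by simp
  let ?w = "(1 / H1_norm \<Omega> v) *\<^sub>R v"
  have w: "?w \<in> H10 \<Omega>" "H1_norm \<Omega> ?w = 1" using v p by (auto simp: H10.N_scale)
  have "\<bar>F ?w\<bar> \<le> Hm1_norm \<Omega> F"
    unfolding Hm1_norm_def by (rule cSUP_upper[OF _ Hm1_bdd[OF F]]) (use w in simp)
  moreover have "F ?w = (1 / H1_norm \<Omega> v) * F v" using F v unfolding Hm1_def by blast
  ultimately show ?thesis using p by (simp add: abs_mult field_simps)
qed

lemma Hm1I:
  assumes "\<And>u v. u \<in> H10 \<Omega> \<Longrightarrow> v \<in> H10 \<Omega> \<Longrightarrow> F (u + v) = F u + F v"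
    "\<And>c v. v \<in> H10 \<Omega> \<Longrightarrow> F (c *\<^sub>R v) = c * F v" "\<And>v. v \<in> H10 \<Omega> \<Longrightarrow> \<bar>F v\<bar> \<le> C * H1_norm \<Omega> v"
  shows "F \<in> Hm1 \<Omega>"
  using assms unfolding Hm1_def by blast

lemma Hm1_add_apply: "F \<in> Hm1 \<Omega> \<Longrightarrow> u \<in> H10 \<Omega> \<Longrightarrow> v \<in> H10 \<Omega> \<Longrightarrow> F (u + v) = F u + F v"
  and Hm1_scale_apply: "F \<in> Hm1 \<Omega> \<Longrightarrow> v \<in> H10 \<Omega> \<Longrightarrow> F (c *\<^sub>R v) = c * F v"
  unfolding Hm1_def by blast+

sublocale Hm1: seminormed_space "Hm1 \<Omega>" "Hm1_norm \<Omega>"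
proof (rule seminormed_space.intro)
  have sc: "c *\<^sub>R F \<in> Hm1 \<Omega>" if F: "F \<in> Hm1 \<Omega>" for c F
  proof (rule Hm1I[where C = "\<bar>c\<bar> * Hm1_norm \<Omega> F"])
    show "\<bar>(c *\<^sub>R F) v\<bar> \<le> \<bar>c\<bar> * Hm1_norm \<Omega> F * H1_norm \<Omega> v" if "v \<in> H10 \<Omega>" for v
      using mult_left_mono[OF Hm1_bound[OF F that], of "\<bar>c\<bar>"] by (simp add: scaleR_apply abs_mult mult.assoc)
  qed (use F in \<open>simp_all add: scaleR_apply Hm1_add_apply Hm1_scale_apply distrib_left\<close>)
  have ad: "F + G \<in> Hm1 \<Omega>" if F: "F \<in> Hm1 \<Omega>" and G: "G \<in> Hm1 \<Omega>" for F G
  proof (rule Hm1I[where C = "Hm1_norm \<Omega> F + Hm1_norm \<Omega> G"])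
    show "\<bar>(F + G) v\<bar> \<le> (Hm1_norm \<Omega> F + Hm1_norm \<Omega> G) * H1_norm \<Omega> v" if "v \<in> H10 \<Omega>" for v
      using Hm1_bound[OF F that] Hm1_bound[OF G that] by (simp add: distrib_right)
  qed (use F G in \<open>simp_all add: Hm1_add_apply Hm1_scale_apply distrib_left\<close>)
  have "0 \<in> Hm1 \<Omega>" by (rule Hm1I[where C = 0]) auto
  then show "subspace (Hm1 \<Omega>)" unfolding subspace_def using sc ad by blast
  fix F assume F: "F \<in> Hm1 \<Omega>"
  show "Hm1_norm \<Omega> (F + G) \<le> Hm1_norm \<Omega> F + Hm1_norm \<Omega> G" if G: "G \<in> Hm1 \<Omega>" for G
  proof (rule Hm1_norm_le)
    show "\<bar>(F + G) v\<bar> \<le> (Hm1_norm \<Omega> F + Hm1_norm \<Omega> G) * H1_norm \<Omega> v" if "v \<in> H10 \<Omega>" for v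
      using Hm1_bound[OF F that] Hm1_bound[OF G that] by (simp add: distrib_right)
  qed (use Hm1_nonneg[OF F] Hm1_nonneg[OF G] in simp)
  have le: "Hm1_norm \<Omega> (c *\<^sub>R F) \<le> \<bar>c\<bar> * Hm1_norm \<Omega> F" if F: "F \<in> Hm1 \<Omega>" for c F
  proof (rule Hm1_norm_le)
    show "\<bar>(c *\<^sub>R F) v\<bar> \<le> \<bar>c\<bar> * Hm1_norm \<Omega> F * H1_norm \<Omega> v" if "v \<in> H10 \<Omega>" for v
      using mult_left_mono[OF Hm1_bound[OF F that], of "\<bar>c\<bar>"] by (simp add: scaleR_apply abs_mult mult.assoc)
  qed (use Hm1_nonneg[OF F] in simp)
  show "Hm1_norm \<Omega> (c *\<^sub>R F) = \<bar>c\<bar> * Hm1_norm \<Omega> F" for c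
  proof (cases "c = 0")
    case True
    then show ?thesis using le[OF F, of 0] Hm1_nonneg[OF sc[OF F, of 0]] by simp
  next
    case False
    have "Hm1_norm \<Omega> ((1/c) *\<^sub>R (c *\<^sub>R F)) \<le> \<bar>1/c\<bar> * Hm1_norm \<Omega> (c *\<^sub>R F)" by (rule le[OF sc[OF F]])
    then have "\<bar>c\<bar> * Hm1_norm \<Omega> F \<le> Hm1_norm \<Omega> (c *\<^sub>R F)" using False by (simp add: field_simps)
    then show ?thesis using le[OF F, of c] by simp
  qed
qed

lemma Hm1_eval: "v \<in> H10 \<Omega> \<Longrightarrow> Hm1.bounded_functional (\<lambda>F. F v)"
  unfolding Hm1.bounded_functional_def using Hm1_bound
  by (auto simp: scaleR_apply intro!: exI[of _ "H1_norm \<Omega> v"] simp: mult.commute)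

lemma Hm1_separating:
  assumes "z \<in> Hm1 \<Omega>" "\<And>v. v \<in> H10 \<Omega> \<Longrightarrow> z v = 0" shows "Hm1_norm \<Omega> z = 0"
  using Hm1_norm_le[of 0 z] Hm1_nonneg[OF assms(1)] assms(2) by simp

text \<open>The limit is the pointwise one.\<close>

theorem Hm1_complete: "complete_in (Hm1 \<Omega>) (Hm1_norm \<Omega>)"
  unfolding complete_in_def
proof (intro allI impI)
  fix F :: "nat \<Rightarrow> (real^'n \<Rightarrow> real) \<Rightarrow> real"
  assume F: "\<forall>k. F k \<in> Hm1 \<Omega>" and C: "\<forall>e>0. \<exists>M. \<forall>i\<ge>M. \<forall>j\<ge>M. Hm1_norm \<Omega> (F i - F j) < e"
  have bound: "\<bar>F i v - F j v\<bar> \<le> Hm1_norm \<Omega> (F i - F j) * H1_norm \<Omega> v" if "v \<in> H10 \<Omega>" for i j v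
    using Hm1_bound[OF Hm1.mem_diff that, of "F i" "F j"] F by simp
  have conv: "convergent (\<lambda>k. F k v)" if v: "v \<in> H10 \<Omega>" for v
  proof (rule Cauchy_convergent, unfold Cauchy_def dist_real_def, intro allI impI)
    fix e :: real assume e: "e > 0"
    have p: "0 < H1_norm \<Omega> v + 1" using H10.N_nonneg[OF v] by simp
    then obtain M where M: "\<forall>i\<ge>M. \<forall>j\<ge>M. Hm1_norm \<Omega> (F i - F j) < e / (H1_norm \<Omega> v + 1)"
      using C e by (meson divide_pos_pos)
    have "\<bar>F i v - F j v\<bar> < e" if "i \<ge> M" "j \<ge> M" for i j
    proof -
      have "Hm1_norm \<Omega> (F i - F j) * H1_norm \<Omega> v \<le> Hm1_norm \<Omega> (F i - F j) * (H1_norm \<Omega> v + 1)"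
        using F Hm1_nonneg[of "F i - F j"] by (intro mult_left_mono) auto
      also have "\<dots> < e / (H1_norm \<Omega> v + 1) * (H1_norm \<Omega> v + 1)"
        using M that p by (intro mult_strict_right_mono) auto
      finally show ?thesis using bound[OF v, of i j] p by simp
    qed
    then show "\<exists>M. \<forall>m\<ge>M. \<forall>n\<ge>M. \<bar>F m v - F n v\<bar> < e" by blast
  qed
  define G where "G v = lim (\<lambda>k. F k v)" for v
  have lim: "(\<lambda>k. F k v) \<longlonglongrightarrow> G v" if "v \<in> H10 \<Omega>" for v
    using conv[OF that] by (simp add: G_def convergent_LIMSEQ_iff)
  have est: "\<bar>F i v - G v\<bar> \<le> e * H1_norm \<Omega> v"
    if M: "\<forall>i\<ge>M. \<forall>j\<ge>M. Hm1_norm \<Omega> (F i - F j) < e" and i: "i \<ge> M" and v: "v \<in> H10 \<Omega>" for M i v e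
  proof (rule LIMSEQ_le_const2)
    show "(\<lambda>j. \<bar>F i v - F j v\<bar>) \<longlonglongrightarrow> \<bar>F i v - G v\<bar>" by (intro tendsto_intros lim v)
    have "\<bar>F i v - F j v\<bar> \<le> e * H1_norm \<Omega> v" if "j \<ge> M" for j
      using bound[OF v, of i j] mult_right_mono[of "Hm1_norm \<Omega> (F i - F j)" e "H1_norm \<Omega> v"]
        H10.N_nonneg[OF v] M i that by fastforce
    then show "\<exists>N. \<forall>n\<ge>N. \<bar>F i v - F n v\<bar> \<le> e * H1_norm \<Omega> v" by blast
  qed
  have G: "G \<in> Hm1 \<Omega>"
  proof -
    obtain M where M: "\<forall>i\<ge>M. \<forall>j\<ge>M. Hm1_norm \<Omega> (F i - F j) < 1" using C by (meson zero_less_one)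
    show ?thesis
    proof (rule Hm1I[where C = "Hm1_norm \<Omega> (F M) + 1"])
      fix v assume v: "v \<in> H10 \<Omega>"
      show "\<bar>G v\<bar> \<le> (Hm1_norm \<Omega> (F M) + 1) * H1_norm \<Omega> v"
        using est[OF M order_refl v] Hm1_bound[OF _ v, of "F M"] F by (simp add: distrib_right)
      show "G (c *\<^sub>R v) = c * G v" for c
      proof (rule LIMSEQ_unique[OF lim])
        show "(\<lambda>k. F k (c *\<^sub>R v)) \<longlonglongrightarrow> c * G v"
          using tendsto_mult_left[OF lim[OF v], of c] F by (simp add: Hm1_scale_apply v)
      qed (simp add: v)
      fix u assume u: "u \<in> H10 \<Omega>"
      show "G (u + v) = G u + G v"
      proof (rule LIMSEQ_unique[OF lim])
        show "(\<lambda>k. F k (u + v)) \<longlonglongrightarrow> G u + G v"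
          using tendsto_add[OF lim[OF u] lim[OF v]] F by (simp add: Hm1_add_apply u v)
      qed (simp add: u v)
    qed
  qed
  have "(\<lambda>k. Hm1_norm \<Omega> (F k - G)) \<longlonglongrightarrow> 0"
  proof (rule LIMSEQ_I)
    fix e :: real assume e: "e > 0"
    then obtain M where M: "\<forall>i\<ge>M. \<forall>j\<ge>M. Hm1_norm \<Omega> (F i - F j) < e / 2" using C half_gt_zero by blast
    have "norm (Hm1_norm \<Omega> (F i - G) - 0) < e" if "i \<ge> M" for i
    proof -
      have "Hm1_norm \<Omega> (F i - G) \<le> e / 2"
        using est[OF M that] e by (intro Hm1_norm_le) auto
      moreover have "0 \<le> Hm1_norm \<Omega> (F i - G)" using F G by (intro Hm1_nonneg) simp
      ultimately show ?thesis using e by simp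
    qed
    then show "\<exists>no. \<forall>n\<ge>no. norm (Hm1_norm \<Omega> (F n - G) - 0) < e" by blast
  qed
  then show "\<exists>l\<in>Hm1 \<Omega>. (\<lambda>k. Hm1_norm \<Omega> (F k - l)) \<longlonglongrightarrow> 0" using G by blast
qed

lemma L2_inner_Hm1:
  assumes g: "g \<in> L2 \<Omega>" shows "L2_inner \<Omega> g \<in> Hm1 \<Omega>" "Hm1_norm \<Omega> (L2_inner \<Omega> g) \<le> L2_norm \<Omega> g"
proof -
  have b: "\<bar>L2_inner \<Omega> g v\<bar> \<le> L2_norm \<Omega> g * H1_norm \<Omega> v" if "v \<in> H10 \<Omega>" for v
    using L2_cauchy_schwarz[OF g H10_L2'[OF that]] mult_left_mono[OF L2_le_H1[OF op, of v] L2_norm_ge_0[of \<Omega> g]]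
    by linarith
  show "L2_inner \<Omega> g \<in> Hm1 \<Omega>"
    by (rule Hm1I[OF _ _ b]) (simp_all add: L2.b_add_right L2.b_scale_right g H10_L2')
  show "Hm1_norm \<Omega> (L2_inner \<Omega> g) \<le> L2_norm \<Omega> g" by (rule Hm1_norm_le[OF _ b]) simp
qed

lemma B_Hm1: "\<exists>M\<ge>0. \<forall>u\<in>H10 \<Omega>. B u \<in> Hm1 \<Omega> \<and> Hm1_norm \<Omega> (B u) \<le> M * H1_norm \<Omega> u"
proof -
  obtain M where M: "M \<ge> 0" "\<And>u v. u \<in> H10 \<Omega> \<Longrightarrow> v \<in> H10 \<Omega> \<Longrightarrow> \<bar>B u v\<bar> \<le> M * H1_norm \<Omega> u * H1_norm \<Omega> v"
    using B_bound by blast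
  have "B u \<in> Hm1 \<Omega> \<and> Hm1_norm \<Omega> (B u) \<le> M * H1_norm \<Omega> u" if u: "u \<in> H10 \<Omega>" for u
  proof
    show "B u \<in> Hm1 \<Omega>" by (rule Hm1I[OF _ _ M(2)[OF u]]) (simp_all add: B.b_add_right B.b_scale_right u)
    show "Hm1_norm \<Omega> (B u) \<le> M * H1_norm \<Omega> u"
      using M(1) H10.N_nonneg[OF u] by (intro Hm1_norm_le M(2) u) simp_all
  qed
  then show ?thesis using M(1) by blast
qed

end

lemma L2_functional: "z \<in> L2 \<Omega> \<Longrightarrow> L2n.bounded_functional \<Omega> (\<lambda>u. L2_inner \<Omega> u z)"
  unfolding L2n.bounded_functional_def using L2_cauchy_schwarz[of _ \<Omega> z]
  by (auto simp: L2.b_add L2.b_scale mult.commute intro!: exI[of _ "L2_norm \<Omega> z"])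

section \<open>Integration by parts against test functions\<close>

lemma integral_open_interval:
  fixes h :: "real \<Rightarrow> real"
  assumes h: "continuous_on {0..T} h"
  shows "integrable (lebesgue_on {0<..<T}) h" "(LINT t|lebesgue_on {0<..<T}. h t) = integral {0..T} h"
proof -
  have ai: "set_integrable lebesgue {0<..<T} h"
    using absolutely_integrable_continuous_real[OF h] by (rule set_integrable_subset) auto
  then show "integrable (lebesgue_on {0<..<T}) h"
    by (simp add: integrable_restrict_space set_integrable_def)
  have "(LINT t|lebesgue_on {0<..<T}. h t) = (LINT t:{0<..<T}|lebesgue. h t)"
    by (simp add: integral_restrict_space set_lebesgue_integral_def)
  also have "\<dots> = integral {0<..<T} h" by (rule set_lebesgue_integral_eq_integral(2)[OF ai])
  also have "\<dots> = integral {0..T} h" by (rule integral_open_interval_real[symmetric])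
  finally show "(LINT t|lebesgue_on {0<..<T}. h t) = integral {0..T} h" .
qed

lemma test_parts:
  fixes F :: "real \<Rightarrow> real"
  assumes T: "0 \<le> T" and F: "\<And>t. t \<in> {0..T} \<Longrightarrow> (F has_real_derivative D t) (at t within {0..T})"
    and D: "continuous_on {0..T} D" and \<phi>: "\<phi> \<in> test_functions {0<..<T}"
  shows "(LINT t|lebesgue_on {0<..<T}. deriv \<phi> t * F t) = - (LINT t|lebesgue_on {0<..<T}. \<phi> t * D t)"
proof -
  have Fc: "continuous_on {0..T} F"
    using F by (meson DERIV_continuous continuous_on_eq_continuous_within)
  have c1: "continuous_on {0..T} (\<lambda>t. deriv \<phi> t * F t)" and c2: "continuous_on {0..T} (\<lambda>t. \<phi> t * D t)"
    by (intro continuous_intros Fc D test_cont[OF \<phi>] test_cont[OF test_deriv[OF \<phi>]])+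
  obtain S where "S \<subseteq> {0<..<T}" "\<And>x. x \<notin> S \<Longrightarrow> \<phi> x = 0" using test_functionsE[OF \<phi>] by metis
  then have z: "\<phi> 0 = 0" "\<phi> T = 0" by (meson greaterThanLessThan_iff less_irrefl subsetD)+
  have "((\<lambda>t. deriv \<phi> t * F t + D t * \<phi> t) has_integral \<phi> T * F T - \<phi> 0 * F 0) {0..T}"
  proof (rule fundamental_theorem_of_calculus[OF T])
    fix t assume "t \<in> {0..T}"
    then have "((\<lambda>t. \<phi> t * F t) has_real_derivative deriv \<phi> t * F t + D t * \<phi> t) (at t within {0..T})"
      by (intro DERIV_mult F has_field_derivative_at_within[OF test_has_real_derivative[OF \<phi>]])
    then show "((\<lambda>t. \<phi> t * F t) has_vector_derivative deriv \<phi> t * F t + D t * \<phi> t) (at t within {0..T})"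
      by (simp add: has_real_derivative_iff_has_vector_derivative)
  qed
  then have "integral {0..T} (\<lambda>t. deriv \<phi> t * F t + D t * \<phi> t) = 0" by (simp add: z integral_unique)
  moreover have "integral {0..T} (\<lambda>t. deriv \<phi> t * F t + D t * \<phi> t) =
      integral {0..T} (\<lambda>t. deriv \<phi> t * F t) + integral {0..T} (\<lambda>t. \<phi> t * D t)"
    using c1 c2 by (subst Henstock_Kurzweil_Integration.integral_add[symmetric])
      (auto intro!: integrable_continuous_interval simp: mult.commute)
  ultimately show ?thesis
    unfolding integral_open_interval(2)[OF c1] integral_open_interval(2)[OF c2] by linarith
qed

section \<open>Uniqueness in the abstract setting\<close>

context positive_operator
begin

text \<open>\<open>V\<close> is the derivative of \<open>K C\<close>, and \<open>(K C)'' = - C\<close>. The energy \<open>V \<bullet> V + C \<bullet> K C\<close> is constant although \<open>C\<close>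
itself is only continuous: by the symmetry of \<open>K\<close>, the difference quotient of \<open>C \<bullet> K C\<close> only
involves that of \<open>K C\<close>.\<close>

lemma energy_rigidity:
  assumes W: "\<And>t. t > 0 \<Longrightarrow> ((\<lambda>t. K (C t)) has_vector_derivative V t) (at t)"
    and V: "\<And>t. t > 0 \<Longrightarrow> (V has_vector_derivative - C t) (at t)"
    and C: "\<And>t. t > 0 \<Longrightarrow> isCont C t" and lim: "(C \<longlongrightarrow> 0) at_top" and t: "t > 0"
  shows "K (C t) = 0"
proof -
  define E where "E t = V t \<bullet> V t + C t \<bullet> K (C t)" for t
  have dE: "(E has_real_derivative 0) (at t)" if t: "t > 0" for t
  proof -
    have d1: "((\<lambda>t. V t \<bullet> V t) has_real_derivative - 2 * (V t \<bullet> C t)) (at t)"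
      using bounded_bilinear.has_vector_derivative[OF bounded_bilinear_inner V[OF t] V[OF t]]
      by (simp add: has_real_derivative_iff_has_vector_derivative inner_commute)
    have lim1: "((\<lambda>h. (1 / h) *\<^sub>R (K (C (t + h)) - K (C t))) \<longlongrightarrow> V t) (at 0)"
    proof (rule LIM_zero_cancel, rule tendsto_norm_zero_cancel)
      have "((\<lambda>h. norm (K (C (t + h)) - K (C t) - h *\<^sub>R V t) / norm h) \<longlongrightarrow> 0) (at 0)"
        using W[OF t] unfolding has_vector_derivative_def has_derivative_at by blast
      moreover have "\<forall>\<^sub>F h in at 0. norm (K (C (t + h)) - K (C t) - h *\<^sub>R V t) / norm h
          = norm ((1 / h) *\<^sub>R (K (C (t + h)) - K (C t)) - V t)"
      proof (rule eventually_at_filter[THEN iffD2], intro always_eventually allI impI)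
        fix h :: real assume h: "h \<noteq> 0"
        have "(1 / h) *\<^sub>R (K (C (t + h)) - K (C t)) - V t = (1 / h) *\<^sub>R (K (C (t + h)) - K (C t) - h *\<^sub>R V t)"
          using h by (simp add: scaleR_diff_right)
        then show "norm (K (C (t + h)) - K (C t) - h *\<^sub>R V t) / norm h
          = norm ((1 / h) *\<^sub>R (K (C (t + h)) - K (C t)) - V t)" by (simp add: divide_inverse mult.commute)
      qed
      ultimately show "((\<lambda>h. norm ((1 / h) *\<^sub>R (K (C (t + h)) - K (C t)) - V t)) \<longlongrightarrow> 0) (at 0)"
        by (rule Lim_transform_eventually)
    qed
    have limC: "((\<lambda>h. C (t + h)) \<longlongrightarrow> C t) (at 0)"
      using C[OF t] by (simp add: isCont_iff)
    have "((\<lambda>h. ((1 / h) *\<^sub>R (K (C (t + h)) - K (C t))) \<bullet> (C (t + h) + C t)) \<longlongrightarrow> V t \<bullet> (C t + C t)) (at 0)"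
      by (intro tendsto_intros lim1 limC)
    moreover have "((1 / h) *\<^sub>R (K (C (t + h)) - K (C t))) \<bullet> (C (t + h) + C t)
        = (C (t + h) \<bullet> K (C (t + h)) - C t \<bullet> K (C t)) / h" for h
    proof -
      have "K (C (t + h)) \<bullet> C t = K (C t) \<bullet> C (t + h)"
        using K_sym[of "C (t + h)" "C t"] by (simp add: inner_commute)
      then show ?thesis
        by (simp add: inner_diff_left inner_add_right inner_commute[of _ "K _"] add_divide_distrib diff_divide_distrib)
    qed
    ultimately have d2: "((\<lambda>t. C t \<bullet> K (C t)) has_real_derivative 2 * (V t \<bullet> C t)) (at t)"
      by (simp add: DERIV_def inner_add_right)
    show ?thesis using DERIV_add[OF d1 d2] by (simp add: E_def[abs_def])
  qed
  have "\<exists>e. \<forall>t\<in>{0<..}. E t = e"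
  proof (rule has_field_derivative_zero_constant)
    show "convex {0::real<..}" by simp
    show "(E has_field_derivative 0) (at t within {0<..})" if "t \<in> {0<..}" for t
      using dE[of t] that by (auto intro: has_field_derivative_at_within)
  qed
  then obtain e where e: "\<And>t. t > 0 \<Longrightarrow> E t = e" by auto
  have limK: "((\<lambda>t. K (C t)) \<longlongrightarrow> 0) at_top"
    using K.tendsto[OF lim] by (simp add: K.zero)
  have limCK: "((\<lambda>t. C t \<bullet> K (C t)) \<longlongrightarrow> 0) at_top"
    using tendsto_inner[OF lim limK] by simp
  have "e \<ge> 0"
  proof -
    have "e = V 1 \<bullet> V 1 + C 1 \<bullet> K (C 1)" using e[of 1] by (simp add: E_def)
    then show ?thesis using K_pos[of "C 1"] by simp
  qed
  have "e \<le> 0"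
  proof (rule ccontr)
    assume "\<not> e \<le> 0"
    then have ep: "e > 0" by simp
    \<comment> \<open>\<open>f\<close> tends to 0, but its derivative \<open>e - 2 (C \<bullet> K C)\<close> would be at least \<open>e / 2\<close> for large times\<close>
    define f where "f t = K (C t) \<bullet> V t" for t
    have df: "(f has_real_derivative e - 2 * (C t \<bullet> K (C t))) (at t)" if t: "t > 0" for t
    proof -
      have "(f has_vector_derivative K (C t) \<bullet> - C t + V t \<bullet> V t) (at t)"
        unfolding f_def by (rule bounded_bilinear.has_vector_derivative[OF bounded_bilinear_inner W[OF t] V[OF t]])
      moreover have "K (C t) \<bullet> - C t + V t \<bullet> V t = e - 2 * (C t \<bullet> K (C t))"
        using e[OF t] by (simp add: E_def inner_commute)
      ultimately show ?thesis by (simp add: has_real_derivative_iff_has_vector_derivative)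
    qed
    have Vb: "norm (V t) \<le> sqrt e" if "t > 0" for t
      using e[OF that] K_pos[of "C t"] by (intro real_le_rsqrt) (simp add: E_def power2_norm_eq_inner)
    have limf: "(f \<longlongrightarrow> 0) at_top"
    proof (rule Lim_null_comparison)
      show "\<forall>\<^sub>F t in at_top. norm (f t) \<le> norm (K (C t)) * sqrt e"
        using eventually_gt_at_top[of 0]
      proof eventually_elim
        case (elim t)
        have "norm (f t) \<le> norm (K (C t)) * norm (V t)" by (simp add: f_def Cauchy_Schwarz_ineq2)
        also have "\<dots> \<le> norm (K (C t)) * sqrt e" by (intro mult_left_mono Vb elim) simp
        finally show ?case .
      qed
      show "((\<lambda>t. norm (K (C t)) * sqrt e) \<longlongrightarrow> 0) at_top"
        using tendsto_mult_right[OF tendsto_norm_zero[OF limK], of "sqrt e"] by simp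
    qed
    have "\<forall>\<^sub>F t in at_top. C t \<bullet> K (C t) < e / 4" "\<forall>\<^sub>F t in at_top. f t < 1" "\<forall>\<^sub>F t in at_top. -1 < f t"
      by (intro order_tendstoD(2)[OF limCK] order_tendstoD(2)[OF limf] order_tendstoD(1)[OF limf]; use ep in simp)+
    then have "\<forall>\<^sub>F t in at_top. C t \<bullet> K (C t) < e / 4 \<and> f t < 1 \<and> -1 < f t"
      by eventually_elim simp
    then obtain t0 where t0: "\<And>t. t \<ge> t0 \<Longrightarrow> C t \<bullet> K (C t) < e / 4 \<and> f t < 1 \<and> -1 < f t"
      by (auto simp: eventually_at_top_linorder)
    define a where "a = max t0 1"
    \<comment> \<open>on an interval of length \<open>4 / e\<close> the function \<open>f\<close> would grow by at least 2\<close>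
    define b where "b = a + 4 / e"
    have ab: "a < b" "a > 0" "a \<ge> t0" using ep by (auto simp: a_def b_def)
    have "\<exists>z. a < z \<and> z < b \<and> f b - f a = (b - a) * (e - 2 * (C z \<bullet> K (C z)))"
      by (rule MVT2[OF ab(1)]) (use df ab in auto)
    then obtain z where z: "a < z" "z < b" "f b - f a = (b - a) * (e - 2 * (C z \<bullet> K (C z)))" by blast
    have "(b - a) * (e / 2) \<le> (b - a) * (e - 2 * (C z \<bullet> K (C z)))"
      using t0[of z] z(1) ab by (intro mult_left_mono) auto
    moreover have "(b - a) * (e / 2) = 2" using ep by (simp add: b_def)
    ultimately have "2 \<le> f b - f a" unfolding z(3) by linarith
    moreover have "-1 < f a" "f b < 1" using t0[of a] t0[of b] ab by auto
    ultimately show False by linarith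
  qed
  with \<open>e \<ge> 0\<close> have "e = 0" by simp
  then have "V t \<bullet> V t + C t \<bullet> K (C t) = 0" using e[OF t] by (simp add: E_def)
  then have "C t \<bullet> K (C t) = 0"
    using add_nonneg_eq_0_iff[OF inner_ge_zero K_pos] by blast
  moreover obtain c where "c \<ge> 0" "\<And>v. norm (K v) \<le> norm v * c" using K.nonneg_bounded by blast
  ultimately show ?thesis using K_norm_le[of c "C t"] by simp
qed

text \<open>The weak equation says that \<open>K C\<close> plus the second antiderivative \<open>J\<close> of \<open>C\<close> has second derivative 0,
hence is affine. So \<open>K C\<close> is twice continuously differentiable with second derivative \<open>- C\<close>.\<close>

theorem abstract_uniqueness:
  assumes C: "continuous_on {0..} C" and lim: "(C \<longlongrightarrow> 0) at_top"
    and eq: "\<And>T \<phi> z. T > 0 \<Longrightarrow> \<phi> \<in> test_functions {0<..<T} \<Longrightarrow>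
      (LINT t|lebesgue_on {0<..<T}. deriv (deriv \<phi>) t * (C t \<bullet> K z)) =
      - (LINT t|lebesgue_on {0<..<T}. \<phi> t * (C t \<bullet> z))"
    and t: "t > 0"
  shows "K (C t) = 0"
proof -
  define J1 where "J1 t = integral {0..t} C" for t
  have dJ1: "(J1 has_vector_derivative C t) (at t within {0..T})" if "t \<in> {0..T}" for t T
    unfolding J1_def
    by (rule integral_has_vector_derivative[OF _ that]) (rule continuous_on_subset[OF C], simp)
  have J1c: "continuous_on {0..T} J1" for T
    using dJ1 by (meson continuous_on_eq_continuous_within has_vector_derivative_continuous)
  define J where "J t = integral {0..t} J1" for t
  have dJ: "(J has_vector_derivative J1 t) (at t within {0..T})" if "t \<in> {0..T}" for t T
    unfolding J_def by (rule integral_has_vector_derivative[OF J1c that])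
  have Jc: "continuous_on {0..T} J" for T
    using dJ by (meson continuous_on_eq_continuous_within has_vector_derivative_continuous)
  define Q where "Q t = K (C t) + J t" for t
  have Qc: "continuous_on {0..T} Q" for T
    unfolding Q_def by (intro continuous_intros Jc K.continuous_on continuous_on_subset[OF C]) auto
  have inner_d: "((\<lambda>t. F t \<bullet> z) has_real_derivative D \<bullet> z) (at t within S)"
    if "(F has_vector_derivative D) (at t within S)" for F D z t S
    using bounded_linear.has_vector_derivative[OF bounded_linear_inner_left that, of z]
    by (simp add: has_real_derivative_iff_has_vector_derivative)
  have three: "(v - m) *\<^sub>R Q u + (m - u) *\<^sub>R Q v = (v - u) *\<^sub>R Q m" if uv: "0 < u" "u < m" "m < v" for u m v
  proof -
    define T where "T = v + 1"
    have T: "T > 0" "v < T" using uv by (auto simp: T_def)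
    have Cc: "continuous_on {0..T} C" by (rule continuous_on_subset[OF C]) simp
    have "(v - m) * (Q u \<bullet> z) + (m - u) * (Q v \<bullet> z) = (v - u) * (Q m \<bullet> z)" for z
    proof (rule second_derivative_zero_affine[of T "\<lambda>t. Q t \<bullet> z", OF _ _ uv T(2)])
      show "continuous_on {0<..<T} (\<lambda>t. Q t \<bullet> z)"
        by (intro continuous_intros continuous_on_subset[OF Qc[of T]]) auto
      fix \<phi> assume \<phi>: "\<phi> \<in> test_functions {0<..<T}"
      let ?M = "lebesgue_on {0<..<T}"
      note \<phi>' = test_deriv[OF \<phi>]
      have "(LINT t|?M. deriv (deriv \<phi>) t * (J t \<bullet> z)) = - (LINT t|?M. deriv \<phi> t * (J1 t \<bullet> z))"
        by (rule test_parts[OF _ inner_d[OF dJ] _ \<phi>']) (use T in \<open>auto intro!: continuous_intros J1c\<close>)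
      also have "(LINT t|?M. deriv \<phi> t * (J1 t \<bullet> z)) = - (LINT t|?M. \<phi> t * (C t \<bullet> z))"
        by (rule test_parts[OF _ inner_d[OF dJ1] _ \<phi>]) (use T in \<open>auto intro!: continuous_intros Cc\<close>)
      finally have J: "(LINT t|?M. deriv (deriv \<phi>) t * (J t \<bullet> z)) = (LINT t|?M. \<phi> t * (C t \<bullet> z))" by simp
      have c1: "continuous_on {0..T} (\<lambda>t. deriv (deriv \<phi>) t * (C t \<bullet> K z))"
        and c2: "continuous_on {0..T} (\<lambda>t. deriv (deriv \<phi>) t * (J t \<bullet> z))"
        by (intro continuous_intros Cc Jc test_cont[OF test_deriv[OF \<phi>']])+
      have "(LINT t|?M. deriv (deriv \<phi>) t * (Q t \<bullet> z)) =
          (LINT t|?M. deriv (deriv \<phi>) t * (C t \<bullet> K z) + deriv (deriv \<phi>) t * (J t \<bullet> z))"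
        by (simp add: Q_def inner_add_left K_sym distrib_left)
      also have "\<dots> = (LINT t|?M. deriv (deriv \<phi>) t * (C t \<bullet> K z)) + (LINT t|?M. deriv (deriv \<phi>) t * (J t \<bullet> z))"
        by (rule Bochner_Integration.integral_add[OF integral_open_interval(1)[OF c1] integral_open_interval(1)[OF c2]])
      also have "\<dots> = 0" unfolding J eq[OF T(1) \<phi>] by simp
      finally show "(LINT t|?M. deriv (deriv \<phi>) t * (Q t \<bullet> z)) = 0" .
    qed
    then have "((v - m) *\<^sub>R Q u + (m - u) *\<^sub>R Q v) \<bullet> z = ((v - u) *\<^sub>R Q m) \<bullet> z" for z
      by (simp add: inner_add_left)
    then have "\<forall>z. ((v - m) *\<^sub>R Q u + (m - u) *\<^sub>R Q v) \<bullet> z = ((v - u) *\<^sub>R Q m) \<bullet> z" by blast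
    then show ?thesis by (simp only: vector_eq_rdot)
  qed
  have three0: "(v - m) *\<^sub>R Q 0 + m *\<^sub>R Q v = v *\<^sub>R Q m" if mv: "0 < m" "m < v" for m v
  proof -
    have "((\<lambda>u. Q u) \<longlongrightarrow> Q 0) (at 0 within {0..m})"
      using Qc[of m] mv by (simp add: continuous_on_def)
    then have Q0: "(Q \<longlongrightarrow> Q 0) (at_right 0)"
      by (rule tendsto_mono[rotated]) (simp add: at_within_Icc_at_right[OF mv(1)])
    have u0: "((\<lambda>u. u) \<longlongrightarrow> 0) (at_right (0::real))" by (rule tendsto_ident_at)
    have l1: "((\<lambda>u. (v - m) *\<^sub>R Q u + (m - u) *\<^sub>R Q v) \<longlongrightarrow> (v - m) *\<^sub>R Q 0 + (m - 0) *\<^sub>R Q v) (at_right 0)"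
      and l2: "((\<lambda>u. (v - u) *\<^sub>R Q m) \<longlongrightarrow> (v - 0) *\<^sub>R Q m) (at_right 0)"
      by (intro tendsto_intros Q0 u0)+
    have "\<forall>\<^sub>F u in at_right 0. (v - m) *\<^sub>R Q u + (m - u) *\<^sub>R Q v = (v - u) *\<^sub>R Q m"
      unfolding eventually_at_right_field using mv three by blast
    from tendsto_unique[OF trivial_limit_at_right_real Lim_transform_eventually[OF l1 this] l2]
    have "(v - m) *\<^sub>R Q 0 + (m - 0) *\<^sub>R Q v = (v - 0) *\<^sub>R Q m" .
    then show ?thesis by simp
  qed
  define b where "b = Q 1 - Q 0"
  have Q_affine: "Q t = Q 0 + t *\<^sub>R b" if "t > 0" for t
  proof -
    consider "t < 1" | "t = 1" | "t > 1" by linarith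
    then show ?thesis
    proof cases
      case 1
      then show ?thesis using three0[of t 1] that by (simp add: b_def algebra_simps)
    next
      case 2
      then show ?thesis by (simp add: b_def)
    next
      case 3
      then show ?thesis using three0[of 1 t] by (simp add: b_def algebra_simps)
    qed
  qed
  show ?thesis
  proof (rule energy_rigidity[where V = "\<lambda>t. b - J1 t", OF _ _ _ lim t])
    fix t :: real assume t: "t > 0"
    have at: "at t within {0..t+1} = at t" using t by (intro at_within_interior) simp
    have dJ': "(J has_vector_derivative J1 t) (at t)" and dJ1': "(J1 has_vector_derivative C t) (at t)"
      using dJ[of t "t+1"] dJ1[of t "t+1"] t by (simp_all add: at)
    have "((\<lambda>t. Q 0 + t *\<^sub>R b - J t) has_vector_derivative b - J1 t) (at t)"
      by (auto intro!: derivative_eq_intros dJ')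
    then show "((\<lambda>t. K (C t)) has_vector_derivative b - J1 t) (at t)"
    proof (rule has_vector_derivative_transform_within_open[where S = "{0<..}"])
      show "Q 0 + s *\<^sub>R b - J s = K (C s)" if "s \<in> {0<..}" for s
        using Q_affine[of s] that by (simp add: Q_def algebra_simps)
    qed (use t in auto)
    show "((\<lambda>t. b - J1 t) has_vector_derivative - C t) (at t)"
      by (auto intro!: derivative_eq_intros dJ1')
    show "isCont C t"
      using continuous_on_interior[OF C, of t] t by simp
  qed
qed

end

section \<open>Uniqueness of decaying solutions\<close>

lemma AE_subinterval:
  "AE t in lebesgue_on {0<..}. P t \<Longrightarrow> AE t in lebesgue_on {0<..<T::real}. P t"
  by (auto simp: AE_restrict_space_iff elim!: eventually_mono)

context elliptic
begin

lemma emb_diff': "u \<in> L2 \<Omega> \<Longrightarrow> v \<in> L2 \<Omega> \<Longrightarrow> emb \<Omega> (u - v) = emb \<Omega> u - emb \<Omega> v"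
  by (rule emb_diff[OF meas])

lemma continuous_rep_emb:
  assumes c: "is_continuous_rep \<Omega> u c" shows "continuous_on {0..} (\<lambda>t. emb \<Omega> (c t))"
  unfolding continuous_on_def
proof
  fix t :: real assume t: "t \<in> {0..}"
  have "((\<lambda>s. norm (emb \<Omega> (c s) - emb \<Omega> (c t))) \<longlongrightarrow> 0) (at t within {0..})"
  proof (rule Lim_transform_eventually)
    show "((\<lambda>s. L2_norm \<Omega> (c s - c t)) \<longlongrightarrow> 0) (at t within {0..})"
      using c t by (auto simp: is_continuous_rep_def)
    show "\<forall>\<^sub>F s in at t within {0..}. L2_norm \<Omega> (c s - c t) = norm (emb \<Omega> (c s) - emb \<Omega> (c t))"
      using c t unfolding is_continuous_rep_def eventually_at_filter
      by (auto intro!: always_eventually simp: emb_diff'[symmetric] norm_emb[OF meas])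
  qed
  then show "((\<lambda>s. emb \<Omega> (c s)) \<longlongrightarrow> emb \<Omega> (c t)) (at t within {0..})"
    by (simp add: tendsto_norm_zero_iff LIM_zero_iff)
qed

text \<open>The weak equation tested with \<open>v = sol z\<close> and integrated by parts twice in time. Since
\<open>B (w t) (sol z)\<close> is the inner product of \<open>w t\<close> and \<open>z\<close>, only inner products in \<open>L\<^sup>2\<close> with the continuous
representative remain, and the equation makes sense for functions that are merely continuous in time.\<close>

lemma solution_scalar:
  assumes w: "weak_solution \<Omega> a f w" and c: "is_continuous_rep \<Omega> w c" and T: "T > 0"
    and \<phi>: "\<phi> \<in> test_functions {0<..<T}"
  shows "\<exists>G. (AE t in lebesgue_on {0<..<T}. G t = L2_inner \<Omega> (f t) (sol z) - emb \<Omega> (c t) \<bullet> z) \<and>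
     integrable (lebesgue_on {0<..<T}) (\<lambda>t. \<phi> t * G t) \<and>
     (LINT t|lebesgue_on {0<..<T}. deriv (deriv \<phi>) t * (emb \<Omega> (c t) \<bullet> K z)) = (LINT t|lebesgue_on {0<..<T}. \<phi> t * G t)"
proof -
  let ?I = "{0<..<T}" let ?M = "lebesgue_on ?I"
  have I: "?I \<in> sets lebesgue" by simp
  define v where "v = sol z"
  have v: "v \<in> H10 \<Omega>" by (simp add: v_def sol_H10)
  obtain u'' where u'': "\<And>T. T > 0 \<Longrightarrow> is_second_deriv_L2 {0<..<T} (Hm1 \<Omega>) (Hm1_norm \<Omega>) (\<lambda>t. L2_inner \<Omega> (w t)) u''"
    and eq: "\<And>v. v \<in> H10 \<Omega> \<Longrightarrow> AE t in lebesgue_on {0<..}. u'' t v + B (w t) v = L2_inner \<Omega> (f t) v"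
    using w unfolding weak_solution_def solves_weakly_def by blast
  obtain V where V: "V \<in> bochner_Lp 2 ?I (Hm1 \<Omega>) (Hm1_norm \<Omega>)"
    and d1: "weak_time_deriv ?I (Hm1 \<Omega>) (Hm1_norm \<Omega>) (\<lambda>t. L2_inner \<Omega> (w t)) V"
    and d2: "weak_time_deriv ?I (Hm1 \<Omega>) (Hm1_norm \<Omega>) V u''"
    and u2: "u'' \<in> bochner_Lp 2 ?I (Hm1 \<Omega>) (Hm1_norm \<Omega>)"
    using u''[OF T] unfolding is_second_deriv_L2_def by blast
  have VX: "AE t in ?M. V t \<in> Hm1 \<Omega>" and u2X: "AE t in ?M. u'' t \<in> Hm1 \<Omega>"
    using V u2 by (auto simp: bochner_Lp_def strongly_measurable_on_def)
  have wX: "AE t in ?M. w t \<in> H10 \<Omega>"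
    using w T unfolding weak_solution_def solution_class_def in_loc_def bochner_Linf_def strongly_measurable_on_def
    by blast
  have wL: "AE t in ?M. L2_inner \<Omega> (w t) \<in> Hm1 \<Omega>"
    using wX by eventually_elim (intro L2_inner_Hm1 H10_L2')
  have cw: "AE t in ?M. AE x in lebesgue_on \<Omega>. c t x = w t x"
    using c AE_subinterval unfolding is_continuous_rep_def by blast
  have cL: "c t \<in> L2 \<Omega>" if "t \<in> ?I" for t using c that by (auto simp: is_continuous_rep_def)
  have tI: "AE t in ?M. t \<in> ?I" by (rule AE_I2) simp
  note \<phi>' = test_deriv[OF \<phi>]
  have "(LINT t|?M. deriv (deriv \<phi>) t * L2_inner \<Omega> (w t) v) = - (LINT t|?M. deriv \<phi> t * V t v)"
    by (rule Hm1.weak_time_derivD(1)[OF I d1 wL VX Hm1_eval[OF v] \<phi>'])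
  also have "(LINT t|?M. deriv \<phi> t * V t v) = - (LINT t|?M. \<phi> t * u'' t v)"
    by (rule Hm1.weak_time_derivD(1)[OF I d2 VX u2X Hm1_eval[OF v] \<phi>])
  finally have main: "(LINT t|?M. deriv (deriv \<phi>) t * L2_inner \<Omega> (w t) v) = (LINT t|?M. \<phi> t * u'' t v)" by simp
  have intG: "integrable ?M (\<lambda>t. \<phi> t * u'' t v)"
    by (rule Hm1.weak_time_derivD(2)[OF I d2 VX u2X Hm1_eval[OF v] \<phi>])
  have intW: "integrable ?M (\<lambda>t. deriv (deriv \<phi>) t * L2_inner \<Omega> (w t) v)"
    by (rule Hm1.weak_time_derivD(3)[OF I d1 wL VX Hm1_eval[OF v] \<phi>'])
  have emb_eq: "L2_inner \<Omega> (w t) h = L2_inner \<Omega> (c t) h"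
    if "w t \<in> H10 \<Omega>" "t \<in> ?I" "AE x in lebesgue_on \<Omega>. c t x = w t x" "h \<in> L2 \<Omega>" for t h
    by (rule L2_inner_cong) (use that cL H10_L2' in \<open>auto elim!: eventually_mono\<close>)
  have cK: "AE t in ?M. deriv (deriv \<phi>) t * L2_inner \<Omega> (w t) v = deriv (deriv \<phi>) t * (emb \<Omega> (c t) \<bullet> K z)"
    using wX cw tI
  proof eventually_elim
    case (elim t)
    then show ?case
      using emb_eq[OF elim(1,3,2), of v] emb_inner[OF meas cL[OF elim(3)] H10_L2'[OF v]] v
      by (simp add: K_def v_def H10_L2')
  qed
  have cont: "continuous_on {0..T} (\<lambda>t. deriv (deriv \<phi>) t * (emb \<Omega> (c t) \<bullet> K z))"
    by (intro continuous_intros test_cont[OF test_deriv[OF \<phi>']] continuous_on_subset[OF continuous_rep_emb[OF c]]) auto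
  have "(LINT t|?M. deriv (deriv \<phi>) t * (emb \<Omega> (c t) \<bullet> K z)) = (LINT t|?M. deriv (deriv \<phi>) t * L2_inner \<Omega> (w t) v)"
    using cK borel_measurable_integrable[OF intW] borel_measurable_integrable[OF integral_open_interval(1)[OF cont]]
    by (intro integral_cong_AE) (auto elim!: eventually_mono)
  moreover have "AE t in ?M. u'' t v = L2_inner \<Omega> (f t) (sol z) - emb \<Omega> (c t) \<bullet> z"
    using AE_subinterval[OF eq[OF v]] wX cw tI
  proof eventually_elim
    case (elim t)
    have "B (w t) v = B (sol z) (w t)" unfolding v_def by (rule B.b_sym[OF elim(2) sol_H10])
    also have "\<dots> = L2_inner \<Omega> (w t) (rep_hilb z)"
      using B_sol[OF elim(2), of z] emb_inner_rep[OF meas H10_L2'[OF elim(2)], of z]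
      by (simp add: L2.b_sym[OF rep_L2[OF meas] H10_L2'[OF elim(2)]])
    also have "\<dots> = L2_inner \<Omega> (c t) (rep_hilb z)" by (rule emb_eq[OF elim(2,4,3) rep_L2[OF meas]])
    also have "\<dots> = emb \<Omega> (c t) \<bullet> z"
      using emb_inner_rep[OF meas cL[OF elim(4)], of z] L2.b_sym[OF rep_L2[OF meas] cL[OF elim(4)]]
      by (simp add: inner_commute)
    finally show ?case using elim(1) by (simp add: v_def)
  qed
  ultimately show ?thesis using main intG by (intro exI[of _ "\<lambda>t. u'' t v"]) simp
qed

text \<open>In the difference of the two equations the right-hand side cancels, and what is left is the hypothesis of
\<open>abstract_uniqueness\<close>.\<close>

theorem uniqueness:
  assumes w1: "weak_solution \<Omega> a f w1" and w2: "weak_solution \<Omega> a f w2"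
  shows "AE t in lebesgue_on {0<..}. AE x in lebesgue_on \<Omega>. w1 t x = w2 t x"
proof -
  obtain c1 where c1: "is_continuous_rep \<Omega> w1 c1" "((\<lambda>t. L2_norm \<Omega> (c1 t)) \<longlongrightarrow> 0) at_top"
    using w1 unfolding weak_solution_def decays_def by blast
  obtain c2 where c2: "is_continuous_rep \<Omega> w2 c2" "((\<lambda>t. L2_norm \<Omega> (c2 t)) \<longlongrightarrow> 0) at_top"
    using w2 unfolding weak_solution_def decays_def by blast
  have cL: "c1 t \<in> L2 \<Omega>" "c2 t \<in> L2 \<Omega>" if "t \<ge> 0" for t
    using c1(1) c2(1) that by (auto simp: is_continuous_rep_def)
  define C where "C t = emb \<Omega> (c1 t) - emb \<Omega> (c2 t)" for t
  have e0: "((\<lambda>t. emb \<Omega> (c t)) \<longlongrightarrow> 0) at_top"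
    if "((\<lambda>t. L2_norm \<Omega> (c t)) \<longlongrightarrow> 0) at_top" "\<And>t. t \<ge> 0 \<Longrightarrow> c t \<in> L2 \<Omega>" for c :: "real \<Rightarrow> real^'n \<Rightarrow> real"
  proof (rule tendsto_norm_zero_cancel, rule Lim_transform_eventually[OF that(1)])
    show "\<forall>\<^sub>F t in at_top. L2_norm \<Omega> (c t) = norm (emb \<Omega> (c t))"
      using eventually_ge_at_top[of 0] by eventually_elim (simp add: norm_emb[OF meas] that(2))
  qed
  have zero: "K (C t) = 0" if t: "t > 0" for t
  proof (rule abstract_uniqueness[OF _ _ _ t])
    show "continuous_on {0..} C"
      unfolding C_def by (intro continuous_intros continuous_rep_emb[OF c1(1)] continuous_rep_emb[OF c2(1)])
    show "(C \<longlongrightarrow> 0) at_top"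
      using tendsto_diff[OF e0[OF c1(2) cL(1)] e0[OF c2(2) cL(2)]] by (simp add: C_def[abs_def])
    fix T :: real and \<phi> z assume T: "T > 0" and \<phi>: "\<phi> \<in> test_functions {0<..<T}"
    let ?M = "lebesgue_on {0<..<T}"
    obtain G1 where G1: "AE t in ?M. G1 t = L2_inner \<Omega> (f t) (sol z) - emb \<Omega> (c1 t) \<bullet> z"
      "integrable ?M (\<lambda>t. \<phi> t * G1 t)"
      "(LINT t|?M. deriv (deriv \<phi>) t * (emb \<Omega> (c1 t) \<bullet> K z)) = (LINT t|?M. \<phi> t * G1 t)"
      using solution_scalar[OF w1 c1(1) T \<phi>, of z] by (elim exE conjE)
    obtain G2 where G2: "AE t in ?M. G2 t = L2_inner \<Omega> (f t) (sol z) - emb \<Omega> (c2 t) \<bullet> z"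
      "integrable ?M (\<lambda>t. \<phi> t * G2 t)"
      "(LINT t|?M. deriv (deriv \<phi>) t * (emb \<Omega> (c2 t) \<bullet> K z)) = (LINT t|?M. \<phi> t * G2 t)"
      using solution_scalar[OF w2 c2(1) T \<phi>, of z] by (elim exE conjE)
    have i: "integrable ?M (\<lambda>t. \<psi> t * (emb \<Omega> (c t) \<bullet> y))"
      if "is_continuous_rep \<Omega> w c" "\<psi> \<in> test_functions {0<..<T}" for w c \<psi> y
      by (intro integral_open_interval(1) continuous_intros test_cont[OF that(2)]
          continuous_on_subset[OF continuous_rep_emb[OF that(1)]]) auto
    note \<phi>'' = test_deriv[OF test_deriv[OF \<phi>]]
    have "(LINT t|?M. deriv (deriv \<phi>) t * (C t \<bullet> K z)) =
        (LINT t|?M. deriv (deriv \<phi>) t * (emb \<Omega> (c1 t) \<bullet> K z)) - (LINT t|?M. deriv (deriv \<phi>) t * (emb \<Omega> (c2 t) \<bullet> K z))"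
      using i[OF c1(1) \<phi>'', of "K z"] i[OF c2(1) \<phi>'', of "K z"]
      by (simp add: C_def inner_diff_left right_diff_distrib)
    also have "\<dots> = (LINT t|?M. \<phi> t * G1 t - \<phi> t * G2 t)" using G1(2) G2(2) by (simp add: G1(3) G2(3))
    also have "\<dots> = (LINT t|?M. \<phi> t * (emb \<Omega> (c2 t) \<bullet> z) - \<phi> t * (emb \<Omega> (c1 t) \<bullet> z))"
    proof (rule integral_cong_AE)
      show "(\<lambda>t. \<phi> t * G1 t - \<phi> t * G2 t) \<in> borel_measurable ?M"
        using G1(2) G2(2) by (intro borel_measurable_integrable Bochner_Integration.integrable_diff)
      show "(\<lambda>t. \<phi> t * (emb \<Omega> (c2 t) \<bullet> z) - \<phi> t * (emb \<Omega> (c1 t) \<bullet> z)) \<in> borel_measurable ?M"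
        by (intro borel_measurable_integrable Bochner_Integration.integrable_diff i[OF c1(1) \<phi>] i[OF c2(1) \<phi>])
      show "AE t in ?M. \<phi> t * G1 t - \<phi> t * G2 t = \<phi> t * (emb \<Omega> (c2 t) \<bullet> z) - \<phi> t * (emb \<Omega> (c1 t) \<bullet> z)"
        using G1(1) G2(1)
      proof eventually_elim
        case (elim t)
        show ?case unfolding elim by (simp add: right_diff_distrib)
      qed
    qed
    also have "\<dots> = - (LINT t|?M. \<phi> t * (C t \<bullet> z))"
      using i[OF c1(1) \<phi>, of z] i[OF c2(1) \<phi>, of z] by (simp add: C_def inner_diff_left right_diff_distrib)
    finally show "(LINT t|?M. deriv (deriv \<phi>) t * (C t \<bullet> K z)) = - (LINT t|?M. \<phi> t * (C t \<bullet> z))" .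
  qed
  have eq: "AE x in lebesgue_on \<Omega>. c1 t x = c2 t x" if t: "t > 0" for t
  proof -
    have L: "c1 t - c2 t \<in> L2 \<Omega>" using cL[of t] t by simp
    have Ce: "C t = emb \<Omega> (c1 t - c2 t)" using cL[of t] t by (simp add: C_def emb_diff')
    have "C t \<bullet> emb \<Omega> (c1 t - c2 t) = 0" by (rule K_kernel[OF zero[OF t] L])
    then have "norm (emb \<Omega> (c1 t - c2 t)) = 0" by (simp add: Ce)
    then have "AE x in lebesgue_on \<Omega>. (c1 t - c2 t) x = 0"
      using norm_emb[OF meas L] L2_norm_eq_0[OF L] by metis
    then show ?thesis by simp
  qed
  have "AE t in lebesgue_on {0<..}. AE x in lebesgue_on \<Omega>. c1 t x = w1 t x"
    "AE t in lebesgue_on {0<..}. AE x in lebesgue_on \<Omega>. c2 t x = w2 t x"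
    using c1(1) c2(1) by (auto simp: is_continuous_rep_def)
  moreover have "AE t in lebesgue_on {0::real<..}. t > 0" by (rule AE_I2) simp
  ultimately show ?thesis
  proof eventually_elim
    case (elim t)
    show ?case using elim(1,2) eq[OF elim(3)] by eventually_elim simp
  qed
qed

end

section \<open>Approximation of the right-hand side\<close>

text \<open>Cut \<open>E\<close> off at a large time, enclose the rest between a closed and an open set of nearly the same
measure, and separate these by Urysohn's lemma.\<close>

lemma indicator_approx_continuous:
  fixes E :: "real set"
  assumes E: "E \<in> sets lebesgue" "emeasure lebesgue E < \<infinity>" and d: "d > 0"
  obtains \<alpha> T where "continuous_on UNIV \<alpha>" "T \<ge> 0" "\<And>t. T \<le> t \<Longrightarrow> \<alpha> t = (0::real)"
    "integrable lebesgue (\<lambda>t. \<bar>indicator E t - \<alpha> t\<bar>)" "(LINT t|lebesgue. \<bar>indicator E t - \<alpha> t\<bar>) \<le> d"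
proof -
  define R where "R n = E \<inter> {real n<..}" for n
  have R: "R n \<in> lmeasurable" for n
  proof (rule fmeasurableI)
    show "R n \<in> sets lebesgue" unfolding R_def using E(1) by (intro sets.Int) simp_all
    have "emeasure lebesgue (R n) \<le> emeasure lebesgue E" by (rule emeasure_mono) (use E(1) in \<open>auto simp: R_def\<close>)
    then show "emeasure lebesgue (R n) < \<infinity>" using E(2) by (rule le_less_trans)
  qed
  have "(\<lambda>n. emeasure lebesgue (R n)) \<longlonglongrightarrow> emeasure lebesgue (\<Inter>n. R n)"
  proof (rule Lim_emeasure_decseq)
    show "decseq R" by (auto simp: decseq_def R_def)
    show "emeasure lebesgue (R n) \<noteq> \<infinity>" for n using fmeasurableD2[OF R] by simp
  qed (use R in \<open>auto simp: fmeasurable_def\<close>)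
  moreover have "(\<Inter>n. R n) = {}"
  proof -
    have "t \<notin> (\<Inter>n. R n)" for t
    proof -
      obtain n where "t < real n" using reals_Archimedean2 by blast
      then have "t \<notin> R n" by (simp add: R_def)
      then show ?thesis by blast
    qed
    then show ?thesis by blast
  qed
  ultimately have "(\<lambda>n. emeasure lebesgue (R n)) \<longlonglongrightarrow> 0" by simp
  then have "\<forall>\<^sub>F n in sequentially. emeasure lebesgue (R n) < ennreal (d / 4)"
    by (rule order_tendstoD(2)) (use d in simp)
  then obtain n where n: "emeasure lebesgue (R n) < ennreal (d / 4)" by (auto simp: eventually_sequentially)
  define F where "F = E \<inter> {..real n}"
  have F: "F \<in> sets lebesgue" using E by (auto simp: F_def)
  obtain S where S: "closed S" "S \<subseteq> F" "F - S \<in> lmeasurable" "emeasure lebesgue (F - S) < ennreal (d / 4)"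
    using sets_lebesgue_inner_closed[OF F, of "d/4"] d by auto
  obtain U where U: "open U" "F \<subseteq> U" "U - F \<in> lmeasurable" "emeasure lebesgue (U - F) < ennreal (d / 4)"
    using sets_lebesgue_outer_open[OF F, of "d/4"] d by auto
  define U' where "U' = U \<inter> {..<real n + 1}"
  have U': "open U'" "F \<subseteq> U'" using U by (auto simp: U'_def F_def)
  obtain \<alpha> :: "real \<Rightarrow> real" where \<alpha>: "continuous_on UNIV \<alpha>" "\<And>t. \<alpha> t \<in> closed_segment 1 0"
    "\<And>t. t \<in> S \<Longrightarrow> \<alpha> t = 1" "\<And>t. t \<in> - U' \<Longrightarrow> \<alpha> t = 0"
    by (rule Urysohn[of S "- U'" "1::real" 0]) (use S U' in auto)
  have \<alpha>01: "0 \<le> \<alpha> t" "\<alpha> t \<le> 1" for t using \<alpha>(2)[of t] by (auto simp: closed_segment_eq_real_ivl)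
  let ?h = "\<lambda>t. indicator (R n) t + indicator (F - S) t + indicator (U - F) t :: real"
  have le: "\<bar>indicator E t - \<alpha> t\<bar> \<le> ?h t" for t
  proof -
    consider "t \<in> S" | "t \<notin> U'" | "t \<in> U'" "t \<notin> S" "t \<in> F" | "t \<in> U'" "t \<notin> S" "t \<notin> F" by blast
    then show ?thesis
    proof cases
      case 1
      then have "t \<in> E" using S(2) by (auto simp: F_def)
      then show ?thesis using \<alpha>(3)[OF 1] by simp
    next
      case 2
      then have "t \<in> E \<Longrightarrow> t \<in> R n" using U'(2) by (auto simp: F_def R_def)
      then show ?thesis using \<alpha>(4)[of t] 2 by (auto simp: indicator_def)
    next
      case 3
      then have "\<bar>indicator E t - \<alpha> t\<bar> \<le> 1" using \<alpha>01[of t] by (auto simp: indicator_def)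
      then show ?thesis using 3 by (auto simp: indicator_def)
    next
      case 4
      then have "\<bar>indicator E t - \<alpha> t\<bar> \<le> 1" using \<alpha>01[of t] by (auto simp: indicator_def)
      then show ?thesis using 4 by (auto simp: indicator_def U'_def)
    qed
  qed
  have mle: "measure lebesgue A \<le> d / 4" if "A \<in> lmeasurable" "emeasure lebesgue A < ennreal (d / 4)" for A :: "real set"
    using that emeasure_eq_measure2[OF that(1)] d by (simp add: ennreal_less_iff)
  have ih: "integrable lebesgue ?h"
    using R[of n] S(3) U(3)
    by (intro Bochner_Integration.integrable_add integrable_real_indicator) (auto simp: fmeasurable_def)
  have im: "(\<lambda>t. \<bar>indicator E t - \<alpha> t\<bar>) \<in> borel_measurable lebesgue"
  proof (rule borel_measurable_abs, rule borel_measurable_diff)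
    show "(indicator E :: real \<Rightarrow> real) \<in> borel_measurable lebesgue" using E(1) by (rule borel_measurable_indicator)
    show "\<alpha> \<in> borel_measurable lebesgue"
      by (rule measurable_completion) (simp add: borel_measurable_continuous_onI[OF \<alpha>(1)])
  qed
  show ?thesis
  proof (rule that[of \<alpha> "real n + 1"])
    show "continuous_on UNIV \<alpha>" by (rule \<alpha>)
    show "\<alpha> t = 0" if "real n + 1 \<le> t" for t using that by (intro \<alpha>(4)) (simp add: U'_def)
    show i: "integrable lebesgue (\<lambda>t. \<bar>indicator E t - \<alpha> t\<bar>)"
      by (rule Bochner_Integration.integrable_bound[OF ih im]) (use le in \<open>auto intro!: AE_I2 order_trans[OF le]\<close>)
    have "(LINT t|lebesgue. \<bar>indicator E t - \<alpha> t\<bar>) \<le> (LINT t|lebesgue. ?h t)"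
      by (rule integral_mono[OF i ih le])
    also have "\<dots> = measure lebesgue (R n) + measure lebesgue (F - S) + measure lebesgue (U - F)"
    proof -
      have i: "integrable lebesgue (indicator (R n) :: real \<Rightarrow> real)" "integrable lebesgue (indicator (F - S) :: real \<Rightarrow> real)"
        "integrable lebesgue (indicator (U - F) :: real \<Rightarrow> real)"
        using R[of n] S(3) U(3) by (auto intro!: integrable_real_indicator simp: fmeasurable_def)
      show ?thesis
        unfolding Bochner_Integration.integral_add[OF Bochner_Integration.integrable_add[OF i(1,2)] i(3)]
          Bochner_Integration.integral_add[OF i(1,2)]
        by simp
    qed
    also have "\<dots> \<le> d" using mle[OF R n] mle[OF S(3,4)] mle[OF U(3,4)] d by simp
    finally show "(LINT t|lebesgue. \<bar>indicator E t - \<alpha> t\<bar>) \<le> d" .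
  qed simp
qed


context positive_operator
begin

text \<open>Approximability in \<open>L\<^sup>1(0, \<infinity>)\<close> by functions \<open>K\<^sup>2 g\<close>. The error is bounded by an integrable function
\<open>H\<close> rather than required to be integrable, which spares the measurability of \<open>h\<close>.\<close>

definition approximable :: "(real \<Rightarrow> 'h) \<Rightarrow> bool" where
  "approximable h \<longleftrightarrow> (\<forall>e>0. \<exists>g T H. continuous_on UNIV g \<and> T \<ge> 0 \<and> (\<forall>t\<ge>T. g t = 0) \<and>
     integrable (lebesgue_on {0<..}) H \<and> (LINT t|lebesgue_on {0<..}. H t) \<le> e \<and>
     (AE t in lebesgue_on {0<..}. norm (K (K (g t)) - h t) \<le> H t))"

lemma approximable_zero: "approximable (\<lambda>t. 0)"
  unfolding approximable_def
proof (intro allI impI)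
  fix e :: real assume "e > 0"
  show "\<exists>g T H. continuous_on UNIV g \<and> T \<ge> 0 \<and> (\<forall>t\<ge>T. g t = 0) \<and>
     integrable (lebesgue_on {0::real<..}) H \<and> (LINT t|lebesgue_on {0::real<..}. H t) \<le> e \<and>
     (AE t in lebesgue_on {0::real<..}. norm (K (K (g t)) - 0) \<le> H t)"
    by (rule exI[of _ "\<lambda>_. 0"], rule exI[of _ 0], rule exI[of _ "\<lambda>_. 0"])
      (use \<open>e > 0\<close> in \<open>simp add: K.zero\<close>)
qed

lemma approximable_add:
  assumes h: "approximable h" and k: "approximable k" shows "approximable (\<lambda>t. h t + k t)"
  unfolding approximable_def
proof (intro allI impI)
  fix e :: real assume e: "e > 0"
  let ?M = "lebesgue_on {0::real<..}"
  have e2: "e / 2 > 0" using e by simp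
  obtain g T H where g: "continuous_on UNIV g" "T \<ge> 0" "\<forall>t\<ge>T. g t = 0" "integrable ?M H"
    "(LINT t|?M. H t) \<le> e / 2" "AE t in ?M. norm (K (K (g t)) - h t) \<le> H t"
    using h[unfolded approximable_def, rule_format, OF e2] by (elim exE conjE)
  obtain g' T' H' where g': "continuous_on UNIV g'" "T' \<ge> 0" "\<forall>t\<ge>T'. g' t = 0" "integrable ?M H'"
    "(LINT t|?M. H' t) \<le> e / 2" "AE t in ?M. norm (K (K (g' t)) - k t) \<le> H' t"
    using k[unfolded approximable_def, rule_format, OF e2] by (elim exE conjE)
  show "\<exists>g T H. continuous_on UNIV g \<and> T \<ge> 0 \<and> (\<forall>t\<ge>T. g t = 0) \<and>
     integrable ?M H \<and> (LINT t|?M. H t) \<le> e \<and> (AE t in ?M. norm (K (K (g t)) - (h t + k t)) \<le> H t)"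
  proof (rule exI[of _ "\<lambda>t. g t + g' t"], rule exI[of _ "max T T'"], rule exI[of _ "\<lambda>t. H t + H' t"], intro conjI)
    show "continuous_on UNIV (\<lambda>t. g t + g' t)" by (intro continuous_intros g g')
    show "0 \<le> max T T'" using g(2) by simp
    show "\<forall>t\<ge>max T T'. g t + g' t = 0" using g(3) g'(3) by simp
    show "integrable ?M (\<lambda>t. H t + H' t)" using g(4) g'(4) by simp
    show "(LINT t|?M. H t + H' t) \<le> e" using g(4,5) g'(4,5) by simp
    show "AE t in ?M. norm (K (K (g t + g' t)) - (h t + k t)) \<le> H t + H' t"
      using g(6) g'(6)
    proof eventually_elim
      case (elim t)
      have eq: "K (K (g t + g' t)) - (h t + k t) = (K (K (g t)) - h t) + (K (K (g' t)) - k t)"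
        by (simp add: K.add)
      show ?case
        unfolding eq using elim norm_triangle_ineq[of "K (K (g t)) - h t" "K (K (g' t)) - k t"] by simp
    qed
  qed
qed

lemma approximable_sum:
  "finite A \<Longrightarrow> (\<And>i. i \<in> A \<Longrightarrow> approximable (h i)) \<Longrightarrow> approximable (\<lambda>t. \<Sum>i\<in>A. h i t)"
proof (induction A rule: finite_induct)
  case (insert i A)
  then show ?case using approximable_add[of "h i" "\<lambda>t. \<Sum>i\<in>A. h i t"] by simp
qed (simp add: approximable_zero)

lemma approximable_indicator:
  assumes ker: "\<And>q. K q = 0 \<Longrightarrow> q \<bullet> h = 0"
    and E: "E \<in> sets lebesgue" "emeasure lebesgue E < \<infinity>"
  shows "approximable (\<lambda>t. indicator E t *\<^sub>R h)"
  unfolding approximable_def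
proof (intro allI impI)
  fix e :: real assume e: "e > 0"
  let ?M = "lebesgue_on {0::real<..}"
  let ?m = "measure lebesgue E"
  define d where "d = e / (2 * (?m + 1))"
  have m1: "?m + 1 > 0" using measure_nonneg[of lebesgue E] by linarith
  have d: "d > 0" "?m * d \<le> e / 2"
  proof -
    show "d > 0" using e m1 by (simp add: d_def)
    then have "?m * d \<le> (?m + 1) * d" by (intro mult_right_mono) simp_all
    also have "\<dots> = e / 2" using m1 by (simp add: d_def field_simps)
    finally show "?m * d \<le> e / 2" .
  qed
  obtain g where g: "norm (h - K (K g)) < d" using range_square_approximates[OF ker d(1)] by blast
  let ?n = "norm (K (K g))"
  define d' where "d' = e / (2 * (?n + 1))"
  have n1: "?n + 1 > 0" using norm_ge_zero[of "K (K g)"] by linarith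
  have d': "d' > 0" "d' * ?n \<le> e / 2"
  proof -
    show "d' > 0" using e n1 by (simp add: d'_def)
    then have "d' * ?n \<le> d' * (?n + 1)" by (intro mult_left_mono) simp_all
    also have "\<dots> = e / 2" using n1 by (simp add: d'_def field_simps)
    finally show "d' * ?n \<le> e / 2" .
  qed
  obtain \<alpha> T where \<alpha>: "continuous_on UNIV \<alpha>" "T \<ge> 0" "\<And>t. T \<le> t \<Longrightarrow> \<alpha> t = (0::real)"
    "integrable lebesgue (\<lambda>t. \<bar>indicator E t - \<alpha> t\<bar>)" "(LINT t|lebesgue. \<bar>indicator E t - \<alpha> t\<bar>) \<le> d'"
    by (rule indicator_approx_continuous[OF E d'(1)]) (rule that; assumption)
  define H where "H t = \<bar>indicator E t - \<alpha> t\<bar> * ?n + indicator E t * d" for t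
  have iE: "integrable lebesgue (indicator E :: real \<Rightarrow> real)" using E by (rule integrable_real_indicator)
  have H0: "0 \<le> H t" for t using d(1) by (simp add: H_def)
  have iH: "integrable lebesgue H"
    unfolding H_def using \<alpha>(4) iE by (intro Bochner_Integration.integrable_add integrable_mult_left) simp_all
  have "(LINT t|lebesgue. H t) = (LINT t|lebesgue. \<bar>indicator E t - \<alpha> t\<bar>) * ?n + ?m * d"
    unfolding H_def using \<alpha>(4) iE by simp
  also have "\<dots> \<le> e" using mult_right_mono[OF \<alpha>(5), of ?n] d(2) d'(2) by simp
  finally have Hle: "(LINT t|lebesgue. H t) \<le> e" .
  have iH': "integrable lebesgue (\<lambda>t. indicator {0<..} t *\<^sub>R H t)"
    by (rule integrable_mult_indicator[OF _ iH]) simp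
  have iM: "integrable ?M H" using iH' by (simp add: integrable_restrict_space)
  have "(LINT t|?M. H t) = (LINT t|lebesgue. indicator {0<..} t *\<^sub>R H t)" by (simp add: integral_restrict_space)
  also have "\<dots> \<le> (LINT t|lebesgue. H t)"
    by (rule integral_mono[OF iH' iH]) (simp add: H0 indicator_def)
  finally have HM: "(LINT t|?M. H t) \<le> e" using Hle by linarith
  have bound: "norm (K (K (\<alpha> t *\<^sub>R g)) - indicator E t *\<^sub>R h) \<le> H t" for t
  proof -
    have "K (K (\<alpha> t *\<^sub>R g)) - indicator E t *\<^sub>R h =
        (\<alpha> t - indicator E t) *\<^sub>R K (K g) - (indicator E t :: real) *\<^sub>R (h - K (K g))"
      by (simp add: K.scaleR scaleR_diff_left scaleR_diff_right)
    also have "norm \<dots> \<le> norm ((\<alpha> t - indicator E t) *\<^sub>R K (K g)) + norm ((indicator E t :: real) *\<^sub>R (h - K (K g)))"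
      by (rule norm_triangle_ineq4)
    also have "\<dots> \<le> H t"
      unfolding H_def norm_scaleR abs_minus_commute[of "\<alpha> t"]
      using g by (intro add_mono order_refl) (simp add: indicator_def)
    finally show ?thesis .
  qed
  show "\<exists>g T H. continuous_on UNIV g \<and> T \<ge> 0 \<and> (\<forall>t\<ge>T. g t = 0) \<and>
     integrable ?M H \<and> (LINT t|?M. H t) \<le> e \<and> (AE t in ?M. norm (K (K (g t)) - indicator E t *\<^sub>R h) \<le> H t)"
  proof (rule exI[of _ "\<lambda>t. \<alpha> t *\<^sub>R g"], rule exI[of _ T], rule exI[of _ H], intro conjI)
    show "continuous_on UNIV (\<lambda>t. \<alpha> t *\<^sub>R g)" by (intro continuous_intros \<alpha>)
    show "\<forall>t\<ge>T. \<alpha> t *\<^sub>R g = 0" using \<alpha>(3) by simp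
    show "AE t in ?M. norm (K (K (\<alpha> t *\<^sub>R g)) - indicator E t *\<^sub>R h) \<le> H t" by (rule AE_I2[OF bound])
  qed (rule \<alpha> iM HM)+
qed

end

context elliptic
begin

lemma approximable_simple:
  fixes s :: "real \<Rightarrow> real^'n \<Rightarrow> real"
  assumes s: "Bochner_Integration.simple_bochner_integrable (lebesgue_on {0<..}) s"
    and L: "\<And>t. t \<in> {0<..} \<Longrightarrow> s t \<in> L2 \<Omega>"
  shows "\<exists>h. approximable h \<and> (\<forall>t>0. h t = emb \<Omega> (s t))"
proof -
  let ?M = "lebesgue_on {0::real<..}"
  let ?Y = "s ` {0<..} - {0}"
  define E where "E y = {t \<in> {0<..}. s t = y}" for y
  define h where "h t = (\<Sum>y\<in>?Y. indicator (E y) t *\<^sub>R emb \<Omega> y)" for t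
  have sf: "simple_function ?M s" and fin: "emeasure ?M {t \<in> space ?M. s t \<noteq> 0} \<noteq> \<infinity>"
    using s by (auto simp: Bochner_Integration.simple_bochner_integrable.simps)
  have fY: "finite ?Y" using sf by (simp add: simple_function_def)
  have "approximable h"
    unfolding h_def
  proof (rule approximable_sum[OF fY])
    fix y assume y: "y \<in> ?Y"
    have EM: "E y \<in> sets ?M"
    proof -
      have "s -` {y} \<inter> space ?M \<in> sets ?M" by (rule simple_functionD(2)[OF sf])
      moreover have "s -` {y} \<inter> space ?M = E y" by (auto simp: E_def)
      ultimately show ?thesis by simp
    qed
    have "{t \<in> space ?M. s t \<noteq> 0} = s -` (- {0}) \<inter> space ?M" by blast
    then have "{t \<in> space ?M. s t \<noteq> 0} \<in> sets ?M" using simple_functionD(2)[OF sf] by (simp only:)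
    then have "emeasure ?M (E y) \<le> emeasure ?M {t \<in> space ?M. s t \<noteq> 0}"
      using y by (intro emeasure_mono) (auto simp: E_def)
    moreover have "emeasure ?M (E y) = emeasure lebesgue (E y)"
      by (rule emeasure_restrict_space) (auto simp: E_def)
    ultimately have "emeasure lebesgue (E y) < \<infinity>" using fin by (simp add: less_top top.not_eq_extremum le_less_trans)
    moreover have "E y \<in> sets lebesgue" using EM by (simp add: sets_restrict_space_iff)
    moreover have "q \<bullet> emb \<Omega> y = 0" if "K q = 0" for q using y L by (intro K_kernel[OF that]) auto
    ultimately show "approximable (\<lambda>t. indicator (E y) t *\<^sub>R emb \<Omega> y)" by (intro approximable_indicator)
  qed
  moreover have "h t = emb \<Omega> (s t)" if t: "t > 0" for t
  proof (cases "s t = 0")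
    case True
    then have "h t = 0" unfolding h_def by (intro sum.neutral) (auto simp: E_def)
    moreover have "emb \<Omega> (s t) = 0" using emb_scaleR[OF meas, of 0 0] True by simp
    ultimately show ?thesis by simp
  next
    case False
    have "h t = (\<Sum>y\<in>?Y. if y = s t then emb \<Omega> y else 0)"
      unfolding h_def using t by (intro sum.cong refl) (auto simp: E_def)
    also have "\<dots> = emb \<Omega> (s t)" using fY False t by (subst sum.delta) auto
    finally show ?thesis .
  qed
  ultimately show ?thesis by blast
qed

text \<open>Approximate \<open>f\<close> by simple functions, their values by elements of the range of \<open>K\<^sup>2\<close>, and the
indicator functions of their level sets by continuous functions of bounded support.\<close>

theorem approximable_rhs:
  assumes f: "f \<in> bochner_Lp 1 {0<..} (L2 \<Omega>) (L2_norm \<Omega>)"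
  shows "approximable (\<lambda>t. emb \<Omega> (f t))"
  unfolding approximable_def
proof (intro allI impI)
  fix e :: real assume e: "e > 0"
  let ?M = "lebesgue_on {0::real<..}"
  have I: "{0::real<..} \<in> sets lebesgue" by simp
  have sm: "strongly_measurable_on {0<..} (L2 \<Omega>) (L2_norm \<Omega>) f"
    and int: "integrable ?M (\<lambda>t. L2_norm \<Omega> (f t))" using f by (simp_all add: bochner_Lp_def)
  obtain s where s: "\<And>k::nat. Bochner_Integration.simple_bochner_integrable ?M (s k)"
    "\<And>k t. t \<in> {0<..} \<Longrightarrow> s k t \<in> L2 \<Omega>" "\<And>k. integrable ?M (\<lambda>t. L2_norm \<Omega> (s k t - f t))"
    "(\<lambda>k. LINT t|?M. L2_norm \<Omega> (s k t - f t)) \<longlonglongrightarrow> 0"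
    by (rule L2n.simple_truncation[OF I sm int]) (rule that; assumption)
  have e2: "e / 2 > 0" using e by simp
  have "\<forall>\<^sub>F k in sequentially. (LINT t|?M. L2_norm \<Omega> (s k t - f t)) < e / 2"
    by (rule order_tendstoD(2)[OF s(4) e2])
  then obtain k where k: "(LINT t|?M. L2_norm \<Omega> (s k t - f t)) < e / 2" by (auto simp: eventually_sequentially)
  obtain h where h: "approximable h" "\<And>t. t > 0 \<Longrightarrow> h t = emb \<Omega> (s k t)"
    using approximable_simple[OF s(1,2)] by blast
  obtain g T H where g: "continuous_on UNIV g" "T \<ge> 0" "\<forall>t\<ge>T. g t = 0" "integrable ?M H"
    "(LINT t|?M. H t) \<le> e / 2" "AE t in ?M. norm (K (K (g t)) - h t) \<le> H t"
    using h(1)[unfolded approximable_def, rule_format, OF e2] by (elim exE conjE)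
  show "\<exists>g T H. continuous_on UNIV g \<and> T \<ge> 0 \<and> (\<forall>t\<ge>T. g t = 0) \<and>
     integrable ?M H \<and> (LINT t|?M. H t) \<le> e \<and> (AE t in ?M. norm (K (K (g t)) - emb \<Omega> (f t)) \<le> H t)"
  proof (rule exI[of _ g], rule exI[of _ T], rule exI[of _ "\<lambda>t. H t + L2_norm \<Omega> (s k t - f t)"], intro conjI)
    show "integrable ?M (\<lambda>t. H t + L2_norm \<Omega> (s k t - f t))" using g(4) s(3) by simp
    show "(LINT t|?M. H t + L2_norm \<Omega> (s k t - f t)) \<le> e" using g(4,5) s(3)[of k] k by simp
    have fL: "AE t in ?M. f t \<in> L2 \<Omega>" using sm by (simp add: strongly_measurable_on_def)
    show "AE t in ?M. norm (K (K (g t)) - emb \<Omega> (f t)) \<le> H t + L2_norm \<Omega> (s k t - f t)"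
      using g(6) fL L2n.AE_in_I[OF I]
    proof eventually_elim
      case (elim t)
      have "L2_norm \<Omega> (s k t - f t) = norm (h t - emb \<Omega> (f t))"
        using s(2)[of t k] elim by (simp add: h(2) emb_diff'[symmetric] norm_emb[OF meas])
      then show ?case using elim(1) norm_triangle_ineq[of "K (K (g t)) - h t" "h t - emb \<Omega> (f t)"] by simp
    qed
  qed (rule g)+
qed

end

section \<open>Continuous functions of time and passage to the limit\<close>

context seminormed_space
begin

lemma continuous_N:
  assumes X: "\<And>t. t \<ge> 0 \<Longrightarrow> u t \<in> X"
    and c: "\<And>t. t \<ge> 0 \<Longrightarrow> ((\<lambda>s. N (u s - u t)) \<longlongrightarrow> 0) (at t within {0..})"
  shows "continuous_on {0::real..} (\<lambda>t. N (u t))"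
  unfolding continuous_on_def
proof
  fix t :: real assume t: "t \<in> {0..}"
  show "((\<lambda>s. N (u s)) \<longlongrightarrow> N (u t)) (at t within {0..})"
  proof (rule LIM_zero_cancel, rule Lim_null_comparison)
    show "\<forall>\<^sub>F s in at t within {0..}. norm (N (u s) - N (u t)) \<le> N (u s - u t)"
      using X t N_reverse unfolding eventually_at_filter by (intro always_eventually) auto
  qed (use c t in auto)
qed

lemma continuous_bochner:
  assumes X: "\<And>t. t \<ge> 0 \<Longrightarrow> u t \<in> X"
    and c: "\<And>t. t \<ge> 0 \<Longrightarrow> ((\<lambda>s. N (u s - u t)) \<longlongrightarrow> 0) (at t within {0..})"
  shows "u \<in> bochner_Linf {0<..<T} X N" "u \<in> bochner_Lp p {0<..<T} X N"
proof -
  have sm: "strongly_measurable_on {0<..<T} X N u" by (rule strongly_measurable_continuous[OF X c])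
  have cN: "continuous_on {0..T} (\<lambda>t. N (u t))"
    by (rule continuous_on_subset[OF continuous_N[OF X c]]) auto
  have "integrable (lebesgue_on {0<..<T}) (\<lambda>t. N (u t) ^ p)"
    by (intro integral_open_interval(1) continuous_on_power cN)
  then show "u \<in> bochner_Lp p {0<..<T} X N" using sm by (simp add: bochner_Lp_def)
  have "compact ((\<lambda>t. N (u t)) ` {0..T})" by (rule compact_continuous_image[OF cN]) simp
  then obtain C where C: "\<And>t. t \<in> {0..T} \<Longrightarrow> \<bar>N (u t)\<bar> \<le> C"
    by (metis bounded_iff compact_imp_bounded image_eqI real_norm_def)
  have "AE t in lebesgue_on {0<..<T}. N (u t) \<le> C"
  proof (rule AE_I2)
    fix t assume "t \<in> space (lebesgue_on {0<..<T})"
    then show "N (u t) \<le> C" using C[of t] by simp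
  qed
  then show "u \<in> bochner_Linf {0<..<T} X N" using sm unfolding bochner_Linf_def by blast
qed

lemma functional_integrable:
  assumes I: "I \<in> sets lebesgue" and u: "strongly_measurable_on I X N u"
    and int: "integrable (lebesgue_on I) (\<lambda>t. N (u t))" and l: "bounded_functional l"
  shows "integrable (lebesgue_on I) (\<lambda>t. l (u t))"
proof -
  obtain C where C: "C \<ge> 0" "\<And>x. x \<in> X \<Longrightarrow> \<bar>l x\<bar> \<le> C * N x" using bounded_functional_bound[OF l] by blast
  have uX: "AE t in lebesgue_on I. u t \<in> X" using u by (simp add: strongly_measurable_on_def)
  show ?thesis
  proof (rule Bochner_Integration.integrable_bound)
    show "integrable (lebesgue_on I) (\<lambda>t. C * N (u t))" using int by simp
    show "(\<lambda>t. l (u t)) \<in> borel_measurable (lebesgue_on I)" by (rule strongly_measurable_functional[OF I u l])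
    show "AE t in lebesgue_on I. norm (l (u t)) \<le> norm (C * N (u t))"
      using uX
    proof eventually_elim
      case (elim t)
      show ?case using C(2)[OF elim] by simp
    qed
  qed
qed

text \<open>The rate \<open>r\<close> does not depend on \<open>t\<close>, so the limit inherits the continuity in time.\<close>

lemma uniform_limit_exists:
  assumes comp: "complete_in X N" and X: "\<And>k t. t \<ge> 0 \<Longrightarrow> x k t \<in> X"
    and C: "\<And>j k t. k \<le> j \<Longrightarrow> t \<ge> 0 \<Longrightarrow> N (x j t - x k t) \<le> r k" and r: "r \<longlonglongrightarrow> 0"
    and c: "\<And>k t. t \<ge> 0 \<Longrightarrow> ((\<lambda>s. N (x k s - x k t)) \<longlongrightarrow> 0) (at t within {0..})"
  shows "\<exists>u. (\<forall>t\<ge>0. u t \<in> X \<and> (\<forall>k. N (x k t - u t) \<le> r k)) \<and>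
    (\<forall>t::real\<ge>0. ((\<lambda>s. N (u s - u t)) \<longlongrightarrow> 0) (at t within {0..}))"
proof -
  have "\<exists>l. l \<in> X \<and> (\<forall>k. N (x k t - l) \<le> r k)" if t: "t \<ge> 0" for t
  proof -
    obtain l where l: "l \<in> X" "(\<lambda>j. N (x j t - l)) \<longlonglongrightarrow> 0"
    proof (rule complete_inD[OF comp, of "\<lambda>k. x k t"])
      fix e :: real assume e: "e > 0"
      have "\<forall>\<^sub>F k in sequentially. r k < e / 2" by (rule order_tendstoD(2)[OF r]) (use e in simp)
      then obtain M where M: "r M < e / 2" by (auto simp: eventually_sequentially)
      have "N (x i t - x j t) < e" if "i \<ge> M" "j \<ge> M" for i j
        using N_triangle[OF X[OF t] X[OF t] X[OF t], of i j M] C[OF that(1) t] C[OF that(2) t]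
          N_commute[OF X[OF t] X[OF t], of M j] M by linarith
      then show "\<exists>M. \<forall>i\<ge>M. \<forall>j\<ge>M. N (x i t - x j t) < e" by blast
    qed (use X t in auto)
    have "N (x k t - l) \<le> r k" for k
    proof (rule LIMSEQ_le_const)
      show "(\<lambda>j. r k + N (x j t - l)) \<longlonglongrightarrow> r k" using tendsto_add[OF tendsto_const l(2), of "r k"] by simp
      have "N (x k t - l) \<le> r k + N (x j t - l)" if "j \<ge> k" for j
        using N_triangle[OF X[OF t] X[OF t] l(1), of k j] C[OF that t] N_commute[OF X[OF t] X[OF t], of k j] by linarith
      then show "\<exists>N'. \<forall>j\<ge>N'. N (x k t - l) \<le> r k + N (x j t - l)" by blast
    qed
    then show ?thesis using l(1) by blast
  qed
  then have "\<forall>t. \<exists>l. t \<ge> 0 \<longrightarrow> l \<in> X \<and> (\<forall>k. N (x k t - l) \<le> r k)" by blast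
  then obtain u where u: "\<And>t. t \<ge> 0 \<Longrightarrow> u t \<in> X" "\<And>t k. t \<ge> 0 \<Longrightarrow> N (x k t - u t) \<le> r k" by metis
  have "((\<lambda>s. N (u s - u t)) \<longlongrightarrow> 0) (at t within {0..})" if t: "t \<ge> 0" for t :: real
  proof (rule tendstoI)
    fix e :: real assume e: "e > 0"
    have "\<forall>\<^sub>F k in sequentially. r k < e / 3" by (rule order_tendstoD(2)[OF r]) (use e in simp)
    then obtain k where k: "r k < e / 3" by (auto simp: eventually_sequentially)
    have "\<forall>\<^sub>F s in at t within {0..}. N (x k s - x k t) < e / 3"
      by (rule order_tendstoD(2)[OF c[OF t]]) (use e in simp)
    moreover have "\<forall>\<^sub>F s in at t within {0..}. s \<in> {0..}" by (simp add: eventually_at_filter)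
    ultimately show "\<forall>\<^sub>F s in at t within {0..}. dist (N (u s - u t)) 0 < e"
    proof eventually_elim
      case (elim s)
      then have s: "s \<ge> 0" by simp
      have "N (u s - u t) \<le> N (u s - x k s) + (N (x k s - x k t) + N (x k t - u t))"
        using N_triangle[OF u(1)[OF s] X[OF s] u(1)[OF t], of k]
          N_triangle[OF X[OF s] X[OF t] u(1)[OF t], of k k] by linarith
      also have "N (u s - x k s) = N (x k s - u s)" by (rule N_commute[OF u(1)[OF s] X[OF s]])
      finally have "N (u s - u t) < e" using u(2)[OF s, of k] u(2)[OF t, of k] k elim(1) by linarith
      then show ?case using N_nonneg[OF mem_diff[OF u(1)[OF s] u(1)[OF t]]] by simp
    qed
  qed
  then show ?thesis using u by (intro exI[of _ u]) blast
qed

end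

lemma test_integral_limit:
  fixes G :: "real \<Rightarrow> real" and T :: real
  defines "M \<equiv> lebesgue_on {0<..<T}"
  assumes \<psi>: "\<psi> \<in> test_functions {0<..<T}" and G': "\<And>k. continuous_on {0..T} (G' k)" and G: "integrable M G"
    and p: "\<And>k::nat. integrable M (p k)" "(\<lambda>k. LINT t|M. p k t) \<longlonglongrightarrow> 0" "\<And>k. AE t in M. \<bar>G' k t - G t\<bar> \<le> p k t"
  shows "(\<lambda>k. LINT t|M. \<psi> t * G' k t) \<longlonglongrightarrow> (LINT t|M. \<psi> t * G t)"
proof -
  obtain C where C: "C \<ge> 0" "\<And>x. \<bar>\<psi> x\<bar> \<le> C" using test_bounded[OF \<psi>] by blast
  have iG': "integrable M (\<lambda>t. \<psi> t * G' k t)" for k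
    unfolding M_def by (intro integral_open_interval(1) continuous_intros test_cont[OF \<psi>] G')
  have iG: "integrable M (\<lambda>t. \<psi> t * G t)"
  proof (rule Bochner_Integration.integrable_bound)
    show "integrable M (\<lambda>t. C * G t)" using G by simp
    have "\<psi> \<in> borel_measurable M"
      unfolding M_def using test_measurable[OF \<psi>] by (intro measurable_restrict_space1 measurable_completion) simp
    then show "(\<lambda>t. \<psi> t * G t) \<in> borel_measurable M" using G by simp
    show "AE t in M. norm (\<psi> t * G t) \<le> norm (C * G t)"
    proof (rule AE_I2)
      fix t
      have "\<bar>\<psi> t\<bar> * \<bar>G t\<bar> \<le> C * \<bar>G t\<bar>" by (rule mult_right_mono[OF C(2)]) simp
      then show "norm (\<psi> t * G t) \<le> norm (C * G t)" using C(1) by (simp add: abs_mult)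
    qed
  qed
  show ?thesis
  proof (rule LIM_zero_cancel, rule Lim_null_comparison)
    show "\<forall>\<^sub>F k in sequentially. norm ((LINT t|M. \<psi> t * G' k t) - (LINT t|M. \<psi> t * G t)) \<le> C * (LINT t|M. p k t)"
    proof (intro always_eventually allI)
      fix k
      have "(LINT t|M. \<psi> t * G' k t) - (LINT t|M. \<psi> t * G t) = (LINT t|M. \<psi> t * G' k t - \<psi> t * G t)"
        using iG iG' by simp
      also have "norm \<dots> \<le> (LINT t|M. norm (\<psi> t * G' k t - \<psi> t * G t))" by (rule integral_norm_bound)
      also have "\<dots> \<le> (LINT t|M. C * p k t)"
      proof (rule integral_mono_AE)
        show "integrable M (\<lambda>t. norm (\<psi> t * G' k t - \<psi> t * G t))" using iG iG' by (intro integrable_norm) simp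
        show "integrable M (\<lambda>t. C * p k t)" using p(1) by simp
        show "AE t in M. norm (\<psi> t * G' k t - \<psi> t * G t) \<le> C * p k t"
          using p(3)[of k]
        proof eventually_elim
          case (elim t)
          have "norm (\<psi> t * G' k t - \<psi> t * G t) = \<bar>\<psi> t\<bar> * \<bar>G' k t - G t\<bar>"
            by (simp add: right_diff_distrib flip: abs_mult)
          also have "\<dots> \<le> C * p k t" using C elim by (intro mult_mono) auto
          finally show ?case .
        qed
      qed
      finally show "norm ((LINT t|M. \<psi> t * G' k t) - (LINT t|M. \<psi> t * G t)) \<le> C * (LINT t|M. p k t)" by simp
    qed
    show "(\<lambda>k. C * (LINT t|M. p k t)) \<longlonglongrightarrow> 0" using tendsto_mult_left[OF p(2), of C] by simp
  qed
qed

text \<open>The classical formula holds along the sequence, and both sides converge when the functions and their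
derivatives converge in \<open>L\<^sup>1\<close>.\<close>

lemma weak_derivative_limit:
  fixes F G :: "real \<Rightarrow> real" and T :: real
  defines "M \<equiv> lebesgue_on {0<..<T}"
  assumes T: "0 \<le> T" and \<phi>: "\<phi> \<in> test_functions {0<..<T}"
    and d: "\<And>k t. t \<in> {0..T} \<Longrightarrow> (F' k has_real_derivative G' k t) (at t within {0..T})"
    and G': "\<And>k. continuous_on {0..T} (G' k)" and F: "integrable M F" and G: "integrable M G"
    and p: "\<And>k::nat. integrable M (p k)" "(\<lambda>k. LINT t|M. p k t) \<longlonglongrightarrow> 0" "\<And>k. AE t in M. \<bar>F' k t - F t\<bar> \<le> p k t"
    and q: "\<And>k::nat. integrable M (q k)" "(\<lambda>k. LINT t|M. q k t) \<longlonglongrightarrow> 0" "\<And>k. AE t in M. \<bar>G' k t - G t\<bar> \<le> q k t"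
  shows "(LINT t|M. deriv \<phi> t * F t) = - (LINT t|M. \<phi> t * G t)"
proof -
  have F': "continuous_on {0..T} (F' k)" for k
    using d by (meson DERIV_continuous continuous_on_eq_continuous_within)
  have "(\<lambda>k. LINT t|M. deriv \<phi> t * F' k t) \<longlonglongrightarrow> (LINT t|M. deriv \<phi> t * F t)"
    using F p unfolding M_def by (intro test_integral_limit[where p = p] test_deriv[OF \<phi>] F')
  moreover have "(\<lambda>k. LINT t|M. deriv \<phi> t * F' k t) = (\<lambda>k. - (LINT t|M. \<phi> t * G' k t))"
    unfolding M_def by (rule ext) (rule test_parts[OF T d G' \<phi>])
  moreover have "(\<lambda>k. - (LINT t|M. \<phi> t * G' k t)) \<longlonglongrightarrow> - (LINT t|M. \<phi> t * G t)"
    using G q unfolding M_def by (intro tendsto_minus test_integral_limit[where p = q] \<phi> G')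
  ultimately show ?thesis by (simp add: LIMSEQ_unique)
qed

section \<open>Existence of a decaying solution\<close>

lemma integral_subinterval:
  fixes H :: "real \<Rightarrow> real"
  assumes H: "integrable (lebesgue_on {0<..}) H" and H0: "AE t in lebesgue_on {0<..}. 0 \<le> H t"
  shows "integrable (lebesgue_on {0<..<T}) H"
    and "(LINT t|lebesgue_on {0<..<T}. H t) \<le> (LINT t|lebesgue_on {0<..}. H t)"
proof -
  have s: "set_integrable lebesgue {0<..} H"
    using H by (simp add: integrable_restrict_space set_integrable_def)
  have sT: "set_integrable lebesgue {0<..<T} H" by (rule set_integrable_subset[OF s]) auto
  then show "integrable (lebesgue_on {0<..<T}) H"
    by (simp add: integrable_restrict_space set_integrable_def)
  have "AE t in lebesgue. t \<in> {0<..} \<longrightarrow> 0 \<le> H t" using H0 by (simp add: AE_restrict_space_iff)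
  then have "AE t in lebesgue. indicator {0<..<T} t *\<^sub>R H t \<le> indicator {0<..} t *\<^sub>R H t"
    by eventually_elim (auto simp: indicator_def)
  then have "(LINT t|lebesgue. indicator {0<..<T} t *\<^sub>R H t) \<le> (LINT t|lebesgue. indicator {0<..} t *\<^sub>R H t)"
    using s sT unfolding set_integrable_def by (intro integral_mono_AE)
  then show "(LINT t|lebesgue_on {0<..<T}. H t) \<le> (LINT t|lebesgue_on {0<..}. H t)"
    by (simp add: integral_restrict_space)
qed

lemma integral_const_interval:
  fixes T c :: real
  assumes "T \<ge> 0" 
  shows "integrable (lebesgue_on {0<..<T}) (\<lambda>_. c)" "(LINT t|lebesgue_on {0<..<T}. c) = c * T"
  using integral_open_interval[of T "\<lambda>_. c"] assms by simp_all

lemma inverse_Suc_limit: "(\<lambda>k. c / real (Suc k)) \<longlonglongrightarrow> 0"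
  using tendsto_mult_left[OF LIMSEQ_inverse_real_of_nat, of c] by (simp add: divide_inverse)

lemma (in positive_operator) K_inner_derivative:
  assumes "(y has_vector_derivative y') (at t)"
  shows "((\<lambda>t. K (y t) \<bullet> z) has_real_derivative K y' \<bullet> z) (at t within S)"
  unfolding has_real_derivative_iff_has_vector_derivative
  by (rule has_vector_derivative_at_within,
      rule bounded_linear.has_vector_derivative[OF bounded_linear_compose[OF bounded_linear_inner_left bl] assms, unfolded o_def])

context elliptic
begin

lemma sol_diff_H1: "\<exists>c>0. \<forall>h k. H1_norm \<Omega> (sol h - sol k) \<le> c * sqrt ((h - k) \<bullet> (K h - K k))"
proof -
  obtain c where c: "c > 0" "\<And>u. u \<in> H10 \<Omega> \<Longrightarrow> H1_norm \<Omega> u \<le> c * sqrt (B u u)" using H1_le_B by blast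
  have "H1_norm \<Omega> (sol h - sol k) \<le> c * sqrt ((h - k) \<bullet> (K h - K k))" for h k
    using c(2)[of "sol h - sol k"] by (simp add: sol_H10 B_sol_diff)
  then show ?thesis using c(1) by blast
qed

lemma sol_diff_L2: "L2_norm \<Omega> (sol h - sol k) = norm (K h - K k)"
proof -
  have "L2_norm \<Omega> (sol h - sol k) = norm (emb \<Omega> (sol h - sol k))"
    by (rule norm_emb[OF meas, symmetric]) (simp add: H10_L2' sol_H10)
  also have "emb \<Omega> (sol h - sol k) = K h - K k" unfolding K_def by (rule emb_diff') (simp_all add: H10_L2' sol_H10)
  finally show ?thesis .
qed

lemma L2_inner_sol: "v \<in> L2 \<Omega> \<Longrightarrow> L2_inner \<Omega> (sol h) v = K h \<bullet> emb \<Omega> v"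
  unfolding K_def by (rule emb_inner[OF meas, symmetric]) (simp_all add: H10_L2' sol_H10)

lemma Hm1_norm_L2_inner_diff:
  assumes "g \<in> L2 \<Omega>" "h \<in> L2 \<Omega>"
  shows "Hm1_norm \<Omega> (L2_inner \<Omega> g - L2_inner \<Omega> h) \<le> L2_norm \<Omega> (g - h)"
proof (rule Hm1_norm_le)
  fix v assume v: "v \<in> H10 \<Omega>"
  have "(L2_inner \<Omega> g - L2_inner \<Omega> h) v = L2_inner \<Omega> (g - h) v"
    using assms v by (simp add: L2.b_diff H10_L2')
  also have "\<bar>\<dots>\<bar> \<le> L2_norm \<Omega> (g - h) * L2_norm \<Omega> v" using assms v by (intro L2_cauchy_schwarz) (simp_all add: H10_L2')
  also have "\<dots> \<le> L2_norm \<Omega> (g - h) * H1_norm \<Omega> v" by (intro mult_left_mono L2_le_H1[OF op]) simp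
  finally show "\<bar>(L2_inner \<Omega> g - L2_inner \<Omega> h) v\<bar> \<le> L2_norm \<Omega> (g - h) * H1_norm \<Omega> v" .
qed simp

text \<open>Approximate solutions for right-hand sides that converge to \<open>f\<close> in \<open>L\<^sup>1\<close> with rate
\<open>1 / Suc k\<close>. In the bounds \<open>6 / Suc k\<close>, twice the distance of two right-hand sides contributes 4 and
the regularisation 2.\<close>

lemma approximating_sequence:
  assumes f: "f \<in> bochner_Lp 1 {0<..} (L2 \<Omega>) (L2_norm \<Omega>)"
  obtains x x1 x2 g :: "nat \<Rightarrow> real \<Rightarrow> 'n hilb" and e T :: "nat \<Rightarrow> real" and H :: "nat \<Rightarrow> real \<Rightarrow> real" where
    "\<And>k t. (x k has_vector_derivative x1 k t) (at t)"
    "\<And>k t. (x1 k has_vector_derivative x2 k t) (at t)"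
    "\<And>k. continuous_on UNIV (x2 k)"
    "\<And>k t. K (x2 k t) + e k *\<^sub>R x2 k t + x k t = K (K (g k t))"
    "\<And>k t. T k \<le> t \<Longrightarrow> x k t = 0"
    "\<And>k t. t \<ge> 0 \<Longrightarrow> norm (e k *\<^sub>R x2 k t) \<le> 1 / real (Suc k)"
    "\<And>k j t. k \<le> j \<Longrightarrow> t \<ge> 0 \<Longrightarrow> norm (K (x1 j t) - K (x1 k t)) \<le> 6 / real (Suc k)"
    "\<And>k j t. k \<le> j \<Longrightarrow> t \<ge> 0 \<Longrightarrow> (x j t - x k t) \<bullet> (K (x j t) - K (x k t)) \<le> (6 / real (Suc k))\<^sup>2"
    "\<And>k. integrable (lebesgue_on {0<..}) (H k)"
    "\<And>k. (LINT t|lebesgue_on {0<..}. H k t) \<le> 1 / real (Suc k)"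
    "\<And>k. AE t in lebesgue_on {0<..}. norm (K (K (g k t)) - emb \<Omega> (f t)) \<le> H k t"
proof -
  let ?M = "lebesgue_on {0::real<..}"
  define Q where "Q k g T H \<longleftrightarrow> continuous_on UNIV g \<and> T \<ge> 0 \<and> (\<forall>t\<ge>T. g t = 0) \<and>
     integrable ?M H \<and> (LINT t|?M. H t) \<le> 1 / real (Suc k) \<and>
     (AE t in ?M. norm (K (K (g t)) - emb \<Omega> (f t)) \<le> H t)" for k :: nat and g T H
  have "\<forall>k. \<exists>g T H. Q k g T H"
    using approximable_rhs[OF f] unfolding approximable_def Q_def by simp
  then obtain g T H where Q: "\<And>k. Q k (g k) (T k) (H k)" by metis
  note g = Q[unfolded Q_def]
  have gc: "continuous_on UNIV (g k)" and T: "T k \<ge> 0" and g0': "\<forall>t\<ge>T k. g k t = 0"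
    and Hi: "integrable ?M (H k)" and Hle: "(LINT t|?M. H k t) \<le> 1 / real (Suc k)"
    and Hb: "AE t in ?M. norm (K (K (g k t)) - emb \<Omega> (f t)) \<le> H k t" for k
    using g[of k] by blast+
  have g0: "g k t = 0" if "T k \<le> t" for k t using g0' that by blast
  obtain e x x1 x2 where R': "\<forall>k. e k > 0 \<and>
     regularised_solution (e k) (T k) (\<lambda>t. K (K (g k t))) (x k) (x1 k) (x2 k) \<and>
     (\<forall>t\<ge>0. norm (e k *\<^sub>R x2 k t) \<le> 1 / real (Suc k)) \<and>
     (\<forall>j\<ge>k. \<forall>t\<ge>0. let M = 2 * integral {0..max (T j) (T k)} (\<lambda>t. norm (K (K (g j t)) - K (K (g k t)))) + 2 / real (Suc k)
        in norm (K (x1 j t - x1 k t)) \<le> M \<and> (x j t - x k t) \<bullet> K (x j t - x k t) \<le> M\<^sup>2)"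
    by (rule approximate_solutions[of g T, OF gc T, elim_format], erule g0, elim exE) (rule that; assumption)
  note R = R'[rule_format]
  have reg: "regularised_solution (e k) (T k) (\<lambda>t. K (K (g k t))) (x k) (x1 k) (x2 k)" for k using R by blast
  have int: "integral {0..m} (\<lambda>t. norm (K (K (g j t)) - K (K (g k t)))) \<le> 2 / real (Suc k)" if "k \<le> j" for j k m
  proof -
    have c: "continuous_on {0..m} (\<lambda>t. norm (K (K (g j t)) - K (K (g k t))))"
      by (intro continuous_intros K.continuous_on continuous_on_subset[OF gc]) auto
    have le: "AE t in ?M. norm (K (K (g j t)) - K (K (g k t))) \<le> H j t + H k t"
      using Hb[of j] Hb[of k]
    proof eventually_elim
      case (elim t)
      have "K (K (g j t)) - K (K (g k t)) = (K (K (g j t)) - emb \<Omega> (f t)) - (K (K (g k t)) - emb \<Omega> (f t))" by simp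
      then have "norm (K (K (g j t)) - K (K (g k t))) \<le>
          norm (K (K (g j t)) - emb \<Omega> (f t)) + norm (K (K (g k t)) - emb \<Omega> (f t))"
        using norm_triangle_ineq4 by metis
      then show ?case using elim by linarith
    qed
    have pos: "AE t in ?M. 0 \<le> H j t + H k t"
      using le by eventually_elim (rule order_trans[OF norm_ge_zero])
    have i: "integrable ?M (\<lambda>t. H j t + H k t)" using Hi by simp
    have "integral {0..m} (\<lambda>t. norm (K (K (g j t)) - K (K (g k t)))) =
        (LINT t|lebesgue_on {0<..<m}. norm (K (K (g j t)) - K (K (g k t))))"
      by (rule integral_open_interval(2)[OF c, symmetric])
    also have "\<dots> \<le> (LINT t|lebesgue_on {0<..<m}. H j t + H k t)"
      by (intro integral_mono_AE integral_open_interval(1)[OF c] integral_subinterval(1)[OF i pos] AE_subinterval[OF le])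
    also have "\<dots> \<le> (LINT t|?M. H j t + H k t)" by (rule integral_subinterval(2)[OF i pos])
    also have "\<dots> \<le> 1 / real (Suc j) + 1 / real (Suc k)" using Hi Hle[of j] Hle[of k] by simp
    also have "\<dots> \<le> 2 / real (Suc k)" using that frac_le[of 1 1 "real (Suc k)" "real (Suc j)"] by simp
    finally show ?thesis .
  qed
  have diff: "norm (K (x1 j t) - K (x1 k t)) \<le> 6 / real (Suc k) \<and>
      (x j t - x k t) \<bullet> (K (x j t) - K (x k t)) \<le> (6 / real (Suc k))\<^sup>2" if "k \<le> j" "t \<ge> 0" for k j t
  proof -
    define J where "J = integral {0..max (T j) (T k)} (\<lambda>t. norm (K (K (g j t)) - K (K (g k t))))"
    have J: "J \<le> 2 / real (Suc k)" unfolding J_def by (rule int[OF that(1)])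
    have J0: "0 \<le> J" unfolding J_def by (rule integral_nonneg) 
        (auto intro!: integrable_continuous_interval continuous_intros K.continuous_on continuous_on_subset[OF gc])
    define m where "m = 2 * J + 2 / real (Suc k)"
    have "m \<le> 2 * (2 / real (Suc k)) + 2 / real (Suc k)" unfolding m_def using J by linarith
    then have m: "0 \<le> m" "m \<le> 6 / real (Suc k)" using J0 by (simp_all add: m_def)
    have "norm (K (x1 j t - x1 k t)) \<le> m \<and> (x j t - x k t) \<bullet> K (x j t - x k t) \<le> m\<^sup>2"
      using R[of k] that unfolding Let_def J_def m_def by blast
    then show ?thesis
      unfolding K.diff using m power_mono[OF m(2) m(1), of 2] by linarith
  qed
  show ?thesis
  proof (rule that[of x x1 x2 e g T H])
    show "norm (e k *\<^sub>R x2 k t) \<le> 1 / real (Suc k)" if "t \<ge> 0" for k t using R[of k] that by blast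
  qed (use reg diff Hi Hle Hb in \<open>simp_all add: regularised_solution_def\<close>)
qed

text \<open>The functions \<open>sol (x k t)\<close> converge to \<open>u t\<close> in \<open>H\<^sup>1\<close> and their time derivatives \<open>sol (x1 k t)\<close>
converge to \<open>P t\<close> in \<open>L\<^sup>2\<close>, uniformly in \<open>t\<close>. The second time derivatives, tested with a fixed \<open>v\<close>,
are \<open>L2_inner (K\<^sup>2 g) v - B (sol x) v\<close> up to the regularising term and converge in \<open>L\<^sup>1\<close> on bounded
intervals.\<close>

theorem existence:
  assumes f1: "f \<in> bochner_Lp 1 {0<..} (L2 \<Omega>) (L2_norm \<Omega>)"
    and f2: "in_loc (\<lambda>I. bochner_Lp 2 I (L2 \<Omega>) (L2_norm \<Omega>)) f"
  shows "\<exists>u. weak_solution \<Omega> a f u"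
proof -
  obtain x x1 x2 g :: "nat \<Rightarrow> real \<Rightarrow> 'n hilb" and e T :: "nat \<Rightarrow> real" and H :: "nat \<Rightarrow> real \<Rightarrow> real" where
    dx: "\<And>k t. (x k has_vector_derivative x1 k t) (at t)" and
    dx1: "\<And>k t. (x1 k has_vector_derivative x2 k t) (at t)" and
    x2c: "\<And>k. continuous_on UNIV (x2 k)" and
    eq: "\<And>k t. K (x2 k t) + e k *\<^sub>R x2 k t + x k t = K (K (g k t))" and
    x0: "\<And>k t. T k \<le> t \<Longrightarrow> x k t = 0" and
    ex2: "\<And>k t. t \<ge> 0 \<Longrightarrow> norm (e k *\<^sub>R x2 k t) \<le> 1 / real (Suc k)" and
    Kx1: "\<And>k j t. k \<le> j \<Longrightarrow> t \<ge> 0 \<Longrightarrow> norm (K (x1 j t) - K (x1 k t)) \<le> 6 / real (Suc k)" and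
    Kx: "\<And>k j t. k \<le> j \<Longrightarrow> t \<ge> 0 \<Longrightarrow> (x j t - x k t) \<bullet> (K (x j t) - K (x k t)) \<le> (6 / real (Suc k))\<^sup>2" and
    Hi: "\<And>k. integrable (lebesgue_on {0<..}) (H k)" and
    Hle: "\<And>k. (LINT t|lebesgue_on {0<..}. H k t) \<le> 1 / real (Suc k)" and
    Hb: "\<And>k. AE t in lebesgue_on {0<..}. norm (K (K (g k t)) - emb \<Omega> (f t)) \<le> H k t"
    by (rule approximating_sequence[OF f1]) (rule that; assumption)
  obtain c where c: "c > 0" "\<And>h k. H1_norm \<Omega> (sol h - sol k) \<le> c * sqrt ((h - k) \<bullet> (K h - K k))"
    using sol_diff_H1 by blast
  obtain Mb where Mb: "Mb \<ge> 0" "\<And>u. u \<in> H10 \<Omega> \<Longrightarrow> B u \<in> Hm1 \<Omega>" "\<And>u. u \<in> H10 \<Omega> \<Longrightarrow> Hm1_norm \<Omega> (B u) \<le> Mb * H1_norm \<Omega> u"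
    using B_Hm1 by blast
  have xt: "((x k) \<longlongrightarrow> x k t) (at t within S)" and x1t: "((x1 k) \<longlongrightarrow> x1 k t) (at t within S)" for k t S
    using has_vector_derivative_continuous[OF dx[of k t]] has_vector_derivative_continuous[OF dx1[of k t]]
    by (auto simp: continuous_within intro: tendsto_within_subset)
  let ?r = "\<lambda>k. 6 / real (Suc k)"
  define R where "R k = c * ?r k" for k
  have R: "R \<longlonglongrightarrow> 0" unfolding R_def using tendsto_mult_left[OF inverse_Suc_limit, of c 6] by simp
  have "\<exists>u. (\<forall>t\<ge>0. u t \<in> H10 \<Omega> \<and> (\<forall>k. H1_norm \<Omega> (sol (x k t) - u t) \<le> R k)) \<and>
    (\<forall>t::real\<ge>0. ((\<lambda>s. H1_norm \<Omega> (u s - u t)) \<longlongrightarrow> 0) (at t within {0..}))"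
  proof (rule H10.uniform_limit_exists[OF H10_complete[OF op] _ _ R])
    show "sol (x k t) \<in> H10 \<Omega>" for k t by (rule sol_H10)
    fix j k :: nat and t :: real assume "k \<le> j" "t \<ge> 0"
    have "sqrt ((x j t - x k t) \<bullet> (K (x j t) - K (x k t))) \<le> sqrt ((?r k)\<^sup>2)"
      by (rule real_sqrt_le_mono[OF Kx]) fact+
    then have "c * sqrt ((x j t - x k t) \<bullet> (K (x j t) - K (x k t))) \<le> R k"
      unfolding R_def using c(1) by (intro mult_left_mono) simp_all
    then show "H1_norm \<Omega> (sol (x j t) - sol (x k t)) \<le> R k" using c(2)[of "x j t" "x k t"] by linarith
  next
    fix k and t :: real assume "t \<ge> 0"
    show "((\<lambda>s. H1_norm \<Omega> (sol (x k s) - sol (x k t))) \<longlongrightarrow> 0) (at t within {0..})"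
    proof (rule Lim_null_comparison)
      show "\<forall>\<^sub>F s in at t within {0..}. norm (H1_norm \<Omega> (sol (x k s) - sol (x k t))) \<le>
          c * sqrt ((x k s - x k t) \<bullet> (K (x k s) - K (x k t)))"
        using c(2) H10.N_nonneg[OF H10.mem_diff[OF sol_H10 sol_H10]] by (intro always_eventually allI) simp
      have "((\<lambda>s. c * sqrt ((x k s - x k t) \<bullet> (K (x k s) - K (x k t)))) \<longlongrightarrow>
          c * sqrt ((x k t - x k t) \<bullet> (K (x k t) - K (x k t)))) (at t within {0..})"
        by (intro tendsto_intros xt K.tendsto)
      then show "((\<lambda>s. c * sqrt ((x k s - x k t) \<bullet> (K (x k s) - K (x k t)))) \<longlongrightarrow> 0) (at t within {0..})" by simp
    qed
  qed
  then obtain u where uH: "\<And>t. t \<ge> 0 \<Longrightarrow> u t \<in> H10 \<Omega>"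
    and uR: "\<And>t k. t \<ge> 0 \<Longrightarrow> H1_norm \<Omega> (sol (x k t) - u t) \<le> R k"
    and uc: "\<And>t. t \<ge> 0 \<Longrightarrow> ((\<lambda>s. H1_norm \<Omega> (u s - u t)) \<longlongrightarrow> 0) (at t within {0..})" by blast
  have "\<exists>P. (\<forall>t\<ge>0. P t \<in> L2 \<Omega> \<and> (\<forall>k. L2_norm \<Omega> (sol (x1 k t) - P t) \<le> ?r k)) \<and>
    (\<forall>t::real\<ge>0. ((\<lambda>s. L2_norm \<Omega> (P s - P t)) \<longlongrightarrow> 0) (at t within {0..}))"
  proof (rule L2n.uniform_limit_exists[OF L2_complete _ _ inverse_Suc_limit])
    show "sol (x1 k t) \<in> L2 \<Omega>" for k t by (rule H10_L2'[OF sol_H10])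
    show "L2_norm \<Omega> (sol (x1 j t) - sol (x1 k t)) \<le> ?r k" if "k \<le> j" "t \<ge> 0" for j k t
      unfolding sol_diff_L2 by (rule Kx1[OF that])
    show "((\<lambda>s. L2_norm \<Omega> (sol (x1 k s) - sol (x1 k t))) \<longlongrightarrow> 0) (at t within {0..})" for k t
    proof -
      have "((\<lambda>s. norm (K (x1 k s) - K (x1 k t))) \<longlongrightarrow> norm (K (x1 k t) - K (x1 k t))) (at t within {0..})"
        by (intro tendsto_intros x1t K.tendsto)
      then show ?thesis by (simp add: sol_diff_L2)
    qed
  qed
  then obtain P where PL: "\<And>t. t \<ge> 0 \<Longrightarrow> P t \<in> L2 \<Omega>"
    and PR: "\<And>t k. t \<ge> 0 \<Longrightarrow> L2_norm \<Omega> (sol (x1 k t) - P t) \<le> ?r k"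
    and Pc: "\<And>t. t \<ge> 0 \<Longrightarrow> ((\<lambda>s. L2_norm \<Omega> (P s - P t)) \<longlongrightarrow> 0) (at t within {0..})" by blast
  have uL: "u t \<in> L2 \<Omega>" if "t \<ge> 0" for t by (rule H10_L2'[OF uH[OF that]])
  have uLc: "((\<lambda>s. L2_norm \<Omega> (u s - u t)) \<longlongrightarrow> 0) (at t within {0..})" if "t \<ge> 0" for t
    by (rule Lim_null_comparison[OF _ uc[OF that]]) (simp add: L2_le_H1[OF op])
  have near: "\<forall>\<^sub>F s::real in at t within {0..}. s \<ge> 0" for t by (simp add: eventually_at_filter)
  have L2c: "((\<lambda>s. Hm1_norm \<Omega> (L2_inner \<Omega> (h s) - L2_inner \<Omega> (h t))) \<longlongrightarrow> 0) (at t within {0..})"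
    if h: "\<And>t. t \<ge> 0 \<Longrightarrow> h t \<in> L2 \<Omega>" "\<And>t. t \<ge> 0 \<Longrightarrow> ((\<lambda>s. L2_norm \<Omega> (h s - h t)) \<longlongrightarrow> 0) (at t within {0..})" and t: "t \<ge> 0"
    for h and t :: real
  proof (rule Lim_null_comparison[OF _ h(2)[OF t]])
    show "\<forall>\<^sub>F s in at t within {0..}. norm (Hm1_norm \<Omega> (L2_inner \<Omega> (h s) - L2_inner \<Omega> (h t))) \<le> L2_norm \<Omega> (h s - h t)"
      using near
    proof eventually_elim
      case (elim s)
      show ?case
        using Hm1_norm_L2_inner_diff[OF h(1)[OF elim] h(1)[OF t]]
          Hm1_nonneg[OF Hm1.mem_diff[OF L2_inner_Hm1(1)[OF h(1)[OF elim]] L2_inner_Hm1(1)[OF h(1)[OF t]]]] by simp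
    qed
  qed
  have Bc: "((\<lambda>s. Hm1_norm \<Omega> (B (u s) - B (u t))) \<longlongrightarrow> 0) (at t within {0..})" if t: "t \<ge> 0" for t
  proof (rule Lim_null_comparison)
    show "\<forall>\<^sub>F s in at t within {0..}. norm (Hm1_norm \<Omega> (B (u s) - B (u t))) \<le> Mb * H1_norm \<Omega> (u s - u t)"
      using near
    proof eventually_elim
      case (elim s)
      have d: "u s - u t \<in> H10 \<Omega>" using uH[OF elim] uH[OF t] by simp
      have "Hm1_norm \<Omega> (B (u s) - B (u t)) \<le> Mb * H1_norm \<Omega> (u s - u t)"
      proof (rule Hm1_norm_le)
        show "0 \<le> Mb * H1_norm \<Omega> (u s - u t)" using Mb(1) H10.N_nonneg[OF d] by simp
        fix v assume v: "v \<in> H10 \<Omega>"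
        have "\<bar>B (u s - u t) v\<bar> \<le> Hm1_norm \<Omega> (B (u s - u t)) * H1_norm \<Omega> v" by (rule Hm1_bound[OF Mb(2)[OF d] v])
        also have "\<dots> \<le> (Mb * H1_norm \<Omega> (u s - u t)) * H1_norm \<Omega> v"
          by (rule mult_right_mono[OF Mb(3)[OF d] H10.N_nonneg[OF v]])
        finally show "\<bar>(B (u s) - B (u t)) v\<bar> \<le> Mb * H1_norm \<Omega> (u s - u t) * H1_norm \<Omega> v"
          using B.b_diff[OF uH[OF elim] uH[OF t] v] by simp
      qed
      then show ?case using Hm1_nonneg[OF Hm1.mem_diff[OF Mb(2)[OF uH[OF elim]] Mb(2)[OF uH[OF t]]]] by simp
    qed
    show "((\<lambda>s. Mb * H1_norm \<Omega> (u s - u t)) \<longlongrightarrow> 0) (at t within {0..})"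
      using tendsto_mult_left[OF uc[OF t], of Mb] by simp
  qed
  have uHm: "L2_inner \<Omega> (u t) \<in> Hm1 \<Omega>" and PHm: "L2_inner \<Omega> (P t) \<in> Hm1 \<Omega>" if "t \<ge> 0" for t
    by (rule L2_inner_Hm1(1), rule uL PL, fact)+
  have uHmc: "((\<lambda>s. Hm1_norm \<Omega> (L2_inner \<Omega> (u s) - L2_inner \<Omega> (u t))) \<longlongrightarrow> 0) (at t within {0..})" if "t \<ge> 0" for t
    by (rule L2c[OF _ _ that], erule uL, erule uLc)
  have PHmc: "((\<lambda>s. Hm1_norm \<Omega> (L2_inner \<Omega> (P s) - L2_inner \<Omega> (P t))) \<longlongrightarrow> 0) (at t within {0..})" if "t \<ge> 0" for t
    by (rule L2c[OF _ _ that], erule PL, erule Pc)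
  \<comment> \<open>the second time derivative of \<open>u\<close>, as the equation prescribes it\<close>
  define w where "w t = L2_inner \<Omega> (f t) - B (u t)" for t
  \<comment> \<open>derivatives and errors of the approximations, tested with a fixed \<open>v\<close>\<close>
  have D1: "((\<lambda>t. L2_inner \<Omega> (sol (x k t)) v) has_real_derivative L2_inner \<Omega> (sol (x1 k t)) v) (at t within S)"
    if "v \<in> L2 \<Omega>" for k t v S
    unfolding L2_inner_sol[OF that] by (rule K_inner_derivative[OF dx])
  have D2: "((\<lambda>t. L2_inner \<Omega> (sol (x1 k t)) v) has_real_derivative K (x2 k t) \<bullet> emb \<Omega> v) (at t within S)"
    if "v \<in> L2 \<Omega>" for k t v S
    unfolding L2_inner_sol[OF that] by (rule K_inner_derivative[OF dx1])
  have E1: "\<bar>L2_inner \<Omega> (sol (x k t)) v - L2_inner \<Omega> (u t) v\<bar> \<le> R k * L2_norm \<Omega> v" if "v \<in> L2 \<Omega>" "t \<ge> 0" for k t v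
  proof -
    have "\<bar>L2_inner \<Omega> (sol (x k t) - u t) v\<bar> \<le> L2_norm \<Omega> (sol (x k t) - u t) * L2_norm \<Omega> v"
      by (rule L2_cauchy_schwarz) (use that uL in \<open>simp_all add: H10_L2' sol_H10\<close>)
    also have "\<dots> \<le> R k * L2_norm \<Omega> v"
      using L2_le_H1[OF op, of "sol (x k t) - u t"] uR[OF that(2), of k] by (intro mult_right_mono) simp_all
    finally show ?thesis using L2.b_diff[OF H10_L2'[OF sol_H10] uL[OF that(2)] that(1)] by simp
  qed
  have E2: "\<bar>L2_inner \<Omega> (sol (x1 k t)) v - L2_inner \<Omega> (P t) v\<bar> \<le> ?r k * L2_norm \<Omega> v" if "v \<in> L2 \<Omega>" "t \<ge> 0" for k t v
  proof -
    have "\<bar>L2_inner \<Omega> (sol (x1 k t) - P t) v\<bar> \<le> L2_norm \<Omega> (sol (x1 k t) - P t) * L2_norm \<Omega> v"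
      by (rule L2_cauchy_schwarz) (use that PL in \<open>simp_all add: H10_L2' sol_H10\<close>)
    also have "\<dots> \<le> ?r k * L2_norm \<Omega> v" by (rule mult_right_mono[OF PR[OF that(2)]]) simp
    finally show ?thesis using L2.b_diff[OF H10_L2'[OF sol_H10] PL[OF that(2)] that(1)] by simp
  qed
  have fL: "AE t in lebesgue_on {0<..}. f t \<in> L2 \<Omega>"
    using f1 by (simp add: bochner_Lp_def strongly_measurable_on_def)
  have Hpos: "AE t in lebesgue_on {0<..}. 0 \<le> H k t" for k
    using Hb[of k] by eventually_elim (rule order_trans[OF norm_ge_zero])
  have main: "u \<in> bochner_W1inf {0<..<T'} (L2 \<Omega>) (L2_norm \<Omega>) \<and>
      is_second_deriv_L2 {0<..<T'} (Hm1 \<Omega>) (Hm1_norm \<Omega>) (\<lambda>t. L2_inner \<Omega> (u t)) w" if T': "T' > 0" for T'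
  proof -
    let ?I = "{0<..<T'}" let ?M = "lebesgue_on ?I"
    have I: "?I \<in> sets lebesgue" by simp
    have T0: "0 \<le> T'" using T' by simp
    have tI: "AE t in ?M. t \<in> ?I" by (rule AE_I2) simp
    have uLinf: "u \<in> bochner_Linf ?I (L2 \<Omega>) (L2_norm \<Omega>)" and uLp: "u \<in> bochner_Lp p ?I (L2 \<Omega>) (L2_norm \<Omega>)" for p
      by (rule L2n.continuous_bochner, erule uL, erule uLc)+
    have PLinf: "P \<in> bochner_Linf ?I (L2 \<Omega>) (L2_norm \<Omega>)" and PLp: "P \<in> bochner_Lp p ?I (L2 \<Omega>) (L2_norm \<Omega>)" for p
      by (rule L2n.continuous_bochner, erule PL, erule Pc)+
    have uHp: "(\<lambda>t. L2_inner \<Omega> (u t)) \<in> bochner_Lp p ?I (Hm1 \<Omega>) (Hm1_norm \<Omega>)" for p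
      by (rule Hm1.continuous_bochner, erule uHm, erule uHmc)
    have PHp: "(\<lambda>t. L2_inner \<Omega> (P t)) \<in> bochner_Lp p ?I (Hm1 \<Omega>) (Hm1_norm \<Omega>)" for p
      by (rule Hm1.continuous_bochner, erule PHm, erule PHmc)
    have Bup: "(\<lambda>t. B (u t)) \<in> bochner_Lp p ?I (Hm1 \<Omega>) (Hm1_norm \<Omega>)" for p
      by (rule Hm1.continuous_bochner, rule Mb(2)[OF uH], assumption, erule Bc)
    have f2T: "f \<in> bochner_Lp 2 ?I (L2 \<Omega>) (L2_norm \<Omega>)" using f2 T' by (simp add: in_loc_def)
    have sI: "strongly_measurable_on ?I X N h" if "h \<in> bochner_Lp p ?I X N" for h p N and X :: "'z::real_vector set"
      using that by (simp add: bochner_Lp_def)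
    have iI: "integrable ?M (\<lambda>t. N (h t) ^ p)" if "h \<in> bochner_Lp p ?I X N" for h p N and X :: "'z::real_vector set"
      using that by (simp add: bochner_Lp_def)
    have fH: "strongly_measurable_on ?I (Hm1 \<Omega>) (Hm1_norm \<Omega>) (\<lambda>t. L2_inner \<Omega> (f t))"
    proof (rule L2n.strongly_measurable_image[OF sI[OF f2T], where C = 1])
      fix g h assume "g \<in> L2 \<Omega>" "h \<in> L2 \<Omega>"
      then show "0 \<le> Hm1_norm \<Omega> (L2_inner \<Omega> g - L2_inner \<Omega> h) \<and>
          Hm1_norm \<Omega> (L2_inner \<Omega> g - L2_inner \<Omega> h) \<le> 1 * L2_norm \<Omega> (g - h)"
        using Hm1_norm_L2_inner_diff[of g h] Hm1_nonneg[OF Hm1.mem_diff[OF L2_inner_Hm1(1) L2_inner_Hm1(1)]] by simp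
    qed (use I in \<open>auto intro: L2_inner_Hm1\<close>)
    have wm: "strongly_measurable_on ?I (Hm1 \<Omega>) (Hm1_norm \<Omega>) w"
    proof -
      have "strongly_measurable_on ?I (Hm1 \<Omega>) (Hm1_norm \<Omega>) (\<lambda>t. L2_inner \<Omega> (f t) + (-1::real) *\<^sub>R B (u t))"
        by (intro Hm1.strongly_measurable_add[OF I fH] Hm1.strongly_measurable_scaleR[OF I _ sI[OF Bup[of 2]]]) simp
      moreover have "(\<lambda>t. L2_inner \<Omega> (f t) + (-1::real) *\<^sub>R B (u t)) = w" unfolding w_def by (rule ext) simp
      ultimately show ?thesis by simp
    qed
    have fLT: "AE t in ?M. f t \<in> L2 \<Omega>" by (rule AE_subinterval[OF fL])
    have wle: "AE t in ?M. 0 \<le> Hm1_norm \<Omega> (w t) \<and> Hm1_norm \<Omega> (w t) \<le> L2_norm \<Omega> (f t) + Hm1_norm \<Omega> (B (u t))"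
      using fLT tI
    proof eventually_elim
      case (elim t)
      then have m: "L2_inner \<Omega> (f t) \<in> Hm1 \<Omega>" "B (u t) \<in> Hm1 \<Omega>" by (simp_all add: L2_inner_Hm1 Mb(2) uH)
      show ?case
        unfolding w_def using Hm1.N_diff[OF m] Hm1_nonneg[OF Hm1.mem_diff[OF m]] L2_inner_Hm1(2)[OF elim(1)] by linarith
    qed
    have wN: "(\<lambda>t. Hm1_norm \<Omega> (w t)) \<in> borel_measurable ?M" by (rule Hm1.strongly_measurable_norm[OF I wm])
    have w2: "w \<in> bochner_Lp 2 ?I (Hm1 \<Omega>) (Hm1_norm \<Omega>)"
    proof -
      have "integrable ?M (\<lambda>t. (Hm1_norm \<Omega> (w t))\<^sup>2)"
      proof (rule Bochner_Integration.integrable_bound)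
        show "integrable ?M (\<lambda>t. 2 * (L2_norm \<Omega> (f t))\<^sup>2 + 2 * (Hm1_norm \<Omega> (B (u t)))\<^sup>2)"
          using iI[OF f2T] iI[OF Bup[of 2]] by simp
        show "(\<lambda>t. (Hm1_norm \<Omega> (w t))\<^sup>2) \<in> borel_measurable ?M" using wN by simp
        show "AE t in ?M. norm ((Hm1_norm \<Omega> (w t))\<^sup>2) \<le> norm (2 * (L2_norm \<Omega> (f t))\<^sup>2 + 2 * (Hm1_norm \<Omega> (B (u t)))\<^sup>2)"
          using wle
        proof eventually_elim
          case (elim t)
          have "(Hm1_norm \<Omega> (w t))\<^sup>2 \<le> (L2_norm \<Omega> (f t) + Hm1_norm \<Omega> (B (u t)))\<^sup>2" using elim by (intro power_mono) auto
          also have "\<dots> \<le> 2 * (L2_norm \<Omega> (f t))\<^sup>2 + 2 * (Hm1_norm \<Omega> (B (u t)))\<^sup>2"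
            using sum_squares_bound[of "L2_norm \<Omega> (f t)" "Hm1_norm \<Omega> (B (u t))"] by (simp add: power2_sum)
          finally show ?case by simp
        qed
      qed
      then show ?thesis using wm by (simp add: bochner_Lp_def)
    qed
    have fN1: "integrable ?M (\<lambda>t. L2_norm \<Omega> (f t))"
    proof (rule integral_subinterval(1))
      show "integrable (lebesgue_on {0<..}) (\<lambda>t. L2_norm \<Omega> (f t))" using f1 by (simp add: bochner_Lp_def)
    qed simp
    have w1: "integrable ?M (\<lambda>t. Hm1_norm \<Omega> (w t))"
    proof (rule Bochner_Integration.integrable_bound[OF _ wN])
      show "integrable ?M (\<lambda>t. L2_norm \<Omega> (f t) + Hm1_norm \<Omega> (B (u t)))"
        using fN1 iI[OF Bup[of 1]] by simp
      show "AE t in ?M. norm (Hm1_norm \<Omega> (w t)) \<le> norm (L2_norm \<Omega> (f t) + Hm1_norm \<Omega> (B (u t)))"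
        using wle by eventually_elim simp
    qed
    have i1: "integrable ?M (\<lambda>t. N (h t))" if "h \<in> bochner_Lp 1 ?I X N" for h N and X :: "'z::real_vector set"
      using iI[OF that] by simp
    have parts1: "(LINT t|?M. deriv \<phi> t * L2_inner \<Omega> (u t) v) = - (LINT t|?M. \<phi> t * L2_inner \<Omega> (P t) v)"
      if v: "v \<in> L2 \<Omega>" and \<phi>: "\<phi> \<in> test_functions ?I" for v \<phi>
    proof (rule weak_derivative_limit[OF T0 \<phi> D1[OF v]])
      show "continuous_on {0..T'} (\<lambda>t. L2_inner \<Omega> (sol (x1 k t)) v)" for k
        using D2[OF v] by (meson DERIV_continuous continuous_on_eq_continuous_within)
      show "integrable ?M (\<lambda>t. L2_inner \<Omega> (u t) v)"
        by (rule L2n.functional_integrable[OF I sI[OF uLp[of 1]] i1[OF uLp] L2_functional[OF v]])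
      show "integrable ?M (\<lambda>t. L2_inner \<Omega> (P t) v)"
        by (rule L2n.functional_integrable[OF I sI[OF PLp[of 1]] i1[OF PLp] L2_functional[OF v]])
      show "integrable ?M (\<lambda>t. R k * L2_norm \<Omega> v)" "integrable ?M (\<lambda>t. ?r k * L2_norm \<Omega> v)" for k
        by (rule integral_const_interval(1)[OF T0])+
      have "(\<lambda>k. R k * L2_norm \<Omega> v * T') \<longlonglongrightarrow> 0 * L2_norm \<Omega> v * T'" by (intro tendsto_intros R)
      then show "(\<lambda>k. LINT t|?M. R k * L2_norm \<Omega> v) \<longlonglongrightarrow> 0" by (simp only: integral_const_interval(2)[OF T0] mult_zero_left)
      have "(\<lambda>k. ?r k * L2_norm \<Omega> v * T') \<longlonglongrightarrow> 0 * L2_norm \<Omega> v * T'" by (intro tendsto_mult tendsto_const inverse_Suc_limit)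
      then show "(\<lambda>k. LINT t|?M. ?r k * L2_norm \<Omega> v) \<longlonglongrightarrow> 0" by (simp only: integral_const_interval(2)[OF T0] mult_zero_left)
      show "AE t in ?M. \<bar>L2_inner \<Omega> (sol (x k t)) v - L2_inner \<Omega> (u t) v\<bar> \<le> R k * L2_norm \<Omega> v" for k
        using tI by eventually_elim (simp add: E1[OF v])
      show "AE t in ?M. \<bar>L2_inner \<Omega> (sol (x1 k t)) v - L2_inner \<Omega> (P t) v\<bar> \<le> ?r k * L2_norm \<Omega> v" for k
        using tI by eventually_elim (use E2[OF v] in simp)
    qed
    have parts2: "(LINT t|?M. deriv \<phi> t * L2_inner \<Omega> (P t) v) = - (LINT t|?M. \<phi> t * w t v)"
      if v: "v \<in> H10 \<Omega>" and \<phi>: "\<phi> \<in> test_functions ?I" for v \<phi>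
    proof -
      let ?v = "norm (emb \<Omega> v)"
      define d where "d k = Mb * R k * H1_norm \<Omega> v + 1 / real (Suc k) * ?v" for k
      have vL: "v \<in> L2 \<Omega>" by (rule H10_L2'[OF v])
      have HI: "integrable ?M (H k)" for k by (rule integral_subinterval(1)[OF Hi Hpos])
      show ?thesis
      proof (rule weak_derivative_limit[OF T0 \<phi> D2[OF vL], where p = "\<lambda>k t. ?r k * L2_norm \<Omega> v" and q = "\<lambda>k t. H k t * ?v + d k"])
        show "continuous_on {0..T'} (\<lambda>t. K (x2 k t) \<bullet> emb \<Omega> v)" for k
          by (intro continuous_intros K.continuous_on continuous_on_subset[OF x2c]) auto
        show "integrable ?M (\<lambda>t. L2_inner \<Omega> (P t) v)"
          by (rule L2n.functional_integrable[OF I sI[OF PLp[of 1]] i1[OF PLp] L2_functional[OF vL]])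
        show "integrable ?M (\<lambda>t. w t v)"
          by (rule Hm1.functional_integrable[OF I wm w1 Hm1_eval[OF v]])
        show "integrable ?M (\<lambda>t. ?r k * L2_norm \<Omega> v)" for k by (rule integral_const_interval(1)[OF T0])
        have "(\<lambda>k. ?r k * L2_norm \<Omega> v * T') \<longlonglongrightarrow> 0 * L2_norm \<Omega> v * T'" by (intro tendsto_mult tendsto_const inverse_Suc_limit)
        then show "(\<lambda>k. LINT t|?M. ?r k * L2_norm \<Omega> v) \<longlonglongrightarrow> 0" by (simp only: integral_const_interval(2)[OF T0] mult_zero_left)
        show "AE t in ?M. \<bar>L2_inner \<Omega> (sol (x1 k t)) v - L2_inner \<Omega> (P t) v\<bar> \<le> ?r k * L2_norm \<Omega> v" for k
          using tI by eventually_elim (use E2[OF vL] in simp)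
        have id: "integrable ?M (\<lambda>t. H k t * ?v)" for k using HI by simp
        show "integrable ?M (\<lambda>t. H k t * ?v + d k)" for k
          by (rule Bochner_Integration.integrable_add[OF id integral_const_interval(1)[OF T0]])
        have Iq: "(LINT t|?M. H k t * ?v + d k) = (LINT t|?M. H k t) * ?v + d k * T'" for k
          unfolding Bochner_Integration.integral_add[OF id integral_const_interval(1)[OF T0]] integral_const_interval(2)[OF T0] by simp
        show "(\<lambda>k. LINT t|?M. H k t * ?v + d k) \<longlonglongrightarrow> 0"
          unfolding Iq
        proof (rule tendsto_add_zero)
          have HT: "(\<lambda>k. LINT t|?M. H k t) \<longlonglongrightarrow> 0"
          proof (rule tendsto_sandwich[OF _ _ tendsto_const inverse_Suc_limit[of 1]])
            show "\<forall>\<^sub>F k in sequentially. 0 \<le> (LINT t|?M. H k t)"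
              by (rule always_eventually, rule allI, rule integral_nonneg_AE[OF AE_subinterval[OF Hpos]])
            show "\<forall>\<^sub>F k in sequentially. (LINT t|?M. H k t) \<le> 1 / real (Suc k)"
              by (rule always_eventually, rule allI, rule order_trans[OF integral_subinterval(2)[OF Hi Hpos] Hle])
          qed
          show "(\<lambda>k. (LINT t|?M. H k t) * ?v) \<longlonglongrightarrow> 0" using tendsto_mult_right[OF HT, of ?v] by simp
          have "(\<lambda>k. (Mb * R k * H1_norm \<Omega> v + 1 / real (Suc k) * ?v) * T') \<longlonglongrightarrow> (Mb * 0 * H1_norm \<Omega> v + 0 * ?v) * T'"
            by (intro tendsto_mult tendsto_add tendsto_const R inverse_Suc_limit)
          then show "(\<lambda>k. d k * T') \<longlonglongrightarrow> 0" by (simp add: d_def)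
        qed
        show "AE t in ?M. \<bar>K (x2 k t) \<bullet> emb \<Omega> v - w t v\<bar> \<le> H k t * ?v + d k" for k
          using tI fLT AE_subinterval[OF Hb[of k]]
        proof eventually_elim
          case (elim t)
          then have t: "t \<ge> 0" by simp
          have S: "sol (x k t) - u t \<in> H10 \<Omega>" using uH[OF t] by (simp add: sol_H10)
          have a1: "\<bar>(K (K (g k t)) - emb \<Omega> (f t)) \<bullet> emb \<Omega> v\<bar> \<le> H k t * ?v"
            by (rule order_trans[OF Cauchy_Schwarz_ineq2 mult_right_mono[OF elim(3) norm_ge_zero]])
          have a2: "\<bar>(e k *\<^sub>R x2 k t) \<bullet> emb \<Omega> v\<bar> \<le> 1 / real (Suc k) * ?v"
            by (rule order_trans[OF Cauchy_Schwarz_ineq2 mult_right_mono[OF ex2[OF t] norm_ge_zero]])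
          have "\<bar>B (sol (x k t) - u t) v\<bar> \<le> Hm1_norm \<Omega> (B (sol (x k t) - u t)) * H1_norm \<Omega> v"
            by (rule Hm1_bound[OF Mb(2)[OF S] v])
          also have "\<dots> \<le> (Mb * H1_norm \<Omega> (sol (x k t) - u t)) * H1_norm \<Omega> v"
            by (rule mult_right_mono[OF Mb(3)[OF S] H10.N_nonneg[OF v]])
          also have "\<dots> \<le> (Mb * R k) * H1_norm \<Omega> v"
            by (rule mult_right_mono[OF mult_left_mono[OF uR[OF t] Mb(1)] H10.N_nonneg[OF v]])
          finally have a3: "\<bar>B (sol (x k t) - u t) v\<bar> \<le> (Mb * R k) * H1_norm \<Omega> v" .
          have Kx2: "K (x2 k t) = K (K (g k t)) - e k *\<^sub>R x2 k t - x k t" unfolding eq[of k t, symmetric] by simp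
          have "w t v = emb \<Omega> (f t) \<bullet> emb \<Omega> v - B (u t) v" by (simp add: w_def emb_inner[OF meas elim(2) vL])
          then have "K (x2 k t) \<bullet> emb \<Omega> v - w t v = (K (K (g k t)) - emb \<Omega> (f t)) \<bullet> emb \<Omega> v
              - (e k *\<^sub>R x2 k t) \<bullet> emb \<Omega> v - B (sol (x k t) - u t) v"
            unfolding Kx2 B.b_diff[OF sol_H10 uH[OF t] v] B_sol[OF v] by (simp add: inner_diff_left)
          then show ?case using a1 a2 a3 unfolding d_def by linarith
        qed
      qed
    qed
    have W1: "weak_time_deriv ?I (L2 \<Omega>) (L2_norm \<Omega>) u P"
    proof (rule L2n.weak_time_derivI[OF I L2_complete sI[OF uLp[of 1]] i1[OF uLp] sI[OF PLp[of 1]] i1[OF PLp],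
          where \<Lambda> = "(\<lambda>v u. L2_inner \<Omega> u v) ` L2 \<Omega>"])
      show "L2n.bounded_functional \<Omega> l" if "l \<in> (\<lambda>v u. L2_inner \<Omega> u v) ` L2 \<Omega>" for l using that L2_functional by auto
      show "L2_norm \<Omega> z = 0" if "z \<in> L2 \<Omega>" "\<And>l. l \<in> (\<lambda>v u. L2_inner \<Omega> u v) ` L2 \<Omega> \<Longrightarrow> l z = 0" for z
        using that(2)[OF imageI[OF that(1)]] by (simp add: L2_norm_def)
    qed (use parts1 in auto)
    have ev: "Hm1.bounded_functional l" if "l \<in> (\<lambda>v F. F v) ` H10 \<Omega>" for l using that Hm1_eval by auto
    have sep: "Hm1_norm \<Omega> z = 0" if "z \<in> Hm1 \<Omega>" "\<And>l. l \<in> (\<lambda>v F. F v) ` H10 \<Omega> \<Longrightarrow> l z = 0" for z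
      using that by (intro Hm1_separating) auto
    have W2: "weak_time_deriv ?I (Hm1 \<Omega>) (Hm1_norm \<Omega>) (\<lambda>t. L2_inner \<Omega> (u t)) (\<lambda>t. L2_inner \<Omega> (P t))"
      by (rule Hm1.weak_time_derivI[OF I Hm1_complete sI[OF uHp[of 1]] i1[OF uHp] sI[OF PHp[of 1]] i1[OF PHp] ev sep])
        (use parts1 H10_L2' in auto)
    have W3: "weak_time_deriv ?I (Hm1 \<Omega>) (Hm1_norm \<Omega>) (\<lambda>t. L2_inner \<Omega> (P t)) w"
      by (rule Hm1.weak_time_derivI[OF I Hm1_complete sI[OF PHp[of 1]] i1[OF PHp] wm w1 ev sep])
        (use parts2 in auto)
    show ?thesis
    proof
      show "u \<in> bochner_W1inf ?I (L2 \<Omega>) (L2_norm \<Omega>)"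
        unfolding bochner_W1inf_def by (rule CollectI, rule conjI[OF uLinf], rule bexI[of _ P], rule W1, rule PLinf)
      show "is_second_deriv_L2 ?I (Hm1 \<Omega>) (Hm1_norm \<Omega>) (\<lambda>t. L2_inner \<Omega> (u t)) w"
        unfolding is_second_deriv_L2_def
        by (rule conjI[OF w2], rule bexI[of _ "\<lambda>t. L2_inner \<Omega> (P t)"], rule conjI[OF W2 W3], rule PHp)
    qed
  qed
  have in_class: "solution_class \<Omega> u"
    unfolding solution_class_def in_loc_def
  proof (intro conjI allI impI)
    fix T' :: real assume T': "T' > 0"
    show "u \<in> bochner_Linf {0<..<T'} (H10 \<Omega>) (H1_norm \<Omega>)" by (rule H10.continuous_bochner(1), erule uH, erule uc)
    show "u \<in> bochner_W1inf {0<..<T'} (L2 \<Omega>) (L2_norm \<Omega>)" by (rule conjunct1[OF main[OF T']])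
    show "(\<lambda>t. L2_inner \<Omega> (u t)) \<in> bochner_H2 {0<..<T'} (Hm1 \<Omega>) (Hm1_norm \<Omega>)"
      unfolding bochner_H2_def
    proof (rule CollectI, rule conjI)
      show "(\<lambda>t. L2_inner \<Omega> (u t)) \<in> bochner_Lp 2 {0<..<T'} (Hm1 \<Omega>) (Hm1_norm \<Omega>)"
        by (rule Hm1.continuous_bochner(2), erule uHm, erule uHmc)
      show "\<exists>w. is_second_deriv_L2 {0<..<T'} (Hm1 \<Omega>) (Hm1_norm \<Omega>) (\<lambda>t. L2_inner \<Omega> (u t)) w"
        by (rule exI[of _ w], rule conjunct2[OF main[OF T']])
    qed
  qed
  have solves: "solves_weakly \<Omega> a f u"
    unfolding solves_weakly_def 
  proof (rule exI[of _ w], intro conjI allI impI ballI)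
    show "is_second_deriv_L2 {0<..<T'} (Hm1 \<Omega>) (Hm1_norm \<Omega>) (\<lambda>t. L2_inner \<Omega> (u t)) w" if "T' > 0" for T'
      by (rule conjunct2[OF main[OF that]])
    show "AE t in lebesgue_on {0<..}. w t v + B (u t) v = L2_inner \<Omega> (f t) v" for v
      by (rule AE_I2) (simp add: w_def)
  qed
  have decay: "((\<lambda>t. L2_norm \<Omega> (u t)) \<longlongrightarrow> 0) at_top"
  proof (rule tendstoI)
    fix d :: real assume d: "d > 0"
    have "\<forall>\<^sub>F k in sequentially. R k < d" by (rule order_tendstoD(2)[OF R d])
    then obtain k where k: "R k < d" by (auto simp: eventually_sequentially)
    have "L2_norm \<Omega> (sol 0) = 0"
      using norm_emb[OF meas H10_L2'[OF sol_H10[of 0]]] K.zero by (simp add: K_def)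
    \<comment> \<open>the approximation \<open>sol (x k t)\<close> is \<open>sol 0\<close> from \<open>T k\<close> on, which has norm 0\<close>
    then have "L2_norm \<Omega> (u t) < d" if "t \<ge> T k" "t \<ge> 0" for t
      using L2n.N_reverse[OF H10_L2'[OF sol_H10[of 0]] uL[OF that(2)]] L2_le_H1[OF op, of "sol 0 - u t"]
        uR[OF that(2), of k] x0[OF that(1)] k by simp
    then have "L2_norm \<Omega> (u t) < d" if "t \<ge> max 0 (T k)" for t using that by simp
    then show "\<forall>\<^sub>F t in at_top. dist (L2_norm \<Omega> (u t)) 0 < d"
      unfolding eventually_at_top_linorder by (intro exI[of _ "max 0 (T k)"]) simp
  qed
  have "is_continuous_rep \<Omega> u u" unfolding is_continuous_rep_def using uL uLc by simp
  then have "decays \<Omega> u" unfolding decays_def using decay by blast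
  then show ?thesis using in_class solves unfolding weak_solution_def by blast
qed

end

theorem proposition3p2:
  fixes \<Omega> :: "(real^'n) set"
    and a :: "'n \<Rightarrow> 'n \<Rightarrow> real^'n \<Rightarrow> real"
    and f :: "real \<Rightarrow> real^'n \<Rightarrow> real"
  assumes "open \<Omega>" and "bounded \<Omega>"
    and "admissible_coeffs \<Omega> a"
    and "in_loc (\<lambda>I. bochner_Lp 2 I (L2 \<Omega>) (L2_norm \<Omega>)) f"
    and "f \<in> bochner_Lp 1 {0<..} (L2 \<Omega>) (L2_norm \<Omega>)"
  shows "\<exists>u. weak_solution \<Omega> a f u \<and>
    (\<forall>w. weak_solution \<Omega> a f w \<longrightarrow>
       (AE t in lebesgue_on {0<..}. AE x in lebesgue_on \<Omega>. w t x = u t x))"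
proof -
  interpret elliptic \<Omega> a by (rule elliptic.intro) (rule assms)+
  obtain u where u: "weak_solution \<Omega> a f u" using existence[OF assms(5,4)] by blast
  then show ?thesis using uniqueness[OF _ u] by blast
qed

end
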